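(* Let $n\ge 1$, let $\mathfrak{g}=\mathfrak{gl}_n(\mathbb{C})$, let $\chi\in \mathrm{Op}_n(\mathcal{D}^\times)$ be a rank $n$ oper on the punctured disk, and let $\nabla=p(\chi)\in\mathrm{Conn}_n(\mathcal{D}^\times)$ be its underlying connection. Let $\hat{\mathfrak{g}}_c\text{-}\mathrm{mod}_\chi$ be the category of smooth critical level $\widehat{\mathfrak{gl}}_n$-modules on which the centre $\mathcal{Z}_c$ acts by the character determined by $\chi$ via the Feigin--Frenkel isomorphism. Then $$\mathrm{Cond}(\hat{\mathfrak{g}}_c\text{-}\mathrm{mod}_\chi)\ \ge\ \mathrm{Irr}(\nabla).$$
   Context: Notation. $\mathcal{O}=\mathbb{C}[[t]]$, $\mathcal{P}=t\mathbb{C}[[t]]$, $\mathcal{K}=\mathbb{C}((t))$, with $\nu$ the $t$-adic valuation ($\nu(0)=\infty$); $\mathcal{D}=\mathrm{Spec}\,\mathcal{O}$, $\mathcal{D}^\times=\mathrm{Spec}\,\mathcal{K}$. Connections and opers. A rank $n$ connection on $\mathcal{D}^\times$ is a pair $(V,D)$ with $V$ an $n$-dimensional $\mathcal{K}$-vector space and $D:V\to V$ a $\mathbb{C}$-linear map with $D(av)=(\partial_t a)v+aD(v)$ for $a\in\mathcal{K}$, $v\in V$; $\mathrm{Conn}_n(\mathcal{D}^\times)$ is the set of these. An oper is a triple $\chi=(V,D,v)$ with $(V,D)$ a rank $n$ connection and $v$ a cyclic vector, i.e. $v,Dv,\dots,D^{n-1}v$ is a $\mathcal{K}$-basis of $V$.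 The equation $D^nv=a_1D^{n-1}v+\cdots+a_{n-1}Dv+a_nv$ identifies $\mathrm{Op}_n(\mathcal{D}^\times)$ with $\mathcal{K}^n$, $\chi\mapsto(a_1,\dots,a_n)$. The map $p$ sends $(V,D,v)$ to $(V,D)$. Likewise $\mathrm{Op}_n(\mathcal{D})$ is the space of $n$-tuples $(a_1,\dots,a_n)\in\mathcal{O}^n$, and $\mathbb{C}[\mathrm{Op}_n(\mathcal{D})]$ is the algebra of polynomials in the Taylor coefficients of the $a_i$. Irregularity. For $\chi=(a_1,\dots,a_n)$, with the convention $a_0=1$, $\mathrm{Irr}(\chi)=\max\{i-\nu(a_{n-i})\}_{i=0,\dots,n}-n$, a nonnegative integer. It depends only on $\nabla=p(\chi)$, and $\mathrm{Irr}(\nabla):=\mathrm{Irr}(\chi)$. Critical level. Let $\kappa_c$ be $-\frac12$ times the Killing form $(X,Y)\mapsto 2n\,\mathrm{tr}(XY)-2\,\mathrm{tr}X\,\mathrm{tr}Y$ of $\mathfrak{gl}_n$. Let $\hat{\mathfrak{g}}_c$ be the central extension of $\mathfrak{g}((t))$ by $\mathbb{C}\mathbf{1}$ with two-cocycle $(x\otimes f,y\otimes g)\mapsto-\kappa_c(x,y)\,\mathrm{Res}_{t=0}(f\,\frac{dg}{dt})$. Modules are required to have $\mathbf{1}$ acting as the identity. A module $M$ is smooth if for each $v\in M$ there is $N$ with $t^N\mathfrak{g}[[t]]v=0$. Let $U_c=U(\hat{\mathfrak{g}}_c)/(\mathbf{1}-1)$, let $\tilde U_c=\varprojlim_N U_c/U_c\,t^N\mathfrak{g}[[t]]$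 be the completed enveloping algebra, which acts on all smooth modules, and let $\mathcal{Z}_c$ be the centre of $\tilde U_c$. Write $x_n=x\otimes t^n$ for $x\in\mathfrak g$. Affine vertex algebra. $V_c=\mathrm{Ind}_{\mathfrak{g}[[t]]\oplus\mathbb{C}\mathbf{1}}^{\hat{\mathfrak{g}}_c}\mathbb{C}$, with vacuum $v_0$ (where $\mathfrak g[[t]]$ acts by $0$ and $\mathbf 1$ by $1$); as a vector space $V_c\simeq U(\mathfrak{g}^-)$ with $\mathfrak{g}^-=t^{-1}\mathfrak{g}[t^{-1}]$. Put $x(z)=\sum_{n\in\mathbb{Z}}x_nz^{-n-1}$. The field of the state $x^1_{-n_1}\cdots x^k_{-n_k}v_0$ ($n_i\ge1$) is $\prod_i\frac{1}{(n_i-1)!}\,{:}\partial_z^{n_1-1}x^1(z)\cdots\partial_z^{n_k-1}x^k(z){:}$ (right-nested normal ordering). For $B\in V_c$, $B_{[k]}\in\tilde U_c$ denotes the coefficient of $z^{-k-1}$ in this field, regarded as an element of $\tilde U_c$, and $B_{(k)}\in\mathrm{End}(V_c)$ the corresponding operator. The centre of the vertex algebra is $\mathfrak{z}_c=\{B\in V_c: A_{(k)}B=0\ \forall A\in V_c,\ k\ge0\}$; for $B\in\mathfrak{z}_c$ all $B_{[k]}$ lie in $\mathcal{Z}_c$. Feigin--Frenkel isomorphism. Let $\mathfrak{h}$ be the diagonal matrices, $\mathfrak{n}_\pm$ the strictly upper/lower triangular matrices, $\mathfrak{h}^-=t^{-1}\mathfrak{h}[t^{-1}]$, $\mathfrak{n}_\pm^-=t^{-1}\mathfrak{n}_\pm[t^{-1}]$.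 The affine Harish-Chandra homomorphism $\mathcal{F}:\mathfrak{z}_c\to\mathrm{Sym}(\mathfrak{h}^-)$ is the restriction to $\mathfrak{z}_c\subset U(\mathfrak{g}^-)^{\mathfrak{h}}$ of the projection $U(\mathfrak{g}^-)\to U(\mathfrak{h}^-)$ along $\mathfrak{n}_-^-U(\mathfrak{g}^-)+U(\mathfrak{g}^-)\mathfrak{n}_+^-$. Identify $\mathrm{Sym}(\mathfrak{h}^-)$ with the polynomial functions on $\mathfrak{h}[[t]]$, so that $E_{ii}\otimes t^{-k-1}$ is the function $(E_{11}(t),\dots,E_{nn}(t))\mapsto$ coefficient of $t^k$ in $E_{ii}(t)$. The Miura map $\mu:\mathfrak{h}[[t]]\to\mathrm{Op}_n(\mathcal{D})$ sends $(E_{11}(t),\dots,E_{nn}(t))$ to the tuple $(a_1,\dots,a_n)$ with $(\partial_t+E_{11}(t))\cdots(\partial_t+E_{nn}(t))=\partial_t^n+a_1(t)\partial_t^{n-1}+\cdots+a_n(t)$. The Feigin--Frenkel isomorphism is the algebra isomorphism $\mathfrak{z}_c\simeq\mathbb{C}[\mathrm{Op}_n(\mathcal{D})]$, $B\mapsto f_B$, with $\mu^*(f_B)=\mathcal{F}(B)$. Writing $f_B(a_1,\dots,a_n)=P_B\big((\partial_t^ra_i)(0)\big)$ with $P_B$ a polynomial in finitely many variables, it induces an isomorphism of topological algebras $\mathcal{Z}_c\simeq\mathbb{C}[\mathrm{Op}_n(\mathcal{D}^\times)]$ which sends $B_{[k]}$ to the function $(a_1,\dots,a_n)\mapsto$ coefficient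 of $t^{-k-1}$ in $P_B\big(\partial_t^ra_i(t)\big)\in\mathcal{K}$. Thus every $\chi\in\mathrm{Op}_n(\mathcal{D}^\times)\simeq\mathcal K^n$ defines a character of $\mathcal{Z}_c$, and $\hat{\mathfrak{g}}_c\text{-}\mathrm{mod}_\chi$ is the full subcategory of smooth $\hat{\mathfrak{g}}_c$-modules on which $\mathcal{Z}_c$ acts by this character. Conductor. For an integer $m\ge0$ let $\mathfrak{k}_m\subset\mathfrak{gl}_n(\mathcal{O})$ be the Lie subalgebra of matrices whose last row has all entries in $\mathcal{P}^m$ (other entries arbitrary in $\mathcal{O}$), and let $K_m\subset \mathrm{GL}_n(\mathcal{O})$ be the corresponding pro-algebraic group (matrices in $\mathrm{GL}_n(\mathcal{O})$ whose last row is congruent to $(0,\dots,0,1)$ modulo $t^m$). The central extension is split over $\mathfrak{gl}_n(\mathcal O)$. A $(\hat{\mathfrak{g}}_c,\mathfrak{k}_m)$ Harish-Chandra module is a $\hat{\mathfrak{g}}_c$-module whose restriction to $\mathfrak{k}_m$ is integrable, i.e. integrates to an algebraic action of $K_m$. $\mathrm{Cond}(\hat{\mathfrak{g}}_c\text{-}\mathrm{mod}_\chi)$ is the smallest integer $m\ge0$ such that $\hat{\mathfrak{g}}_c\text{-}\mathrm{mod}_\chi$ contains a nonzero $(\hat{\mathfrak{g}}_c,\mathfrak{k}_m)$ Harish-Chandra module ($+\infty$ if there is none). *)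

theory Defs
  imports "HOL-Analysis.Analysis" "HOL-Library.Poly_Mapping"
    "HOL-Computational_Algebra.Formal_Laurent_Series"
begin

notation fls_nth (infixl "$$" 75)

text \<open>
  Conventions. The rank \<open>n\<close> is \<open>CARD('n)\<close> for an index type \<open>'n\<close> of class \<open>{finite, linorder}\<close>,
  whose elements in increasing order play the role of \<open>1, \<dots>, n\<close>. The field \<open>\<K>\<close> is \<open>complex fls\<close>,
  the ring \<open>\<O>\<close> is \<open>complex fps\<close>, and \<open>gl\<^sub>n \<otimes> \<K>\<close> is the type of matrices over \<open>complex fls\<close>.
\<close>


section \<open>Connections, opers and irregularity\<close>

definition connection ::
  "nat \<Rightarrow> (complex fls \<Rightarrow> 'w::ab_group_add \<Rightarrow> 'w) \<Rightarrow> ('w \<Rightarrow> 'w) \<Rightarrow> bool" where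
  "connection n sK D \<longleftrightarrow>
     vector_space sK \<and>
     (\<exists>B. finite B \<and> card B = n \<and> \<not> module.dependent sK B \<and> module.span sK B = UNIV) \<and>
     (\<forall>x y. D (x + y) = D x + D y) \<and>
     (\<forall>c x. D (sK (fls_const c) x) = sK (fls_const c) (D x)) \<and>
     (\<forall>a x. D (sK a x) = sK (fls_deriv a) x + sK a (D x))"

definition oper ::
  "nat \<Rightarrow> (complex fls \<Rightarrow> 'w::ab_group_add \<Rightarrow> 'w) \<Rightarrow> ('w \<Rightarrow> 'w) \<Rightarrow> 'w \<Rightarrow> bool" where
  "oper n sK D v \<longleftrightarrow>
     connection n sK D \<and>
     inj_on (\<lambda>i. (D ^^ i) v) {..<n} \<and>
     \<not> module.dependent sK ((\<lambda>i. (D ^^ i) v) ` {..<n}) \<and>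
     module.span sK ((\<lambda>i. (D ^^ i) v) ` {..<n}) = UNIV"

definition oper_coeffs ::
  "nat \<Rightarrow> (complex fls \<Rightarrow> 'w::ab_group_add \<Rightarrow> 'w) \<Rightarrow> ('w \<Rightarrow> 'w) \<Rightarrow> 'w \<Rightarrow> nat \<Rightarrow> complex fls" where
  "oper_coeffs n sK D v = (THE a.
     (\<forall>i. i \<notin> {1..n} \<longrightarrow> a i = 0) \<and>
     (D ^^ n) v = (\<Sum>i = 1..n. sK (a i) ((D ^^ (n - i)) v)))"

text \<open>
  Since \<open>fls_subdegree 0 = 0\<close>, the zero coefficients (valuation \<open>\<infinity>\<close>) are left out of the maximum;
  the set is nonempty because of \<open>a\<^sub>0 = 1\<close>.
\<close>

definition irr_coeffs :: "nat \<Rightarrow> (nat \<Rightarrow> complex fls) \<Rightarrow> int" where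
  "irr_coeffs n a =
     (let b = a(0 := 1) in
        Max {int i - fls_subdegree (b (n - i)) | i. i \<le> n \<and> b (n - i) \<noteq> 0} - int n)"

text \<open>The irregularity of a connection is the common value over all of its cyclic vectors.\<close>

definition irregularity ::
  "nat \<Rightarrow> (complex fls \<Rightarrow> 'w::ab_group_add \<Rightarrow> 'w) \<Rightarrow> ('w \<Rightarrow> 'w) \<Rightarrow> int" where
  "irregularity n sK D =
     (THE r. \<exists>v. oper n sK D v \<and> r = irr_coeffs n (oper_coeffs n sK D v))"


section \<open>The affine Lie algebra at the critical level\<close>

text \<open>\<open>\<kappa>\<^sub>c\<close> extended \<open>\<K>\<close>-bilinearly to \<open>gl\<^sub>n \<otimes> \<K>\<close>, with values in \<open>\<K>\<close>.\<close>

definition killing_K :: "complex fls^'n::finite^'n \<Rightarrow> complex fls^'n^'n \<Rightarrow> complex fls" where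
  "killing_K X Y = 2 * of_nat CARD('n) * trace (X ** Y) - 2 * trace X * trace Y"

definition kappa_c :: "complex fls^'n::finite^'n \<Rightarrow> complex fls^'n^'n \<Rightarrow> complex fls" where
  "kappa_c X Y = fls_const (- 1 / 2) * killing_K X Y"

definition deriv_K :: "complex fls^'n::finite^'n \<Rightarrow> complex fls^'n^'n" where
  "deriv_K X = (\<chi> i j. fls_deriv (X $ i $ j))"

definition cocycle :: "complex fls^'n::finite^'n \<Rightarrow> complex fls^'n^'n \<Rightarrow> complex" where
  "cocycle X Y = - (kappa_c X (deriv_K Y) $$ (- 1))"

text \<open>The pair \<open>(X, c)\<close> stands for \<open>X + c\<one>\<close>.\<close>

type_synonym 'n ghat = "(complex fls^'n^'n) \<times> complex"

definition ghat_scale :: "complex \<Rightarrow> 'n::finite ghat \<Rightarrow> 'n ghat" where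
  "ghat_scale c x = ((\<chi> i j. fls_const c * fst x $ i $ j), c * snd x)"

definition ghat_bracket :: "'n::finite ghat \<Rightarrow> 'n ghat \<Rightarrow> 'n ghat" where
  "ghat_bracket x y = (fst x ** fst y - fst y ** fst x, cocycle (fst x) (fst y))"

definition loop :: "complex^'n::finite^'n \<Rightarrow> int \<Rightarrow> complex fls^'n^'n" where
  "loop x k = (\<chi> i j. fls_const (x $ i $ j) * fls_X_intpow k)"

definition arcs :: "nat \<Rightarrow> (complex fls^'n::finite^'n) set" where
  "arcs N = {X. \<forall>i j k. k < int N \<longrightarrow> X $ i $ j $$ k = 0}"


section \<open>The completed enveloping algebra and its centre\<close>

text \<open>The free associative algebra on a type is the monoid algebra of the free monoid on it.\<close>

datatype 'a free_monoid = Word (letters: "'a list")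

instantiation free_monoid :: (type) monoid_add
begin
definition zero_free_monoid :: "'a free_monoid" where
  "zero_free_monoid = Word []"
definition plus_free_monoid :: "'a free_monoid \<Rightarrow> 'a free_monoid \<Rightarrow> 'a free_monoid" where
  "plus_free_monoid u w = Word (letters u @ letters w)"
instance
  by standard (simp_all add: zero_free_monoid_def plus_free_monoid_def)
end

type_synonym 'a free_alg = "'a free_monoid \<Rightarrow>\<^sub>0 complex"

definition scal :: "complex \<Rightarrow> 'a free_alg" where
  "scal c = Poly_Mapping.single 0 c"

definition gen :: "'a \<Rightarrow> 'a free_alg" where
  "gen x = Poly_Mapping.single (Word [x]) 1"

inductive_set U_rels :: "'n::finite ghat free_alg set" where
  add: "gen (x + y) - gen x - gen y \<in> U_rels"
| scale: "gen (ghat_scale c x) - scal c * gen x \<in> U_rels"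
| bracket: "gen x * gen y - gen y * gen x - gen (ghat_bracket x y) \<in> U_rels"
| level: "gen (0, 1) - 1 \<in> U_rels"

text \<open>The two-sided ideal with \<open>U\<^sub>c = free_alg / U_ideal\<close>.\<close>

inductive_set U_ideal :: "'n::finite ghat free_alg set" where
  zero: "0 \<in> U_ideal"
| rel: "r \<in> U_rels \<Longrightarrow> a * r * b \<in> U_ideal"
| add: "x \<in> U_ideal \<Longrightarrow> y \<in> U_ideal \<Longrightarrow> x + y \<in> U_ideal"

text \<open>The preimage in the free algebra of the left ideal \<open>U\<^sub>c t\<^sup>N g[[t]]\<close> of \<open>U\<^sub>c\<close>.\<close>

inductive_set left_ideal :: "nat \<Rightarrow> 'n::finite ghat free_alg set" for N where
  base: "x \<in> U_ideal \<Longrightarrow> x \<in> left_ideal N"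
| arc: "X \<in> arcs N \<Longrightarrow> a * gen (X, 0) \<in> left_ideal N"
| add: "x \<in> left_ideal N \<Longrightarrow> y \<in> left_ideal N \<Longrightarrow> x + y \<in> left_ideal N"

definition coset :: "nat \<Rightarrow> 'n::finite ghat free_alg \<Rightarrow> 'n ghat free_alg set" where
  "coset N a = (+) a ` left_ideal N"

text \<open>
  An element of \<open>lim U\<^sub>c / U\<^sub>c t\<^sup>N g[[t]]\<close> is a decreasing sequence of cosets. The product is
  well defined because for every \<open>b\<close> and \<open>N\<close> there is \<open>M\<close> with
  \<open>left_ideal M * b \<subseteq> left_ideal N\<close>.
\<close>

type_synonym 'n Uhat = "nat \<Rightarrow> 'n ghat free_alg set"

definition Uhat_carrier :: "'n::finite Uhat set" where
  "Uhat_carrier = {u. (\<forall>N. u N \<in> range (coset N)) \<and> (\<forall>N. u (Suc N) \<subseteq> u N)}"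

definition Uhat_add :: "'n::finite Uhat \<Rightarrow> 'n Uhat \<Rightarrow> 'n Uhat" where
  "Uhat_add u w = (\<lambda>N. {a + b | a b. a \<in> u N \<and> b \<in> w N})"

definition Uhat_mult :: "'n::finite Uhat \<Rightarrow> 'n Uhat \<Rightarrow> 'n Uhat" where
  "Uhat_mult u w = (\<lambda>N. {c. \<exists>b\<in>w N. \<exists>M. \<forall>a\<in>u M. c - a * b \<in> left_ideal N})"

definition Uhat_of :: "'n::finite ghat free_alg \<Rightarrow> 'n Uhat" where
  "Uhat_of a = (\<lambda>N. coset N a)"

definition Uhat_lim :: "(nat \<Rightarrow> 'n::finite ghat free_alg) \<Rightarrow> 'n Uhat" where
  "Uhat_lim s = (\<lambda>N. {c. \<exists>L0. \<forall>L\<ge>L0. c - s L \<in> left_ideal N})"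

definition Uhat_centre :: "'n::finite Uhat set" where
  "Uhat_centre = {z \<in> Uhat_carrier. \<forall>u\<in>Uhat_carrier. Uhat_mult z u = Uhat_mult u z}"


section \<open>The affine vertex algebra\<close>

text \<open>
  The induced module is \<open>V\<^sub>c = U\<^sub>c / U\<^sub>c g[[t]]\<close>, the set of cosets of \<open>left_ideal 0\<close>. Its elements
  are presented by linear combinations of words; the word \<open>[(x\<^sub>1, r\<^sub>1), \<dots>, (x\<^sub>k, r\<^sub>k)]\<close> denotes the
  monomial \<open>(x\<^sub>1 t\<^bsup>-r\<^sub>1-1\<^esup>) \<dots> (x\<^sub>k t\<^bsup>-r\<^sub>k-1\<^esup>)\<close> of \<open>U(g\<^sup>-)\<close>.
\<close>

type_synonym 'n state = "((complex^'n^'n) \<times> nat) list \<Rightarrow>\<^sub>0 complex"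

definition state_elem :: "'n::finite state \<Rightarrow> 'n ghat free_alg" where
  "state_elem p = (\<Sum>w\<in>Poly_Mapping.keys p. scal (Poly_Mapping.lookup p w) *
     prod_list (map (\<lambda>(x, r). gen (loop x (- int r - 1), 0)) w))"

definition vec_of :: "'n::finite state \<Rightarrow> 'n ghat free_alg set" where
  "vec_of p = coset 0 (state_elem p)"

definition Uhat_act_vac :: "'n::finite Uhat \<Rightarrow> 'n ghat free_alg set \<Rightarrow> 'n ghat free_alg set" where
  "Uhat_act_vac u B = {c. \<exists>b\<in>B. \<exists>M. \<forall>a\<in>u M. c - a * b \<in> left_ideal 0}"

text \<open>A field \<open>F(z)\<close> is given by \<open>k \<mapsto>\<close> the coefficient of \<open>z\<^bsup>-k-1\<^esup>\<close>.\<close>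

definition field_deriv :: "(int \<Rightarrow> 'n::finite ghat free_alg) \<Rightarrow> int \<Rightarrow> 'n ghat free_alg" where
  "field_deriv F = (\<lambda>k. - of_int k * F (k - 1))"

definition letter_field :: "(complex^'n::finite^'n) \<times> nat \<Rightarrow> int \<Rightarrow> 'n ghat free_alg" where
  "letter_field l = (\<lambda>k. scal (1 / fact (snd l)) *
     (field_deriv ^^ snd l) (\<lambda>j. gen (loop (fst l) j, 0)) k)"

text \<open>
  The normally ordered product is \<open>:F(z) G(z): = F\<^sub>+(z) G(z) + G(z) F\<^sub>-(z)\<close>, where \<open>F\<^sub>+\<close> collects
  the modes of negative index. Its coefficients are infinite sums; \<open>L\<close> truncates them, and the
  modes of a state are the limits for \<open>L \<rightarrow> \<infinity>\<close> in the completed enveloping algebra.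
\<close>

definition normal_trunc ::
  "nat \<Rightarrow> (int \<Rightarrow> 'n::finite ghat free_alg) \<Rightarrow> (int \<Rightarrow> 'n ghat free_alg) \<Rightarrow> int \<Rightarrow> 'n ghat free_alg" where
  "normal_trunc L F G = (\<lambda>k. (\<Sum>j\<in>{- int L..<0}. F j * G (k - 1 - j)) +
                              (\<Sum>j\<in>{0..<int L}. G (k - 1 - j) * F j))"

definition vacuum_field :: "int \<Rightarrow> 'n::finite ghat free_alg" where
  "vacuum_field k = (if k = - 1 then 1 else 0)"

definition word_field_trunc ::
  "nat \<Rightarrow> ((complex^'n::finite^'n) \<times> nat) list \<Rightarrow> int \<Rightarrow> 'n ghat free_alg" where
  "word_field_trunc L w = foldr (\<lambda>l. normal_trunc L (letter_field l)) w vacuum_field"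

definition state_mode :: "'n::finite state \<Rightarrow> int \<Rightarrow> 'n Uhat" where
  "state_mode p k = Uhat_lim (\<lambda>L. \<Sum>w\<in>Poly_Mapping.keys p.
     scal (Poly_Mapping.lookup p w) * word_field_trunc L w k)"

definition va_centre :: "'n::finite ghat free_alg set set" where
  "va_centre = {B \<in> range (coset 0).
     \<forall>(q :: 'n state) k. 0 \<le> k \<longrightarrow> Uhat_act_vac (state_mode q k) B = coset 0 0}"


section \<open>The affine Harish-Chandra homomorphism and the Miura map\<close>

definition g_minus :: "(complex fls^'n::finite^'n) set" where
  "g_minus = {X. \<forall>i j k. 0 \<le> k \<longrightarrow> X $ i $ j $$ k = 0}"

definition n_plus_minus :: "(complex fls^'n::{finite,linorder}^'n::{finite,linorder}) set" where
  "n_plus_minus = {X \<in> g_minus. \<forall>i j. \<not> i < j \<longrightarrow> X $ i $ j = 0}"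

definition n_minus_minus :: "(complex fls^'n::{finite,linorder}^'n::{finite,linorder}) set" where
  "n_minus_minus = {X \<in> g_minus. \<forall>i j. \<not> j < i \<longrightarrow> X $ i $ j = 0}"

text \<open>
  The cocycle vanishes on \<open>g\<^sup>-\<close>, so by the Poincare-Birkhoff-Witt theorem \<open>U(g\<^sup>-)\<close> is the subalgebra of
  \<open>U\<^sub>c\<close> generated by \<open>g\<^sup>-\<close>. The next two sets live in the free algebra: words in \<open>g\<^sup>-\<close>, and
  representatives modulo \<open>U_ideal\<close> of \<open>n\<^sub>-\<^sup>- U(g\<^sup>-) + U(g\<^sup>-) n\<^sub>+\<^sup>-\<close>.
\<close>

definition U_minus :: "'n::finite ghat free_alg set" where
  "U_minus = {u. \<forall>w\<in>Poly_Mapping.keys u. set (letters w) \<subseteq> g_minus \<times> {0}}"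

inductive_set hc_kernel :: "'n::{finite,linorder} ghat free_alg set" where
  base: "x \<in> U_ideal \<Longrightarrow> x \<in> hc_kernel"
| left: "Y \<in> n_minus_minus \<Longrightarrow> u \<in> U_minus \<Longrightarrow> gen (Y, 0) * u \<in> hc_kernel"
| right: "Y \<in> n_plus_minus \<Longrightarrow> u \<in> U_minus \<Longrightarrow> u * gen (Y, 0) \<in> hc_kernel"
| add: "x \<in> hc_kernel \<Longrightarrow> y \<in> hc_kernel \<Longrightarrow> x + y \<in> hc_kernel"

text \<open>
  An element of \<open>U(h\<^sup>-) = Sym(h\<^sup>-)\<close> is presented by a linear combination of words in the letters
  \<open>(i, k)\<close>, which stand for \<open>E\<^sub>i\<^sub>i t\<^bsup>-k-1\<^esup>\<close> and, as functions on \<open>h[[t]]\<close>, for the coefficient of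
  \<open>t\<^sup>k\<close> in \<open>E\<^sub>i\<^sub>i(t)\<close>.
\<close>

type_synonym 'n cartan = "('n \<times> nat) list \<Rightarrow>\<^sub>0 complex"

definition diag_unit :: "'n \<Rightarrow> complex^'n::finite^'n" where
  "diag_unit i = (\<chi> a b. if a = i \<and> b = i then 1 else 0)"

definition cartan_elem :: "'n::finite cartan \<Rightarrow> 'n ghat free_alg" where
  "cartan_elem s = (\<Sum>w\<in>Poly_Mapping.keys s. scal (Poly_Mapping.lookup s w) *
     prod_list (map (\<lambda>(i, k). gen (loop (diag_unit i) (- int k - 1), 0)) w))"

definition cartan_fun :: "'n cartan \<Rightarrow> ('n \<Rightarrow> complex fps) \<Rightarrow> complex" where
  "cartan_fun s E = (\<Sum>w\<in>Poly_Mapping.keys s. Poly_Mapping.lookup s w *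
     prod_list (map (\<lambda>(i, k). fps_nth (E i) k) w))"

definition harish_chandra :: "'n::{finite,linorder} state \<Rightarrow> 'n cartan \<Rightarrow> bool" where
  "harish_chandra p s \<longleftrightarrow> state_elem p - cartan_elem s \<in> hc_kernel"

text \<open>
  Differential operators \<open>\<Sum>\<^sub>j c\<^sub>j \<partial>\<^sup>j\<close> over \<open>\<O>\<close> are stored as polynomials with coefficients \<open>c\<^sub>j\<close>;
  the following is the composite \<open>(\<partial> + e) \<circ> Q\<close>.
\<close>

definition first_order_comp :: "complex fps \<Rightarrow> complex fps poly \<Rightarrow> complex fps poly" where
  "first_order_comp e Q = pCons 0 Q + map_poly fps_deriv Q + Polynomial.smult e Q"

definition miura :: "('n::{finite,linorder} \<Rightarrow> complex fps) \<Rightarrow> nat \<Rightarrow> complex fps" where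
  "miura E i = poly.coeff
     (foldr (\<lambda>j. first_order_comp (E j)) (sorted_list_of_set UNIV) 1) (CARD('n) - i)"


section \<open>The Feigin-Frenkel isomorphism\<close>

text \<open>Multivariate polynomials with variables in \<open>'x\<close>, evaluated in a commutative algebra.\<close>

type_synonym 'x mpolynomial = "('x \<Rightarrow>\<^sub>0 nat) \<Rightarrow>\<^sub>0 complex"

definition poly_eval ::
  "(complex \<Rightarrow> 'a::comm_ring_1) \<Rightarrow> ('x \<Rightarrow> 'a) \<Rightarrow> 'x mpolynomial \<Rightarrow> 'a" where
  "poly_eval emb \<phi> P = (\<Sum>m\<in>Poly_Mapping.keys P. emb (Poly_Mapping.lookup P m) *
     (\<Prod>x\<in>Poly_Mapping.keys m. \<phi> x ^ Poly_Mapping.lookup m x))"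

text \<open>Differential polynomials in \<open>a\<^sub>1, \<dots>, a\<^sub>n\<close>; the variable \<open>(i, r)\<close> is \<open>\<partial>\<^sup>r a\<^sub>i\<close>.\<close>

definition diff_polys :: "nat \<Rightarrow> (nat \<times> nat) mpolynomial set" where
  "diff_polys n = {P. \<forall>m\<in>Poly_Mapping.keys P. \<forall>x\<in>Poly_Mapping.keys m. fst x \<in> {1..n}}"

text \<open>
  \<open>C[Op\<^sub>n(D\<^sup>\<times>)] = lim C[t\<^bsup>-N\<^esup> \<O>\<^sup>n]\<close>: functions of \<open>(a\<^sub>1, \<dots>, a\<^sub>n) \<in> \<K>\<^sup>n\<close> that for each \<open>N\<close> restrict
  on \<open>t\<^bsup>-N\<^esup> \<O>\<^sup>n\<close> to a polynomial in finitely many Laurent coefficients. A basis of neighbourhoods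
  of zero is given by the ideals of functions vanishing on \<open>t\<^bsup>-N\<^esup> \<O>\<^sup>n\<close>.
\<close>

definition bounded_pole :: "nat \<Rightarrow> nat \<Rightarrow> (nat \<Rightarrow> complex fls) set" where
  "bounded_pole n N = {a. \<forall>i\<in>{1..n}. \<forall>k < - int N. a i $$ k = 0}"

definition op_functions :: "nat \<Rightarrow> ((nat \<Rightarrow> complex fls) \<Rightarrow> complex) set" where
  "op_functions n = {f.
     (\<forall>a b. (\<forall>i\<in>{1..n}. a i = b i) \<longrightarrow> f a = f b) \<and>
     (\<forall>N. \<exists>P :: (nat \<times> int) mpolynomial. \<forall>a\<in>bounded_pole n N.
        f a = poly_eval (\<lambda>c. c) (\<lambda>(i, k). a i $$ k) P)}"

text \<open>\<open>P\<close> is the polynomial \<open>P\<^sub>B\<close>, i.e. \<open>\<mu>\<^sup>* f\<^sub>B = \<F>(B)\<close>, for the state \<open>B\<close> presented by \<open>p\<close>.\<close>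

definition ff_polynomial ::
  "'n::{finite,linorder} state \<Rightarrow> (nat \<times> nat) mpolynomial \<Rightarrow> bool" where
  "ff_polynomial p P \<longleftrightarrow> P \<in> diff_polys CARD('n) \<and>
     (\<exists>s. harish_chandra p s \<and>
        (\<forall>E. poly_eval (\<lambda>c. c) (\<lambda>(i, r). fps_nth ((fps_deriv ^^ r) (miura E i)) 0) P
              = cartan_fun s E))"

text \<open>
  The Feigin-Frenkel theorem says that there is exactly one such \<open>\<Phi>\<close> on the centre. The topology
  of the centre is induced by the inverse limit, so that the basic neighbourhoods of zero are
  given by \<open>z N = coset N 0\<close>.
\<close>

definition feigin_frenkel ::
  "('n::{finite,linorder} Uhat \<Rightarrow> (nat \<Rightarrow> complex fls) \<Rightarrow> complex) \<Rightarrow> bool" where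
  "feigin_frenkel \<Phi> \<longleftrightarrow>
     bij_betw \<Phi> Uhat_centre (op_functions CARD('n)) \<and>
     (\<forall>u\<in>Uhat_centre. \<forall>w\<in>Uhat_centre.
        \<Phi> (Uhat_add u w) = (\<lambda>a. \<Phi> u a + \<Phi> w a) \<and>
        \<Phi> (Uhat_mult u w) = (\<lambda>a. \<Phi> u a * \<Phi> w a)) \<and>
     (\<forall>c. \<Phi> (Uhat_of (scal c)) = (\<lambda>a. c)) \<and>
     (\<forall>N. \<exists>M. \<forall>z\<in>Uhat_centre. z M = coset M 0 \<longrightarrow> (\<forall>a\<in>bounded_pole CARD('n) N. \<Phi> z a = 0)) \<and>
     (\<forall>N. \<exists>M. \<forall>z\<in>Uhat_centre. (\<forall>a\<in>bounded_pole CARD('n) M. \<Phi> z a = 0) \<longrightarrow> z N = coset N 0) \<and>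
     (\<forall>p P k. vec_of p \<in> va_centre \<and> ff_polynomial p P \<longrightarrow>
        \<Phi> (state_mode p k) =
          (\<lambda>a. poly_eval fls_const (\<lambda>(i, r). (fls_deriv ^^ r) (a i)) P $$ (- k - 1)))"


section \<open>Modules and the conductor\<close>

text \<open>
  A \<open>ghat\<close>-module whose underlying abelian group is the type \<open>'v\<close>: scalar multiplication \<open>sc\<close> and
  action \<open>\<rho>\<close>, with \<open>\<one>\<close> acting as the identity.
\<close>

definition ghat_module ::
  "(complex \<Rightarrow> 'v::ab_group_add \<Rightarrow> 'v) \<Rightarrow> ('n::finite ghat \<Rightarrow> 'v \<Rightarrow> 'v) \<Rightarrow> bool" where
  "ghat_module sc \<rho> \<longleftrightarrow>
     vector_space sc \<and>
     (\<forall>x. Vector_Spaces.linear sc sc (\<rho> x)) \<and>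
     (\<forall>x y v. \<rho> (x + y) v = \<rho> x v + \<rho> y v) \<and>
     (\<forall>c x v. \<rho> (ghat_scale c x) v = sc c (\<rho> x v)) \<and>
     (\<forall>x y v. \<rho> (ghat_bracket x y) v = \<rho> x (\<rho> y v) - \<rho> y (\<rho> x v)) \<and>
     (\<forall>v. \<rho> (0, 1) v = v)"

definition smooth :: "('n::finite ghat \<Rightarrow> 'v::zero \<Rightarrow> 'v) \<Rightarrow> bool" where
  "smooth \<rho> \<longleftrightarrow> (\<forall>v. \<exists>N. \<forall>X\<in>arcs N. \<rho> (X, 0) v = 0)"

definition alg_act ::
  "(complex \<Rightarrow> 'v::ab_group_add \<Rightarrow> 'v) \<Rightarrow> ('n::finite ghat \<Rightarrow> 'v \<Rightarrow> 'v)
     \<Rightarrow> 'n ghat free_alg \<Rightarrow> 'v \<Rightarrow> 'v" where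
  "alg_act sc \<rho> a v =
     (\<Sum>w\<in>Poly_Mapping.keys a. sc (Poly_Mapping.lookup a w) (foldr \<rho> (letters w) v))"

text \<open>On a smooth module \<open>left_ideal N\<close> kills a given vector for large \<open>N\<close>.\<close>

definition Uhat_act ::
  "(complex \<Rightarrow> 'v::ab_group_add \<Rightarrow> 'v) \<Rightarrow> ('n::finite ghat \<Rightarrow> 'v \<Rightarrow> 'v) \<Rightarrow> 'n Uhat \<Rightarrow> 'v \<Rightarrow> 'v" where
  "Uhat_act sc \<rho> u v = (THE y. \<exists>N. \<forall>a\<in>u N. alg_act sc \<rho> a v = y)"

definition in_mod_chi ::
  "(nat \<Rightarrow> complex fls) \<Rightarrow> (complex \<Rightarrow> 'v::ab_group_add \<Rightarrow> 'v)
     \<Rightarrow> ('n::{finite,linorder} ghat \<Rightarrow> 'v \<Rightarrow> 'v) \<Rightarrow> bool" where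
  "in_mod_chi a sc \<rho> \<longleftrightarrow> ghat_module sc \<rho> \<and> smooth \<rho> \<and>
     (\<exists>\<Phi>. feigin_frenkel \<Phi> \<and> (\<forall>z\<in>Uhat_centre. \<forall>v. Uhat_act sc \<rho> z v = sc (\<Phi> z a) v))"

definition last_index :: "'n::{finite,linorder}" where
  "last_index = Max UNIV"

definition k_alg :: "nat \<Rightarrow> (complex fps^'n::{finite,linorder}^'n::{finite,linorder}) set" where
  "k_alg m = {X. \<forall>j. \<forall>r<m. fps_nth (X $ last_index $ j) r = 0}"

definition K_group :: "nat \<Rightarrow> (complex fps^'n::{finite,linorder}^'n::{finite,linorder}) set" where
  "K_group m = {g. fps_nth (det g) 0 \<noteq> 0 \<and>
     (\<forall>j. \<forall>r<m. fps_nth (g $ last_index $ j) r = fps_nth (mat 1 $ last_index $ j) r)}"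

text \<open>
  Regular functions on \<open>GL\<^sub>n(\<O>)\<close>: polynomials in the Taylor coefficients of the entries
  (variable \<open>Some (i, j, r)\<close>) and in \<open>1 / det g(0)\<close> (variable \<open>None\<close>).
\<close>

definition regular_fun :: "(complex fps^'n::finite^'n \<Rightarrow> complex) \<Rightarrow> bool" where
  "regular_fun f \<longleftrightarrow> (\<exists>Q :: ('n \<times> 'n \<times> nat) option mpolynomial. \<forall>g.
     f g = poly_eval (\<lambda>c. c)
       (\<lambda>x. case x of None \<Rightarrow> inverse (fps_nth (det g) 0)
                    | Some (i, j, r) \<Rightarrow> fps_nth (g $ i $ j) r) Q)"

definition matrix_to_K :: "complex fps^'n::finite^'n \<Rightarrow> complex fls^'n^'n" where
  "matrix_to_K X = (\<chi> i j. fps_to_fls (X $ i $ j))"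

text \<open>
  The action of \<open>k_alg m\<close> is the differential of an algebraic action \<open>R\<close> of \<open>K_group m\<close>: each
  orbit map \<open>g \<mapsto> R g v\<close> is a finite sum \<open>\<Sum>\<^sub>l f\<^sub>l(g) v\<^sub>l\<close> with regular \<open>f\<^sub>l\<close>, and its derivative at
  \<open>1\<close> in the direction \<open>X\<close>, taken along \<open>s \<mapsto> 1 + s X\<close> (which lies in \<open>K_group m\<close> for small \<open>s\<close>),
  is the action of \<open>X\<close>, where \<open>k_alg m\<close> is embedded by \<open>X \<mapsto> (X, 0)\<close>.
\<close>

definition integrable_k ::
  "nat \<Rightarrow> (complex \<Rightarrow> 'v::ab_group_add \<Rightarrow> 'v) \<Rightarrow> ('n::{finite,linorder} ghat \<Rightarrow> 'v \<Rightarrow> 'v) \<Rightarrow> bool" where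
  "integrable_k m sc \<rho> \<longleftrightarrow> (\<exists>R :: complex fps^'n::{finite,linorder}^'n::{finite,linorder} \<Rightarrow> 'v \<Rightarrow> 'v.
     (\<forall>g\<in>K_group m. Vector_Spaces.linear sc sc (R g)) \<and>
     (\<forall>v. R (mat 1) v = v) \<and>
     (\<forall>g\<in>K_group m. \<forall>h\<in>K_group m. \<forall>v. R (g ** h) v = R g (R h v)) \<and>
     (\<forall>v. \<exists>(q::nat) f e.
        (\<forall>l<q. regular_fun (f l)) \<and>
        (\<forall>g\<in>K_group m. R g v = (\<Sum>l<q. sc (f l g) (e l))) \<and>
        (\<forall>X\<in>k_alg m. \<exists>d.
           (\<forall>l<q. ((\<lambda>s. f l (\<chi> i j. mat 1 $ i $ j + fps_const s * X $ i $ j))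
                     has_field_derivative d l) (at 0)) \<and>
           \<rho> (matrix_to_K X, 0) v = (\<Sum>l<q. sc (d l) (e l)))))"

text \<open>
  The conductor among modules whose underlying group is the type \<open>'v\<close>; the conductor of the whole
  category is the minimum over all \<open>'v\<close>. One type of countably infinite dimension attains it: a vector
  generates a submodule of countable dimension, of which one takes a countable direct sum of copies.
\<close>

definition conductor ::
  "'n::{finite,linorder} itself \<Rightarrow> 'v::ab_group_add itself \<Rightarrow> (nat \<Rightarrow> complex fls) \<Rightarrow> enat" where
  "conductor _ _ a = Inf {enat m | m.
     \<exists>(sc :: complex \<Rightarrow> 'v \<Rightarrow> 'v) (\<rho> :: 'n ghat \<Rightarrow> 'v \<Rightarrow> 'v).
       (UNIV :: 'v set) \<noteq> {0} \<and> in_mod_chi a sc \<rho> \<and> integrable_k m sc \<rho>}"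

end

theory Submission
  imports Defs "HOL-Library.Function_Algebras"
begin

text \<open>
Let \<open>M\<close> be a nonzero module over the affine algebra on which the centre acts through
\<open>\<chi> = (a\<^sub>1, \<dots>, a\<^sub>n)\<close> and which is integrable for \<open>k\<^sub>m\<close>. The inequality follows from the
bound \<open>\<nu>(a\<^sub>j) \<ge> - (j + m)\<close> for all \<open>j\<close> (\<open>pole_bound\<close>), because the irregularity is the maximum of \<open>0\<close>
and the numbers \<open>- j - \<nu>(a\<^sub>j)\<close>.

The coefficients of \<open>a\<^sub>j\<close> are read off from explicit central elements. Over the affine algebra at the
critical level, the column determinant of the matrix with entries \<open>E\<^sub>i\<^sub>j t\<^bsup>-1\<^esup> + \<delta>\<^sub>i\<^sub>j (T + u)\<close>,
with \<open>T\<close> the translation operator and \<open>u\<close> a commuting variable, has coefficients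
that are the Segal-Sugawara vectors \<open>S\<^sub>1, \<dots>, S\<^sub>n\<close> of Chervov, Talalaev and Molev. The proof that they
are invariant under the currents replaces the determinant by a product \<open>\<xi>\<^sub>1 \<dots> \<xi>\<^sub>n\<close> of odd
elements \<open>\<xi>\<^sub>j = \<Sum>\<^sub>a \<psi>\<^sub>a L\<^sub>a\<^sub>j\<close> with Grassmann variables \<open>\<psi>\<^sub>a\<close>; the central term at the critical
level is exactly what makes the operators \<open>E\<^sub>a\<^sub>b t\<close> kill this product (\<open>E1_column_det\<close>). The computation is
carried out for the fields \<open>S\<^sub>j(z)\<close> on an arbitrary smooth module, where locality
upgrades it to commutation with the whole affine algebra (\<open>S_comm\<close>). Applied to the
sum of all quotients \<open>U / U t\<^sup>N g[[t]]\<close> of the enveloping algebra it shows that the modes of \<open>S\<^sub>j\<close>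
lie in the centre of the completed enveloping algebra (\<open>sugawara_mode_central\<close>) and that
\<open>S\<^sub>j\<close> lies in the centre of the vertex algebra (\<open>sugawara_va_centre\<close>). The column determinant is triangular for the
Harish-Chandra projection, and its diagonal is the Miura product, so the Feigin-Frenkel polynomial of \<open>S\<^sub>j\<close> is
the variable \<open>a\<^sub>j\<close> (\<open>sugawara_ff_polynomial\<close>). Hence the mode \<open>k\<close> of \<open>S\<^sub>j\<close> acts on \<open>M\<close> by the scalar
coefficient of \<open>t\<^bsup>-k-1\<^esup>\<close> in \<open>a\<^sub>j\<close> (\<open>mode_value\<close>).

It remains to find a nonzero vector of \<open>M\<close> that is killed by these modes for \<open>k \<ge> j + m - 1\<close>, taking \<open>m \<ge> 1\<close>.
Integrability makes the elements \<open>E\<^sub>a\<^sub>b t\<^sup>r\<close> of \<open>k\<^sub>m\<close> with \<open>r \<ge> 1\<close> locally nilpotent, and a descending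
induction on \<open>r\<close> that starts from smoothness yields a common null vector of all of them
(\<open>fixed_vector\<close>). On such a vector every entry in a term of the determinant raises the pole order by one,
except that an entry of the last row can cost \<open>m - 1\<close> more; as every term of the determinant contains
exactly one entry of the last row, the total cost is \<open>j + m - 1\<close> (\<open>S_pole\<close>).

Finally, the irregularity of a connection is defined as the common value over all cyclic vectors, so its independence
of the cyclic vector is needed. With \<open>\<Theta> = t D\<close> and \<open>y\<^sub>i = t\<^sup>i D\<^sup>i v\<close>, the \<open>\<O>\<close>-span of
\<open>y\<^sub>0, \<dots>, y\<^bsub>n-1+k\<^esub>\<close> has dimension \<open>k r\<close> over \<open>\<complex>\<close> relative to the span of \<open>y\<^sub>0, \<dots>, y\<^bsub>n-1\<^esub>\<close>, where \<open>r\<close> is the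
irregularity of the oper. Two cyclic vectors give lattices that differ by a bounded power of \<open>t\<close>, so comparing the growth in \<open>k\<close> of these
dimensions gives equal irregularities (\<open>rank_bound\<close>, \<open>irregularity_oper\<close>).
\<close>

section \<open>Fields on an abelian group\<close>

text \<open>
Integer multiples; modes of fields are only required to be additive, so that the calculus below also applies
before scalars are introduced.
\<close>

definition zmul :: "int \<Rightarrow> 'v::ab_group_add \<Rightarrow> 'v" where
  "zmul k v = (\<Sum>i<nat k. v) - (\<Sum>i<nat (- k). v)"

lemma zmul_0 [simp]: "zmul 0 v = 0" by (simp add: zmul_def)

lemma zmul_succ: "zmul (k + 1) v = zmul k v + v"
proof (cases "0 \<le> k")
  case True
  then have "nat (k + 1) = Suc (nat k)" by simp
  with True show ?thesis by (simp add: zmul_def)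
next
  case False
  then have "nat (- k) = Suc (nat (- (k + 1)))" by simp
  with False show ?thesis by (simp add: zmul_def)
qed

lemma zmul_pred: "zmul (k - 1) v = zmul k v - v"
  using zmul_succ[of "k - 1" v] by simp

lemma zmul_1 [simp]: "zmul 1 v = v"
  using zmul_succ[of 0 v] by simp

lemma zmul_zero [simp]: "zmul k 0 = 0"
  by (simp add: zmul_def)

lemma zmul_add_left: "zmul (a + b) v = zmul a v + zmul b v"
proof (induction b rule: int_induct[where k = 0])
  case (step1 i)
  then show ?case using zmul_succ[of "a + i" v] zmul_succ[of i v] by (simp add: algebra_simps)
next
  case (step2 i)
  then show ?case using zmul_pred[of "a + i" v] zmul_pred[of i v] by (simp add: add_diff_eq)
qed simp

lemma zmul_add_right: "zmul k (u + v) = zmul k u + zmul k v"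
  by (simp add: zmul_def sum.distrib)

lemma zmul_minus_left: "zmul (- k) v = - zmul k v"
  using zmul_add_left[of k "- k" v] by (simp add: eq_neg_iff_add_eq_0 add.commute)

lemma zmul_minus_right: "zmul k (- v) = - zmul k v"
  using zmul_add_right[of k v "- v"] by (simp add: eq_neg_iff_add_eq_0 add.commute)

lemma zmul_diff_left: "zmul (a - b) v = zmul a v - zmul b v"
  using zmul_add_left[of a "- b" v] by (simp add: zmul_minus_left)

lemma zmul_diff_right: "zmul k (u - v) = zmul k u - zmul k v"
  using zmul_add_right[of k u "- v"] by (simp add: zmul_minus_right)

lemma zmul_sum: "zmul k (sum f A) = (\<Sum>x\<in>A. zmul k (f x))"
  by (induction A rule: infinite_finite_induct) (simp_all add: zmul_add_right)

lemma additive_diff_zero: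
  fixes f :: "'a::ab_group_add \<Rightarrow> 'b::ab_group_add"
  assumes "\<And>u v. f (u + v) = f u + f v"
  shows "f 0 = 0" "f (- u) = - f u" "f (u - v) = f u - f v"
proof -
  show z: "f 0 = 0" using assms[of 0 0] by simp
  show m: "f (- u) = - f u" for u
    using assms[of u "- u"] z by (simp add: eq_neg_iff_add_eq_0 add.commute)
  show "f (u - v) = f u - f v" using assms[of u "- v"] m by simp
qed

lemma additive_sum:
  fixes f :: "'a::ab_group_add \<Rightarrow> 'b::ab_group_add"
  assumes "\<And>u v. f (u + v) = f u + f v"
  shows "f (sum g A) = (\<Sum>x\<in>A. f (g x))"
  by (induction A rule: infinite_finite_induct) (simp_all add: assms additive_diff_zero[of f, OF assms])

lemma additive_zmul:
  fixes f :: "'a::ab_group_add \<Rightarrow> 'b::ab_group_add"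
  assumes "\<And>u v. f (u + v) = f u + f v"
  shows "f (zmul k v) = zmul k (f v)"
  by (simp add: zmul_def additive_diff_zero[of f, OF assms] additive_sum[of f, OF assms])

text \<open>
A field \<open>F(z) = \<Sum>\<^sub>k F\<^sub>k z\<^bsup>-k-1\<^esup>\<close> is stored as its modes \<open>F\<^sub>k\<close>; every vector is killed by almost all modes
of nonnegative index.
\<close>

typedef (overloaded) 'v fld = "{F :: int \<Rightarrow> 'v::ab_group_add \<Rightarrow> 'v.
    (\<forall>k u v. F k (u + v) = F k u + F k v) \<and> (\<forall>v. \<exists>K. \<forall>k\<ge>K. F k v = 0)}"
  morphisms md Abs_fld
  by (rule exI[of _ "\<lambda>k v. 0"]) simp

setup_lifting type_definition_fld

lemma fld_eqI: "(\<And>k v. md F k v = md G k v) \<Longrightarrow> F = G"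
  by (metis md_inject ext)

lemma md_add: "md F k (u + v) = md F k u + md F k v"
  using md[of F] by simp

lemmas md_zero [simp] = additive_diff_zero(1)[of "md F k" for F k, OF md_add]
lemmas md_minus = additive_diff_zero(2)[of "md F k" for F k, OF md_add]
lemmas md_diff = additive_diff_zero(3)[of "md F k" for F k, OF md_add]
lemmas md_sum = additive_sum[of "md F k" for F k, OF md_add]
lemmas md_zmul = additive_zmul[of "md F k" for F k, OF md_add]
lemmas md_lin = md_add md_minus md_diff md_sum md_zmul

lemma md_bound: "\<exists>K. \<forall>k\<ge>K. md F k v = 0"
  using md[of F] by simp

lemma ev_int_ge: "\<forall>\<^sub>F N in sequentially. K \<le> int N + k"
  using eventually_ge_at_top[of "nat (K - k)"] by eventually_elim auto

lemma md_ev: "\<forall>\<^sub>F N in sequentially. \<forall>j\<ge>N. md F (k + int j) v = 0"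
proof -
  obtain K where K: "\<forall>k\<ge>K. md F k v = 0" using md_bound by blast
  from ev_int_ge[of K k] show ?thesis
    by eventually_elim (use K in auto)
qed

instantiation fld :: (ab_group_add) ab_group_add
begin
lift_definition zero_fld :: "'a fld" is "\<lambda>k v. 0" by simp
lift_definition plus_fld :: "'a fld \<Rightarrow> 'a fld \<Rightarrow> 'a fld" is "\<lambda>F G k v. F k v + G k v"
proof (intro conjI allI, goal_cases)
  case (2 F G v)
  then obtain K L where "\<forall>k\<ge>K. F k v = 0" "\<forall>k\<ge>L. G k v = 0" by blast
  then show ?case by (intro exI[of _ "max K L"]) auto
qed (simp add: algebra_simps)
lift_definition minus_fld :: "'a fld \<Rightarrow> 'a fld \<Rightarrow> 'a fld" is "\<lambda>F G k v. F k v - G k v"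
proof (intro conjI allI, goal_cases)
  case (2 F G v)
  then obtain K L where "\<forall>k\<ge>K. F k v = 0" "\<forall>k\<ge>L. G k v = 0" by blast
  then show ?case by (intro exI[of _ "max K L"]) auto
qed (simp add: algebra_simps)
lift_definition uminus_fld :: "'a fld \<Rightarrow> 'a fld" is "\<lambda>F k v. - F k v"
  by (auto simp: algebra_simps)
instance
  by standard (transfer, auto simp: fun_eq_iff)+
end

lemma md_simps [simp]:
  "md 0 k v = 0" "md (F + G) k v = md F k v + md G k v" "md (F - G) k v = md F k v - md G k v"
  "md (- F) k v = - md F k v"
  by (transfer; simp)+

lift_definition fone :: "'v::ab_group_add fld" is "\<lambda>k v. if k = - 1 then v else 0"
  by (intro conjI allI exI[of _ 0]) auto

lift_definition fder :: "'v::ab_group_add fld \<Rightarrow> 'v fld" is "\<lambda>F k v. zmul (- k) (F (k - 1) v)"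
proof (intro conjI allI, goal_cases)
  case (2 F v)
  then obtain K where "\<forall>k\<ge>K. F k v = 0" by blast
  then show ?case by (intro exI[of _ "K + 1"]) auto
qed (simp add: zmul_add_right)

lift_definition shift :: "int \<Rightarrow> 'v::ab_group_add fld \<Rightarrow> 'v fld" is "\<lambda>r F k v. F (k + r) v"
proof (intro conjI allI, goal_cases)
  case (2 r F v)
  then obtain K where "\<forall>k\<ge>K. F k v = 0" by blast
  then show ?case by (intro exI[of _ "K - r"]) auto
qed simp

lemma md_fone: "md fone k v = (if k = - 1 then v else 0)" by transfer simp
lemma md_fder: "md (fder F) k v = zmul (- k) (md F (k - 1) v)" by transfer simp
lemma md_shift: "md (shift r F) k v = md F (k + r) v" by transfer simp

definition is_add :: "('v::ab_group_add \<Rightarrow> 'v) \<Rightarrow> bool" where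
  "is_add x \<longleftrightarrow> (\<forall>u v. x (u + v) = x u + x v)"

lemma is_addD: "is_add x \<Longrightarrow> x (u + v) = x u + x v" by (simp add: is_add_def)
lemma is_add_md [simp]: "is_add (md F k)" by (simp add: is_add_def md_add)
lemma is_add_lin:
  assumes "is_add x"
  shows "x 0 = 0" "x (- u) = - x u" "x (u - v) = x u - x v" "x (sum g A) = (\<Sum>a\<in>A. x (g a))"
   "x (zmul k v) = zmul k (x v)"
  using additive_diff_zero[of x, OF is_addD[OF assms]] additive_sum[of x, OF is_addD[OF assms]]
    additive_zmul[of x, OF is_addD[OF assms]] by auto

definition ad :: "('v::ab_group_add \<Rightarrow> 'v) \<Rightarrow> 'v fld \<Rightarrow> 'v fld" where
  "ad x F = Abs_fld (\<lambda>k v. x (md F k v) - md F k (x v))"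

lemma md_ad:
  assumes "is_add x"
  shows "md (ad x F) k v = x (md F k v) - md F k (x v)"
proof -
  have "(\<lambda>k v. x (md F k v) - md F k (x v)) \<in> {F. (\<forall>k u v. F k (u + v) = F k u + F k v) \<and> (\<forall>v. \<exists>K. \<forall>k\<ge>K. F k v = 0)}"
  proof (intro CollectI conjI allI)
    fix v
    obtain K L where "\<forall>k\<ge>K. md F k v = 0" "\<forall>k\<ge>L. md F k (x v) = 0" using md_bound by blast
    then show "\<exists>K. \<forall>k\<ge>K. x (md F k v) - md F k (x v) = 0"
      by (intro exI[of _ "max K L"]) (auto simp: is_add_lin[OF assms])
  qed (simp add: is_addD[OF assms] md_add)
  then show ?thesis by (simp add: ad_def Abs_fld_inverse)
qed

text \<open>
The sum of a sequence with finitely many nonzero terms, which is how infinite sums of modes act on a vector.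
\<close>

definition esum :: "(nat \<Rightarrow> 'v::ab_group_add) \<Rightarrow> 'v" where
  "esum f = sum f {..<(LEAST N. \<forall>j\<ge>N. f j = 0)}"

lemma esum_eq:
  assumes "\<forall>j\<ge>N. f j = 0"
  shows "esum f = sum f {..<N}"
proof -
  define M where "M = (LEAST N. \<forall>j\<ge>N. f j = 0)"
  have M: "\<forall>j\<ge>M. f j = 0" and "M \<le> N"
    unfolding M_def using assms by (rule LeastI, rule Least_le)
  have "sum f {..<M} = sum f {..<N}"
    by (rule sum.mono_neutral_left) (use M \<open>M \<le> N\<close> in auto)
  then show ?thesis by (simp add: esum_def M_def)
qed

text \<open>
The mode \<open>k\<close> of the normally ordered product \<open>:A(z) F(z):\<close>. On each vector both sums are finite.
\<close>

definition NO_fun :: "(int \<Rightarrow> 'v::ab_group_add \<Rightarrow> 'v) \<Rightarrow> (int \<Rightarrow> 'v \<Rightarrow> 'v) \<Rightarrow> int \<Rightarrow> 'v \<Rightarrow> 'v" where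
  "NO_fun A F k v = esum (\<lambda>j. A (- int j - 1) (F (k + int j) v)) + esum (\<lambda>j. F (k - 1 - int j) (A (int j) v))"

lemma NO_fun_eq:
  assumes "\<forall>j\<ge>N. md F (k + int j) v = 0" "\<forall>j\<ge>N. md A (int j) v = 0"
  shows "NO_fun (md A) (md F) k v = (\<Sum>j<N. md A (- int j - 1) (md F (k + int j) v))
     + (\<Sum>j<N. md F (k - 1 - int j) (md A (int j) v))"
  unfolding NO_fun_def
  by (intro arg_cong2[of _ _ _ _ "(+)"] esum_eq) (use assms in auto)

lift_definition NO :: "'v::ab_group_add fld \<Rightarrow> 'v fld \<Rightarrow> 'v fld" is NO_fun
proof -
  fix A F :: "int \<Rightarrow> 'v \<Rightarrow> 'v"
  assume A: "(\<forall>k u v. A k (u + v) = A k u + A k v) \<and> (\<forall>v. \<exists>K. \<forall>k\<ge>K. A k v = 0)"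
    and F: "(\<forall>k u v. F k (u + v) = F k u + F k v) \<and> (\<forall>v. \<exists>K. \<forall>k\<ge>K. F k v = 0)"
  define A' F' where "A' = Abs_fld A" and "F' = Abs_fld F"
  have AF: "A = md A'" "F = md F'" using A F by (auto simp: A'_def F'_def Abs_fld_inverse)
  have NO_ev: "\<forall>\<^sub>F N in sequentially. NO_fun A F k v = (\<Sum>j<N. A (- int j - 1) (F (k + int j) v))
     + (\<Sum>j<N. F (k - 1 - int j) (A (int j) v))" for k v
    using md_ev[of F' k v] md_ev[of A' 0 v] unfolding AF
    by eventually_elim (rule NO_fun_eq, auto)
  show "(\<forall>k u v. NO_fun A F k (u + v) = NO_fun A F k u + NO_fun A F k v) \<and>
       (\<forall>v. \<exists>K. \<forall>k\<ge>K. NO_fun A F k v = 0)"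
  proof (intro conjI allI)
    fix k u v
    have "\<forall>\<^sub>F N in sequentially. NO_fun A F k (u + v) = NO_fun A F k u + NO_fun A F k v"
      using NO_ev[of k "u + v"] NO_ev[of k u] NO_ev[of k v]
      by eventually_elim (simp add: A F sum.distrib algebra_simps)
    then show "NO_fun A F k (u + v) = NO_fun A F k u + NO_fun A F k v" by simp
  next
    fix v
    obtain K where K: "\<forall>k\<ge>K. F k v = 0" using F by blast
    obtain N where N: "\<forall>j\<ge>N. A (int j) v = 0"
      using md_ev[of A' 0 v] unfolding AF by (auto simp: eventually_sequentially)
    have "\<forall>j<N. \<exists>L. \<forall>k\<ge>L. F k (A (int j) v) = 0" using F by blast
    then obtain L where L: "\<And>j k. j < N \<Longrightarrow> k \<ge> L j \<Longrightarrow> F k (A (int j) v) = 0" by metis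
    define M where "M = max K (Max (insert 0 ((\<lambda>j. L j + 1 + int j) ` {..<N})))"
    show "\<exists>K. \<forall>k\<ge>K. NO_fun A F k v = 0"
    proof (intro exI[of _ M] allI impI)
      fix k assume "M \<le> k"
      then have "K \<le> k" and LM: "L j \<le> k - 1 - int j" if "j < N" for j
      proof -
        have "L j + 1 + int j \<le> Max (insert 0 ((\<lambda>j. L j + 1 + int j) ` {..<N}))"
          by (rule Max_ge) (use that in auto)
        with \<open>M \<le> k\<close> show "L j \<le> k - 1 - int j" unfolding M_def by linarith
      qed (simp add: M_def)
      from \<open>M \<le> k\<close> have Kk: "K \<le> k" by (simp add: M_def)
      have "NO_fun A F k v = (\<Sum>j<N. A (- int j - 1) (F (k + int j) v))
         + (\<Sum>j<N. F (k - 1 - int j) (A (int j) v))"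
        unfolding AF by (rule NO_fun_eq) (use K Kk N in \<open>auto simp: AF\<close>)
      also have "\<dots> = 0"
        using K Kk L LM additive_diff_zero(1)[of "A _"] A by (auto intro!: sum.neutral)
      finally show "NO_fun A F k v = 0" .
    qed
  qed
qed

lemma NO_eq:
  assumes "\<forall>j\<ge>N. md F (k + int j) v = 0" "\<forall>j\<ge>N. md A (int j) v = 0"
  shows "md (NO A F) k v = (\<Sum>j<N. md A (- int j - 1) (md F (k + int j) v))
     + (\<Sum>j<N. md F (k - 1 - int j) (md A (int j) v))"
  using NO_fun_eq[OF assms] by (simp add: NO.rep_eq)

lemma NO_ev: "\<forall>\<^sub>F N in sequentially. md (NO A F) k v = (\<Sum>j<N. md A (- int j - 1) (md F (k + int j) v))
     + (\<Sum>j<N. md F (k - 1 - int j) (md A (int j) v))"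
  using md_ev[of F k v] md_ev[of A 0 v]
  by eventually_elim (rule NO_eq, auto)

lemma NO_add_left: "NO (A + B) F = NO A F + NO B F"
proof (rule fld_eqI)
  fix k v
  have "\<forall>\<^sub>F N in sequentially. md (NO (A + B) F) k v = md (NO A F + NO B F) k v"
    using NO_ev[of "A + B" F k v] NO_ev[of A F k v] NO_ev[of B F k v]
    by eventually_elim (simp add: md_lin sum.distrib algebra_simps)
  then show "md (NO (A + B) F) k v = md (NO A F + NO B F) k v" by simp
qed

lemma NO_add_right: "NO A (F + G) = NO A F + NO A G"
proof (rule fld_eqI)
  fix k v
  have "\<forall>\<^sub>F N in sequentially. md (NO A (F + G)) k v = md (NO A F + NO A G) k v"
    using NO_ev[of A "F + G" k v] NO_ev[of A F k v] NO_ev[of A G k v]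
    by eventually_elim (simp add: md_lin sum.distrib algebra_simps)
  then show "md (NO A (F + G)) k v = md (NO A F + NO A G) k v" by simp
qed

lemmas NO_right_lin = additive_diff_zero[of "NO A" for A, OF NO_add_right]
   additive_sum[of "NO A" for A, OF NO_add_right] additive_zmul[of "NO A" for A, OF NO_add_right]
lemmas NO_left_lin = additive_diff_zero[of "\<lambda>A. NO A F" for F, OF NO_add_left]
   additive_sum[of "\<lambda>A. NO A F" for F, OF NO_add_left] additive_zmul[of "\<lambda>A. NO A F" for F, OF NO_add_left]

lemma fder_add: "fder (F + G) = fder F + fder G"
  by (rule fld_eqI) (simp add: md_fder zmul_add_right)
lemma shift_add: "shift r (F + G) = shift r F + shift r G"
  by (rule fld_eqI) (simp add: md_shift)
lemma shift_diff: "shift r (F - G) = shift r F - shift r G"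
  by (rule fld_eqI) (simp add: md_shift)
lemma ad_add: "is_add x \<Longrightarrow> ad x (F + G) = ad x F + ad x G"
  by (rule fld_eqI) (simp add: md_ad is_addD)
lemma shift_shift: "shift r (shift s F) = shift (r + s) F"
  by (rule fld_eqI) (simp add: md_shift algebra_simps)
lemma shift_0 [simp]: "shift 0 F = F"
  by (rule fld_eqI) (simp add: md_shift)
lemma fder_fone [simp]: "fder fone = 0"
  by (rule fld_eqI) (simp add: md_fder md_fone)
lemma ad_fone [simp]: "is_add x \<Longrightarrow> ad x fone = 0"
  by (rule fld_eqI) (simp add: md_ad md_fone is_add_lin)

lemma NO_fone: "NO fone F = F"
proof (rule fld_eqI)
  fix k v
  have "\<forall>\<^sub>F N in sequentially. md (NO fone F) k v = md F k v"
    using NO_ev[of fone F k v] eventually_gt_at_top[of 0]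
    by eventually_elim (simp add: md_fone if_distrib[of "\<lambda>x. md _ _ x"] sum.delta cong: if_cong)
  then show "md (NO fone F) k v = md F k v" by simp
qed

lemma ad_NO:
  assumes "is_add x"
  shows "ad x (NO A F) = NO (ad x A) F + NO A (ad x F)"
proof (rule fld_eqI)
  fix k v
  have "\<forall>\<^sub>F N in sequentially. md (ad x (NO A F)) k v = md (NO (ad x A) F + NO A (ad x F)) k v"
    using NO_ev[of A F k v] NO_ev[of A F k "x v"] NO_ev[of "ad x A" F k v] NO_ev[of A "ad x F" k v]
    by eventually_elim (simp add: md_ad assms is_addD is_add_lin[OF assms] md_lin sum_subtractf)
  then show "md (ad x (NO A F)) k v = md (NO (ad x A) F + NO A (ad x F)) k v" by simp
qed

lemma shift_NO: "shift r (NO A F) = NO A (shift r F)"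
proof (rule fld_eqI)
  fix k v
  have "\<forall>\<^sub>F N in sequentially. md (shift r (NO A F)) k v = md (NO A (shift r F)) k v"
    using NO_ev[of A F "k + r" v] NO_ev[of A "shift r F" k v]
    by eventually_elim (simp add: md_shift algebra_simps)
  then show "md (shift r (NO A F)) k v = md (NO A (shift r F)) k v" by simp
qed

text \<open>
Multiplication of \<open>A(z)\<close> by \<open>z\<close> moves the mode \<open>A\<^sub>0\<close> from the annihilation part to the
creation part, and the commutator with \<open>A\<^sub>0\<close> is the correction.
\<close>

lemma NO_shift1: "NO (shift 1 A) F = shift 1 (NO A F) + ad (md A 0) F"
proof (rule fld_eqI)
  fix k v
  have "\<forall>\<^sub>F N in sequentially. md (NO (shift 1 A) F) k v = md (shift 1 (NO A F) + ad (md A 0) F) k v"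
    using NO_ev[of "shift 1 A" F k v] NO_ev[of A F "k + 1" v] md_ev[of F k v] md_ev[of A 0 v]
  proof eventually_elim
    case (elim N)
    define g where "g j = md A (- int j) (md F (k + int j) v)" for j
    define h where "h j = md F (k - int j) (md A (int j) v)" for j
    have g: "(\<Sum>j<N. g j) - (\<Sum>j<N. g (Suc j)) = g 0 - g N" by (simp add: sum_lessThan_telescope' flip: sum_subtractf)
    have h: "(\<Sum>j<N. h (Suc j)) - (\<Sum>j<N. h j) = h N - h 0" by (simp add: sum_lessThan_telescope flip: sum_subtractf)
    have e: "k - int j - 1 = k - (1 + int j)" "k + (1 + int j) = k + 1 + int j" "- 1 - int j = - int j - 1" for j by auto
    have "g N = 0" "h N = 0" using elim by (simp_all add: g_def h_def)
    with elim g h show ?case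
      by (simp add: md_shift md_ad g_def h_def algebra_simps e)
  qed
  then show "md (NO (shift 1 A) F) k v = md (shift 1 (NO A F) + ad (md A 0) F) k v" by simp
qed

lemma fder_NO: "fder (NO A F) = NO (fder A) F + NO A (fder F)"
proof (rule fld_eqI)
  fix k v
  have "\<forall>\<^sub>F N in sequentially. md (fder (NO A F)) k v = md (NO (fder A) F + NO A (fder F)) k v"
    using NO_ev[of A F "k - 1" v] NO_ev[of "fder A" F k v] NO_ev[of A "fder F" k v] md_ev[of F "k - 1" v] md_ev[of A 0 v] md_ev[of A "- 1" v]
  proof eventually_elim
    case (elim N)
    define g where "g j = md A (- int j - 1) (md F (k - 1 + int j) v)" for j
    define h where "h j = md F (k - 2 - int j) (md A (int j) v)" for j
    have gN: "g N = 0" and hN: "h N = 0" using elim by (simp_all add: g_def h_def)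
    have z1: "(\<Sum>j<M. zmul (int j + 1) (x (Suc j)) - zmul (int j) (x j)) = zmul (int M) (x M)"
      for x :: "nat \<Rightarrow> 'a" and M
      by (induction M) (simp_all add: algebra_simps)
    have A1: "md A (- int j - 2) (md F (k + int j) v) = g (Suc j)" for j
      by (simp add: g_def algebra_simps)
    have A2: "md F (k - 1 - int (Suc j)) (md A (int j) v) = h j" for j by (simp add: h_def algebra_simps)
    have L: "md (fder (NO A F)) k v = (\<Sum>j<N. zmul (- k) (g j)) + (\<Sum>j<N. zmul (- k) (h j))"
      using elim(1) by (simp add: md_fder zmul_add_right zmul_sum g_def h_def algebra_simps)
    have R1: "md (NO (fder A) F) k v = (\<Sum>j<N. zmul (int j + 1) (g (Suc j))) + (\<Sum>j<N. zmul (- int j) (md F (k - 1 - int j) (md A (int j - 1) v)))"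
      using elim(2) by (simp add: md_fder md_zmul g_def algebra_simps)
    have R2: "md (NO A (fder F)) k v = (\<Sum>j<N. zmul (- k - int j) (g j)) + (\<Sum>j<N. zmul (1 + int j - k) (h j))"
      using elim(3) by (simp add: md_fder md_zmul g_def h_def algebra_simps)
    have R3: "(\<Sum>j<N. zmul (- int j) (md F (k - 1 - int j) (md A (int j - 1) v))) = (\<Sum>j<N. zmul (- (1 + int j)) (h j))"
    proof (cases N)
      case (Suc M)
      have "(\<Sum>j<Suc m. zmul (- int j) (md F (k - 1 - int j) (md A (int j - 1) v))) = (\<Sum>j<m. zmul (- (1 + int j)) (h j))" for m
        by (induction m) (simp_all add: h_def algebra_simps)
      moreover have "h M = 0" using elim(6)[rule_format, of "Suc M"] Suc by (simp add: h_def)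
      ultimately show ?thesis unfolding Suc by simp
    qed simp
    have G: "(\<Sum>j<N. zmul (- k) (g j)) = (\<Sum>j<N. zmul (int j + 1) (g (Suc j))) + (\<Sum>j<N. zmul (- k - int j) (g j))"
      using z1[of g N] gN by (simp add: zmul_diff_left zmul_add_left zmul_minus_left sum.distrib sum_subtractf algebra_simps)
    have H: "(\<Sum>j<N. zmul (- k) (h j)) = (\<Sum>j<N. zmul (- (1 + int j)) (h j)) + (\<Sum>j<N. zmul (1 + int j - k) (h j))"
      by (simp flip: sum.distrib zmul_add_left)
    show ?case
      using L R1 R2 R3 G H by simp
  qed
  then show "md (fder (NO A F)) k v = md (NO (fder A) F + NO A (fder F)) k v" by simp
qed

lemma sum_diagonals:
  fixes h :: "nat \<Rightarrow> 'v::ab_group_add"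
  assumes "\<forall>p\<ge>N. h p = 0"
  shows "(\<Sum>i<N. \<Sum>j<N. h (i + j)) = (\<Sum>p<N. zmul (int p + 1) (h p))"
proof -
  have "(\<Sum>i<N. \<Sum>j<N. h (i + j)) = (\<Sum>(i, j)\<in>{..<N} \<times> {..<N}. h (i + j))"
    by (simp add: sum.cartesian_product)
  also have "\<dots> = (\<Sum>(i, j)\<in>{(i, j). i + j < N}. h (i + j))"
    by (rule sum.mono_neutral_right) (use assms in \<open>auto simp: not_less\<close>, meson not_less)
  also have "\<dots> = (\<Sum>p<N. \<Sum>i\<le>p. h (i + (p - i)))"
    by (rule sum.triangle_reindex)
  also have "\<dots> = (\<Sum>p<N. \<Sum>i\<le>p. h p)" by simp
  also have "\<dots> = (\<Sum>p<N. zmul (int p + 1) (h p))"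
  proof (intro sum.cong refl)
    fix p
    have "nat (int p + 1) = Suc p" by simp
    then show "(\<Sum>i\<le>p. h p) = zmul (int p + 1) (h p)" by (simp add: zmul_def lessThan_Suc_atMost)
  qed
  finally show ?thesis .
qed

lemma NO_inner_ev:
  "\<forall>\<^sub>F N in sequentially. \<forall>i. md (NO B F) (k - int i) (md A (int i) v)
     = (\<Sum>j<N. md B (- int j - 1) (md F (k - int i + int j) (md A (int i) v)))
     + (\<Sum>j<N. md F (k - int i - 1 - int j) (md B (int j) (md A (int i) v)))"
proof -
  obtain M where M: "\<forall>i\<ge>M. md A (0 + int i) v = 0"
    using md_ev[of A 0 v] by (auto simp: eventually_sequentially)
  have "\<forall>\<^sub>F N in sequentially. \<forall>i\<in>{..<M}. md (NO B F) (k - int i) (md A (int i) v)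
     = (\<Sum>j<N. md B (- int j - 1) (md F (k - int i + int j) (md A (int i) v)))
     + (\<Sum>j<N. md F (k - int i - 1 - int j) (md B (int j) (md A (int i) v)))"
    using NO_ev by (intro eventually_ball_finite) auto
  then show ?thesis
  proof eventually_elim
    case (elim N)
    show ?case
    proof
      fix i
      show "md (NO B F) (k - int i) (md A (int i) v)
     = (\<Sum>j<N. md B (- int j - 1) (md F (k - int i + int j) (md A (int i) v)))
     + (\<Sum>j<N. md F (k - int i - 1 - int j) (md B (int j) (md A (int i) v)))"
        using elim M by (cases "i < M") auto
    qed
  qed
qed

lemma NO_NO_ev:
  "\<forall>\<^sub>F N in sequentially. md (NO A (NO B F)) k v =
      (\<Sum>i<N. \<Sum>j<N. md A (- int i - 1) (md B (- int j - 1) (md F (k + int (i + j)) v)))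
    + (\<Sum>i<N. \<Sum>j<N. md A (- int i - 1) (md F (k + int i - 1 - int j) (md B (int j) v)))
    + (\<Sum>i<N. \<Sum>j<N. md B (- int j - 1) (md F (k - 1 - int i + int j) (md A (int i) v)))
    + (\<Sum>i<N. \<Sum>j<N. md F (k - 2 - int (i + j)) (md B (int j) (md A (int i) v)))"
  using NO_ev[of A "NO B F" k v] md_ev[of F k v] md_ev[of B 0 v] NO_inner_ev[of B F "k - 1" A v]
proof eventually_elim
  case (elim N)
  have 1: "md (NO B F) (k + int i) v = (\<Sum>j<N. md B (- int j - 1) (md F (k + int (i + j)) v))
     + (\<Sum>j<N. md F (k + int i - 1 - int j) (md B (int j) v))" for i
  proof -
    have "md F (k + int i + int j) v = 0" if "N \<le> j" for j
    proof -
      have "md F (k + int (i + j)) v = 0" using elim(2) that by (metis trans_le_add2)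
      then show ?thesis by (simp add: add.assoc)
    qed
    with elim(3) show ?thesis by (subst NO_eq[where N = N]) (auto simp: add.assoc)
  qed
  show ?case
    unfolding elim(1) using elim(4)
    by (simp add: 1 md_lin sum.distrib algebra_simps)
qed

text \<open>
If the creation parts and the annihilation parts of \<open>A\<close> and \<open>B\<close> commute up to the modes of \<open>C\<close>, then in
\<open>:A :B F:: - :B :A F::\<close> the mixed terms cancel, and the mode \<open>C\<^sub>p\<close> occurs once for each splitting of \<open>p\<close> into two indices of the
same sign. These multiplicities assemble into the derivative of \<open>C\<close>. A central term of the commutators occurs only for indices of opposite sign,
so it does not contribute.
\<close>

lemma NO_commutator:
  assumes "\<And>i j v. (0 \<le> i \<and> 0 \<le> j) \<or> (i < 0 \<and> j < 0) \<Longrightarrow>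
     md A i (md B j v) - md B j (md A i v) = md C (i + j) v"
  shows "NO A (NO B F) - NO B (NO A F) = NO (fder C) F"
proof (rule fld_eqI)
  fix k v
  have "\<forall>\<^sub>F N in sequentially. md (NO A (NO B F) - NO B (NO A F)) k v = md (NO (fder C) F) k v"
    using NO_NO_ev[of A B F k v] NO_NO_ev[of B A F k v] NO_ev[of "fder C" F k v]
      md_ev[of F k v] md_ev[of C 0 v] md_ev[of C "- 1" v]
  proof eventually_elim
    case (elim N)
    let ?g = "\<lambda>p. md C (- int p - 2) (md F (k + int p) v)"
    let ?h = "\<lambda>p. md F (k - 2 - int p) (md C (int p) v)"
    have PP: "(\<Sum>i<N. \<Sum>j<N. md A (- int i - 1) (md B (- int j - 1) (md F (k + int (i + j)) v)))
       - (\<Sum>i<N. \<Sum>j<N. md B (- int i - 1) (md A (- int j - 1) (md F (k + int (i + j)) v)))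
       = (\<Sum>p<N. zmul (int p + 1) (?g p))"
    proof -
      have "(\<Sum>i<N. \<Sum>j<N. md B (- int i - 1) (md A (- int j - 1) (md F (k + int (i + j)) v)))
        = (\<Sum>i<N. \<Sum>j<N. md B (- int j - 1) (md A (- int i - 1) (md F (k + int (i + j)) v)))"
        by (subst sum.swap) (simp add: add.commute)
      moreover have "md A (- int i - 1) (md B (- int j - 1) w) - md B (- int j - 1) (md A (- int i - 1) w) = md C (- int (i + j) - 2) w" for i j w
        by (subst assms) (auto simp: algebra_simps)
      ultimately have "(\<Sum>i<N. \<Sum>j<N. md A (- int i - 1) (md B (- int j - 1) (md F (k + int (i + j)) v)))
       - (\<Sum>i<N. \<Sum>j<N. md B (- int i - 1) (md A (- int j - 1) (md F (k + int (i + j)) v)))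
       = (\<Sum>i<N. \<Sum>j<N. ?g (i + j))"
        by (simp flip: sum_subtractf)
      also have "\<dots> = (\<Sum>p<N. zmul (int p + 1) (?g p))"
        by (rule sum_diagonals) (use elim(4) in auto)
      finally show ?thesis .
    qed
    have MM: "(\<Sum>i<N. \<Sum>j<N. md F (k - 2 - int (i + j)) (md B (int j) (md A (int i) v)))
       - (\<Sum>i<N. \<Sum>j<N. md F (k - 2 - int (i + j)) (md A (int j) (md B (int i) v)))
       = - (\<Sum>p<N. zmul (int p + 1) (?h p))"
    proof -
      have "(\<Sum>i<N. \<Sum>j<N. md F (k - 2 - int (i + j)) (md A (int j) (md B (int i) v)))
        = (\<Sum>i<N. \<Sum>j<N. md F (k - 2 - int (i + j)) (md A (int i) (md B (int j) v)))"
        by (subst sum.swap) (simp add: add.commute)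
      moreover have "md F l (md B (int j) (md A (int i) v)) - md F l (md A (int i) (md B (int j) v)) = - md F l (md C (int (i + j)) v)" for i j l
        using assms[of "int i" "int j" v] by (simp flip: md_diff md_minus add: eq_diff_eq diff_eq_eq)
      ultimately have "(\<Sum>i<N. \<Sum>j<N. md F (k - 2 - int (i + j)) (md B (int j) (md A (int i) v)))
       - (\<Sum>i<N. \<Sum>j<N. md F (k - 2 - int (i + j)) (md A (int j) (md B (int i) v)))
       = - (\<Sum>i<N. \<Sum>j<N. ?h (i + j))"
        by (simp flip: sum_subtractf sum_negf)
      also have "(\<Sum>i<N. \<Sum>j<N. ?h (i + j)) = (\<Sum>p<N. zmul (int p + 1) (?h p))"
        by (rule sum_diagonals) (use elim(5) in auto)
      finally show ?thesis .
    qed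
    have PM: "(\<Sum>i<N. \<Sum>j<N. md A (- int i - 1) (md F (k + int i - 1 - int j) (md B (int j) v)))
      = (\<Sum>i<N. \<Sum>j<N. md A (- int j - 1) (md F (k - 1 - int i + int j) (md B (int i) v)))"
      by (subst sum.swap) (simp add: algebra_simps)
    have MP: "(\<Sum>i<N. \<Sum>j<N. md B (- int j - 1) (md F (k - 1 - int i + int j) (md A (int i) v)))
      = (\<Sum>i<N. \<Sum>j<N. md B (- int i - 1) (md F (k + int i - 1 - int j) (md A (int j) v)))"
      by (subst sum.swap) (simp add: algebra_simps)
    have R: "(\<Sum>j<N. zmul (- int j) (md F (k - 1 - int j) (md C (int j - 1) v))) = - (\<Sum>p<N. zmul (int p + 1) (?h p))"
    proof (cases N)
      case (Suc M)
      have "(\<Sum>j<Suc m. zmul (- int j) (md F (k - 1 - int j) (md C (int j - 1) v))) = - (\<Sum>p<m. zmul (int p + 1) (?h p))" for m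
        by (induction m) (simp_all add: algebra_simps flip: zmul_minus_left)
      moreover have "?h M = 0" using elim(6)[rule_format, of "Suc M"] Suc by simp
      ultimately show ?thesis unfolding Suc by simp
    qed simp
    have N3: "md (NO (fder C) F) k v = (\<Sum>p<N. zmul (int p + 1) (?g p))
       + (\<Sum>j<N. zmul (- int j) (md F (k - 1 - int j) (md C (int j - 1) v)))"
      unfolding elim(3) by (simp add: md_fder md_zmul algebra_simps)
    show ?case unfolding md_simps elim(1,2) N3 R
      using PP MM PM MP by (simp add: algebra_simps)
  qed
  then show "md (NO A (NO B F) - NO B (NO A F)) k v = md (NO (fder C) F) k v" by simp
qed

section \<open>Operators that annihilate a column determinant\<close>

text \<open>
The odd elements \<open>\<xi>\<^sub>j\<close> are the columns of a matrix contracted with Grassmann variables, so the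
product over all columns is the column determinant. \<open>N\<close> and \<open>E1\<close> are shifted forms of the modes \<open>E\<^sub>a\<^sub>b t\<^sup>0\<close> and
\<open>E\<^sub>a\<^sub>b t\<^sup>1\<close>, \<open>Dg\<close> counts the Grassmann degree, and \<open>J\<close> is the left ideal that annihilates the vacuum. The term
\<open>of_nat CARD('n) * \<psi> b\<close> is the contribution of the critical level.
\<close>

locale column_det =
  fixes \<psi> \<xi> :: "'n::finite \<Rightarrow> 'r::ring_1" and N E1 :: "'n \<Rightarrow> 'n \<Rightarrow> 'r" and Dg :: 'r and J :: "'r set"
  assumes psi_psi: "\<psi> a * \<psi> b = - (\<psi> b * \<psi> a)"
    and psi_xi: "\<psi> a * \<xi> j = - (\<xi> j * \<psi> a)"
    and xi_xi: "\<xi> i * \<xi> j = - (\<xi> j * \<xi> i)"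
    and xi_sq: "\<xi> i * \<xi> i = 0"
    and N_xi: "N a b * \<xi> j = \<xi> j * N a b - (if a = j then \<xi> b else 0)"
    and Dg_xi: "Dg * \<xi> j = \<xi> j * Dg + \<xi> j"
    and E1_xi: "E1 a b * \<xi> j = \<xi> j * E1 a b + \<psi> j * N a b + \<psi> b * N a j + (if a = b then \<psi> j else 0)
       - (if a = j then (\<Sum>i\<in>UNIV. \<psi> i * N i b) - \<psi> b * Dg + of_nat CARD('n) * \<psi> b else 0)"
    and J_add: "x \<in> J \<Longrightarrow> y \<in> J \<Longrightarrow> x + y \<in> J"
    and J_mult: "x \<in> J \<Longrightarrow> r * x \<in> J"
    and N_J: "N a b \<in> J" and Dg_J: "Dg \<in> J" and E1_J: "E1 a b \<in> J"
begin

lemma J_0: "0 \<in> J" using J_mult[OF Dg_J, of 0] by simp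
lemma J_minus: "x \<in> J \<Longrightarrow> - x \<in> J" using J_mult[of x "- 1"] by simp
lemma J_diff: "x \<in> J \<Longrightarrow> y \<in> J \<Longrightarrow> x - y \<in> J" using J_add[of x "- y"] J_minus by simp
lemma J_sum: "(\<And>i. i \<in> A \<Longrightarrow> f i \<in> J) \<Longrightarrow> sum f A \<in> J"
  by (induction A rule: infinite_finite_induct) (auto intro: J_0 J_add)

definition X :: "'n list \<Rightarrow> 'r" where "X l = prod_list (map \<xi> l)"

text \<open>
The sum over the occurrences of \<open>a\<close> in \<open>l\<close> of the product with \<open>\<xi>\<^sub>a\<close> replaced by \<open>c\<close>.
\<close>

fun sub :: "'n \<Rightarrow> 'r \<Rightarrow> 'n list \<Rightarrow> 'r" where
  "sub a c [] = 0"
| "sub a c (j # l) = (if j = a then c * X l else 0) + \<xi> j * sub a c l"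

text \<open>
The derivative of the product in the direction \<open>\<xi>\<^sub>j \<mapsto> \<psi>\<^sub>j\<close> for all \<open>j\<close>.
\<close>

fun DD :: "'n list \<Rightarrow> 'r" where
  "DD [] = 0"
| "DD (j # l) = \<psi> j * X l + \<xi> j * DD l"

text \<open>
The derivative \<open>DD\<close> of the words obtained by replacing \<open>\<xi>\<^sub>a\<close> by \<open>\<xi>\<^sub>b\<close>, with \<open>\<xi>\<^sub>b\<close> differentiated to \<open>\<psi>\<^sub>b\<close>.
\<close>

fun DS :: "'n \<Rightarrow> 'n \<Rightarrow> 'n list \<Rightarrow> 'r" where
  "DS a b [] = 0"
| "DS a b (j # l) = (if j = a then \<psi> b * X l + \<xi> b * DD l else 0)
     + \<psi> j * sub a (\<xi> b) l + \<xi> j * DS a b l"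

lemma X_simps [simp]: "X [] = 1" "X (j # l) = \<xi> j * X l"
  by (simp_all add: X_def)

definition odd_el :: "'r \<Rightarrow> bool" where "odd_el c \<longleftrightarrow> (\<forall>j. c * \<xi> j = - (\<xi> j * c))"

lemma odd_psi: "odd_el (\<psi> a)" by (simp add: odd_el_def psi_xi)
lemma odd_xi: "odd_el (\<xi> a)" unfolding odd_el_def by (intro allI xi_xi)

lemma odd_elD: "odd_el c \<Longrightarrow> c * (\<xi> j * x) = - (\<xi> j * (c * x))"
  by (metis (no_types) odd_el_def minus_mult_left mult.assoc)

lemma sub_swap:
  assumes "odd_el c" "odd_el d" "c * d = - (d * c)"
  shows "c * sub a d l = - (d * sub a c l)"
proof (induction l)
  case (Cons j l)
  have "c * (\<xi> j * sub a d l) = - (d * (\<xi> j * sub a c l))"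
    using Cons by (simp add: odd_elD assms)
  moreover have "c * (d * X l) = - (d * (c * X l))"
    using assms(3) by (metis minus_mult_left mult.assoc)
  ultimately show ?case by (simp add: distrib_left)
qed simp

lemma sub_self:
  assumes "odd_el c" "c * c = 0"
  shows "c * sub a c l = 0"
proof (induction l)
  case (Cons j l)
  have "c * (c * X l) = 0" using assms(2) by (simp flip: mult.assoc)
  with Cons show ?case by (simp add: distrib_left odd_elD assms)
qed simp

lemma sum_sub_psi: "(\<Sum>i\<in>UNIV. sub i (\<psi> i) l) = DD l"
proof (induction l)
  case (Cons j l)
  then show ?case by (simp add: sum.distrib sum.delta if_distrib[of "\<lambda>x. x * _"] flip: sum_distrib_left cong: if_cong)
qed simp

lemma N_X: "N a b * X l + sub a (\<xi> b) l \<in> J"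
proof (induction l)
  case (Cons j l)
  have "N a b * X (j # l) + sub a (\<xi> b) (j # l) = \<xi> j * (N a b * X l + sub a (\<xi> b) l)"
    by (simp add: N_xi distrib_left left_diff_distrib flip: mult.assoc)
  with Cons show ?case by (simp add: J_mult)
qed (simp add: N_J)

lemma Dg_X: "Dg * X l - of_nat (length l) * X l \<in> J"
proof (induction l)
  case (Cons j l)
  have "Dg * X (j # l) - of_nat (length (j # l)) * X (j # l) = (Dg * \<xi> j) * X l - of_nat (length l) * \<xi> j * X l - \<xi> j * X l"
    by (simp add: algebra_simps)
  also have "\<dots> = \<xi> j * (Dg * X l - of_nat (length l) * X l)"
    by (simp add: Dg_xi distrib_right right_diff_distrib mult_of_nat_commute[of _ "\<xi> j"] flip: mult.assoc)
  finally show ?case using Cons by (simp add: J_mult)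
qed (simp add: Dg_J)

text \<open>
The value of \<open>E1 a b\<close> on a partial product. The factor \<open>length l - CARD('n)\<close> is the difference between the Grassmann degree
and the critical level, which vanishes for the full product.
\<close>

definition E1_val :: "'n \<Rightarrow> 'n \<Rightarrow> 'n list \<Rightarrow> 'r" where
  "E1_val a b l = (of_nat (length l) - of_nat CARD('n)) * sub a (\<psi> b) l - DS a b l + (if a = b then DD l else 0)"

text \<open>
Moving \<open>E1\<close> past one factor \<open>\<xi>\<^sub>j\<close> leaves \<open>N\<close> and \<open>Dg\<close> in front of the shorter product; their values are already known
modulo \<open>J\<close>, and the recursion for \<open>E1_val\<close> is what remains.
\<close>

lemma E1_X: "E1 a b * X l - E1_val a b l \<in> J"
proof (induction l)
  case (Cons j l)
  define p where "p = (of_nat (length l) :: 'r)"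
  define n where "n = (of_nat CARD('n) :: 'r)"
  have cp: "x * (p * y) = p * (x * y)" "x * (n * y) = n * (x * y)" for x y
    using mult_of_nat_commute[of "length l" x] mult_of_nat_commute[of "CARD('n)" x]
    unfolding p_def n_def by (simp_all flip: mult.assoc)
  have s1: "\<psi> b * sub a (\<xi> j) l = - (\<xi> j * sub a (\<psi> b) l)" for a b j
    by (intro sub_swap odd_psi odd_xi psi_xi)
  have s2: "(\<Sum>i\<in>UNIV. \<psi> i * sub i (\<xi> b) l) = - (\<xi> b * DD l)"
  proof -
    have "(\<Sum>i\<in>UNIV. \<psi> i * sub i (\<xi> b) l) = (\<Sum>i\<in>UNIV. - (\<xi> b * sub i (\<psi> i) l))"
      by (intro sum.cong refl sub_swap odd_psi odd_xi psi_xi)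
    then show ?thesis by (simp add: sum_negf flip: sum_distrib_left sum_sub_psi)
  qed
  define T where "T = (if a = j then (\<Sum>i\<in>UNIV. \<psi> i * (N i b * X l + sub i (\<xi> b) l)) - \<psi> b * (Dg * X l - p * X l) else 0)"
  have T: "T = (if a = j then (\<Sum>i\<in>UNIV. \<psi> i * N i b * X l) - \<xi> b * DD l - \<psi> b * Dg * X l + p * (\<psi> b * X l) else 0)"
    by (simp add: T_def distrib_left right_diff_distrib sum.distrib s2 cp mult.assoc)
  have "E1 a b * X (j # l) - E1_val a b (j # l) = \<xi> j * (E1 a b * X l - E1_val a b l)
     + \<psi> j * (N a b * X l + sub a (\<xi> b) l) + \<psi> b * (N a j * X l + sub a (\<xi> j) l) - T"
  proof -
    have e: "E1 a b * X (j # l) = (E1 a b * \<xi> j) * X l" by (simp add: mult.assoc)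
    have v: "E1_val a b (j # l) = (p + 1 - n) * ((if j = a then \<psi> b * X l else 0) + \<xi> j * sub a (\<psi> b) l)
      - ((if j = a then \<psi> b * X l + \<xi> b * DD l else 0) + \<psi> j * sub a (\<xi> b) l + \<xi> j * DS a b l)
      + (if a = b then \<psi> j * X l + \<xi> j * DD l else 0)"
      by (simp add: E1_val_def p_def n_def algebra_simps)
    show ?thesis
      unfolding e v E1_xi T unfolding E1_val_def p_def[symmetric] n_def[symmetric]
      by (cases "a = j"; cases "a = b") (simp_all add: algebra_simps s1 cp sum_distrib_left sum_distrib_right)
  qed
  moreover have "T \<in> J"
    unfolding T_def p_def by (auto intro!: J_diff J_sum J_mult N_X Dg_X J_0)
  ultimately show ?case
    using J_diff[OF J_add[OF J_add[OF J_mult[OF Cons] J_mult[OF N_X]] J_mult[OF N_X]]] by metis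
qed (simp add: E1_J E1_val_def)

lemma sub_notin: "a \<notin> set l \<Longrightarrow> sub a c l = 0" by (induction l) auto
lemma DS_notin: "a \<notin> set l \<Longrightarrow> DS a b l = 0" by (induction l) (auto simp: sub_notin)

lemma DS_diag: "distinct l \<Longrightarrow> a \<in> set l \<Longrightarrow> sub a (\<xi> a) l = X l \<and> DS a a l = DD l"
  by (induction l) (auto simp: sub_notin DS_notin)

lemma xi_X_0: "b \<in> set l \<Longrightarrow> \<xi> b * X l = 0"
proof (induction l)
  case (Cons j l)
  show ?case
  proof (cases "j = b")
    case True
    then show ?thesis by (simp add: xi_sq flip: mult.assoc)
  next
    case False
    with Cons show ?thesis by (simp add: odd_elD[OF odd_xi])
  qed
qed simp

lemma xi_DD_0: "b \<in> set l \<Longrightarrow> \<psi> b * X l + \<xi> b * DD l = 0"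
proof (induction l)
  case (Cons j l)
  have p: "\<psi> b * (\<xi> j * X l) = - (\<xi> j * (\<psi> b * X l))" by (rule odd_elD[OF odd_psi])
  have q: "\<xi> b * (\<xi> j * DD l) = - (\<xi> j * (\<xi> b * DD l))" by (rule odd_elD[OF odd_xi])
  have r: "\<xi> b * (\<psi> j * X l) = - (\<psi> j * (\<xi> b * X l))"
    by (metis psi_xi minus_mult_left mult.assoc minus_minus)
  show ?case
  proof (cases "j = b")
    case True
    then show ?thesis by (simp add: p q r distrib_left) (simp add: xi_sq psi_xi flip: mult.assoc)
  next
    case False
    with Cons have "b \<in> set l" by simp
    then have "\<xi> j * (\<psi> b * X l + \<xi> b * DD l) = 0" "\<xi> b * X l = 0" using Cons xi_X_0 by auto
    then show ?thesis by (simp add: p q r distrib_left eq_neg_iff_add_eq_0 add_ac neg_eq_iff_add_eq_0)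
  qed
qed simp

lemma sub_xi_0: "distinct l \<Longrightarrow> b \<in> set l \<Longrightarrow> a \<noteq> b \<Longrightarrow> sub a (\<xi> b) l = 0"
proof (induction l)
  case (Cons j l)
  show ?case
  proof (cases "b \<in> set l")
    case True
    with Cons show ?thesis by (auto simp: xi_X_0)
  next
    case False
    with Cons have "j = b" by simp
    with Cons(4) show ?thesis by (simp add: sub_self odd_xi xi_sq)
  qed
qed simp

lemma xi_DS_0: "\<psi> b * sub a (\<xi> b) l + \<xi> b * DS a b l = 0"
proof (induction l)
  case (Cons j l)
  have 1: "\<psi> b * (\<xi> j * sub a (\<xi> b) l) = - (\<xi> j * (\<psi> b * sub a (\<xi> b) l))" by (rule odd_elD[OF odd_psi])
  have 2: "\<xi> b * (\<xi> j * DS a b l) = - (\<xi> j * (\<xi> b * DS a b l))" by (rule odd_elD[OF odd_xi])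
  have 3: "\<xi> b * (\<psi> j * sub a (\<xi> b) l) = 0"
  proof -
    have "\<xi> b * (\<psi> j * sub a (\<xi> b) l) = - (\<psi> j * (\<xi> b * sub a (\<xi> b) l))"
      by (metis psi_xi minus_mult_left mult.assoc minus_minus)
    then show ?thesis by (simp add: sub_self odd_xi xi_sq)
  qed
  have 4: "\<psi> b * (\<xi> b * X l) + \<xi> b * (\<psi> b * X l + \<xi> b * DD l) = 0"
    by (simp add: distrib_left) (simp add: xi_sq psi_xi flip: mult.assoc)
  have "\<psi> b * sub a (\<xi> b) (j # l) + \<xi> b * DS a b (j # l)
     = (if j = a then \<psi> b * (\<xi> b * X l) + \<xi> b * (\<psi> b * X l + \<xi> b * DD l) else 0)
       - \<xi> j * (\<psi> b * sub a (\<xi> b) l + \<xi> b * DS a b l)"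
    by (simp only: sub.simps DS.simps distrib_left 1 2 3) (simp add: distrib_left)
  then show ?case by (simp add: 4 Cons)
qed simp

lemma DS_off: "distinct l \<Longrightarrow> b \<in> set l \<Longrightarrow> a \<noteq> b \<Longrightarrow> DS a b l = 0"
proof (induction l)
  case (Cons j l)
  show ?case
  proof (cases "j = b")
    case True
    with Cons show ?thesis using xi_DS_0[of b a l] by simp
  next
    case False
    with Cons have "b \<in> set l" by simp
    with Cons show ?thesis by (auto simp: xi_DD_0 sub_xi_0)
  qed
qed simp

text \<open>
When all columns occur, replacing a column by another one gives a repeated factor, and \<open>\<xi>\<^sub>b \<xi>\<^sub>b = 0\<close>. For \<open>a \<noteq> b\<close> all
terms vanish for this reason; for \<open>a = b\<close> the two copies of \<open>DD\<close> cancel. The first term of \<open>E1_val\<close> vanishes because the level is critical.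
\<close>

theorem E1_column_det: "distinct l \<Longrightarrow> set l = UNIV \<Longrightarrow> E1 a b * X l \<in> J"
proof -
  assume l: "distinct l" "set l = UNIV"
  then have "length l = CARD('n)" using distinct_card[of l] by simp
  then have "E1_val a b l = 0"
    using l DS_diag[of l a] DS_off[of l b a] by (auto simp: E1_val_def)
  then show ?thesis using E1_X[of a b l] by simp
qed

theorem N_column_det: "distinct l \<Longrightarrow> set l = UNIV \<Longrightarrow> (N a b + (if a = b then 1 else 0)) * X l \<in> J"
  using N_X[of a b l] DS_diag[of l a] sub_xi_0[of l b a] by (auto simp: distrib_right)

end

section \<open>Matrices with the relations of the affine algebra\<close>

lemma sum_antisym_0:
  fixes f :: "'n::{finite,linorder} \<Rightarrow> 'n \<Rightarrow> 'r::ab_group_add"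
  assumes "\<And>a b. f a b = - f b a" "\<And>a. f a a = 0"
  shows "(\<Sum>a\<in>UNIV. \<Sum>b\<in>UNIV. f a b) = 0"
proof -
  let ?lt = "{(a, b). a < (b :: 'n)}" and ?gt = "{(a, b). b < (a :: 'n)}" and ?eq = "{(a, b). a = (b :: 'n)}"
  have "(\<Sum>a\<in>UNIV. \<Sum>b\<in>UNIV. f a b) = (\<Sum>(a, b)\<in>?lt \<union> ?gt \<union> ?eq. f a b)"
    by (simp add: sum.cartesian_product) (rule sum.cong, auto)
  also have "\<dots> = (\<Sum>(a, b)\<in>?lt. f a b) + (\<Sum>(a, b)\<in>?gt. f a b) + (\<Sum>(a, b)\<in>?eq. f a b)"
    by (subst sum.union_disjoint, auto)+
  also have "(\<Sum>(a, b)\<in>?eq. f a b) = 0" by (rule sum.neutral) (auto simp: assms(2))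
  also have "(\<Sum>(a, b)\<in>?gt. f a b) = (\<Sum>(a, b)\<in>?lt. f b a)"
    by (rule sum.reindex_bij_witness[of _ "\<lambda>(a, b). (b, a)" "\<lambda>(a, b). (b, a)"]) auto
  also have "\<dots> = (\<Sum>(a, b)\<in>?lt. - f a b)"
    by (rule sum.cong[OF refl]) (metis assms(1) case_prod_beta)
  also have "\<dots> = - (\<Sum>(a, b)\<in>?lt. f a b)"
    by (subst sum_negf[symmetric]) (rule sum.cong, auto)
  finally show ?thesis by simp
qed

text \<open>
\<open>L\<close> is a Manin matrix: entries of a column commute and the commutators across columns are
symmetric, which makes the elements \<open>\<xi>\<^sub>j = \<Sum>\<^sub>a \<psi>\<^sub>a L\<^sub>a\<^sub>j\<close> anticommute. \<open>E0\<close> and \<open>E1\<close> act as \<open>E\<^sub>a\<^sub>b t\<^sup>0\<close> and \<open>E\<^sub>a\<^sub>b t\<^sup>1\<close> do at the critical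
level. The element \<open>I\<close> is a left unit for the entries; it need not be the unit of the ring.
\<close>

locale manin =
  fixes \<psi> d :: "'n::{finite,linorder} \<Rightarrow> 'r::ring_1" and L E0 E1 :: "'n \<Rightarrow> 'n \<Rightarrow> 'r" and I :: 'r and J :: "'r set"
  assumes psi_anti: "\<psi> a * \<psi> b = - (\<psi> b * \<psi> a)" and psi_sq: "\<psi> a * \<psi> a = 0"
    and d_psi: "d a * \<psi> b = (if a = b then I else 0) - \<psi> b * d a"
    and psi_L: "\<psi> a * L i j = L i j * \<psi> a" and d_L: "d a * L i j = L i j * d a"
    and psi_E0: "\<psi> a * E0 i j = E0 i j * \<psi> a"
    and psi_E1: "\<psi> a * E1 i j = E1 i j * \<psi> a"
    and I_L: "I * L i j = L i j" and I_psi: "\<psi> i * I = \<psi> i"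
    and L_L: "L i j * L k l - L k l * L i j = L k j * L i l - L i l * L k j"
    and L_col: "L i j * L k j = L k j * L i j"
    and E0_L: "E0 a b * L i j = L i j * E0 a b + (if b = i then L a j else 0) - (if a = j then L i b else 0)"
    and E1_L: "E1 a b * L i j = L i j * E1 a b + (if i = j then E0 a b else 0) + (if b = i then E0 a j else 0)
       - (if a = j then E0 i b else 0) - (if b = i \<and> a = j then of_nat CARD('n) * I else 0) + (if a = b \<and> i = j then I else 0)"
    and Jadd: "x \<in> J \<Longrightarrow> y \<in> J \<Longrightarrow> x + y \<in> J" and Jmult: "x \<in> J \<Longrightarrow> r * x \<in> J"
    and d_J: "d a \<in> J" and E0_J: "E0 a b \<in> J" and E1_J: "E1 a b \<in> J"
begin

definition xi :: "'n \<Rightarrow> 'r" where "xi j = (\<Sum>a\<in>UNIV. \<psi> a * L a j)"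

lemma quad: "xi i * xi j = (\<Sum>a\<in>UNIV. \<Sum>b\<in>UNIV. \<psi> a * \<psi> b * (L a i * L b j))"
proof -
  have "(\<psi> a * L a i) * (\<psi> b * L b j) = \<psi> a * \<psi> b * (L a i * L b j)" for a b
    using psi_L[of b a i] by (metis mult.assoc)
  then show ?thesis by (simp add: xi_def sum_product)
qed

lemma psi_psi_sym_0:
  assumes "\<And>a b. M a b = M b a"
  shows "(\<Sum>a\<in>UNIV. \<Sum>b\<in>UNIV. \<psi> a * \<psi> b * M a b) = 0"
proof (rule sum_antisym_0)
  show "\<psi> a * \<psi> b * M a b = - (\<psi> b * \<psi> a * M b a)" for a b
    by (subst psi_anti[of a b], subst assms[of a b]) simp
qed (simp add: psi_sq)

lemma xi_anti: "xi i * xi j = - (xi j * xi i)"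
proof -
  have "xi i * xi j + xi j * xi i = (\<Sum>a\<in>UNIV. \<Sum>b\<in>UNIV. \<psi> a * \<psi> b * (L a i * L b j + L a j * L b i))"
    by (simp add: quad distrib_left sum.distrib)
  also have "\<dots> = 0"
  proof (rule psi_psi_sym_0)
    show "L a i * L b j + L a j * L b i = L b i * L a j + L b j * L a i" for a b
      using L_L[of a i b j] by (simp add: algebra_simps)
  qed
  finally show ?thesis by (simp add: eq_neg_iff_add_eq_0)
qed

lemma xi_sq: "xi i * xi i = 0"
  unfolding quad by (rule psi_psi_sym_0) (rule L_col)

lemma psi_xi: "\<psi> b * xi j = - (xi j * \<psi> b)"
proof -
  have "\<psi> b * (\<psi> a * L a j) = - (\<psi> a * L a j * \<psi> b)" for a
    by (metis psi_anti psi_L minus_mult_left mult.assoc)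
  then show ?thesis by (simp add: xi_def sum_distrib_left sum_distrib_right sum_negf)
qed

lemma d_xi: "d a * xi j = L a j - xi j * d a"
proof -
  have "d a * (\<psi> i * L i j) = (if a = i then L i j else 0) - \<psi> i * L i j * d a" for i
  proof -
    have "d a * (\<psi> i * L i j) = (d a * \<psi> i) * L i j" by (simp add: mult.assoc)
    also have "\<dots> = (if a = i then L i j else 0) - \<psi> i * (d a * L i j)"
      by (simp add: d_psi I_L left_diff_distrib mult.assoc)
    finally show ?thesis by (simp add: d_L mult.assoc)
  qed
  then show ?thesis by (simp add: xi_def sum_distrib_left sum_distrib_right sum_subtractf)
qed

text \<open>
The rotation of the Grassmann variables is subtracted, so that \<open>NN\<close> acts on the \<open>\<xi>\<^sub>j\<close> only through their column index.
\<close>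

definition NN :: "'n \<Rightarrow> 'n \<Rightarrow> 'r" where "NN a b = E0 a b - \<psi> b * d a"
definition Dg :: 'r where "Dg = (\<Sum>i\<in>UNIV. \<psi> i * d i)"

lemma E0_xi: "E0 a b * xi j = xi j * E0 a b + \<psi> b * L a j - (if a = j then xi b else 0)"
proof -
  have "E0 a b * (\<psi> i * L i j) = \<psi> i * L i j * E0 a b + (if b = i then \<psi> i * L a j else 0) - (if a = j then \<psi> i * L i b else 0)" for i
  proof -
    have "E0 a b * (\<psi> i * L i j) = \<psi> i * (E0 a b * L i j)" by (metis psi_E0 mult.assoc)
    then show ?thesis by (simp add: E0_L distrib_left right_diff_distrib mult.assoc)
  qed
  then show ?thesis
    by (simp add: xi_def sum_distrib_left sum_distrib_right sum_subtractf sum.distrib)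
qed

lemma NN_xi: "NN a b * xi j = xi j * NN a b - (if a = j then xi b else 0)"
proof -
  have "\<psi> b * d a * xi j = \<psi> b * L a j + xi j * (\<psi> b * d a)"
    by (simp add: mult.assoc d_xi right_diff_distrib) (metis psi_xi minus_mult_left mult.assoc minus_minus)
  then show ?thesis by (simp add: NN_def left_diff_distrib right_diff_distrib E0_xi)
qed

lemma Dg_xi: "Dg * xi j = xi j * Dg + xi j"
proof -
  have "\<psi> b * d b * xi j = \<psi> b * L b j + xi j * (\<psi> b * d b)" for b
    by (simp add: mult.assoc d_xi right_diff_distrib) (metis psi_xi minus_mult_left mult.assoc minus_minus)
  then show ?thesis
    by (simp add: Dg_def sum_distrib_left sum_distrib_right sum.distrib) (simp add: xi_def)
qed

lemma E1_xi: "E1 a b * xi j = xi j * E1 a b + \<psi> j * NN a b + \<psi> b * NN a j + (if a = b then \<psi> j else 0)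
       - (if a = j then (\<Sum>i\<in>UNIV. \<psi> i * NN i b) - \<psi> b * Dg + of_nat CARD('n) * \<psi> b else 0)"
proof -
  have c: "\<psi> i * of_nat m = of_nat m * \<psi> i" for i m by (simp add: mult_of_nat_commute)
  have "E1 a b * (\<psi> i * L i j) = \<psi> i * L i j * E1 a b + (if i = j then \<psi> i * E0 a b else 0) + (if b = i then \<psi> i * E0 a j else 0)
     - (if a = j then \<psi> i * E0 i b else 0) - (if b = i then if a = j then of_nat CARD('n) * \<psi> i else 0 else 0)
     + (if i = j then if a = b then \<psi> i else 0 else 0)" for i
  proof -
    have "E1 a b * (\<psi> i * L i j) = \<psi> i * (E1 a b * L i j)" by (metis psi_E1 mult.assoc)
    moreover have "\<psi> i * (of_nat m * I) = of_nat m * \<psi> i" for m by (metis I_psi c mult.assoc)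
    ultimately show ?thesis by (simp add: E1_L distrib_left right_diff_distrib mult.assoc I_psi)
  qed
  then have F1: "E1 a b * xi j = xi j * E1 a b + (\<psi> j * E0 a b + \<psi> b * E0 a j)
     - (if a = j then (\<Sum>i\<in>UNIV. \<psi> i * E0 i b) + of_nat CARD('n) * \<psi> b else 0) + (if a = b then \<psi> j else 0)"
    by (simp add: xi_def sum_distrib_left sum_distrib_right sum_subtractf sum.distrib)
  have F2: "\<psi> j * E0 a b + \<psi> b * E0 a j = \<psi> j * NN a b + \<psi> b * NN a j"
  proof -
    have "\<psi> j * (\<psi> b * d a) = - (\<psi> b * (\<psi> j * d a))" by (metis psi_anti minus_mult_left mult.assoc)
    then show ?thesis by (simp add: NN_def right_diff_distrib)
  qed
  have F3: "(\<Sum>i\<in>UNIV. \<psi> i * E0 i b) = (\<Sum>i\<in>UNIV. \<psi> i * NN i b) - \<psi> b * Dg"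
  proof -
    have "\<psi> i * (\<psi> b * d i) = - (\<psi> b * (\<psi> i * d i))" for i by (metis psi_anti minus_mult_left mult.assoc)
    then show ?thesis by (simp add: NN_def Dg_def right_diff_distrib sum_subtractf sum_distrib_left sum_negf sum.distrib)
  qed
  show ?thesis using F1 unfolding F2 F3 by (simp add: algebra_simps)
qed

lemma Jm: "x \<in> J \<Longrightarrow> - x \<in> J" using Jmult[of x "- 1"] by simp
lemma J0: "0 \<in> J" using Jmult[OF d_J, of 0] by simp

sublocale C: column_det \<psi> xi NN E1 Dg J
proof unfold_locales
  show "NN a b \<in> J" for a b unfolding NN_def using Jadd[OF E0_J Jm[OF Jmult[OF d_J]]] by simp
  have "(\<Sum>i\<in>A. \<psi> i * d i) \<in> J" for A
    by (induction A rule: infinite_finite_induct) (auto intro: J0 Jadd Jmult d_J)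
  then show "Dg \<in> J" by (simp add: Dg_def)
  show "\<psi> a * \<psi> b = - (\<psi> b * \<psi> a)" for a b by (rule psi_anti)
  show "\<psi> a * xi b = - (xi b * \<psi> a)" for a b by (rule psi_xi)
  show "xi a * xi b = - (xi b * xi a)" for a b by (rule xi_anti)
  show "xi a * xi a = 0" for a by (rule xi_sq)
qed (rule NN_xi Dg_xi E1_xi E1_J Jadd Jmult; assumption)+

end

section \<open>The ring of additive endomorphisms\<close>

text \<open>
Additive maps form a ring, but on the zero group it has \<open>0 = 1\<close>, which the type class of rings with unit excludes. The integer
component makes \<open>0\<close> and \<open>1\<close> distinct; it is zero on all operators of interest, so the identity map is not the unit.
\<close>

typedef (overloaded) 'a endo = "{(c :: int, f :: 'a::ab_group_add \<Rightarrow> 'a). \<forall>u v. f (u + v) = f u + f v}"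
  by (rule exI[of _ "(0, \<lambda>u. 0)"]) simp

setup_lifting type_definition_endo

lift_definition ap :: "'a::ab_group_add endo \<Rightarrow> 'a \<Rightarrow> 'a" is snd .

instantiation endo :: (ab_group_add) ring_1
begin
lift_definition zero_endo :: "'a endo" is "(0, \<lambda>u. 0)" by simp
lift_definition one_endo :: "'a endo" is "(1, \<lambda>u. u)" by simp
lift_definition plus_endo :: "'a endo \<Rightarrow> 'a endo \<Rightarrow> 'a endo" is "\<lambda>(c, f) (d, g). (c + d, \<lambda>u. f u + g u)"
  by (auto simp: algebra_simps)
lift_definition minus_endo :: "'a endo \<Rightarrow> 'a endo \<Rightarrow> 'a endo" is "\<lambda>(c, f) (d, g). (c - d, \<lambda>u. f u - g u)"
  by (auto simp: algebra_simps)
lift_definition uminus_endo :: "'a endo \<Rightarrow> 'a endo" is "\<lambda>(c, f). (- c, \<lambda>u. - f u)"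
  by (auto simp: algebra_simps)
lift_definition times_endo :: "'a endo \<Rightarrow> 'a endo \<Rightarrow> 'a endo" is "\<lambda>(c, f) (d, g). (c * d, \<lambda>u. f (g u))"
  by auto
instance
  by standard (transfer, force simp: algebra_simps fun_eq_iff)+
end

lift_definition mk :: "('a::ab_group_add \<Rightarrow> 'a) \<Rightarrow> 'a endo" is
  "\<lambda>f. (0, if \<forall>u v. f (u + v) = f u + f v then f else (\<lambda>u. 0))" by auto

lemma ap_mk: "is_add f \<Longrightarrow> ap (mk f) = f" unfolding is_add_def by transfer auto

lemma ap_simps [simp]: "ap (x + y) u = ap x u + ap y u" "ap (x - y) u = ap x u - ap y u" "ap (- x) u = - ap x u"
  "ap (x * y) u = ap x (ap y u)" "ap 0 u = 0" "ap 1 u = u"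
  by (transfer; auto)+

lemma ap_add: "ap x (u + v) = ap x u + ap x v" by transfer auto
lemmas ap_zero [simp] = additive_diff_zero(1)[of "ap x" for x, OF ap_add]
lemma ap_sum: "ap (sum f A) u = (\<Sum>i\<in>A. ap (f i) u)"
  by (induction A rule: infinite_finite_induct) auto

lift_definition scl :: "'a::ab_group_add endo \<Rightarrow> int" is fst .
lemma scl_simps [simp]: "scl (x + y) = scl x + scl y" "scl (x - y) = scl x - scl y" "scl (- x) = - scl x"
  "scl (x * y) = scl x * scl y" "scl 0 = 0" "scl 1 = 1" "scl (mk f) = 0"
  by (transfer; auto)+
lemma endo_eqI: "(\<And>u. ap x u = ap y u) \<Longrightarrow> scl x = scl y \<Longrightarrow> x = y"
  by transfer (auto simp: fun_eq_iff)

lemma mk_comm: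
  assumes "is_add f" "is_add g" "\<And>u. f (g u) = g (f u)"
  shows "mk f * mk g = mk g * mk f"
proof (rule endo_eqI)
  fix u show "ap (mk f * mk g) u = ap (mk g * mk f) u"
    unfolding ap_simps ap_mk[OF assms(1)] ap_mk[OF assms(2)] by (rule assms(3))
qed simp

lemma ap_of_nat: "ap (of_nat m) u = (\<Sum>i<m. u)"
  by (induction m) (auto simp: algebra_simps)

section \<open>The column determinant in Grassmann variables\<close>

text \<open>
The sign of moving the variable \<open>\<psi>\<^sub>a\<close> past the smaller variables of the monomial \<open>S\<close>.
\<close>

definition sgn_at :: "'n::linorder \<Rightarrow> 'n set \<Rightarrow> 'b::ab_group_add \<Rightarrow> 'b" where
  "sgn_at a S x = (if even (card {k \<in> S. k < a}) then x else - x)"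

type_synonym ('n, 'b) grass = "'n set \<Rightarrow> nat \<Rightarrow> 'b"

text \<open>
A function of \<open>(S, i)\<close> is the element \<open>\<Sum> g S i \<psi>\<^sub>S u\<^sup>i\<close> with coefficients in a module. On it, \<open>gpsi\<close> is left
multiplication by a Grassmann variable, \<open>gdel\<close> the corresponding derivative and \<open>gshift\<close> multiplication by \<open>u\<close>.
\<close>

definition gpsi :: "'n::linorder \<Rightarrow> ('n, 'b::ab_group_add) grass \<Rightarrow> ('n, 'b) grass" where
  "gpsi a g = (\<lambda>S i. if a \<in> S then sgn_at a S (g (S - {a}) i) else 0)"

definition gdel :: "'n::linorder \<Rightarrow> ('n, 'b::ab_group_add) grass \<Rightarrow> ('n, 'b) grass" where
  "gdel a g = (\<lambda>S i. if a \<in> S then 0 else sgn_at a S (g (insert a S) i))"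

definition glift :: "('b \<Rightarrow> 'b::ab_group_add) \<Rightarrow> ('n, 'b) grass \<Rightarrow> ('n, 'b) grass" where
  "glift f g = (\<lambda>S i. f (g S i))"

definition gshift :: "('n, 'b::ab_group_add) grass \<Rightarrow> ('n, 'b) grass" where
  "gshift g = (\<lambda>S i. if i = 0 then 0 else g S (i - 1))"

lemma sgn_at_simps [simp]: "sgn_at a S (- x) = - sgn_at a S x" "sgn_at a S 0 = 0"
  "sgn_at a S (x + y) = sgn_at a S x + sgn_at a S y" "sgn_at a S (sgn_at a S x) = x"
  by (auto simp: sgn_at_def)

lemma sgn_at_commute: "sgn_at a S (sgn_at b T x) = sgn_at b T (sgn_at a S x)"
  unfolding sgn_at_def by (cases "even (card {k \<in> S. k < a})"; cases "even (card {k \<in> T. k < b})") (simp_all only: if_True if_False)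

lemma sgn_at_diff:
  fixes a b :: "'n::{finite,linorder}"
  assumes "b \<in> S"
  shows "sgn_at a (S - {b}) x = (if b < a then - sgn_at a S x else sgn_at a S x)"
proof (cases "b < a")
  case True
  have "{k \<in> S. k < a} = insert b {k \<in> S - {b}. k < a}" using True assms by auto
  moreover have "b \<notin> {k \<in> S - {b}. k < a}" by simp
  ultimately have "card {k \<in> S. k < a} = Suc (card {k \<in> S - {b}. k < a})" by simp
  with True show ?thesis by (simp add: sgn_at_def)
next
  case False
  then have "{k \<in> S - {b}. k < a} = {k \<in> S. k < a}" by auto
  with False show ?thesis by (simp add: sgn_at_def)
qed

lemma sgn_at_insert:
  fixes a b :: "'n::{finite,linorder}"
  assumes "b \<notin> S"
  shows "sgn_at a (insert b S) x = (if b < a then - sgn_at a S x else sgn_at a S x)"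
  using sgn_at_diff[of b "insert b S" a x] assms by (auto simp: insert_Diff_if split: if_splits)

lemma gpsi_anti: "gpsi a (gpsi b g) = - gpsi b (gpsi (a :: 'n::{finite,linorder}) g)"
proof (rule ext, rule ext)
  fix S i
  show "gpsi a (gpsi b g) S i = (- gpsi b (gpsi a g)) S i"
  proof (cases "a \<in> S \<and> b \<in> S \<and> a \<noteq> b")
    case True
    have eq: "S - {b} - {a} = S - {a} - {b}" by blast
    from True have t: "a \<in> S" "b \<in> S" "b \<noteq> a" by auto
    define c where "c = g (S - {a} - {b}) i"
    have 1: "gpsi a (gpsi b g) S i = sgn_at a S (sgn_at b (S - {a}) c)"
      using t by (simp add: gpsi_def c_def)
    have 2: "(- gpsi b (gpsi a g)) S i = - sgn_at b S (sgn_at a (S - {b}) c)"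
      using t by (simp add: gpsi_def eq c_def)
    show ?thesis
      unfolding 1 2 using True sgn_at_commute[of a S b S c] by (cases "a < b") (auto simp: sgn_at_diff)
  qed (auto simp: gpsi_def)
qed

lemma gpsi_sq: "gpsi a (gpsi a g) = 0"
  by (rule ext, rule ext) (simp add: gpsi_def)

lemma gdel_gpsi: "gdel a (gpsi b g) = (if a = b then g else 0) - gpsi b (gdel (a :: 'n::{finite,linorder}) g)"
proof (rule ext, rule ext)
  fix S i
  show "gdel a (gpsi b g) S i = ((if a = b then g else 0) - gpsi b (gdel a g)) S i"
  proof (cases "a = b")
    case True
    then show ?thesis by (auto simp: gdel_def gpsi_def sgn_at_insert sgn_at_diff insert_absorb)
  next
    case False
    show ?thesis
    proof (cases "a \<notin> S \<and> b \<in> S")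
      case True
      have eq: "insert a S - {b} = insert a (S - {b})" using False by auto
      define c where "c = g (insert a (S - {b})) i"
      have 1: "gdel a (gpsi b g) S i = sgn_at a S (sgn_at b (insert a S) c)"
        using True False by (simp add: gdel_def gpsi_def eq c_def)
      have 2: "((if a = b then g else 0) - gpsi b (gdel a g)) S i = - sgn_at b S (sgn_at a (S - {b}) c)"
        using True False by (simp add: gdel_def gpsi_def c_def)
      show ?thesis
        unfolding 1 2 using True False sgn_at_commute[of a S b S c]
        by (cases "a < b") (auto simp: sgn_at_diff sgn_at_insert)
    qed (use False in \<open>auto simp: gdel_def gpsi_def\<close>)
  qed
qed

lemma is_add_g: "is_add (gpsi a)" "is_add (gdel a)" "is_add gshift" "is_add f \<Longrightarrow> is_add (glift f)"
  by (auto simp: is_add_def gpsi_def gdel_def gshift_def glift_def fun_eq_iff)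

definition gL :: "('n \<Rightarrow> 'n \<Rightarrow> 'b \<Rightarrow> 'b) \<Rightarrow> ('b \<Rightarrow> 'b) \<Rightarrow> 'n \<Rightarrow> 'n \<Rightarrow> ('n, 'b::ab_group_add) grass \<Rightarrow> ('n, 'b) grass" where
  "gL e \<tau> a j g = glift (e a j) g + (if a = j then glift \<tau> g + gshift g else 0)"

definition gxi :: "('n \<Rightarrow> 'n \<Rightarrow> 'b \<Rightarrow> 'b) \<Rightarrow> ('b \<Rightarrow> 'b) \<Rightarrow> 'n::{finite,linorder} \<Rightarrow> ('n, 'b::ab_group_add) grass \<Rightarrow> ('n, 'b) grass" where
  "gxi e \<tau> j g = (\<Sum>a\<in>UNIV. gpsi a (gL e \<tau> a j g))"

definition gone :: "'b \<Rightarrow> ('n, 'b::ab_group_add) grass" where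
  "gone x = (\<lambda>S i. if S = {} \<and> i = 0 then x else 0)"

definition gdet :: "('n \<Rightarrow> 'n \<Rightarrow> 'b \<Rightarrow> 'b) \<Rightarrow> ('b \<Rightarrow> 'b) \<Rightarrow> 'b \<Rightarrow> 'n::{finite,linorder} list \<Rightarrow> ('n, 'b::ab_group_add) grass" where
  "gdet e \<tau> x l = foldr (gxi e \<tau>) l (gone x)"

text \<open>
The coefficient of \<open>u\<^bsup>n-j\<^esup>\<close> in the column determinant of \<open>e\<^sub>i\<^sub>k + \<delta>\<^sub>i\<^sub>k (\<tau> + u)\<close> applied to \<open>x\<close>: the coefficient
of the top Grassmann monomial is the column determinant. It is used with different modules, so that one construction yields
the state, its field, and their images.
\<close>

definition sugawara :: "('n::{finite,linorder} \<Rightarrow> 'n \<Rightarrow> 'b \<Rightarrow> 'b) \<Rightarrow> ('b \<Rightarrow> 'b) \<Rightarrow> 'b \<Rightarrow> nat \<Rightarrow> 'b::ab_group_add" where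
  "sugawara e \<tau> x j = gdet e \<tau> x (sorted_list_of_set (UNIV :: 'n set)) UNIV (CARD('n) - j)"

text \<open>
The relations between \<open>e\<^sub>i\<^sub>j = E\<^sub>i\<^sub>j t\<^bsup>-1\<^esup>\<close>, the translation \<open>\<tau>\<close> and the modes \<open>E\<^sub>a\<^sub>b t\<^sup>0\<close> and \<open>E\<^sub>a\<^sub>b t\<^sup>1\<close> on the
vacuum module. The commutator of two operators \<open>e\<close> lies in \<open>g t\<^bsup>-2\<^esup>\<close> and is therefore expressed by commutators with \<open>\<tau>\<close>.
\<close>

locale current_module =
  fixes e :: "'n::{finite,linorder} \<Rightarrow> 'n \<Rightarrow> 'b::ab_group_add \<Rightarrow> 'b" and \<tau> :: "'b \<Rightarrow> 'b"
    and E0 E1 :: "'n \<Rightarrow> 'n \<Rightarrow> 'b \<Rightarrow> 'b" and vac :: 'b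
  assumes add: "is_add (e a b)" "is_add \<tau>" "is_add (E0 a b)" "is_add (E1 a b)"
    and e_e: "e i j (e k l x) - e k l (e i j x)
       = (if j = k then \<tau> (e i l x) - e i l (\<tau> x) else 0) - (if i = l then \<tau> (e k j x) - e k j (\<tau> x) else 0)"
    and E0_e: "E0 a b (e i j x) = e i j (E0 a b x) + (if b = i then e a j x else 0) - (if a = j then e i b x else 0)"
    and E0_tau: "E0 a b (\<tau> x) = \<tau> (E0 a b x)"
    and E1_e: "E1 a b (e i j x) = e i j (E1 a b x) + (if b = i then E0 a j x else 0) - (if a = j then E0 i b x else 0)
       - (if b = i \<and> a = j then (\<Sum>k<CARD('n). x) else 0) + (if a = b \<and> i = j then x else 0)"
    and E1_tau: "E1 a b (\<tau> x) = \<tau> (E1 a b x) + E0 a b x"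
    and E0_vac: "E0 a b vac = 0" and E1_vac: "E1 a b vac = 0"
begin

lemmas e_lin = is_addD[OF add(1)] is_add_lin[OF add(1)]
lemmas tau_lin = is_addD[OF add(2)] is_add_lin[OF add(2)]
lemmas E0_lin = is_addD[OF add(3)] is_add_lin[OF add(3)]
lemmas E1_lin = is_addD[OF add(4)] is_add_lin[OF add(4)]

abbreviation "GL \<equiv> gL e \<tau>"

lemma is_add_gL: "is_add (GL a j)"
  by (simp add: is_add_def[of "GL a j"] gL_def is_addD[OF is_add_g(3)] is_addD[OF is_add_g(4)[OF add(1)]]
     is_addD[OF is_add_g(4)[OF add(2)]] algebra_simps)

lemma gpsi_glift: "is_add f \<Longrightarrow> gpsi a (glift f g) = glift f (gpsi a g)"
  by (auto simp: gpsi_def glift_def sgn_at_def is_add_lin fun_eq_iff)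
lemma gdel_glift: "is_add f \<Longrightarrow> gdel a (glift f g) = glift f (gdel a g)"
  by (auto simp: gdel_def glift_def sgn_at_def is_add_lin fun_eq_iff)
lemma gpsi_gshift: "gpsi a (gshift g) = gshift (gpsi a g)"
  by (auto simp: gpsi_def gshift_def fun_eq_iff)
lemma gdel_gshift: "gdel a (gshift g) = gshift (gdel a g)"
  by (auto simp: gdel_def gshift_def fun_eq_iff)

lemma gpsi_gL: "gpsi a (GL i j g) = GL i j (gpsi a g)"
  by (simp add: gL_def is_addD[OF is_add_g(1)] is_add_lin[OF is_add_g(1)] gpsi_glift add gpsi_gshift)
lemma gdel_gL: "gdel a (GL i j g) = GL i j (gdel a g)"
  by (simp add: gL_def is_addD[OF is_add_g(2)] is_add_lin[OF is_add_g(2)] gdel_glift add gdel_gshift)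

lemma gL_apply: "GL i j g S m = e i j (g S m) + (if i = j then \<tau> (g S m) + (if m = 0 then 0 else g S (m - 1)) else 0)"
  by (simp add: gL_def glift_def gshift_def)

lemma L_col_app: "GL i j (GL k j g) = GL k j (GL i j g)"
proof (rule ext, rule ext)
  fix S m
  show "GL i j (GL k j g) S m = GL k j (GL i j g) S m"
    using e_e[of i j k j "g S m"]
    by (auto simp: gL_apply e_lin tau_lin algebra_simps split: if_splits)
qed

lemma L_L_app: "GL i j (GL k l g) - GL k l (GL i j g) = GL k j (GL i l g) - GL i l (GL k j g)"
proof (rule ext, rule ext)
  fix S m
  show "(GL i j (GL k l g) - GL k l (GL i j g)) S m = (GL k j (GL i l g) - GL i l (GL k j g)) S m"
    using e_e[of i j k l "g S m"] e_e[of k j i l "g S m"] L_col_app[of i j k g]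
    by (cases "j = l") (auto simp: gL_apply e_lin tau_lin algebra_simps split: if_splits)
qed

lemma E0_L_app: "glift (E0 a b) (GL i j g) = GL i j (glift (E0 a b) g) + (if b = i then GL a j g else 0) - (if a = j then GL i b g else 0)"
proof (rule ext, rule ext)
  fix S m
  show "glift (E0 a b) (GL i j g) S m = (GL i j (glift (E0 a b) g) + (if b = i then GL a j g else 0) - (if a = j then GL i b g else 0)) S m"
    by (auto simp: gL_apply glift_def E0_lin E0_e E0_tau)
qed

lemma E1_L_app: "glift (E1 a b) (GL i j g) = GL i j (glift (E1 a b) g) + (if i = j then glift (E0 a b) g else 0)
    + (if b = i then glift (E0 a j) g else 0) - (if a = j then glift (E0 i b) g else 0)
    - (if b = i \<and> a = j then (\<Sum>k<CARD('n). g) else 0) + (if a = b \<and> i = j then g else 0)"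
proof (rule ext, rule ext)
  fix S m
  have s: "(\<Sum>k<(N::nat). g) S m = (\<Sum>k<N. g S m)" for N by (induction N) auto
  show "glift (E1 a b) (GL i j g) S m = (GL i j (glift (E1 a b) g) + (if i = j then glift (E0 a b) g else 0)
    + (if b = i then glift (E0 a j) g else 0) - (if a = j then glift (E0 i b) g else 0)
    - (if b = i \<and> a = j then (\<Sum>k<CARD('n). g) else 0) + (if a = b \<and> i = j then g else 0)) S m"
    unfolding plus_fun_apply minus_apply gL_apply glift_def E1_lin(1) E1_e
    by (simp add: s if_distrib[of "\<lambda>f. f S m"] E1_lin E1_tau cong: if_cong)
qed

definition vacJ :: "('n, 'b) grass endo set" where "vacJ = {r. ap r (gone vac) = 0}"

lemma is_add_id: "is_add (\<lambda>x. x)" by (simp add: is_add_def)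

lemma mk_f1: "mk (gpsi a) * mk (gpsi b) = - (mk (gpsi b) * (mk (gpsi a) :: ('n, 'b) grass endo))"
proof (rule endo_eqI)
  fix u :: "('n, 'b) grass"
  show "ap (mk (gpsi a) * mk (gpsi b)) u = ap (- (mk (gpsi b) * mk (gpsi a))) u"
    unfolding ap_simps ap_mk[OF is_add_g(1)] by (rule gpsi_anti)
qed simp
lemma mk_f2: "mk (gpsi a) * mk (gpsi a) = (0 :: ('n, 'b) grass endo)"
proof (rule endo_eqI)
  fix u :: "('n, 'b) grass"
  show "ap (mk (gpsi a) * mk (gpsi a)) u = ap 0 u"
    unfolding ap_simps ap_mk[OF is_add_g(1)] by (rule gpsi_sq)
qed simp
lemma mk_f3: "mk (gdel a) * mk (gpsi b) = (if a = b then mk (\<lambda>x. x) else 0) - mk (gpsi b) * (mk (gdel a) :: ('n, 'b) grass endo)"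
proof (rule endo_eqI)
  fix u :: "('n, 'b) grass"
  show "ap (mk (gdel a) * mk (gpsi b)) u = ap ((if a = b then mk (\<lambda>x. x) else 0) - mk (gpsi b) * (mk (gdel a) :: ('n, 'b) grass endo)) u"
    unfolding ap_simps ap_mk[OF is_add_g(1)] ap_mk[OF is_add_g(2)] if_distrib[of "\<lambda>x. ap x u"] ap_mk[OF is_add_id] by (rule gdel_gpsi)
qed simp
lemma mk_f4: "mk (\<lambda>x. x) * mk (GL i j) = mk (GL i j)"
proof (rule endo_eqI)
  fix u :: "('n, 'b) grass"
  show "ap (mk (\<lambda>x. x) * mk (GL i j)) u = ap (mk (GL i j)) u"
    unfolding ap_simps ap_mk[OF is_add_id] by (rule refl)
qed simp
lemma mk_f5: "mk (gpsi i) * mk (\<lambda>x. x) = (mk (gpsi i) :: ('n, 'b) grass endo)"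
proof (rule endo_eqI)
  fix u :: "('n, 'b) grass"
  show "ap (mk (gpsi i) * mk (\<lambda>x. x)) u = ap (mk (gpsi i)) u"
    unfolding ap_simps ap_mk[OF is_add_id] by (rule refl)
qed simp
lemmas mk_facts = mk_f1 mk_f2 mk_f3 mk_f4 mk_f5

lemma mk_c1: "mk (gpsi a) * mk (GL i j) = mk (GL i j) * mk (gpsi a)"
  apply (rule mk_comm)
    apply (rule is_add_g(1))
   apply (rule is_add_gL)
  apply (rule gpsi_gL)
  done
lemma mk_c2: "mk (gdel a) * mk (GL i j) = mk (GL i j) * mk (gdel a)"
  apply (rule mk_comm)
    apply (rule is_add_g(2))
   apply (rule is_add_gL)
  apply (rule gdel_gL)
  done
lemma mk_c3: "mk (gpsi a) * mk (glift (E0 i j)) = mk (glift (E0 i j)) * mk (gpsi a)"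
  by (rule mk_comm) (rule is_add_g(1), rule is_add_g(4)[OF add(3)], rule gpsi_glift[OF add(3)])
lemma mk_c4: "mk (gpsi a) * mk (glift (E1 i j)) = mk (glift (E1 i j)) * mk (gpsi a)"
  by (rule mk_comm) (rule is_add_g(1), rule is_add_g(4)[OF add(4)], rule gpsi_glift[OF add(4)])
lemma mk_c5: "mk (GL i j) * mk (GL k j) = mk (GL k j) * mk (GL i j)"
  by (rule mk_comm) (rule is_add_gL, rule is_add_gL, rule L_col_app)
lemmas mk_comms = mk_c1 mk_c2 mk_c3 mk_c4 mk_c5

lemma mk_L_L: "mk (GL i j) * mk (GL k l) - mk (GL k l) * mk (GL i j) = mk (GL k j) * mk (GL i l) - mk (GL i l) * mk (GL k j)"
proof (rule endo_eqI)
  fix u show "ap (mk (GL i j) * mk (GL k l) - mk (GL k l) * mk (GL i j)) u = ap (mk (GL k j) * mk (GL i l) - mk (GL i l) * mk (GL k j)) u"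
    unfolding ap_simps ap_mk[OF is_add_gL] by (rule L_L_app)
qed simp

lemma mk_E0_L: "mk (glift (E0 a b)) * mk (GL i j) = mk (GL i j) * mk (glift (E0 a b)) + (if b = i then mk (GL a j) else 0) - (if a = j then mk (GL i b) else 0)"
proof (rule endo_eqI)
  fix u show "ap (mk (glift (E0 a b)) * mk (GL i j)) u = ap (mk (GL i j) * mk (glift (E0 a b)) + (if b = i then mk (GL a j) else 0) - (if a = j then mk (GL i b) else 0)) u"
    unfolding ap_simps if_distrib[of "\<lambda>x. ap x u"] ap_mk[OF is_add_gL] ap_mk[OF is_add_g(4)[OF add(3)]]
    by (rule E0_L_app)
qed simp

lemma mk_E1_L: "mk (glift (E1 a b)) * mk (GL i j) = mk (GL i j) * mk (glift (E1 a b)) + (if i = j then mk (glift (E0 a b)) else 0) + (if b = i then mk (glift (E0 a j)) else 0)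
       - (if a = j then mk (glift (E0 i b)) else 0) - (if b = i \<and> a = j then of_nat CARD('n) * mk (\<lambda>x. x) else 0) + (if a = b \<and> i = j then mk (\<lambda>x. x) else 0)"
proof (rule endo_eqI)
  fix u show "ap (mk (glift (E1 a b)) * mk (GL i j)) u = ap (mk (GL i j) * mk (glift (E1 a b)) + (if i = j then mk (glift (E0 a b)) else 0) + (if b = i then mk (glift (E0 a j)) else 0)
       - (if a = j then mk (glift (E0 i b)) else 0) - (if b = i \<and> a = j then of_nat CARD('n) * mk (\<lambda>x. x) else 0) + (if a = b \<and> i = j then mk (\<lambda>x. x) else 0)) u"
    apply (simp only: ap_simps if_distrib[of "\<lambda>x. ap x u"] ap_mk[OF is_add_gL] ap_mk[OF is_add_g(4)[OF add(3)]] ap_mk[OF is_add_g(4)[OF add(4)]])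
    apply (simp only: ap_of_nat ap_mk[OF is_add_id])
    apply (subst E1_L_app)
    apply (rule refl)
    done
qed (simp only: scl_simps if_distrib[of scl] mult_zero_right if_cancel add_0 diff_0_right)

lemma vacJ_facts:
  shows "mk (gdel a) \<in> vacJ" and "mk (glift (E0 a b)) \<in> vacJ" and "mk (glift (E1 a b)) \<in> vacJ"
  unfolding vacJ_def mem_Collect_eq ap_mk[OF is_add_g(2)] ap_mk[OF is_add_g(4)[OF add(3)]] ap_mk[OF is_add_g(4)[OF add(4)]]
  by (rule ext, rule ext, simp add: gdel_def glift_def gone_def E0_lin E0_vac E1_lin E1_vac)+

sublocale M: manin "\<lambda>a. mk (gpsi a)" "\<lambda>a. mk (gdel a)" "\<lambda>a b. mk (GL a b)" "\<lambda>a b. mk (glift (E0 a b))"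
    "\<lambda>a b. mk (glift (E1 a b))" "mk (\<lambda>x. x)" vacJ
  by unfold_locales (rule mk_facts mk_comms mk_L_L mk_E0_L mk_E1_L vacJ_facts | simp add: vacJ_def)+

lemma ap_xi: "ap (M.xi j) g = gxi e \<tau> j g"
  by (simp add: M.xi_def ap_sum ap_mk is_add_g is_add_gL gxi_def)

lemma ap_X: "ap (M.C.X l) g = foldr (gxi e \<tau>) l g"
  by (induction l) (simp_all add: ap_xi)

text \<open>
The operators on Grassmann-valued elements satisfy the relations of a Manin matrix, so the annihilation of the
column determinant applies to every coefficient.
\<close>

theorem E1_sugawara: "E1 a b (sugawara e \<tau> vac j) = 0"
proof -
  have "mk (glift (E1 a b)) * M.C.X (sorted_list_of_set UNIV) \<in> vacJ"
    by (rule M.C.E1_column_det) auto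
  then have "glift (E1 a b) (gdet e \<tau> vac (sorted_list_of_set UNIV)) = 0"
    by (simp add: vacJ_def ap_X gdet_def ap_mk is_add_g add)
  then have "glift (E1 a b) (gdet e \<tau> vac (sorted_list_of_set UNIV)) UNIV (CARD('n) - j) = 0" by simp
  then show ?thesis by (simp add: glift_def sugawara_def)
qed

text \<open>
On the top Grassmann monomial the rotation \<open>\<psi>\<^sub>b d\<^sub>a\<close> acts by \<open>\<delta>\<^sub>a\<^sub>b\<close>, which compensates the diagonal term of the determinant identity.
\<close>

theorem E0_sugawara: "E0 a b (sugawara e \<tau> vac j) = 0"
proof -
  define g where "g = gdet e \<tau> vac (sorted_list_of_set UNIV)"
  have "(M.NN a b + (if a = b then 1 else 0)) * M.C.X (sorted_list_of_set UNIV) \<in> vacJ"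
    by (rule M.C.N_column_det) auto
  then have "(glift (E0 a b) g - gpsi b (gdel a g) + (if a = b then g else 0)) = 0"
    by (auto simp: vacJ_def ap_X g_def gdet_def ap_mk is_add_g add M.NN_def split: if_splits)
  then have "(glift (E0 a b) g - gpsi b (gdel a g) + (if a = b then g else 0)) UNIV (CARD('n) - j) = 0" by simp
  then show ?thesis by (auto simp: glift_def sugawara_def gpsi_def gdel_def g_def sgn_at_diff insert_absorb split: if_splits)
qed

end

section \<open>Loops and the critical form\<close>

definition lmon :: "complex \<Rightarrow> int \<Rightarrow> complex fls" where "lmon c k = fls_const c * fls_X_intpow k"

lemma lmon_nth: "lmon c k $$ m = (if m = k then c else 0)"
  by (simp add: lmon_def)
lemma lmon_mult: "lmon c k * lmon d l = lmon (c * d) (k + l)"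
proof -
  have "lmon c k * lmon d l = fls_const c * fls_const d * (fls_X_intpow k * fls_X_intpow l)"
    unfolding lmon_def by (simp only: mult_ac)
  then show ?thesis by (simp only: fls_X_intpow_times_fls_X_intpow fls_const_mult_const lmon_def)
qed
lemma lmon_add: "lmon (c + d) k = lmon c k + lmon d k"
  by (rule fls_eqI) (simp add: lmon_nth)
lemma lmon_diff: "lmon (c - d) k = lmon c k - lmon d k"
  by (rule fls_eqI) (simp add: lmon_nth)
lemma lmon_0 [simp]: "lmon 0 k = 0"
  by (rule fls_eqI) (simp add: lmon_nth)
lemma lmon_sum: "lmon (sum f A) k = (\<Sum>i\<in>A. lmon (f i) k)"
  by (induction A rule: infinite_finite_induct) (simp_all add: lmon_add)
lemma lmon_deriv: "fls_deriv (lmon c k) = lmon (of_int k * c) (k - 1)"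
  by (rule fls_eqI) (auto simp: lmon_nth)
lemma lmon_const: "fls_const d * lmon c k = lmon (d * c) k"
  by (rule fls_eqI) (auto simp: lmon_nth)

definition mscale :: "complex \<Rightarrow> complex^'n::finite^'n \<Rightarrow> complex^'n^'n" where
  "mscale c x = (\<chi> i j. c * x $ i $ j)"

lemma loop_lmon: "loop x k $ i $ j = lmon (x $ i $ j) k"
  by (simp add: loop_def lmon_def)

lemma loop_add: "loop (x + y) k = loop x k + loop y k"
  by (simp add: vec_eq_iff loop_lmon lmon_add)
lemma loop_diff: "loop (x - y) k = loop x k - loop y k"
  by (simp add: vec_eq_iff loop_lmon lmon_diff)
lemma loop_0 [simp]: "loop 0 k = 0"
  by (simp add: vec_eq_iff loop_lmon)
lemma loop_mult: "loop x k ** loop y l = loop (x ** y) (k + l)"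
  by (simp add: vec_eq_iff matrix_matrix_mult_def loop_lmon lmon_mult lmon_sum)
lemma loop_trace: "trace (loop x k) = lmon (trace x) k"
  by (simp add: trace_def loop_lmon lmon_sum)
lemma loop_deriv: "deriv_K (loop y k) = loop (mscale (of_int k) y) (k - 1)"
  by (simp add: vec_eq_iff deriv_K_def loop_lmon lmon_deriv mscale_def)
lemma loop_in_arcs: "int N \<le> r \<Longrightarrow> loop x r \<in> arcs N"
  by (simp add: arcs_def loop_lmon lmon_nth)
lemma ghat_scale_loop: "ghat_scale c (loop x r, d) = (loop (mscale c x) r, c * d)"
  by (simp add: ghat_scale_def vec_eq_iff loop_lmon lmon_const mscale_def)

lemma trace_mscale: "trace (mscale c x) = c * trace x"
  by (simp add: trace_def mscale_def sum_distrib_left)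
lemma mult_mscale: "x ** mscale c y = mscale c (x ** y)"
  by (simp add: vec_eq_iff matrix_matrix_mult_def mscale_def sum_distrib_left mult_ac)

text \<open>
This is \<open>- \<kappa>\<^sub>c\<close> on constant matrices, the sign being that of the cocycle.
\<close>

definition kform :: "complex^'n::finite^'n \<Rightarrow> complex^'n^'n \<Rightarrow> complex" where
  "kform x y = of_nat CARD('n) * trace (x ** y) - trace x * trace y"

lemma cocycle_loop:
  fixes x y :: "complex^'n::finite^'n"
  shows "cocycle (loop x r) (loop y s) = (if r + s = 0 then of_int s * kform x y else 0)"
proof -
  have "kappa_c (loop x r) (deriv_K (loop y s)) = lmon (- of_int s * kform x y) (r + s - 1)"
    unfolding kappa_c_def killing_K_def loop_deriv loop_mult loop_trace trace_mscale mult_mscale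
    by (rule fls_eqI) (simp add: lmon_mult mult.assoc lmon_nth kform_def fls_of_nat algebra_simps)
  then show ?thesis by (simp add: cocycle_def lmon_nth)
qed

definition munit :: "'n \<Rightarrow> 'n \<Rightarrow> complex^'n::finite^'n" where
  "munit a b = (\<chi> i j. if i = a \<and> j = b then 1 else 0)"

lemma munit_mult: "munit a b ** munit c d = (if b = c then munit a d else 0)"
  by (auto simp: vec_eq_iff matrix_matrix_mult_def munit_def if_distrib[of "\<lambda>x. x * _"] if_distrib[of "\<lambda>x. _ * x"]
     sum.delta cong: if_cong split: if_splits intro!: sum.neutral)
lemma munit_trace: "trace (munit a b) = (if a = b then 1 else 0)"
  by (auto simp: trace_def munit_def intro!: sum.neutral)
lemma kform_munit:
  "kform (munit a b) (munit c d) = (if b = c \<and> a = d then of_nat CARD('n) else 0) - (if a = b \<and> c = d then 1 else 0)"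
  for a b c d :: "'n::finite"
proof -
  have "trace (0 :: complex^'n^'n) = 0" by (simp add: trace_def)
  then have t: "trace (munit a b ** munit c d) = (if b = c \<and> a = d then 1 else 0)"
    unfolding munit_mult by (simp add: munit_trace)
  show ?thesis unfolding kform_def t munit_trace
    by (cases "b = c \<and> a = d"; cases "a = b"; cases "c = d")
      (simp_all only: simp_thms if_True if_False mult_1_right mult_1_left mult_zero_left mult_zero_right)
qed

lemma matrix_munit_sum: "x = (\<Sum>a\<in>UNIV. \<Sum>b\<in>UNIV. mscale (x $ a $ b) (munit a b))"
proof -
  have "(\<Sum>a\<in>UNIV. \<Sum>b\<in>UNIV. mscale (x $ a $ b) (munit a b)) $ i $ j = x $ i $ j" for i j
  proof -
    have "(\<Sum>a\<in>UNIV. \<Sum>b\<in>UNIV. mscale (x $ a $ b) (munit a b)) $ i $ j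
      = (\<Sum>a\<in>UNIV. \<Sum>b\<in>UNIV. if a = i \<and> b = j then x $ a $ b else 0)"
      by (simp add: mscale_def munit_def) (intro sum.cong refl, auto)
    also have "\<dots> = (\<Sum>a\<in>UNIV. if a = i then x $ i $ j else 0)"
      by (intro sum.cong refl) auto
    finally show ?thesis by simp
  qed
  then show ?thesis by (simp add: vec_eq_iff)
qed

section \<open>Fields on smooth modules\<close>

type_synonym 'n cmat = "((complex, 'n) vec, 'n) vec"

lemma add_diff_swap: "x + y - z = x - z + (y :: 'a::ab_group_add)" by simp

locale smooth_rep =
  fixes sc :: "complex \<Rightarrow> 'v::ab_group_add \<Rightarrow> 'v" and \<rho> :: "'n::{finite,linorder} ghat \<Rightarrow> 'v \<Rightarrow> 'v"
  assumes module: "ghat_module sc \<rho>" and smooth: "smooth \<rho>"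
begin

lemma vs: "vector_space sc" using module unfolding ghat_module_def by blast
sublocale V: vector_space sc by (rule vs)

lemma rho_lin: "Vector_Spaces.linear sc sc (\<rho> x)" using module unfolding ghat_module_def by blast
lemma rho_add: "\<rho> x (u + v) = \<rho> x u + \<rho> x v" using rho_lin by (simp add: Vector_Spaces.linear_iff)
lemma rho_sc: "\<rho> x (sc c v) = sc c (\<rho> x v)" using rho_lin by (simp add: Vector_Spaces.linear_iff)
lemma is_add_rho [simp]: "is_add (\<rho> x)" by (simp add: is_add_def rho_add)
lemma rho_add_left: "\<rho> (x + y) v = \<rho> x v + \<rho> y v" using module unfolding ghat_module_def by blast
lemma rho_scale: "\<rho> (ghat_scale c x) v = sc c (\<rho> x v)" using module unfolding ghat_module_def by blast
lemma rho_bracket: "\<rho> (ghat_bracket x y) v = \<rho> x (\<rho> y v) - \<rho> y (\<rho> x v)" using module unfolding ghat_module_def by blast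
lemma rho_level: "\<rho> (0, 1) v = v" using module unfolding ghat_module_def by blast

lemma rho_central: "\<rho> (0, c) v = sc c v"
proof -
  have "ghat_scale c (0, 1) = ((0, c) :: 'n ghat)" by (simp add: ghat_scale_def vec_eq_iff)
  then show ?thesis by (metis rho_scale rho_level)
qed
lemma rho_pair: "\<rho> (X, c) v = \<rho> (X, 0) v + sc c v"
  using rho_add_left[of "(X, 0)" "(0, c)" v] by (simp add: rho_central)
lemma rho_0 [simp]: "\<rho> (0, 0) v = 0" using rho_central[of 0 v] by simp
lemmas rho_lin_r = is_add_lin[OF is_add_rho]

lemma is_add_sc [simp]: "is_add (sc c)" by (simp add: is_add_def V.scale_right_distrib)

lemma zmul_sc: "zmul k v = sc (of_int k) v"
proof (induction k rule: int_induct[where k = 0])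
  case (step1 i)
  then show ?case by (simp add: zmul_succ V.scale_left_distrib)
next
  case (step2 i)
  then show ?case by (simp add: zmul_pred V.scale_left_diff_distrib)
qed simp

definition xm :: "'n cmat \<Rightarrow> int \<Rightarrow> 'v \<Rightarrow> 'v" where "xm x r v = \<rho> (loop x r, 0) v"

lemma is_add_xm [simp]: "is_add (xm x r)" by (simp add: is_add_def xm_def rho_add)
lemma xm_add: "xm (x + y) r v = xm x r v + xm y r v"
  using rho_add_left[of "(loop x r, 0)" "(loop y r, 0)"] by (simp add: xm_def loop_add)
lemma xm_scale: "xm (mscale c x) r v = sc c (xm x r v)"
  using rho_scale[of c "(loop x r, 0)"] by (simp add: xm_def ghat_scale_loop)
lemma xm_0 [simp]: "xm 0 r v = 0" by (simp add: xm_def)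
lemma xm_diff: "xm (x - y) r v = xm x r v - xm y r v"
  using xm_add[of "x - y" y r v] by simp
lemma xm_sum: "xm (sum f A) r v = (\<Sum>a\<in>A. xm (f a) r v)"
  by (induction A rule: infinite_finite_induct) (simp_all add: xm_add)
lemma xm_sc: "xm x r (sc c v) = sc c (xm x r v)" by (simp add: xm_def rho_sc)

lemma xm_bound: "\<exists>K. \<forall>k\<ge>K. xm x k v = 0"
proof -
  obtain N where "\<forall>X\<in>arcs N. \<rho> (X, 0) v = 0" using smooth by (auto simp: smooth_def)
  then show ?thesis by (intro exI[of _ "int N"]) (auto simp: xm_def loop_in_arcs)
qed

lemma xm_comm: "xm x r (xm y s v) - xm y s (xm x r v)
   = xm (x ** y - y ** x) (r + s) v + (if r + s = 0 then sc (of_int s * kform x y) v else 0)"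
proof -
  have "xm x r (xm y s v) - xm y s (xm x r v) = \<rho> (ghat_bracket (loop x r, 0) (loop y s, 0)) v"
    by (simp add: xm_def rho_bracket)
  also have "\<dots> = \<rho> (loop (x ** y - y ** x) (r + s), cocycle (loop x r) (loop y s)) v"
    by (simp add: ghat_bracket_def loop_mult loop_diff add.commute)
  also have "\<dots> = xm (x ** y - y ** x) (r + s) v + sc (cocycle (loop x r) (loop y s)) v"
    by (subst rho_pair) (simp add: xm_def)
  finally show ?thesis by (simp add: cocycle_loop)
qed

definition lf :: "'n cmat \<Rightarrow> 'v fld" where "lf x = Abs_fld (xm x)"

lemma md_lf: "md (lf x) r v = xm x r v"
proof -
  have "xm x \<in> {F. (\<forall>k u v. F k (u + v) = F k u + F k v) \<and> (\<forall>v. \<exists>K. \<forall>k\<ge>K. F k v = 0)}"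
    using xm_bound by (simp add: is_addD)
  then show ?thesis by (simp add: lf_def Abs_fld_inverse)
qed
lemma md_lf': "md (lf x) r = xm x r" by (rule ext) (rule md_lf)

lemma lf_diff: "lf (x - y) = lf x - lf y" by (rule fld_eqI) (simp add: md_lf xm_diff)
lemma lf_0 [simp]: "lf 0 = 0" by (rule fld_eqI) (simp add: md_lf)

lemma md_shift': "md (shift r (F :: 'v fld)) k = md F (k + r)" by (rule ext) (rule md_shift)

definition fsc :: "complex \<Rightarrow> 'v fld \<Rightarrow> 'v fld" where
  "fsc c F = Abs_fld (\<lambda>k v. sc c (md F k v))"

lemma md_fsc: "md (fsc c F) k v = sc c (md F k v)"
proof -
  have "(\<lambda>k v. sc c (md F k v)) \<in> {F. (\<forall>k u v. F k (u + v) = F k u + F k v) \<and> (\<forall>v. \<exists>K. \<forall>k\<ge>K. F k v = 0)}"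
  proof (intro CollectI conjI allI)
    fix v obtain K where "\<forall>k\<ge>K. md F k v = 0" using md_bound by blast
    then show "\<exists>K. \<forall>k\<ge>K. sc c (md F k v) = 0" by (intro exI[of _ K]) simp
  qed (simp add: md_add V.scale_right_distrib)
  then show ?thesis by (simp add: fsc_def Abs_fld_inverse)
qed
lemma fsc_0 [simp]: "fsc 0 F = 0" by (rule fld_eqI) (simp add: md_fsc)
lemma fsc_zero [simp]: "fsc c 0 = 0" by (rule fld_eqI) (simp add: md_fsc)
lemma fsc_add: "fsc c (F + G) = fsc c F + fsc c G" by (rule fld_eqI) (simp add: md_fsc V.scale_right_distrib)
lemma fsc_diff_left: "fsc (c - d) F = fsc c F - fsc d F" by (rule fld_eqI) (simp add: md_fsc V.scale_left_diff_distrib)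
lemma fsc_add_left: "fsc (c + d) F = fsc c F + fsc d F" by (rule fld_eqI) (simp add: md_fsc V.scale_left_distrib)
lemma fsc_1 [simp]: "fsc 1 F = F" by (rule fld_eqI) (simp add: md_fsc)
lemma shift_fsc: "shift r (fsc c F) = fsc c (shift r F)" by (rule fld_eqI) (simp add: md_fsc md_shift)
lemma NO_fsc_int: "NO (fsc (of_int k) A) F = fsc (of_int k) (NO A F)"
proof -
  have "fsc (of_int k) G = zmul k G" for G :: "'v fld"
  proof (rule fld_eqI)
    fix j v
    have "md (zmul k G) j v = zmul k (md G j v)"
      by (induction k rule: int_induct[where k = 0]) (simp_all add: zmul_succ zmul_pred)
    then show "md (fsc (of_int k) G) j v = md (zmul k G) j v" by (simp add: md_fsc zmul_sc)
  qed
  then show ?thesis by (simp add: NO_left_lin)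
qed

text \<open>
The commutator of the mode \<open>x t\<^sup>r\<close> with a field.
\<close>

definition adr :: "'n cmat \<Rightarrow> int \<Rightarrow> 'v fld \<Rightarrow> 'v fld" where "adr x r = ad (xm x r)"

lemma md_adr: "md (adr x r F) k v = xm x r (md F k v) - md F k (xm x r v)"
  by (simp add: adr_def md_ad)
lemma is_add_adr: "is_add (adr x r)" unfolding is_add_def adr_def by (simp add: ad_add)
lemmas adr_lin = is_addD[OF is_add_adr] is_add_lin[OF is_add_adr]
lemma adr_left_add: "adr (x + y) r F = adr x r F + adr y r F"
  by (rule fld_eqI) (simp add: md_adr xm_add md_add)
lemma adr_left_0 [simp]: "adr 0 r F = 0" by (rule fld_eqI) (simp add: md_adr)
lemma adr_left_diff: "adr (x - y) r F = adr x r F - adr y r F"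
  by (rule fld_eqI) (simp add: md_adr xm_diff md_diff)
lemma adr_left_sum: "adr (sum f A) r F = (\<Sum>a\<in>A. adr (f a) r F)"
  by (induction A rule: infinite_finite_induct) (simp_all add: adr_left_add)
lemma adr_fder: "adr x r (fder F) = fder (adr x r F)"
  by (rule fld_eqI) (simp add: md_adr md_fder is_add_lin zmul_diff_right)
lemma adr_fone [simp]: "adr x r fone = 0" by (simp add: adr_def)
lemma adr_NO: "adr x r (NO A F) = NO (adr x r A) F + NO A (adr x r F)"
  by (simp add: adr_def ad_NO)
lemma fder_shift1: "fder (shift 1 F) = shift 1 (fder F) + F"
proof (rule fld_eqI)
  fix k v show "md (fder (shift 1 F)) k v = md (shift 1 (fder F) + F) k v"
    using zmul_succ[of "- k - 1" "md F k v"] by (simp add: md_fder md_shift)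
qed

lemma shift_fone_NO: "NO (shift s fone) F = shift s (F :: 'v fld)"
proof -
  have ad0: "ad (md (shift s (fone :: 'v fld)) 0) F = 0" for s F
    by (rule fld_eqI) (simp add: md_ad md_shift md_fone)
  have st: "NO (shift (s + 1) fone) F = shift 1 (NO (shift s fone) F)" for s and F :: "'v fld"
    using NO_shift1[of "shift s fone" F] by (simp add: shift_shift ad0 add.commute)
  show ?thesis
  proof (induction s rule: int_induct[where k = 0])
    case base
    then show ?case by (simp add: NO_fone)
  next
    case (step1 i)
    then show ?case using st[of i F] by (simp add: shift_shift add.commute)
  next
    case (step2 i)
    have "shift (- 1) (NO (shift (i - 1 + 1) fone) F) = NO (shift (i - 1) fone) F"
      unfolding st by (simp add: shift_shift)
    with step2 show ?case by (simp add: shift_shift)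
  qed
qed

lemma sc_neg: "k + r = 0 \<Longrightarrow> sc (of_int k * c) v = - sc (of_int r * c) v"
proof -
  assume "k + r = 0"
  then have "k = - r" by simp
  then show ?thesis by simp
qed

lemma adr_lf: "adr x r (lf y) = shift r (lf (x ** y - y ** x)) + fsc (- of_int r * kform x y) (shift (r - 1) fone)"
  by (rule fld_eqI) (auto simp: md_adr md_lf xm_comm md_shift md_fsc md_fone add.commute sc_neg)

abbreviation ec :: "'n \<Rightarrow> 'n \<Rightarrow> 'v fld \<Rightarrow> 'v fld" where "ec a b \<equiv> NO (lf (munit a b))"

definition kz :: "'n \<Rightarrow> 'n \<Rightarrow> 'n \<Rightarrow> 'n \<Rightarrow> int" where
  "kz a b c d = (if b = c \<and> a = d then int CARD('n) else 0) - (if a = b \<and> c = d then 1 else 0)"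
lemma kform_kz: "kform (munit a b) (munit c d) = of_int (kz a b c d)"
  unfolding kform_munit kz_def
  by (cases "b = c \<and> a = d"; cases "a = b \<and> c = d") (simp_all only: simp_thms if_True if_False of_int_diff of_int_0 of_int_1 of_int_of_nat_eq)

definition unit_bracket :: "'n \<Rightarrow> 'n \<Rightarrow> 'n \<Rightarrow> 'n \<Rightarrow> 'n cmat" where
  "unit_bracket a b c d = munit a b ** munit c d - munit c d ** munit a b"
lemma unit_bracket_eq: "unit_bracket a b c d = (if b = c then munit a d else 0) - (if d = a then munit c b else 0)"
  by (simp add: unit_bracket_def munit_mult)

lemma adr_ec: "adr (munit a b) r (ec c d F) = ec c d (adr (munit a b) r F)
    + NO (shift r (lf (unit_bracket a b c d))) F + fsc (of_int (- r * kz a b c d)) (shift (r - 1) F)"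
proof -
  have "- of_int r * kform (munit a b) (munit c d) = (of_int (- r * kz a b c d) :: complex)"
    by (simp add: kform_kz)
  then show ?thesis
    unfolding adr_NO adr_lf by (simp only: NO_add_left NO_fsc_int shift_fone_NO unit_bracket_def) (simp add: add_ac)
qed

lemma adr0_ec: "adr (munit a b) 0 (ec c d F) = ec c d (adr (munit a b) 0 F) + NO (lf (unit_bracket a b c d)) F"
  by (simp add: adr_ec)

text \<open>
At \<open>s = 0\<close> this is the field of \<open>x\<^sub>(\<^sub>1\<^sub>) F\<close>: in vertex algebra terms \<open>[x\<^sub>r, F(z)] = \<Sum>\<^sub>i (r choose i) z\<^bsup>r-i\<^esup> (x\<^sub>(\<^sub>i\<^sub>) F)(z)\<close>.
\<close>

definition T1 :: "'n cmat \<Rightarrow> int \<Rightarrow> 'v fld \<Rightarrow> 'v fld" where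
  "T1 x s F = adr x (s + 1) F - shift 1 (adr x s F)"

lemma T1_ec: "T1 (munit a b) s (ec c d F) = ec c d (T1 (munit a b) s F) + adr (unit_bracket a b c d) s F
   - fsc (of_int (kz a b c d)) (shift s F)"
proof -
  have "NO (shift (s + 1) (lf (unit_bracket a b c d))) F = shift 1 (NO (shift s (lf (unit_bracket a b c d))) F) + adr (unit_bracket a b c d) s F"
    using NO_shift1[of "shift s (lf (unit_bracket a b c d))" F]
    by (simp add: shift_shift adr_def add.commute md_shift' md_lf')
  moreover have "fsc (of_int (- (s + 1) * kz a b c d)) (shift s F) - fsc (of_int (- s * kz a b c d)) (shift s F)
     = - fsc (of_int (kz a b c d)) (shift s F)"
  proof -
    have "(of_int (- s * kz a b c d) :: complex) = of_int (- (s + 1) * kz a b c d) + of_int (kz a b c d)"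
      by (simp add: algebra_simps)
    then show ?thesis by (simp only: fsc_add_left) simp
  qed
  ultimately show ?thesis
    unfolding T1_def adr_ec
    by (simp add: shift_add shift_NO shift_fsc shift_shift NO_right_lin algebra_simps)
qed

lemma T1_fder: "T1 x s (fder F) = fder (T1 x s F) + adr x s F"
  by (simp add: T1_def adr_fder fder_shift1 additive_diff_zero(3)[of fder, OF fder_add])

lemma is_add_shift [simp]: "is_add (shift r)" by (simp add: is_add_def shift_add)
lemma is_add_fder [simp]: "is_add fder" by (simp add: is_add_def fder_add)
lemma is_add_NO [simp]: "is_add (NO A)" by (simp add: is_add_def NO_add_right)

lemma ec_ec: "ec i j (ec k l F) - ec k l (ec i j F)
       = (if j = k then fder (ec i l F) - ec i l (fder F) else 0) - (if i = l then fder (ec k j F) - ec k j (fder F) else 0)"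
proof -
  have "ec i j (ec k l F) - ec k l (ec i j F) = NO (fder (lf (unit_bracket i j k l))) F"
  proof (rule NO_commutator)
    fix r s :: int and v :: 'v
    assume "(0 \<le> r \<and> 0 \<le> s) \<or> (r < 0 \<and> s < 0)"
    then have "r + s = 0 \<Longrightarrow> s = 0" by auto
    then show "md (lf (munit i j)) r (md (lf (munit k l)) s v) - md (lf (munit k l)) s (md (lf (munit i j)) r v) = md (lf (unit_bracket i j k l)) (r + s) v"
      by (auto simp: md_lf xm_comm unit_bracket_def)
  qed
  also have "\<dots> = fder (NO (lf (unit_bracket i j k l)) F) - NO (lf (unit_bracket i j k l)) (fder F)"
    by (simp add: fder_NO)
  finally show ?thesis
    by (simp add: unit_bracket_eq lf_diff NO_left_lin is_add_lin[OF is_add_fder])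
qed

sublocale CM: current_module ec fder "\<lambda>a b. adr (munit a b) 0" "\<lambda>a b. T1 (munit a b) 0" fone
proof
  fix a b i j :: 'n and x :: "'v fld"
  show "is_add (ec a b)" "is_add fder" "is_add (adr (munit a b) 0)" by (simp_all add: is_add_adr)
  show "is_add (T1 (munit a b) 0)" by (simp add: is_add_def T1_def adr_lin shift_add)
  show "adr (munit a b) 0 (ec i j x) = ec i j (adr (munit a b) 0 x) + (if b = i then ec a j x else 0) - (if a = j then ec i b x else 0)"
    by (simp add: adr0_ec unit_bracket_eq lf_diff NO_left_lin)
  show "adr (munit a b) 0 (fder x) = fder (adr (munit a b) 0 x)" by (rule adr_fder)
  have n: "fsc (of_nat m) x = (\<Sum>k<m. x)" for m
    by (induction m) (simp_all add: fsc_add_left add.commute)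
  have "fsc (of_int (kz a b i j)) x = (if b = i \<and> a = j then (\<Sum>k<CARD('n). x) else 0) - (if a = b \<and> i = j then x else 0)"
    unfolding kz_def
    by (cases "b = i \<and> a = j"; cases "a = b \<and> i = j")
      (simp_all only: simp_thms if_True if_False of_int_diff of_int_0 of_int_1 of_int_of_nat_eq fsc_diff_left n fsc_0 fsc_1)
  then show "T1 (munit a b) 0 (ec i j x) = ec i j (T1 (munit a b) 0 x) + (if b = i then adr (munit a j) 0 x else 0)
     - (if a = j then adr (munit i b) 0 x else 0) - (if b = i \<and> a = j then (\<Sum>k<CARD('n). x) else 0) + (if a = b \<and> i = j then x else 0)"
    unfolding T1_ec unit_bracket_eq adr_left_diff shift_0 if_distrib[of "\<lambda>z. adr z 0 x"] adr_left_0
    by (simp only: eq_commute[of j a] diff_diff_eq2 add_diff_eq) (rule add_diff_swap)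
  show "T1 (munit a b) 0 (fder x) = fder (T1 (munit a b) 0 x) + adr (munit a b) 0 x" by (rule T1_fder)
  show "adr (munit a b) 0 fone = 0" "T1 (munit a b) 0 fone = 0" by (simp_all add: T1_def is_add_lin)
qed (rule ec_ec)

text \<open>
The Segal-Sugawara fields, formed inside the fields on a module instead of the vertex algebra, with normally ordered
multiplication by \<open>E\<^sub>a\<^sub>b(z)\<close> as \<open>e\<close> and \<open>\<partial>\<^sub>z\<close> as \<open>\<tau>\<close>.
\<close>

definition S :: "nat \<Rightarrow> 'v fld" where "S j = sugawara ec fder fone j"

end

text \<open>
An induction principle: \<open>sugawara\<close> is a finite combination of words in \<open>e\<close> and \<open>\<tau>\<close> applied to the vacuum.
\<close>

lemma sugawara_closed:
  fixes e :: "'n::{finite,linorder} \<Rightarrow> 'n \<Rightarrow> 'a::ab_group_add \<Rightarrow> 'a"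
  assumes P0: "P 0" and Padd: "\<And>x y. P x \<Longrightarrow> P y \<Longrightarrow> P (x + y)" and Pm: "\<And>x. P x \<Longrightarrow> P (- x)"
    and Pe: "\<And>a b x. P x \<Longrightarrow> P (e a b x)" and Pt: "\<And>x. P x \<Longrightarrow> P (\<tau> x)" and Pv: "P vac"
  shows "P (sugawara e \<tau> vac j)"
proof -
  have s: "P (sgn_at a A x)" if "P x" for a and A :: "'n set" and x using that Pm by (simp add: sgn_at_def)
  have sum: "P (\<Sum>a\<in>A. f a)" if "\<And>a. P (f a)" for f and A :: "'n set"
    by (induction A rule: infinite_finite_induct) (auto intro: P0 Padd that)
  have ap: "(\<Sum>a\<in>A. (f a :: ('n, 'a) grass)) B i = (\<Sum>a\<in>A. f a B i)" for f and A :: "'n set" and B i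
    by (induction A rule: infinite_finite_induct) auto
  have "P (gdet e \<tau> vac l B i)" for l B i
  proof (induction l arbitrary: B i)
    case Nil
    then show ?case by (simp add: gdet_def gone_def P0 Pv)
  next
    case (Cons j l)
    define g where "g = gdet e \<tau> vac l"
    have g: "P (g B i)" for B i unfolding g_def by (rule Cons)
    have "gdet e \<tau> vac (j # l) = gxi e \<tau> j g" by (simp add: gdet_def g_def)
    moreover have "P (gxi e \<tau> j g B i)"
      unfolding gxi_def ap
      by (rule sum) (auto simp: gpsi_def gL_def glift_def gshift_def intro!: s P0 Padd Pe Pt g)
    ultimately show ?case by simp
  qed
  then show ?thesis by (simp add: sugawara_def)
qed

section \<open>Centrality of the Segal-Sugawara fields\<close>

context smooth_rep
begin

lemma S_closed:
  assumes "P 0" "\<And>F G. P F \<Longrightarrow> P G \<Longrightarrow> P (F + G)" "\<And>F. P F \<Longrightarrow> P (- F)"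
    "\<And>a b F. P F \<Longrightarrow> P (ec a b F)" "\<And>F. P F \<Longrightarrow> P (fder F)" "P fone"
  shows "P (S j)"
  unfolding S_def by (rule sugawara_closed) (use assms in auto)

lemma adr_0_S: "adr (munit a b) 0 (S j) = 0" unfolding S_def by (rule CM.E0_sugawara)
lemma T1_0_S: "T1 (munit a b) 0 (S j) = 0" unfolding S_def by (rule CM.E1_sugawara)
lemma adr_1_S: "adr (munit a b) 1 (S j) = 0"
  using T1_0_S[of a b j] by (simp add: T1_def adr_0_S is_add_lin)

text \<open>
The coefficient of \<open>w\<^bsup>-s-1\<^esup>\<close> in \<open>(w - z)\<^sup>N [x(w), F(z)]\<close>; its vanishing for all \<open>s\<close> is locality of order \<open>N\<close>.
\<close>

fun TN :: "nat \<Rightarrow> 'n cmat \<Rightarrow> int \<Rightarrow> 'v fld \<Rightarrow> 'v fld" where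
  "TN 0 x s F = adr x s F"
| "TN (Suc N) x s F = TN N x (s + 1) F - shift 1 (TN N x s F)"

lemma TN_1: "TN (Suc 0) x s F = T1 x s F" by (simp add: T1_def)

lemma TN_add: "TN N x s (F + G) = TN N x s F + TN N x s G"
  by (induction N arbitrary: s) (simp_all add: adr_lin shift_add)
lemma is_add_TN: "is_add (TN N x s)" by (simp add: is_add_def TN_add)
lemmas TN_lin = is_add_lin[OF is_add_TN]

lemma TN_left: "TN N (x - y) s F = TN N x s F - TN N y s F" "TN N 0 s F = 0"
  by (induction N arbitrary: s) (simp_all add: adr_left_diff shift_diff is_add_lin)

lemma TN_ec: "TN (Suc (Suc N)) (munit a b) s (ec c d F) = ec c d (TN (Suc (Suc N)) (munit a b) s F) + TN (Suc N) (unit_bracket a b c d) s F"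
proof (induction N arbitrary: s)
  case 0
  have "TN (Suc (Suc 0)) (munit a b) s G = T1 (munit a b) (s + 1) G - shift 1 (T1 (munit a b) s G)" for G by (simp add: T1_def)
  then show ?case unfolding TN_1
    by (simp add: T1_ec shift_add shift_diff shift_fsc shift_shift shift_NO NO_right_lin T1_def[of "unit_bracket a b c d"] add.commute)
next
  case (Suc N)
  have u: "TN (Suc (Suc (Suc N))) x s G = TN (Suc (Suc N)) x (s + 1) G - shift 1 (TN (Suc (Suc N)) x s G)"
    "TN (Suc (Suc N)) x s G = TN (Suc N) x (s + 1) G - shift 1 (TN (Suc N) x s G)" for x s G by simp_all
  show ?case unfolding u(1)[of "munit a b"] u(2)[of "unit_bracket a b c d"] Suc
    by (simp only: shift_add shift_NO NO_right_lin algebra_simps)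
qed

lemma TN_fder: "TN N x s (fder F) = fder (TN N x s F) + zmul (int N) (TN (N - 1) x s F)"
proof (induction N arbitrary: s)
  case 0 then show ?case by (simp add: adr_fder)
next
  case (Suc N)
  have z: "zmul (int N) (TN N x s F) = zmul (int N) (TN (N - 1) x (s + 1) F) - shift 1 (zmul (int N) (TN (N - 1) x s F))"
    by (cases N) (simp_all add: zmul_diff_right is_add_lin)
  have zs: "zmul (1 + int N) G = G + zmul (int N) G" for G :: "'v fld" by (simp add: zmul_add_left)
  show ?case
    using z by (simp add: Suc shift_add is_add_lin fder_shift1 zs algebra_simps)
qed

definition local_fld :: "'v fld \<Rightarrow> bool" where
  "local_fld F \<longleftrightarrow> (\<exists>N. \<forall>a b s. TN N (munit a b) s F = 0)"

lemma TN_mono: "(\<And>s. TN N x s F = 0) \<Longrightarrow> N \<le> M \<Longrightarrow> TN M x s F = 0"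
proof (induction M arbitrary: s)
  case (Suc M)
  show ?case
  proof (cases "N = Suc M")
    case False
    with Suc have "TN M x s F = 0" for s by simp
    then show ?thesis by (simp add: is_add_lin)
  qed (use Suc in auto)
qed simp

lemma local_large:
  assumes "local_fld F"
  obtains N where "\<And>M a b s. N \<le> M \<Longrightarrow> TN M (munit a b) s F = 0"
  using assms TN_mono unfolding local_fld_def by metis

text \<open>
Dong's lemma for normally ordered products with currents and derivatives: each step raises the order of locality by at most two.
\<close>

lemma local_S: "local_fld (S j)"
proof (rule S_closed)
  show "local_fld 0" by (simp add: local_fld_def TN_lin)
  show "local_fld fone" unfolding local_fld_def by (rule exI[of _ 0]) simp
  fix F assume F: "local_fld F"
  then show "local_fld (- F)" by (simp add: local_fld_def TN_lin)
  from F obtain N where N: "\<And>M a b s. N \<le> M \<Longrightarrow> TN M (munit a b) s F = 0" by (rule local_large) blast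
  show "local_fld (fder F)"
    unfolding local_fld_def by (rule exI[of _ "Suc N"]) (simp add: TN_fder N is_add_lin del: TN.simps)
  fix a b
  have "TN (Suc N) (unit_bracket a' b' a b) s F = 0" for a' b' s
    by (simp add: unit_bracket_eq TN_left N del: TN.simps)
  then show "local_fld (ec a b F)"
    unfolding local_fld_def by (intro exI[of _ "Suc (Suc N)"]) (simp add: TN_ec N NO_right_lin del: TN.simps)
next
  fix F G assume "local_fld F" "local_fld G"
  then obtain N M where N: "\<And>L a b s. N \<le> L \<Longrightarrow> TN L (munit a b) s F = 0" and M: "\<And>L a b s. M \<le> L \<Longrightarrow> TN L (munit a b) s G = 0"
    using local_large by metis
  show "local_fld (F + G)"
    unfolding local_fld_def by (rule exI[of _ "max N M"]) (simp add: TN_add N M)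
qed

lemma xm_comm_unit: "xm (munit a b) r (xm (munit c d) s v) - xm (munit c d) s (xm (munit a b) r v)
   = xm (unit_bracket a b c d) (r + s) v + (if r + s = 0 then zmul (s * kz a b c d) v else 0)"
  unfolding xm_comm by (simp add: unit_bracket_def kform_kz zmul_sc)

lemma adr_adr: "adr (munit a b) r (adr (munit c d) s F) - adr (munit c d) s (adr (munit a b) r F) = adr (unit_bracket a b c d) (r + s) F"
proof (rule fld_eqI)
  fix k v
  have 1: "xm (munit a b) r (xm (munit c d) s w) = xm (munit c d) s (xm (munit a b) r w)
    + (xm (unit_bracket a b c d) (r + s) w + (if r + s = 0 then zmul (s * kz a b c d) w else 0))" for w
    using xm_comm_unit[of a b r c d s w] by (simp add: algebra_simps)
  show "md (adr (munit a b) r (adr (munit c d) s F) - adr (munit c d) s (adr (munit a b) r F)) k v = md (adr (unit_bracket a b c d) (r + s) F) k v"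
    by (simp add: md_adr is_add_lin 1 md_lin algebra_simps)
qed

definition mone :: "'n cmat" where "mone = (\<Sum>a\<in>UNIV. munit a a)"

lemma adr_mone_S: "adr mone r (S j) = 0"
proof (rule S_closed)
  fix F :: "'v fld" and a b
  assume F: "adr mone r F = 0"
  show "adr mone r (fder F) = 0" by (simp add: adr_fder F is_add_lin)
  have m: "mone $ i $ k = (if i = k then 1 else 0)" for i k
    by (simp add: mone_def munit_def) (auto intro: sum.neutral)
  then have m1: "mone = mat 1" by (simp add: vec_eq_iff mat_def)
  have "kform mone (munit a b) = 0"
    by (simp add: kform_def m1 trace_I)
  then have "adr mone r (lf (munit a b)) = 0"
    by (simp add: adr_lf m1 is_add_lin)
  then show "adr mone r (ec a b F) = 0" by (simp add: adr_NO F NO_right_lin NO_left_lin)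
qed (simp_all add: adr_lin)

text \<open>
Commutation with the modes of index \<open>0\<close> and \<open>1\<close> propagates to all positive indices by brackets. These reach all
off-diagonal units and the differences of diagonal ones; the missing direction is the identity matrix, whose modes commute with everything because
the critical form vanishes on it.
\<close>

lemma adr_pos_S: "0 \<le> r \<Longrightarrow> adr (munit a b) r (S j) = 0"
proof (induction r arbitrary: a b rule: int_ge_induct)
  case (step r)
  have br: "adr (unit_bracket a b c d) (r + 1) (S j) = 0" for a b c d
    using adr_adr[of a b 1 c d r "S j"] step by (simp add: adr_1_S adr_lin add.commute)
  show ?case
  proof (cases "a = b")
    case False
    then show ?thesis using br[of a a a b] by (simp add: unit_bracket_eq)
  next
    case True
    have eq: "adr (munit c c) (r + 1) (S j) = adr (munit a a) (r + 1) (S j)" for c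
      using br[of c a a c] by (cases "c = a") (simp_all add: unit_bracket_eq adr_left_diff)
    have "0 = adr mone (r + 1) (S j)" by (simp add: adr_mone_S)
    also have "\<dots> = (\<Sum>c\<in>UNIV. adr (munit c c) (r + 1) (S j))" by (simp add: mone_def adr_left_sum)
    also have "\<dots> = (\<Sum>c\<in>(UNIV :: 'n set). adr (munit a a) (r + 1) (S j))" by (intro sum.cong refl eq)
    finally have z: "(\<Sum>c\<in>(UNIV :: 'n set). adr (munit a a) (r + 1) (S j)) = 0" by simp
    have "(\<Sum>c\<in>A. G) = fsc (of_nat (card A)) G" if "finite A" for A :: "'n set" and G
      using that by (induction A) (simp_all add: fsc_add_left)
    with z have "fsc (of_nat CARD('n)) (adr (munit a a) (r + 1) (S j)) = 0" by simp
    then have "fsc (1 / of_nat CARD('n)) (fsc (of_nat CARD('n)) (adr (munit a a) (r + 1) (S j))) = 0" by simp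
    moreover have "fsc c (fsc d G) = fsc (c * d) G" for c d G by (rule fld_eqI) (simp add: md_fsc)
    ultimately show ?thesis using True by simp
  qed
qed (rule adr_0_S)

lemma TN_eventually_0: "(\<And>t. s \<le> t \<Longrightarrow> adr x t F = 0) \<Longrightarrow> TN N x s F = 0"
  by (induction N arbitrary: s) (simp_all add: is_add_lin)

lemma TN_lead: "(\<And>t. s < t \<Longrightarrow> adr x t F = 0) \<Longrightarrow> TN N x s F = (if even N then id else uminus) (shift (int N) (adr x s F))"
proof (induction N)
  case (Suc N)
  have "TN N x (s + 1) F = 0" by (rule TN_eventually_0) (use Suc in auto)
  with Suc show ?case by (simp add: shift_shift is_add_lin add.commute)
qed simp

text \<open>
For negative indices commutators are not available. If all modes above \<open>r\<close> commute with \<open>S\<^sub>j\<close>, then locality of order \<open>N\<close> involves only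
the commutator with the mode \<open>r\<close>, multiplied by a power of \<open>z\<close>, and so forces it to vanish.
\<close>

theorem adr_S: "adr (munit a b) r (S j) = 0"
proof (cases "0 \<le> r")
  case False
  obtain N where N: "\<And>s. TN N (munit a b) s (S j) = 0" using local_S unfolding local_fld_def by blast
  have "\<forall>t\<ge>r. adr (munit a b) t (S j) = 0" if "r \<le> 0" for r
    using that
  proof (induction r rule: int_le_induct)
    case base then show ?case by (simp add: adr_pos_S)
  next
    case (step r)
    have "shift (int N) (adr (munit a b) (r - 1) (S j)) = 0"
      using TN_lead[of "r - 1" "munit a b" "S j" N] step N by (auto split: if_splits)
    then have "shift (- int N) (shift (int N) (adr (munit a b) (r - 1) (S j))) = 0" by (simp add: is_add_lin)
    then have "adr (munit a b) (r - 1) (S j) = 0" by (simp add: shift_shift)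
    moreover have "t = r - 1 \<or> r \<le> t" if "r - 1 \<le> t" for t using that by linarith
    ultimately show ?case using step by blast
  qed
  from this[of r] False show ?thesis by simp
qed (rule adr_pos_S)

lemma S_sc: "md (S j) k (sc c v) = sc c (md (S j) k v)"
proof -
  have "\<forall>k c v. md (S j) k (sc c v) = sc c (md (S j) k v)"
  proof (rule S_closed)
    fix F G :: "'v fld" and a b
    assume F: "\<forall>k c v. md F k (sc c v) = sc c (md F k v)"
    show "\<forall>k c v. md (fder F) k (sc c v) = sc c (md (fder F) k v)"
      by (simp add: md_fder F zmul_sc mult.commute)
    show "\<forall>k c v. md (ec a b F) k (sc c v) = sc c (md (ec a b F) k v)"
    proof (intro allI)
      fix k c v
      have "\<forall>\<^sub>F N in sequentially. md (ec a b F) k (sc c v) = sc c (md (ec a b F) k v)"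
        using NO_ev[of "lf (munit a b)" F k "sc c v"] NO_ev[of "lf (munit a b)" F k v]
        by eventually_elim (simp add: F md_lf xm_sc V.scale_right_distrib V.scale_sum_right)
      then show "md (ec a b F) k (sc c v) = sc c (md (ec a b F) k v)" by simp
    qed
  qed (simp_all add: md_fone V.scale_right_distrib)
  then show ?thesis by blast
qed

lemma S_comm_unit: "md (S j) k (xm (munit a b) r v) = xm (munit a b) r (md (S j) k v)"
  using adr_S[of a b r j] md_adr[of "munit a b" r "S j" k v] by simp

lemma S_comm_xm: "md (S j) k (xm x r v) = xm x r (md (S j) k v)"
proof -
  have "xm x r w = (\<Sum>a\<in>UNIV. \<Sum>b\<in>UNIV. sc (x $ a $ b) (xm (munit a b) r w))" for w
    by (subst matrix_munit_sum) (simp add: xm_sum xm_scale)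
  then show ?thesis by (simp add: md_sum S_sc S_comm_unit)
qed

end

text \<open>
A Laurent matrix is a finite sum of loops up to a remainder that smoothness makes negligible.
\<close>

lemma laurent_matrix_split:
  fixes X :: "complex fls^'n::finite^'n"
  obtains M where "X - (\<Sum>r\<in>{- int M..<int N}. loop (\<chi> i j. X $ i $ j $$ r) r) \<in> arcs N"
proof -
  define M where "M = nat (Max ((\<lambda>(i, j). - fls_subdegree (X $ i $ j)) ` UNIV))"
  have M: "- int M \<le> fls_subdegree (X $ i $ j)" for i j
  proof -
    have "- fls_subdegree (X $ i $ j) \<le> Max ((\<lambda>(i, j). - fls_subdegree (X $ i $ j)) ` UNIV)"
      by (rule Max_ge) (auto intro: image_eqI[of _ _ "(i, j)"])
    then show ?thesis unfolding M_def by linarith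
  qed
  have "X - (\<Sum>r\<in>{- int M..<int N}. loop (\<chi> i j. X $ i $ j $$ r) r) \<in> arcs N"
    unfolding arcs_def
  proof (intro CollectI allI impI)
    fix i j k assume k: "k < int N"
    have "X $ i $ j $$ k = 0" if "k < - int M" using M[of i j] that by simp
    then show "(X - (\<Sum>r\<in>{- int M..<int N}. loop (\<chi> i j. X $ i $ j $$ r) r)) $ i $ j $$ k = 0"
      using k by (auto simp: fls_nth_sum loop_lmon lmon_nth)
  qed
  then show ?thesis by (rule that)
qed

lemma arcs_antimono: "N \<le> M \<Longrightarrow> arcs M \<subseteq> arcs N" by (auto simp: arcs_def)

context smooth_rep
begin

theorem S_comm: "md (S j) k (\<rho> x v) = \<rho> x (md (S j) k v)"
proof (cases x)
  case (Pair X c)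
  obtain N1 where "\<forall>Y\<in>arcs N1. \<rho> (Y, 0) v = 0" using smooth unfolding smooth_def by blast
  moreover obtain N2 where "\<forall>Y\<in>arcs N2. \<rho> (Y, 0) (md (S j) k v) = 0"
    using smooth unfolding smooth_def by blast
  ultimately have N: "\<rho> (Y, 0) v = 0" "\<rho> (Y, 0) (md (S j) k v) = 0" if "Y \<in> arcs (max N1 N2)" for Y
    using that arcs_antimono[of N1 "max N1 N2"] arcs_antimono[of N2 "max N1 N2"] by auto
  define N where "N = max N1 N2"
  obtain M where M: "X - (\<Sum>r\<in>{- int M..<int N}. loop (\<chi> i j. X $ i $ j $$ r) r) \<in> arcs N" (is "X - ?Y \<in> _")
    by (rule laurent_matrix_split)
  have sum: "\<rho> ((\<Sum>r\<in>A. loop (f r) r), 0) w = (\<Sum>r\<in>A. xm (f r) r w)" for A f w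
  proof (induction A rule: infinite_finite_induct)
    case (insert r A)
    then show ?case using rho_add_left[of "(loop (f r) r, 0)" "(\<Sum>r\<in>A. loop (f r) r, 0)" w] by (simp add: xm_def)
  qed simp_all
  have X: "\<rho> (X, c) w = \<rho> (X - ?Y, 0) w + \<rho> (?Y, 0) w + sc c w" for w
    using rho_add_left[of "(X - ?Y, 0)" "(?Y, 0)" w] by (simp add: rho_pair[of X c])
  have "\<rho> (X - ?Y, 0) v = 0" "\<rho> (X - ?Y, 0) (md (S j) k v) = 0" using N M by (auto simp: N_def)
  then show ?thesis unfolding Pair X sum by (simp add: md_lin S_sc S_comm_xm)
qed

end

section \<open>States as combinations of words\<close>

definition lin :: "(complex \<Rightarrow> 'x \<Rightarrow> 'b) \<Rightarrow> ('k \<Rightarrow> 'x) \<Rightarrow> ('k \<Rightarrow>\<^sub>0 complex) \<Rightarrow> 'b::ab_group_add" where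
  "lin s f p = (\<Sum>k\<in>Poly_Mapping.keys p. s (Poly_Mapping.lookup p k) (f k))"

lemma lin_add:
  assumes "\<And>c d x. s (c + d) x = s c x + s d x"
  shows "lin s f (p + q) = lin s f p + lin s f q"
proof -
  have "s 0 x = 0" for x using assms[of 0 0 x] by simp
  then show ?thesis
    unfolding lin_def by (intro setsum_keys_plus_distrib[where f = "\<lambda>k c. s c (f k)"]) (simp_all add: assms)
qed

lemma lin_single:
  assumes "\<And>c d x. s (c + d) x = s c x + s d x"
  shows "lin s f (Poly_Mapping.single k c) = s c (f k)"
proof -
  have "s 0 x = 0" for x using assms[of 0 0 x] by simp
  then show ?thesis by (cases "c = 0") (simp_all add: lin_def)
qed

lemma lin_zero [simp]: "lin s f 0 = 0" by (simp add: lin_def)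

lemma pm_induct [case_names zero single add]:
  assumes "P 0" "\<And>k c. P (Poly_Mapping.single k c)" "\<And>p q. P p \<Longrightarrow> P q \<Longrightarrow> P (p + q)"
  shows "P (p :: 'k \<Rightarrow>\<^sub>0 complex)"
proof -
  have "(\<Sum>k\<in>Poly_Mapping.keys p. Poly_Mapping.single k (Poly_Mapping.lookup p k)) = p"
    by (rule poly_mapping_eqI) (auto simp: lookup_sum lookup_single when_def not_in_keys_iff_lookup_eq_zero)
  moreover have "P (\<Sum>k\<in>A. Poly_Mapping.single k (f k))" for A f
    by (induction A rule: infinite_finite_induct) (auto intro: assms)
  ultimately show ?thesis by metis
qed

text \<open>
Linear extension commutes with linear maps.
\<close>

lemma lin_map:
  assumes "\<And>c d x. s (c + d) x = s c x + s d x" "\<And>c d x. t (c + d) x = t c x + t d x"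
    "\<And>x y. h (x + y) = h x + h y" "\<And>c k. h (s c (f k)) = t c (g k)"
  shows "h (lin s f p) = lin t g p"
proof (induction p rule: pm_induct)
  case zero
  then show ?case using assms(3)[of 0 0] by simp
next
  case (single k c)
  then show ?case by (simp add: lin_single[of s, OF assms(1)] lin_single[of t, OF assms(2)] assms(4))
next
  case (add p q)
  then show ?case by (simp add: lin_add[of s, OF assms(1)] lin_add[of t, OF assms(2)] assms(3))
qed

type_synonym 'l words = "('l \<times> nat) list \<Rightarrow>\<^sub>0 complex"

definition psc :: "complex \<Rightarrow> ('k \<Rightarrow>\<^sub>0 complex) \<Rightarrow> ('k \<Rightarrow>\<^sub>0 complex)" where
  "psc c = Poly_Mapping.map ((*) c)"

lemma lookup_psc: "Poly_Mapping.lookup (psc c p) k = c * Poly_Mapping.lookup p k"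
  by (simp add: psc_def Poly_Mapping.map.rep_eq when_def)

lemma psc_left: "psc (c + d) p = psc c p + psc d p" by (rule poly_mapping_eqI) (simp add: lookup_psc lookup_add ring_distribs)
lemma psc_right: "psc c (p + q) = psc c p + psc c q" by (rule poly_mapping_eqI) (simp add: lookup_psc lookup_add ring_distribs)
lemma psc_single: "psc c (Poly_Mapping.single k d) = Poly_Mapping.single k (c * d)"
  by (rule poly_mapping_eqI) (simp add: lookup_psc lookup_single when_def)

definition pre :: "'l \<times> nat \<Rightarrow> 'l words \<Rightarrow> 'l words" where
  "pre l = lin (\<lambda>c w. Poly_Mapping.single w c) (\<lambda>w. l # w)"

lemma pre_add: "pre l (p + q) = pre l p + pre l q"
  unfolding pre_def by (rule lin_add) (simp add: single_add)
lemma pre_single: "pre l (Poly_Mapping.single w c) = Poly_Mapping.single (l # w) c"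
  unfolding pre_def by (rule lin_single) (simp add: single_add)

text \<open>
Translation of a word, as a derivation with \<open>T (x t\<^bsup>-r-1\<^esup>) = (r + 1) x t\<^bsup>-r-2\<^esup>\<close>.
\<close>

fun tword :: "('l \<times> nat) list \<Rightarrow> 'l words" where
  "tword [] = 0"
| "tword ((x, r) # w) = Poly_Mapping.single ((x, Suc r) # w) (of_nat (Suc r)) + pre (x, r) (tword w)"

definition tstate :: "'l words \<Rightarrow> 'l words" where "tstate = lin psc tword"

lemma tstate_add: "tstate (p + q) = tstate p + tstate q"
  unfolding tstate_def by (rule lin_add) (rule psc_left)
lemma tstate_single: "tstate (Poly_Mapping.single w c) = psc c (tword w)"
  unfolding tstate_def by (rule lin_single) (rule psc_left)

text \<open>
A module in which words can be evaluated letter by letter, with a translation operator \<open>tB\<close>. Evaluation turns formal states into fields, into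
states over the Cartan subalgebra embedded in all states, and into functions of \<open>h[[t]]\<close>.
\<close>

locale word_rep =
  fixes s :: "complex \<Rightarrow> 'b::ab_group_add \<Rightarrow> 'b" and lt :: "'l \<times> nat \<Rightarrow> 'b \<Rightarrow> 'b" and tB :: "'b \<Rightarrow> 'b" and one :: 'b
  assumes s_left: "s (c + d) x = s c x + s d x" and s_right: "s c (x + y) = s c x + s c y"
    and s_s: "s c (s d x) = s (c * d) x" and s_1: "s 1 x = x"
    and lt_add: "lt l (x + y) = lt l x + lt l y" and lt_s: "lt l (s c x) = s c (lt l x)"
    and tB_add: "tB (x + y) = tB x + tB y" and tB_s: "tB (s c x) = s c (tB x)"
    and tB_one: "tB one = 0"
    and tB_lt: "tB (lt (a, r) x) = s (of_nat (Suc r)) (lt (a, Suc r) x) + lt (a, r) (tB x)"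
begin

definition wd :: "('l \<times> nat) list \<Rightarrow> 'b" where "wd w = foldr lt w one"
definition ev :: "'l words \<Rightarrow> 'b" where "ev = lin s wd"

lemma wd_simps [simp]: "wd [] = one" "wd (l # w) = lt l (wd w)" by (simp_all add: wd_def)
lemma ev_add: "ev (p + q) = ev p + ev q" unfolding ev_def by (rule lin_add) (rule s_left)
lemma ev_0 [simp]: "ev 0 = 0" by (simp add: ev_def)
lemma ev_single: "ev (Poly_Mapping.single w c) = s c (wd w)" unfolding ev_def by (rule lin_single) (rule s_left)
lemma ev_one: "ev (Poly_Mapping.single [] 1) = one" by (simp add: ev_single s_1)
lemma s_0 [simp]: "s c 0 = 0" using s_right[of c 0 0] by simp
lemma lt_0 [simp]: "lt l 0 = 0" using lt_add[of l 0 0] by simp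
lemma tB_0 [simp]: "tB 0 = 0" using tB_add[of 0 0] by simp

lemma ev_pre: "ev (pre l p) = lt l (ev p)"
  by (induction p rule: pm_induct)
    (simp_all add: ev_single pre_single lt_s pre_add ev_add lt_add, simp add: pre_def)

lemma ev_psc: "ev (psc c p) = s c (ev p)"
proof (induction p rule: pm_induct)
  case zero
  have "psc c 0 = (0 :: 'l words)" by (rule poly_mapping_eqI) (simp add: lookup_psc)
  then show ?case by simp
qed (simp_all add: psc_single ev_single s_s psc_right ev_add s_right)

lemma ev_tword: "ev (tword w) = tB (wd w)"
proof (induction w)
  case (Cons l w)
  then show ?case by (cases l) (simp add: ev_add ev_single ev_pre tB_lt)
qed (simp add: tB_one)

lemma ev_tstate: "ev (tstate p) = tB (ev p)"
proof (induction p rule: pm_induct)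
  case zero
  then show ?case by (simp add: tstate_def)
qed (simp_all add: tstate_single ev_psc ev_tword ev_single tB_s tstate_add ev_add tB_add)

end

text \<open>
Naturality: a map that intertwines \<open>e\<close>, \<open>\<tau>\<close> and the vacuum maps the one construction to the other.
\<close>

lemma sugawara_map:
  fixes e :: "'n::{finite,linorder} \<Rightarrow> 'n \<Rightarrow> 'a::ab_group_add \<Rightarrow> 'a" and H :: "'a \<Rightarrow> 'b::ab_group_add"
  assumes add: "\<And>x y. H (x + y) = H x + H y" and e: "\<And>a b x. H (e a b x) = e' a b (H x)"
    and t: "\<And>x. H (\<tau> x) = \<tau>' (H x)" and one: "H one = one'"
  shows "H (sugawara e \<tau> one j) = sugawara e' \<tau>' one' j"
proof -
  note lin = additive_diff_zero[of H, OF add] additive_sum[of H, OF add]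
  have s: "H (sgn_at a A x) = sgn_at a A (H x)" for a and A :: "'n set" and x by (simp add: sgn_at_def lin)
  have ap: "(\<Sum>a\<in>A. (f a :: ('n, 'z::ab_group_add) grass)) B i = (\<Sum>a\<in>A. f a B i)" for f and A :: "'n set" and B i
    by (induction A rule: infinite_finite_induct) auto
  have "(\<lambda>B i. H (gdet e \<tau> one l B i)) = gdet e' \<tau>' one' l" for l
  proof (induction l)
    case Nil
    then show ?case by (auto simp: gdet_def gone_def one lin fun_eq_iff)
  next
    case (Cons j l)
    have g: "H (gdet e \<tau> one l B i) = gdet e' \<tau>' one' l B i" for B i using Cons by (metis (no_types, lifting))
    have u: "gdet e \<tau> one (j # l) = gxi e \<tau> j (gdet e \<tau> one l)" "gdet e' \<tau>' one' (j # l) = gxi e' \<tau>' j (gdet e' \<tau>' one' l)"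
      by (simp_all add: gdet_def)
    show ?case
    proof (rule ext, rule ext)
      fix B i
      show "H (gdet e \<tau> one (j # l) B i) = gdet e' \<tau>' one' (j # l) B i"
        unfolding u gxi_def ap lin(4)
        by (intro sum.cong refl) (simp add: gpsi_def gL_def glift_def gshift_def lin s add e t g)
    qed
  qed
  then show ?thesis unfolding sugawara_def by metis
qed

definition est :: "'n \<Rightarrow> 'n \<Rightarrow> 'n::finite state \<Rightarrow> 'n state" where "est a b = pre (munit a b, 0)"

text \<open>
The state presented by formal words. Its words contain no relations of the enveloping algebra, so that its field and its image under other
evaluations are obtained from \<open>sugawara_map\<close>.
\<close>

definition sugawara_state :: "nat \<Rightarrow> 'n::{finite,linorder} state" where
  "sugawara_state j = sugawara est tstate (Poly_Mapping.single [] 1) j"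

definition trunc_mode :: "'n::finite state \<Rightarrow> int \<Rightarrow> nat \<Rightarrow> 'n ghat free_alg" where
  "trunc_mode p k L = (\<Sum>w\<in>Poly_Mapping.keys p. scal (Poly_Mapping.lookup p w) * word_field_trunc L w k)"

section \<open>The action of the free algebra\<close>

context smooth_rep
begin

abbreviation act :: "'n ghat free_alg \<Rightarrow> 'v \<Rightarrow> 'v" where "act \<equiv> alg_act sc \<rho>"

lemma act_lin: "act a v = lin sc (\<lambda>w. foldr \<rho> (letters w) v) a"
  by (simp add: alg_act_def lin_def)
lemma act_add: "act (a + b) v = act a v + act b v"
  unfolding act_lin by (rule lin_add) (rule V.scale_left_distrib)
lemma act_0 [simp]: "act 0 v = 0" by (simp add: act_lin)
lemma act_single: "act (Poly_Mapping.single w c) v = sc c (foldr \<rho> (letters w) v)"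
  unfolding act_lin by (rule lin_single) (rule V.scale_left_distrib)
lemma act_minus: "act (- a) v = - act a v" "act (a - b) v = act a v - act b v"
  using additive_diff_zero[of "\<lambda>a. act a v", OF act_add] by auto
lemma act_sum: "act (sum f A) v = (\<Sum>i\<in>A. act (f i) v)"
  by (rule additive_sum[of "\<lambda>a. act a v", OF act_add])

lemma foldr_rho_add: "foldr \<rho> w (u + v) = foldr \<rho> w u + foldr \<rho> w v" by (induction w) (simp_all add: rho_add)
lemma foldr_rho_sc: "foldr \<rho> w (sc c v) = sc c (foldr \<rho> w v)" by (induction w) (simp_all add: rho_sc)

lemma act_right_add: "act a (u + v) = act a u + act a v"
  by (induction a rule: pm_induct) (simp_all add: act_single foldr_rho_add V.scale_right_distrib act_add)
lemma is_add_act: "is_add (act a)" by (simp add: is_add_def act_right_add)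
lemmas act_right_lin = is_add_lin[OF is_add_act]

lemma act_mult: "act (a * b) v = act a (act b v)"
proof (induction a rule: pm_induct)
  case (single u c)
  show ?case
  proof (induction b rule: pm_induct)
    case (single w d)
    then show ?case
      by (simp add: mult_single act_single plus_free_monoid_def foldr_rho_sc)
  qed (simp_all add: act_right_lin act_add act_right_add distrib_left)
qed (simp_all add: act_add distrib_right)

lemma act_gen: "act (gen x) v = \<rho> x v" by (simp add: gen_def act_single)
lemma act_scal: "act (scal c) v = sc c v" by (simp add: scal_def act_single zero_free_monoid_def)
lemma act_1: "act 1 v = v"
  using act_scal[of 1 v] by (simp add: scal_def)
lemma act_of_int: "act (of_int k) v = sc (of_int k) v"
  using act_scal[of "of_int k" v] by (simp add: scal_def)

lemma act_U_rels: "r \<in> U_rels \<Longrightarrow> act r v = 0"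
  by (induction rule: U_rels.induct)
    (simp_all add: act_minus act_mult act_gen act_scal act_1 rho_add_left rho_scale rho_bracket rho_level)

lemma act_U_ideal: "r \<in> U_ideal \<Longrightarrow> act r v = 0"
  by (induction arbitrary: v rule: U_ideal.induct)
    (simp_all add: act_mult act_U_rels act_right_lin act_add)

lemma act_left_ideal:
  assumes "\<And>X. X \<in> arcs N \<Longrightarrow> \<rho> (X, 0) v = 0"
  shows "r \<in> left_ideal N \<Longrightarrow> act r v = 0"
  by (induction rule: left_ideal.induct)
    (simp_all add: act_U_ideal act_mult act_gen assms act_right_lin act_add)

section \<open>Fields of states\<close>

definition lfd :: "'n cmat \<times> nat \<Rightarrow> 'v fld" where
  "lfd l = fsc (1 / fact (snd l)) ((fder ^^ snd l) (lf (fst l)))"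

lemma fder_fsc: "fder (fsc c F) = fsc c (fder F)"
  by (rule fld_eqI) (simp add: md_fder md_fsc zmul_sc mult.commute)
lemma fsc_fsc: "fsc c (fsc d F) = fsc (c * d) F"
  by (rule fld_eqI) (simp add: md_fsc)

lemma fder_lfd: "fder (lfd (x, r)) = fsc (of_nat (Suc r)) (lfd (x, Suc r))"
proof -
  have "of_nat (Suc r) * (1 / fact (Suc r)) = (1 / fact r :: complex)"
    unfolding fact_Suc by (simp add: divide_simps del: of_nat_Suc)
  then show ?thesis by (simp only: lfd_def fder_fsc fsc_fsc fst_conv snd_conv funpow.simps o_apply)
qed

lemma md_lfd_sc: "md (lfd l) k (sc c v) = sc c (md (lfd l) k v)"
proof -
  have "md ((fder ^^ r) (lf x)) k (sc c v) = sc c (md ((fder ^^ r) (lf x)) k v)" for r x k c v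
    by (induction r arbitrary: k) (simp_all add: md_lf xm_sc md_fder zmul_sc mult.commute)
  then show ?thesis by (simp add: lfd_def md_fsc mult.commute)
qed

lemma NO_lfd_fsc: "NO (lfd l) (fsc c F) = fsc c (NO (lfd l) F)"
proof (rule fld_eqI)
  fix k v
  have "\<forall>\<^sub>F N in sequentially. md (NO (lfd l) (fsc c F)) k v = md (fsc c (NO (lfd l) F)) k v"
    using NO_ev[of "lfd l" "fsc c F" k v] NO_ev[of "lfd l" F k v]
    by eventually_elim (simp add: md_fsc md_lfd_sc V.scale_right_distrib V.scale_sum_right)
  then show "md (NO (lfd l) (fsc c F)) k v = md (fsc c (NO (lfd l) F)) k v" by simp
qed

sublocale Y: word_rep fsc "\<lambda>l. NO (lfd l)" fder fone
proof
  fix a r and x :: "'v fld"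
  have "fsc (of_nat (Suc r)) = (fsc (of_int (int (Suc r))) :: 'v fld \<Rightarrow> _)" by simp
  then have "NO (fsc (of_nat (Suc r)) (lfd (a, Suc r))) x = fsc (of_nat (Suc r)) (NO (lfd (a, Suc r)) x)"
    using NO_fsc_int by metis
  then show "fder (NO (lfd (a, r)) x) = fsc (of_nat (Suc r)) (NO (lfd (a, Suc r)) x) + NO (lfd (a, r)) (fder x)"
    by (simp only: fder_NO fder_lfd)
qed (simp_all add: fsc_add_left fsc_add fsc_fsc NO_add_right NO_lfd_fsc fder_add fder_fsc)

lemma lfd_0: "lfd (x, 0) = lf x" by (simp add: lfd_def)

text \<open>
The state-field correspondence intertwines left multiplication by \<open>E\<^sub>a\<^sub>b t\<^bsup>-1\<^esup>\<close> with normally ordered multiplication by \<open>E\<^sub>a\<^sub>b(z)\<close>, and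
translation with the derivative.
\<close>

lemma Y_sugawara: "Y.ev (sugawara_state j) = S j"
  unfolding sugawara_state_def S_def
  by (rule sugawara_map) (simp_all add: Y.ev_add est_def Y.ev_pre lfd_0 Y.ev_tstate Y.ev_one)

lemma act_letter_field: "act (letter_field l k) v = md (lfd l) k v"
proof -
  have "act ((field_deriv ^^ r) (\<lambda>j. gen (loop x j, 0)) k) v = md ((fder ^^ r) (lf x)) k v" for r x
  proof (induction r arbitrary: k)
    case (Suc r)
    have "act (- of_int k * a) v = zmul (- k) (act a v)" for a
      using act_mult[of "of_int (- k)" a v] by (simp only: of_int_minus[symmetric] act_of_int zmul_sc)
    moreover have "field_deriv F k = - of_int k * F (k - 1)" for F :: "int \<Rightarrow> 'n ghat free_alg"
      by (simp add: field_deriv_def)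
    ultimately show ?case by (simp only: funpow.simps o_apply md_fder Suc)
  qed (simp add: act_gen md_lf xm_def)
  then show ?thesis by (simp add: letter_field_def lfd_def act_mult act_scal md_fsc)
qed

text \<open>
The statement is uniform in \<open>k \<ge> k0\<close>, because the truncated sums of the next letter use all larger modes of the shorter word.
\<close>

lemma word_trunc_limit:
  "\<forall>\<^sub>F L in sequentially. \<forall>k\<ge>k0. act (word_field_trunc L w k) v = md (Y.wd w) k v"
proof (induction w arbitrary: k0 v)
  case Nil
  then show ?case by (simp add: word_field_trunc_def vacuum_field_def md_fone act_1)
next
  case (Cons l w)
  let ?A = "lfd l" and ?F = "Y.wd w"
  obtain M where M: "\<forall>j\<ge>M. md ?A (0 + int j) v = 0" using md_ev[of ?A 0 v] by (auto simp: eventually_sequentially)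
  obtain M' where M': "\<forall>j\<ge>M'. md ?F (k0 + int j) v = 0" using md_ev[of ?F k0 v] by (auto simp: eventually_sequentially)
  have "\<forall>\<^sub>F L in sequentially. \<forall>j\<in>{..<M}. \<forall>k\<ge>k0 - 1 - int j. act (word_field_trunc L w k) (md ?A (int j) v) = md ?F k (md ?A (int j) v)"
    by (intro eventually_ball_finite ballI Cons) auto
  then show ?case
    using Cons[of k0 v] eventually_ge_at_top[of M] eventually_ge_at_top[of M']
  proof eventually_elim
    case (elim L)
    show ?case
    proof (intro allI impI)
      fix k assume k: "k0 \<le> k"
      let ?T = "word_field_trunc L w"
      have r1: "(\<Sum>j\<in>{- int L..<0}. f j) = (\<Sum>i<L. f (- int i - 1))" for f :: "int \<Rightarrow> 'v"
        by (rule sum.reindex_bij_witness[of _ "\<lambda>i. - int i - 1" "\<lambda>j. nat (- j - 1)"]) auto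
      have r2: "(\<Sum>j\<in>{0..<int L}. f j) = (\<Sum>i<L. f (int i))" for f :: "int \<Rightarrow> 'v"
        by (rule sum.reindex_bij_witness[of _ int nat]) auto
      have "act (word_field_trunc L (l # w) k) v = act (normal_trunc L (letter_field l) ?T k) v"
        by (simp add: word_field_trunc_def)
      also have "\<dots> = (\<Sum>i<L. md ?A (- int i - 1) (act (?T (k + int i)) v)) + (\<Sum>i<L. act (?T (k - 1 - int i)) (md ?A (int i) v))"
        by (simp add: normal_trunc_def act_add act_sum act_mult act_letter_field r1 r2 algebra_simps)
      also have "(\<Sum>i<L. md ?A (- int i - 1) (act (?T (k + int i)) v)) = (\<Sum>i<L. md ?A (- int i - 1) (md ?F (k + int i) v))"
        using elim(2) k by (intro sum.cong refl) simp
      also have "(\<Sum>i<L. act (?T (k - 1 - int i)) (md ?A (int i) v)) = (\<Sum>i<L. md ?F (k - 1 - int i) (md ?A (int i) v))"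
      proof (intro sum.cong refl)
        fix i
        show "act (?T (k - 1 - int i)) (md ?A (int i) v) = md ?F (k - 1 - int i) (md ?A (int i) v)"
          using elim(1) k M by (cases "i < M") (auto simp: act_right_lin)
      qed
      also have "(\<Sum>i<L. md ?A (- int i - 1) (md ?F (k + int i) v)) + (\<Sum>i<L. md ?F (k - 1 - int i) (md ?A (int i) v)) = md (NO ?A ?F) k v"
      proof (rule NO_eq[symmetric])
        show "\<forall>j\<ge>L. md ?F (k + int j) v = 0"
        proof (intro allI impI)
          fix j assume "L \<le> j"
          then have "M' \<le> nat (k - k0) + j" using elim(4) by simp
          then have "md ?F (k0 + int (nat (k - k0) + j)) v = 0" using M' by blast
          then show "md ?F (k + int j) v = 0" using k by (simp add: algebra_simps)
        qed
        show "\<forall>j\<ge>L. md ?A (int j) v = 0" using M elim(3) by simp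
      qed
      finally show "act (word_field_trunc L (l # w) k) v = md (Y.wd (l # w)) k v" by simp
    qed
  qed
qed

lemma trunc_mode_limit: "\<forall>\<^sub>F L in sequentially. act (trunc_mode p k L) v = md (Y.ev p) k v"
proof -
  have "\<forall>\<^sub>F L in sequentially. \<forall>w\<in>Poly_Mapping.keys p. \<forall>k'\<ge>k. act (word_field_trunc L w k') v = md (Y.wd w) k' v"
    by (intro eventually_ball_finite ballI word_trunc_limit) simp
  then show ?thesis
  proof eventually_elim
    case (elim L)
    have md_sum': "md (sum f A) k v = (\<Sum>a\<in>A. md (f a) k v)" for f :: "_ \<Rightarrow> 'v fld" and A
      by (induction A rule: infinite_finite_induct) simp_all
    show ?case using elim
      by (simp add: trunc_mode_def act_sum act_mult act_scal Y.ev_def lin_def md_sum' md_fsc)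
  qed
qed

text \<open>
Creation property: on a vacuum vector a field has no singular part, and its constant term recovers the state.
\<close>

lemma vacuum_word:
  assumes v: "\<And>X. X \<in> arcs 0 \<Longrightarrow> \<rho> (X, 0) v = 0"
  shows "(\<forall>k\<ge>0. md (Y.wd w) k v = 0) \<and>
    md (Y.wd w) (- 1) v = act (prod_list (map (\<lambda>(x, r). gen (loop x (- int r - 1), 0)) w)) v"
proof (induction w)
  case Nil
  then show ?case by (simp add: md_fone act_1)
next
  case (Cons l w)
  obtain x r where l: "l = (x, r)" by (cases l)
  let ?F = "Y.wd w" and ?A = "lfd l"
  have z: "md ((fder ^^ r) (lf x)) j v = 0" if "0 \<le> j" for j r
    using that
  proof (induction r arbitrary: j)
    case 0
    then show ?case using v loop_in_arcs[of 0 j x] by (simp add: md_lf xm_def)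
  next
    case (Suc r)
    then show ?case by (cases "j = 0") (simp_all add: md_fder)
  qed
  have A: "md ?A j v = 0" if "0 \<le> j" for j using z that by (simp add: lfd_def md_fsc l)
  have lead: "md ((fder ^^ r) (lf x)) (- int m - 1) u = sc (of_nat (fact (m + r) div fact m)) (xm x (- int (m + r) - 1) u)" for m r u
  proof (induction r arbitrary: m)
    case (Suc r)
    have "fact (Suc m + r) div fact m = Suc m * (fact (Suc m + r) div fact (Suc m) :: nat)"
    proof -
      have "fact (Suc m) dvd (fact (Suc m + r) :: nat)" by (rule fact_dvd) simp
      then obtain q where q: "fact (Suc m + r) = fact (Suc m) * (q :: nat)" by (rule dvdE)
      have "fact (Suc m + r) = fact m * (Suc m * q)" unfolding q by (simp add: algebra_simps)
      then have "fact (Suc m + r) div fact m = Suc m * q" by (metis nonzero_mult_div_cancel_left fact_nonzero)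
      moreover have "fact (Suc m + r) div fact (Suc m) = q" unfolding q by (metis nonzero_mult_div_cancel_left fact_nonzero)
      ultimately show ?thesis by simp
    qed
    moreover have "md ((fder ^^ Suc r) (lf x)) (- int m - 1) u = sc (of_nat (Suc m)) (md ((fder ^^ r) (lf x)) (- int (Suc m) - 1) u)"
      by (simp add: md_fder zmul_sc algebra_simps)
    ultimately show ?case unfolding Suc
      by (simp only: V.scale_scale of_nat_mult[symmetric] add_Suc add_Suc_right)
  qed (simp add: md_lf)
  have A1: "md ?A (- 1) u = xm x (- int r - 1) u" for u
    using lead[of r 0 u] by (simp add: lfd_def md_fsc l)
  have NO: "md (NO ?A ?F) k v = (\<Sum>j<1. md ?A (- int j - 1) (md ?F (k + int j) v))
     + (\<Sum>j<1. md ?F (k - 1 - int j) (md ?A (int j) v))" if "- 1 \<le> k" for k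
    by (rule NO_eq) (use Cons A that in auto)
  show ?case using NO Cons A
    by (auto simp: A1[unfolded l] l act_mult act_gen xm_def rho_lin_r)
qed

lemma vacuum_state:
  assumes v: "\<And>X. X \<in> arcs 0 \<Longrightarrow> \<rho> (X, 0) v = 0"
  shows "md (Y.ev p) (- 1) v = act (state_elem p) v"
proof -
  have md_sum': "md (sum f A) k v = (\<Sum>a\<in>A. md (f a) k v)" for f :: "_ \<Rightarrow> 'v fld" and A k
    by (induction A rule: infinite_finite_induct) simp_all
  show ?thesis
    using vacuum_word[OF v] by (simp add: Y.ev_def lin_def md_sum' md_fsc state_elem_def act_sum act_mult act_scal)
qed

lemma vacuum_trunc:
  assumes v: "\<And>X. X \<in> arcs 0 \<Longrightarrow> \<rho> (X, 0) v = 0" and "0 \<le> k"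
  shows "act (trunc_mode p k L) v = 0"
proof -
  have "0 \<le> k \<Longrightarrow> act (word_field_trunc L w k) v = 0" for w k
  proof (induction w arbitrary: k)
    case (Cons l w)
    have z: "md ((fder ^^ r) (lf x)) j v = 0" if "0 \<le> j" for j r x
      using that
    proof (induction r arbitrary: j)
      case 0
      then show ?case using v loop_in_arcs[of 0 j x] by (simp add: md_lf xm_def)
    next
      case (Suc r)
      then show ?case by (cases "j = 0") (simp_all add: md_fder)
    qed
    then have A: "md (lfd l) j v = 0" if "0 \<le> j" for j using that by (simp add: lfd_def md_fsc)
    have "act (word_field_trunc L (l # w) k) v = act (normal_trunc L (letter_field l) (word_field_trunc L w) k) v"
      by (simp add: word_field_trunc_def)
    also have "\<dots> = 0"
      unfolding normal_trunc_def act_add act_sum act_mult act_letter_field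
      using Cons A by (simp add: act_right_lin sum.neutral)
    finally show ?case .
  qed (simp add: word_field_trunc_def vacuum_field_def)
  then show ?thesis using assms(2) by (simp add: trunc_mode_def act_sum act_mult act_scal)
qed

end

section \<open>Orders of Laurent series\<close>

definition ordge :: "complex fls \<Rightarrow> int \<Rightarrow> bool" where "ordge f k \<longleftrightarrow> (\<forall>i<k. f $$ i = 0)"

lemma ordge_mult: "ordge f k \<Longrightarrow> ordge g l \<Longrightarrow> ordge (f * g) (k + l)"
proof (cases "f = 0 \<or> g = 0")
  case False
  assume "ordge f k" "ordge g l"
  then have "k \<le> fls_subdegree f" "l \<le> fls_subdegree g"
    using False by (auto simp: ordge_def intro!: fls_subdegree_geI)
  moreover have "fls_subdegree (f * g) = fls_subdegree f + fls_subdegree g"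
    using False by (intro fls_subdegree_mult) auto
  ultimately show ?thesis by (auto simp: ordge_def intro!: fls_eq0_below_subdegree)
qed (auto simp: ordge_def)

lemma ordge_add: "ordge f k \<Longrightarrow> ordge g k \<Longrightarrow> ordge (f + g) k" by (simp add: ordge_def)
lemma ordge_diff: "ordge f k \<Longrightarrow> ordge g k \<Longrightarrow> ordge (f - g) k" by (simp add: ordge_def)
lemma ordge_0 [simp]: "ordge 0 k" by (simp add: ordge_def)
lemma ordge_sum: "(\<And>a. a \<in> A \<Longrightarrow> ordge (f a) k) \<Longrightarrow> ordge (sum f A) k"
  by (induction A rule: infinite_finite_induct) (auto intro: ordge_add)
lemma ordge_deriv: "ordge f k \<Longrightarrow> ordge (fls_deriv f) (k - 1)" by (simp add: ordge_def)
lemma ordge_mono: "ordge f k \<Longrightarrow> l \<le> k \<Longrightarrow> ordge f l" by (simp add: ordge_def)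
lemma ordge_const: "ordge f k \<Longrightarrow> ordge (fls_const c * f) k" by (simp add: ordge_def)
lemma ordge_ex: "\<exists>k. ordge f (- int k)"
proof -
  have "ordge f (fls_subdegree f)" by (auto simp: ordge_def)
  then show ?thesis using ordge_mono[of f "fls_subdegree f"] by (intro exI[of _ "nat (- fls_subdegree f)"]) auto
qed

lemma arcs_ordge: "X \<in> arcs N \<longleftrightarrow> (\<forall>i j. ordge (X $ i $ j) (int N))" by (auto simp: arcs_def ordge_def)

text \<open>
A bracket with a fixed Laurent matrix shifts the filtration by a bounded amount.
\<close>

lemma arcs_bracket:
  fixes Y :: "complex fls^'n::finite^'n"
  obtains d where "\<And>M X. X \<in> arcs (M + d) \<Longrightarrow> X ** Y - Y ** X \<in> arcs M \<and> cocycle X Y = 0"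
proof -
  have "\<exists>k. \<forall>i j. ordge (Y $ i $ j) (- int k)"
  proof -
    have "\<forall>i j. \<exists>k. ordge (Y $ i $ j) (- int k)" using ordge_ex by blast
    then obtain k where k: "\<And>i j. ordge (Y $ i $ j) (- int (k i j))" by metis
    define K where "K = Max ((\<lambda>(i, j). k i j) ` UNIV)"
    have "k i j \<le> K" for i j unfolding K_def by (rule Max_ge) (auto intro: image_eqI[of _ _ "(i, j)"])
    then show ?thesis by (intro exI[of _ K] allI) (rule ordge_mono[OF k], simp)
  qed
  then obtain k where k: "\<And>i j. ordge (Y $ i $ j) (- int k)" by blast
  show ?thesis
  proof (rule that[of "Suc k"])
    fix M and X :: "complex fls^'n^'n"
    assume "X \<in> arcs (M + Suc k)"
    then have X: "ordge (X $ i $ j) (int M + int k + 1)" for i j by (simp add: arcs_ordge add_ac)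
    have "ordge (X $ i $ l * Y $ l' $ j) (int M)" "ordge (Y $ i $ l * X $ l' $ j) (int M)" for i j l l'
      using ordge_mult[OF X[of i l] k[of l' j]] ordge_mult[OF k[of i l] X[of l' j]] by (auto intro: ordge_mono)
    then have br: "X ** Y - Y ** X \<in> arcs M"
      by (auto simp: arcs_ordge matrix_matrix_mult_def intro!: ordge_diff ordge_sum)
    have dk: "ordge (deriv_K Y $ i $ j) (- int k - 1)" for i j
      using ordge_deriv[OF k] by (simp add: deriv_K_def)
    have p: "ordge (X $ i $ l * deriv_K Y $ l' $ j) 0" for i j l l'
      using ordge_mult[OF X[of i l] dk[of l' j]] by (auto intro: ordge_mono)
    have t1: "ordge (trace (X ** deriv_K Y)) 0"
      by (auto simp: trace_def matrix_matrix_mult_def intro!: ordge_sum p)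
    have t2: "ordge (trace X * trace (deriv_K Y)) 0"
      by (auto simp: trace_def sum_product intro!: ordge_sum p)
    have "ordge (killing_K X (deriv_K Y)) 0"
    proof -
      have "killing_K X (deriv_K Y) = fls_const (2 * of_nat CARD('n)) * trace (X ** deriv_K Y) - fls_const 2 * (trace X * trace (deriv_K Y))"
        by (simp add: killing_K_def fls_of_nat mult.assoc flip: fls_const_mult_const)
      then show ?thesis using ordge_diff[OF ordge_const[OF t1] ordge_const[OF t2]] by metis
    qed
    then have "cocycle X Y = 0" by (simp add: cocycle_def kappa_c_def ordge_def)
    with br show "X ** Y - Y ** X \<in> arcs M \<and> cocycle X Y = 0" by simp
  qed
qed

section \<open>Left ideals of the enveloping algebra\<close>

lemma U_ideal_left: "x \<in> U_ideal \<Longrightarrow> a * x \<in> U_ideal"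
proof (induction rule: U_ideal.induct)
  case (rel r b c)
  then show ?case using U_ideal.rel[of r "a * b" c] by (simp add: mult.assoc)
qed (auto intro: U_ideal.intros simp: distrib_left)

lemma left_ideal_left: "x \<in> left_ideal N \<Longrightarrow> a * x \<in> left_ideal N"
proof (induction rule: left_ideal.induct)
  case (arc X b)
  then show ?case using left_ideal.arc[of X N "a * b"] by (simp add: mult.assoc)
qed (auto intro: left_ideal.intros U_ideal_left simp: distrib_left)

lemma left_ideal_0 [simp]: "0 \<in> left_ideal N" by (intro left_ideal.base U_ideal.zero)
lemma left_ideal_add: "x \<in> left_ideal N \<Longrightarrow> y \<in> left_ideal N \<Longrightarrow> x + y \<in> left_ideal N" by (rule left_ideal.add)
lemma left_ideal_minus: "x \<in> left_ideal N \<Longrightarrow> - x \<in> left_ideal N" using left_ideal_left[of x N "- 1"] by simp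
lemma left_ideal_diff: "x \<in> left_ideal N \<Longrightarrow> y \<in> left_ideal N \<Longrightarrow> x - y \<in> left_ideal N"
  using left_ideal_add[of x N "- y"] left_ideal_minus[of y N] by simp
lemma left_ideal_rel: "r \<in> U_rels \<Longrightarrow> r * b \<in> left_ideal N"
  using left_ideal.base[OF U_ideal.rel[of r 1 b]] by simp

lemma left_ideal_antimono: "N \<le> M \<Longrightarrow> left_ideal M \<subseteq> left_ideal N"
proof
  fix x :: "'a ghat free_alg" assume "N \<le> M" "x \<in> left_ideal M"
  then show "x \<in> left_ideal N"
    by (induction rule: left_ideal.induct[consumes 1, OF \<open>x \<in> left_ideal M\<close>])
      (use arcs_antimono[OF \<open>N \<le> M\<close>] in \<open>auto intro: left_ideal.intros\<close>)
qed

text \<open>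
Left multiplication on \<open>U / U t\<^sup>N g[[t]]\<close> is smooth: moving an element of high order to the right past the letters of \<open>b\<close> lowers the order by a bounded amount.
\<close>

lemma gen_smooth:
  fixes b :: "'n::finite ghat free_alg"
  shows "\<exists>M. \<forall>X\<in>arcs M. gen (X, 0) * b \<in> left_ideal N"
proof (induction b rule: pm_induct)
  case zero
  then show ?case by simp
next
  case (single k c)
  obtain w where k: "k = Word w" by (cases k)
  have "\<exists>M. \<forall>X\<in>arcs M. gen (X, 0) * Poly_Mapping.single (Word w) c \<in> left_ideal N"
  proof (induction w)
    case Nil
    have eq: "gen (X, 0) * Poly_Mapping.single (Word []) c = Poly_Mapping.single (Word []) c * gen (X, 0)" for X :: "complex fls^'n^'n"
      by (simp add: gen_def mult_single plus_free_monoid_def)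
    show ?case
    proof (intro exI[of _ N] ballI)
      fix X :: "complex fls^'n^'n" assume "X \<in> arcs N"
      then show "gen (X, 0) * Poly_Mapping.single (Word []) c \<in> left_ideal N"
        unfolding eq by (rule left_ideal.arc)
    qed
  next
    case (Cons y w)
    then obtain M where M: "\<forall>X\<in>arcs M. gen (X, 0) * Poly_Mapping.single (Word w) c \<in> left_ideal N" by blast
    obtain Y e where y: "y = (Y, e)" by (cases y)
    obtain d where d: "\<And>M X. X \<in> arcs (M + d) \<Longrightarrow> X ** Y - Y ** X \<in> arcs M \<and> cocycle X Y = 0" using arcs_bracket[of Y] by metis
    let ?b = "Poly_Mapping.single (Word w) c"
    have cons: "Poly_Mapping.single (Word (y # w)) c = gen y * ?b"
      by (simp add: gen_def mult_single plus_free_monoid_def)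
    show ?case
    proof (intro exI[of _ "M + d"] ballI)
      fix X :: "complex fls^'n^'n" assume X: "X \<in> arcs (M + d)"
      have XM: "X \<in> arcs M" using X arcs_antimono[of M "M + d"] by auto
      have br: "ghat_bracket (X, 0) y = (X ** Y - Y ** X, 0)" using d[OF X] by (simp add: ghat_bracket_def y)
      have "gen (X, 0) * gen y - gen y * gen (X, 0) - gen (X ** Y - Y ** X, 0) \<in> U_rels"
        using U_rels.bracket[of "(X, 0)" y] br by simp
      then have r: "(gen (X, 0) * gen y - gen y * gen (X, 0) - gen (X ** Y - Y ** X, 0)) * ?b \<in> left_ideal N"
        by (rule left_ideal_rel)
      have "gen (X, 0) * (gen y * ?b) = (gen (X, 0) * gen y - gen y * gen (X, 0) - gen (X ** Y - Y ** X, 0)) * ?b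
         + gen y * (gen (X, 0) * ?b) + gen (X ** Y - Y ** X, 0) * ?b"
        by (simp add: left_diff_distrib mult.assoc)
      also have "\<dots> \<in> left_ideal N"
      proof -
        have "gen (X, 0) * ?b \<in> left_ideal N" "gen (X ** Y - Y ** X, 0) * ?b \<in> left_ideal N"
          using M XM d[OF X] by blast+
        then show ?thesis using left_ideal_add[OF left_ideal_add[OF r left_ideal_left]] by blast
      qed
      finally show "gen (X, 0) * Poly_Mapping.single (Word (y # w)) c \<in> left_ideal N" unfolding cons .
    qed
  qed
  then show ?case by (simp add: k)
next
  case (add p q)
  then obtain M1 M2 where "\<forall>X\<in>arcs M1. gen (X, 0) * p \<in> left_ideal N" "\<forall>X\<in>arcs M2. gen (X, 0) * q \<in> left_ideal N" by blast
  then show ?case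
    using arcs_antimono[of M1 "max M1 M2"] arcs_antimono[of M2 "max M1 M2"]
    by (intro exI[of _ "max M1 M2"]) (auto simp: distrib_left intro!: left_ideal_add)
qed

section \<open>The sum of the quotients of the enveloping algebra\<close>

text \<open>
A finitely supported sequence \<open>f\<close> represents the element \<open>(f N mod U t\<^sup>N g[[t]])\<^sub>N\<close> of the direct sum of all quotients. This sum is one smooth module on which
all quotients can be treated at once.
\<close>

definition lmul :: "'n ghat free_alg \<Rightarrow> (nat \<Rightarrow>\<^sub>0 'n::finite ghat free_alg) \<Rightarrow> (nat \<Rightarrow>\<^sub>0 'n ghat free_alg)" where
  "lmul a = Poly_Mapping.map ((*) a)"

lemma lookup_lmul: "Poly_Mapping.lookup (lmul a f) N = a * Poly_Mapping.lookup f N"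
  by (simp add: lmul_def Poly_Mapping.map.rep_eq when_def)

definition Uq_rel :: "(nat \<Rightarrow>\<^sub>0 'n::finite ghat free_alg) \<Rightarrow> (nat \<Rightarrow>\<^sub>0 'n ghat free_alg) \<Rightarrow> bool" where
  "Uq_rel f g \<longleftrightarrow> (\<forall>N. Poly_Mapping.lookup f N - Poly_Mapping.lookup g N \<in> left_ideal N)"

quotient_type (overloaded) 'n Uq = "nat \<Rightarrow>\<^sub>0 'n::finite ghat free_alg" / Uq_rel
proof (rule equivpI)
  show "reflp (Uq_rel :: (nat \<Rightarrow>\<^sub>0 'n ghat free_alg) \<Rightarrow> _)" by (rule reflpI) (simp add: Uq_rel_def)
  show "symp (Uq_rel :: (nat \<Rightarrow>\<^sub>0 'n ghat free_alg) \<Rightarrow> _)"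
    by (rule sympI) (metis Uq_rel_def left_ideal_minus minus_diff_eq)
  show "transp (Uq_rel :: (nat \<Rightarrow>\<^sub>0 'n ghat free_alg) \<Rightarrow> _)"
  proof (rule transpI)
    fix f g h :: "nat \<Rightarrow>\<^sub>0 'n ghat free_alg"
    assume fg: "Uq_rel f g" and gh: "Uq_rel g h"
    show "Uq_rel f h" unfolding Uq_rel_def
    proof
      fix N
      have "(Poly_Mapping.lookup f N - Poly_Mapping.lookup g N) + (Poly_Mapping.lookup g N - Poly_Mapping.lookup h N) \<in> left_ideal N"
        using fg gh by (auto simp only: Uq_rel_def intro: left_ideal_add)
      then show "Poly_Mapping.lookup f N - Poly_Mapping.lookup h N \<in> left_ideal N" by simp
    qed
  qed
qed

lemma abs_Uq_iff: "abs_Uq f = abs_Uq g \<longleftrightarrow> Uq_rel f g"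
  using Quotient3_rel[OF Quotient3_Uq, of f g] by (auto simp: Uq_rel_def)
lemma abs_Uq_ex: "\<exists>f. x = abs_Uq f" by (metis Quotient3_abs_rep[OF Quotient3_Uq])
lemma rep_abs_Uq: "Uq_rel (rep_Uq (abs_Uq f)) f"
  by (metis Quotient3_abs_rep[OF Quotient3_Uq] abs_Uq_iff)

instantiation Uq :: (finite) ab_group_add
begin
definition zero_Uq :: "'a Uq" where "zero_Uq = abs_Uq 0"
definition plus_Uq :: "'a Uq \<Rightarrow> 'a Uq \<Rightarrow> 'a Uq" where "plus_Uq x y = abs_Uq (rep_Uq x + rep_Uq y)"
definition uminus_Uq :: "'a Uq \<Rightarrow> 'a Uq" where "uminus_Uq x = abs_Uq (- rep_Uq x)"
definition minus_Uq :: "'a Uq \<Rightarrow> 'a Uq \<Rightarrow> 'a Uq" where "minus_Uq x y = abs_Uq (rep_Uq x - rep_Uq y)"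

lemma Uq_abs_ops:
  "abs_Uq f + abs_Uq g = (abs_Uq (f + g) :: 'a Uq)"
  "abs_Uq f - abs_Uq g = (abs_Uq (f - g) :: 'a Uq)"
  "- abs_Uq f = (abs_Uq (- f) :: 'a Uq)"
proof -
  have f: "Poly_Mapping.lookup (rep_Uq (abs_Uq f)) N - Poly_Mapping.lookup f N \<in> left_ideal N"
    and g: "Poly_Mapping.lookup (rep_Uq (abs_Uq g)) N - Poly_Mapping.lookup g N \<in> left_ideal N" for N
    using rep_abs_Uq[of f] rep_abs_Uq[of g] by (simp_all add: Uq_rel_def)
  have e: "a + b - (c + d) = (a - c) + (b - d)" "a - b - (c - d) = (a - c) - (b - d)" "- a - (- c) = - (a - c)"
    for a b c d :: "'a ghat free_alg" by simp_all
  show "abs_Uq f + abs_Uq g = abs_Uq (f + g)"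
    unfolding plus_Uq_def abs_Uq_iff Uq_rel_def lookup_add e using f g by (blast intro: left_ideal_add)
  show "abs_Uq f - abs_Uq g = abs_Uq (f - g)"
    unfolding minus_Uq_def abs_Uq_iff Uq_rel_def lookup_minus e using f g by (blast intro: left_ideal_diff)
  show "- abs_Uq f = abs_Uq (- f)"
    unfolding uminus_Uq_def abs_Uq_iff Uq_rel_def lookup_uminus e using f by (blast intro: left_ideal_minus)
qed

instance
proof
  fix a b c :: "'a Uq"
  obtain f g h where [simp]: "a = abs_Uq f" "b = abs_Uq g" "c = abs_Uq h" using abs_Uq_ex by metis
  show "a + b + c = a + (b + c)" by (simp add: Uq_abs_ops add.assoc)
  show "a + b = b + a" by (simp add: Uq_abs_ops add.commute)
  show "0 + a = a" by (simp add: Uq_abs_ops zero_Uq_def)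
  show "- a + a = 0" by (simp add: Uq_abs_ops zero_Uq_def)
  show "a - b = a + - b" by (simp add: Uq_abs_ops)
qed
end

definition umul :: "'n::finite ghat free_alg \<Rightarrow> 'n Uq \<Rightarrow> 'n Uq" where "umul a x = abs_Uq (lmul a (rep_Uq x))"

lemma umul_abs: "umul a (abs_Uq f) = abs_Uq (lmul a f)"
proof -
  have "a * Poly_Mapping.lookup (rep_Uq (abs_Uq f)) N - a * Poly_Mapping.lookup f N \<in> left_ideal N" for N
    using left_ideal_left[of "Poly_Mapping.lookup (rep_Uq (abs_Uq f)) N - Poly_Mapping.lookup f N" N a] rep_abs_Uq[of f]
    by (simp add: Uq_rel_def right_diff_distrib)
  then show ?thesis by (simp add: umul_def abs_Uq_iff Uq_rel_def lookup_lmul)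
qed

definition uin :: "nat \<Rightarrow> 'n::finite ghat free_alg \<Rightarrow> 'n Uq" where "uin N b = abs_Uq (Poly_Mapping.single N b)"

definition usc :: "complex \<Rightarrow> 'n::finite Uq \<Rightarrow> 'n Uq" where "usc c = umul (scal c)"
definition urho :: "'n::finite ghat \<Rightarrow> 'n Uq \<Rightarrow> 'n Uq" where "urho x = umul (gen x)"

lemma umul_simps:
  "umul a (x + y) = umul a x + umul a y" "umul (a + b) x = umul a x + umul b x"
  "umul (a * b) x = umul a (umul b x)" "umul 1 x = x" "umul (a - b) x = umul a x - umul b x"
proof -
  obtain f g where [simp]: "x = abs_Uq f" "y = abs_Uq g" using abs_Uq_ex by metis
  note d = umul_abs Uq_abs_ops abs_Uq_iff Uq_rel_def lookup_lmul lookup_add lookup_minus ring_distribs mult.assoc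
  show "umul a (x + y) = umul a x + umul a y" by (simp add: d)
  show "umul (a + b) x = umul a x + umul b x" by (simp add: d)
  show "umul (a * b) x = umul a (umul b x)" by (simp add: d)
  show "umul 1 x = x" by (simp add: d)
  show "umul (a - b) x = umul a x - umul b x" by (simp add: d)
qed

lemma umul_rel: "r \<in> U_rels \<Longrightarrow> umul r x = 0"
  using abs_Uq_ex[of x] by (auto simp: umul_abs zero_Uq_def abs_Uq_iff Uq_rel_def lookup_lmul left_ideal_rel)

lemma umul_uin: "umul a (uin N b) = uin N (a * b)"
  by (simp add: uin_def umul_abs abs_Uq_iff Uq_rel_def lookup_lmul lookup_single when_def)

lemma uin_0_iff: "uin N b = 0 \<longleftrightarrow> b \<in> left_ideal N"
  by (auto simp: uin_def zero_Uq_def abs_Uq_iff Uq_rel_def lookup_single when_def)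

lemma uin_diff: "uin N (a - b) = uin N a - uin N b"
  by (simp add: uin_def Uq_abs_ops abs_Uq_iff Uq_rel_def lookup_single when_def lookup_minus)

lemma uin_eq_iff: "uin N a = uin N b \<longleftrightarrow> a - b \<in> left_ideal N"
  by (metis uin_diff uin_0_iff eq_iff_diff_eq_0)

lemma scal_simps: "scal (c + d) = scal c + scal d" "scal (c * d) = scal c * scal d" "scal 1 = 1"
  by (simp_all add: scal_def single_add mult_single)

lemma scal_commute: "scal c * a = a * scal c"
  by (induction a rule: pm_induct)
    (simp_all add: scal_def mult_single plus_free_monoid_def zero_free_monoid_def distrib_left distrib_right mult.commute)

lemma ghat_module_Uq: "ghat_module usc (urho :: 'n::finite ghat \<Rightarrow> 'n Uq \<Rightarrow> 'n Uq)"
proof -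
  have vs: "vector_space (usc :: complex \<Rightarrow> 'n Uq \<Rightarrow> 'n Uq)"
    by standard (simp_all add: usc_def umul_simps scal_simps)
  have c: "umul (scal c) (umul a x) = umul a (umul (scal c) x)" for c a and x :: "'n Uq"
    by (metis umul_simps(3) scal_commute)
  have "Vector_Spaces.linear usc usc (urho x)" for x :: "'n ghat"
    unfolding Vector_Spaces.linear_iff by (simp add: vs urho_def umul_simps) (simp add: usc_def c)
  moreover have "urho (x + y) v = urho x v + urho y v" for x y :: "'n ghat" and v
    using umul_rel[OF U_rels.add[of x y], of v] by (simp add: umul_simps urho_def diff_diff_eq)
  moreover have "urho (ghat_scale d x) v = usc d (urho x v)" for d and x :: "'n ghat" and v
    using umul_rel[OF U_rels.scale[of d x], of v] by (simp add: umul_simps urho_def usc_def)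
  moreover have "urho (ghat_bracket x y) v = urho x (urho y v) - urho y (urho x v)" for x y :: "'n ghat" and v
    using umul_rel[OF U_rels.bracket[of x y], of v] by (simp add: umul_simps urho_def)
  moreover have "urho (0, 1) v = v" for v :: "'n Uq"
    using umul_rel[OF U_rels.level, of v] by (simp add: umul_simps urho_def)
  ultimately show ?thesis unfolding ghat_module_def using vs by blast
qed

lemma smooth_Uq: "smooth (urho :: 'n::finite ghat \<Rightarrow> 'n Uq \<Rightarrow> 'n Uq)"
  unfolding smooth_def
proof
  fix v :: "'n Uq"
  show "\<exists>N. \<forall>X\<in>arcs N. urho (X, 0) v = 0"
  proof -
    obtain f where v: "v = abs_Uq f" using abs_Uq_ex by metis
    have "\<forall>N. \<exists>M. \<forall>X\<in>arcs M. gen (X, 0) * Poly_Mapping.lookup f N \<in> left_ideal N" using gen_smooth by blast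
    then obtain M where M: "\<And>N X. X \<in> arcs (M N) \<Longrightarrow> gen (X, 0) * Poly_Mapping.lookup f N \<in> left_ideal N" by metis
    define K where "K = Max (insert 0 (M ` Poly_Mapping.keys f))"
    have K: "M N \<le> K" if "N \<in> Poly_Mapping.keys f" for N unfolding K_def using that by (intro Max_ge) auto
    show "\<exists>N. \<forall>X\<in>arcs N. urho (X, 0) v = 0"
    proof (intro exI[of _ K] ballI)
      fix X :: "complex fls^'n^'n" assume X: "X \<in> arcs K"
      have "gen (X, 0) * Poly_Mapping.lookup f N \<in> left_ideal N" for N
        using M K X arcs_antimono[of "M N" K]
        by (cases "N \<in> Poly_Mapping.keys f") (auto simp: not_in_keys_iff_lookup_eq_zero)
      then show "urho (X, 0) v = 0" by (simp add: urho_def v umul_abs zero_Uq_def abs_Uq_iff Uq_rel_def lookup_lmul)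
    qed
  qed
qed

interpretation UQ: smooth_rep usc "urho :: 'n::{finite,linorder} ghat \<Rightarrow> 'n Uq \<Rightarrow> 'n Uq"
  by standard (rule ghat_module_Uq, rule smooth_Uq)

lemma UQ_act: "UQ.act a x = umul a x"
proof (induction a rule: pm_induct)
  case zero
  have "umul 0 x = 0" using umul_simps(5)[of 0 0 x] by simp
  then show ?case by simp
next
  case (single k c)
  obtain w where k: "k = Word w" by (cases k)
  have "foldr urho w x = umul (Poly_Mapping.single (Word w) 1) x" for w
  proof (induction w)
    case Nil
    then show ?case by (simp add: umul_simps flip: zero_free_monoid_def)
  next
    case (Cons y w)
    have "Poly_Mapping.single (Word (y # w)) 1 = gen y * Poly_Mapping.single (Word w) 1"
      by (simp add: gen_def mult_single plus_free_monoid_def)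
    then show ?case by (simp only: foldr.simps o_apply Cons umul_simps(3) urho_def[of y])
  qed
  moreover have "Poly_Mapping.single (Word w) c = scal c * Poly_Mapping.single (Word w) 1"
    by (simp add: scal_def mult_single plus_free_monoid_def zero_free_monoid_def)
  ultimately show ?case unfolding k UQ.act_single by (simp add: usc_def umul_simps(3))
qed (simp add: UQ.act_add umul_simps)

lemma UQ_act_uin: "UQ.act a (uin N b) = uin N (a * b)"
  by (simp add: UQ_act umul_uin)

section \<open>Modes in the completed enveloping algebra\<close>

lemma state_mode_trunc: "state_mode p k N = {c. \<exists>L0. \<forall>L\<ge>L0. c - trunc_mode p k L \<in> left_ideal N}"
  by (simp add: state_mode_def Uhat_lim_def trunc_mode_def)

lemma coset_uin: "coset N a = {c. uin N c = uin N a}"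
proof -
  have "c \<in> coset N a \<longleftrightarrow> c - a \<in> left_ideal N" for c
    unfolding coset_def by (auto intro!: image_eqI[of _ _ "c - a"])
  then show ?thesis by (auto simp: uin_eq_iff)
qed

text \<open>
The component \<open>N\<close> of a mode is determined by its action on the generator of the quotient \<open>U / U t\<^sup>N g[[t]]\<close>.
\<close>

lemma state_mode_uin:
  fixes p :: "'n::{finite,linorder} state"
  shows "state_mode p k N = {c. uin N c = md (UQ.Y.ev p) k (uin N 1)}"
proof -
  obtain L0 where L0: "\<And>L. L0 \<le> L \<Longrightarrow> UQ.act (trunc_mode p k L) (uin N 1) = md (UQ.Y.ev p) k (uin N 1)"
    using UQ.trunc_mode_limit[of p k "uin N 1"] by (auto simp: eventually_sequentially)
  then have L: "uin N (trunc_mode p k L) = md (UQ.Y.ev p) k (uin N 1)" if "L0 \<le> L" for L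
    using that by (simp add: UQ_act_uin)
  show ?thesis
    unfolding state_mode_trunc uin_eq_iff[symmetric]
  proof (intro Collect_cong iffI)
    fix c assume "\<exists>L0. \<forall>L\<ge>L0. uin N c = uin N (trunc_mode p k L)"
    then obtain L1 where "\<forall>L\<ge>L1. uin N c = uin N (trunc_mode p k L)" by blast
    then have "uin N c = uin N (trunc_mode p k (max L0 L1))" by simp
    then show "uin N c = md (UQ.Y.ev p) k (uin N 1)" using L[of "max L0 L1"] by simp
  next
    fix c assume c: "uin N c = md (UQ.Y.ev p) k (uin N 1)"
    show "\<exists>L0. \<forall>L\<ge>L0. uin N c = uin N (trunc_mode p k L)"
      by (rule exI[of _ L0]) (simp add: L c)
  qed
qed

lemma state_mode_coset:
  fixes p :: "'n::{finite,linorder} state"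
  shows "\<exists>c. state_mode p k N = coset N c"
proof -
  obtain L where "UQ.act (trunc_mode p k L) (uin N 1) = md (UQ.Y.ev p) k (uin N 1)"
    using UQ.trunc_mode_limit[of p k "uin N 1"] by (auto simp: eventually_sequentially)
  then show ?thesis by (intro exI[of _ "trunc_mode p k L"]) (simp add: state_mode_uin coset_uin UQ_act_uin)
qed

lemma coset_nonempty: "coset N c \<noteq> {}" by (auto simp: coset_uin)

lemma Uhat_carrierD:
  assumes "u \<in> Uhat_carrier"
  shows "\<exists>c. u N = {b. uin N b = uin N c}" "N \<le> M \<Longrightarrow> u M \<subseteq> u N"
proof -
  from assms obtain c where "u N = coset N c" unfolding Uhat_carrier_def by blast
  then show "\<exists>c. u N = {b. uin N b = uin N c}" by (auto simp: coset_uin)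
  assume "N \<le> M"
  moreover have "\<And>N. u (Suc N) \<subseteq> u N" using assms by (simp add: Uhat_carrier_def)
  ultimately show "u M \<subseteq> u N" by (rule lift_Suc_antimono_le[rotated])
qed

lemma state_mode_carrier: "state_mode (p :: 'n::{finite,linorder} state) k \<in> Uhat_carrier"
  unfolding Uhat_carrier_def
proof (intro CollectI conjI allI)
  fix N
  show "state_mode p k N \<in> range (coset N)" using state_mode_coset[of p k N] by auto
  show "state_mode p k (Suc N) \<subseteq> state_mode p k N"
    unfolding state_mode_trunc using left_ideal_antimono[of N "Suc N"] by fastforce
qed

text \<open>
An element of a sufficiently deep coset acts on a given vector as the mode of the field does.
\<close>

lemma state_mode_act:
  fixes p :: "'n::{finite,linorder} state"
  shows "\<exists>M. \<forall>a\<in>state_mode p k M. uin N (a * b) = md (UQ.Y.ev p) k (uin N b)"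
proof -
  obtain M where M: "\<And>X. X \<in> arcs M \<Longrightarrow> urho (X, 0) (uin N b) = 0"
    using smooth_Uq unfolding smooth_def by blast
  have "uin N (a * b) = md (UQ.Y.ev p) k (uin N b)" if aM: "a \<in> state_mode p k M" for a
  proof -
    obtain L1 where L1: "\<forall>L\<ge>L1. a - trunc_mode p k L \<in> left_ideal M" using aM unfolding state_mode_trunc by blast
    obtain L2 where L2: "\<forall>L\<ge>L2. UQ.act (trunc_mode p k L) (uin N b) = md (UQ.Y.ev p) k (uin N b)"
      using UQ.trunc_mode_limit[of p k "uin N b"] by (auto simp: eventually_sequentially)
    define L where "L = max L1 L2"
    have "UQ.act (a - trunc_mode p k L) (uin N b) = 0"
      using UQ.act_left_ideal[of M "uin N b"] M L1 by (simp add: L_def)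
    then have "UQ.act a (uin N b) = UQ.act (trunc_mode p k L) (uin N b)" unfolding UQ.act_minus by simp
    then show ?thesis using L2 unfolding UQ_act_uin by (simp add: L_def)
  qed
  then show ?thesis by blast
qed

lemma md_act_comm:
  assumes "\<And>x v. md F k (urho x v) = urho x (md F k v)" "\<And>c v. md F k (usc c v) = usc c (md F k v)"
  shows "md F k (UQ.act a v) = UQ.act a (md F k v)"
proof (induction a rule: pm_induct)
  case (single w c)
  have "md F k (foldr urho w v) = foldr urho w (md F k v)" for w by (induction w) (simp_all add: assms)
  then show ?case by (simp add: UQ.act_single assms)
qed (simp_all add: UQ.act_add md_add)

text \<open>
Multiplication by the mode on either side is the action of the field \<open>S\<^sub>j\<close> on the quotients: on the left directly, and on the right after
commuting it past the other factor, which is possible because \<open>S\<^sub>j\<close> commutes with the affine algebra.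
\<close>

theorem sugawara_mode_central:
  "state_mode (sugawara_state j :: 'n::{finite,linorder} state) k \<in> Uhat_centre"
  unfolding Uhat_centre_def
proof (intro CollectI conjI ballI state_mode_carrier)
  let ?p = "sugawara_state j :: 'n state"
  let ?z = "state_mode ?p k"
  define F where "F = md (UQ.Y.ev ?p) k"
  have Fa: "F (UQ.act a v) = UQ.act a (F v)" for a v
    unfolding F_def UQ.Y_sugawara by (rule md_act_comm) (rule UQ.S_comm, rule UQ.S_sc)
  have z_dec: "?z M \<subseteq> ?z N" if "N \<le> M" for N M by (rule Uhat_carrierD(2)[OF state_mode_carrier that])
  have z_ne: "?z M \<noteq> {}" for M using state_mode_coset[of ?p k M] coset_nonempty by metis
  fix u :: "'n Uhat" assume u: "u \<in> Uhat_carrier"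
  have u_ne: "u M \<noteq> {}" for M using Uhat_carrierD(1)[OF u, of M] by auto
  show "Uhat_mult ?z u = Uhat_mult u ?z"
  proof
    fix N
    obtain b0 where b0: "u N = {b. uin N b = uin N b0}" using Uhat_carrierD(1)[OF u] by blast
    have "c \<in> Uhat_mult ?z u N \<longleftrightarrow> uin N c = F (uin N b0)" for c
    proof
      assume "c \<in> Uhat_mult ?z u N"
      then obtain b M where b: "b \<in> u N" and M: "\<forall>a\<in>?z M. uin N c = uin N (a * b)"
        by (auto simp: Uhat_mult_def uin_eq_iff)
      obtain M' where M': "\<forall>a\<in>?z M'. uin N (a * b) = F (uin N b)" unfolding F_def using state_mode_act by blast
      obtain a where "a \<in> ?z (max M M')" using z_ne by blast
      then have "a \<in> ?z M" "a \<in> ?z M'" using z_dec[of M "max M M'"] z_dec[of M' "max M M'"] by auto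
      then show "uin N c = F (uin N b0)" using M M' b b0 by auto
    next
      assume c: "uin N c = F (uin N b0)"
      obtain M where "\<forall>a\<in>?z M. uin N (a * b0) = F (uin N b0)" unfolding F_def using state_mode_act by blast
      with c have "\<forall>a\<in>?z M. c - a * b0 \<in> left_ideal N" by (simp add: uin_eq_iff[symmetric])
      then show "c \<in> Uhat_mult ?z u N" unfolding Uhat_mult_def using b0 by auto
    qed
    moreover have "c \<in> Uhat_mult u ?z N \<longleftrightarrow> uin N c = F (uin N b0)" for c
    proof -
      have key: "uin N (a * b) = F (uin N b0)" if "a \<in> u N" "b \<in> ?z N" for a b
      proof -
        have "uin N (a * b) = UQ.act a (uin N b)" by (simp add: UQ_act_uin)
        also have "uin N b = F (uin N 1)" using that(2) by (simp add: state_mode_uin F_def)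
        also have "UQ.act a (F (uin N 1)) = F (UQ.act a (uin N 1))" by (simp add: Fa)
        also have "\<dots> = F (uin N b0)" using that(1) b0 by (simp add: UQ_act_uin)
        finally show ?thesis .
      qed
      show ?thesis
      proof
        assume "c \<in> Uhat_mult u ?z N"
        then obtain b M where b: "b \<in> ?z N" and M: "\<forall>a\<in>u M. uin N c = uin N (a * b)"
          by (auto simp: Uhat_mult_def uin_eq_iff)
        obtain a where "a \<in> u (max M N)" using u_ne by blast
        then have "a \<in> u M" "a \<in> u N" using Uhat_carrierD(2)[OF u, of M "max M N"] Uhat_carrierD(2)[OF u, of N "max M N"] by auto
        then show "uin N c = F (uin N b0)" using M b key by auto
      next
        assume c: "uin N c = F (uin N b0)"
        obtain b where b: "b \<in> ?z N" using z_ne by blast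
        have "\<forall>a\<in>u N. c - a * b \<in> left_ideal N" using key b c by (simp add: uin_eq_iff[symmetric])
        then show "c \<in> Uhat_mult u ?z N" unfolding Uhat_mult_def using b by blast
      qed
    qed
    ultimately show "Uhat_mult ?z u N = Uhat_mult u ?z N" by blast
  qed
qed

text \<open>
The state is \<open>S\<^sub>j\<close> applied to the vacuum. Since \<open>S\<^sub>j\<close> commutes with the affine algebra, the state is again a vacuum vector, and the
modes of nonnegative index of every field kill vacuum vectors.
\<close>

theorem sugawara_va_centre: "vec_of (sugawara_state j :: 'n::{finite,linorder} state) \<in> va_centre"
  unfolding va_centre_def
proof (intro CollectI conjI allI impI)
  let ?p = "sugawara_state j :: 'n state"
  show "vec_of ?p \<in> range (coset 0)" by (simp add: vec_of_def)
  fix q :: "'n state" and k :: int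
  assume k: "0 \<le> k"
  have vac: "urho (X, 0) (uin 0 1) = 0" if "X \<in> arcs 0" for X :: "((complex fls, 'n) vec, 'n) vec"
    using left_ideal.arc[OF that, of 1] by (simp add: urho_def umul_uin uin_0_iff)
  define b0 where "b0 = state_elem ?p"
  have "uin 0 b0 = md (UQ.S j) (- 1) (uin 0 1)"
    using UQ.vacuum_state[OF vac, of ?p] by (simp add: UQ.Y_sugawara UQ_act_uin b0_def)
  then have b0: "urho (X, 0) (uin 0 b0) = 0" if "X \<in> arcs 0" for X :: "((complex fls, 'n) vec, 'n) vec"
    using vac[OF that] by (simp flip: UQ.S_comm)
  let ?z = "state_mode q k"
  have z_dec: "?z M \<subseteq> ?z N" if "N \<le> M" for N M by (rule Uhat_carrierD(2)[OF state_mode_carrier that])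
  have z_ne: "?z M \<noteq> {}" for M using state_mode_coset[of q k M] coset_nonempty by metis
  have kill: "uin 0 (a * b) = 0" if a: "a \<in> ?z 0" and b: "uin 0 b = uin 0 b0" for a b
  proof -
    obtain L where L: "a - trunc_mode q k L \<in> left_ideal 0" using a unfolding state_mode_trunc by blast
    have "UQ.act (a - trunc_mode q k L) (uin 0 b0) = 0" by (rule UQ.act_left_ideal[OF b0 L])
    moreover have "UQ.act (trunc_mode q k L) (uin 0 b0) = 0" by (rule UQ.vacuum_trunc[OF b0 k])
    ultimately have "UQ.act a (uin 0 b0) = 0" by (simp add: UQ.act_minus)
    then show ?thesis using b by (simp flip: UQ_act_uin)
  qed
  have "c \<in> Uhat_act_vac ?z (vec_of ?p) \<longleftrightarrow> uin 0 c = 0" for c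
  proof
    assume "c \<in> Uhat_act_vac ?z (vec_of ?p)"
    then obtain b M where b: "uin 0 b = uin 0 b0" and M: "\<forall>a\<in>?z M. uin 0 c = uin 0 (a * b)"
      by (auto simp: Uhat_act_vac_def vec_of_def coset_uin b0_def uin_eq_iff)
    obtain a where "a \<in> ?z M" using z_ne by blast
    moreover from this have "a \<in> ?z 0" using z_dec[of 0 M] by auto
    ultimately show "uin 0 c = 0" using M kill b by auto
  next
    assume c: "uin 0 c = 0"
    have "\<forall>a\<in>?z 0. c - a * b0 \<in> left_ideal 0" using kill c by (simp add: uin_eq_iff[symmetric])
    moreover have "b0 \<in> vec_of ?p" by (simp add: vec_of_def coset_uin b0_def)
    ultimately show "c \<in> Uhat_act_vac ?z (vec_of ?p)" unfolding Uhat_act_vac_def by blast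
  qed
  moreover have "uin 0 (0 :: 'n ghat free_alg) = 0" by (simp add: uin_0_iff)
  ultimately show "Uhat_act_vac ?z (vec_of ?p) = coset 0 0" by (auto simp: coset_uin)
qed

context smooth_rep
begin

theorem Uhat_act_sugawara: "Uhat_act sc \<rho> (state_mode (sugawara_state j) k) v = md (S j) k v"
  unfolding Uhat_act_def
proof (rule the_equality)
  let ?z = "state_mode (sugawara_state j :: 'n state) k"
  obtain M where M: "\<And>X. X \<in> arcs M \<Longrightarrow> \<rho> (X, 0) v = 0" using smooth unfolding smooth_def by blast
  have z: "act a v = md (S j) k v" if aM: "a \<in> ?z M" for a
  proof -
    obtain L1 where L1: "\<forall>L\<ge>L1. a - trunc_mode (sugawara_state j) k L \<in> left_ideal M" using aM unfolding state_mode_trunc by blast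
    obtain L2 where L2: "\<forall>L\<ge>L2. act (trunc_mode (sugawara_state j) k L) v = md (Y.ev (sugawara_state j)) k v"
      using trunc_mode_limit[of "sugawara_state j" k v] by (auto simp: eventually_sequentially)
    define L where "L = max L1 L2"
    have "act (a - trunc_mode (sugawara_state j) k L) v = 0"
      using act_left_ideal[of M v] M L1 by (simp add: L_def)
    then show ?thesis using L2 by (simp add: act_minus L_def Y_sugawara)
  qed
  then show "\<exists>N. \<forall>a\<in>?z N. act a v = md (S j) k v" by blast
  fix y assume "\<exists>N. \<forall>a\<in>?z N. act a v = y"
  then obtain N where N: "\<forall>a\<in>?z N. act a v = y" by blast
  have "?z (max M N) \<noteq> {}" using state_mode_coset[of "sugawara_state j :: 'n state" k "max M N"] coset_nonempty by metis
  then obtain a where "a \<in> ?z (max M N)" by blast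
  then have "a \<in> ?z M" "a \<in> ?z N"
    using subsetD[OF Uhat_carrierD(2)[OF state_mode_carrier max.cobounded1]]
      subsetD[OF Uhat_carrierD(2)[OF state_mode_carrier max.cobounded2]] by (blast, blast)
  then show "y = md (S j) k v" using z N by auto
qed

end

section \<open>Miura products\<close>

text \<open>
The coefficients in \<open>u\<close> of the product of the first-order operators \<open>e\<^sub>j + \<tau> + u\<close> applied to \<open>one\<close>. For the functions on \<open>h[[t]]\<close> it is the Miura
product, and for the diagonal letters it is the diagonal term of the column determinant.
\<close>

fun ddet :: "('n \<Rightarrow> 'b \<Rightarrow> 'b) \<Rightarrow> ('b \<Rightarrow> 'b) \<Rightarrow> 'b \<Rightarrow> 'n list \<Rightarrow> nat \<Rightarrow> 'b::ab_group_add" where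
  "ddet e \<tau> one [] = (\<lambda>i. if i = 0 then one else 0)"
| "ddet e \<tau> one (j # l) = (\<lambda>i. e j (ddet e \<tau> one l i) + (\<tau> (ddet e \<tau> one l i)
      + (if i = 0 then 0 else ddet e \<tau> one l (i - 1))))"

lemma ddet_map:
  assumes "\<And>x y. H (x + y) = H x + H y" "\<And>j x. H (e j x) = e' j (H x)" "\<And>x. H (\<tau> x) = \<tau>' (H x)" "H one = one'"
  shows "H (ddet e \<tau> one l i) = ddet e' \<tau>' one' l i"
proof -
  have "H 0 = 0" using assms(1)[of 0 0] by simp
  then show ?thesis by (induction l arbitrary: i) (simp_all add: assms)
qed

definition miura_cartan :: "nat \<Rightarrow> 'n::{finite,linorder} cartan" where
  "miura_cartan j = ddet (\<lambda>i. pre (i, 0)) tstate (Poly_Mapping.single [] 1) (sorted_list_of_set UNIV) (CARD('n) - j)"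

lemma psc_zero [simp]: "psc c 0 = 0" by (rule poly_mapping_eqI) (simp add: lookup_psc)
lemma pre_zero [simp]: "pre l 0 = 0" by (simp add: pre_def)
lemma tstate_zero [simp]: "tstate 0 = 0" by (simp add: tstate_def)
lemma pre_psc: "pre l (psc c q) = psc c (pre l q)"
  by (induction q rule: pm_induct) (simp_all add: psc_single pre_single psc_right pre_add)

lemma tstate_pre: "tstate (pre (a, r) p) = psc (of_nat (Suc r)) (pre (a, Suc r) p) + pre (a, r) (tstate p)"
proof (induction p rule: pm_induct)
  case zero
  then show ?case by simp
next
  case (single w c)
  then show ?case
    by (simp add: pre_single tstate_single psc_right psc_single pre_psc mult.commute del: of_nat_Suc)
next
  case (add p q)
  then show ?case by (simp add: pre_add tstate_add psc_right algebra_simps)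
qed

text \<open>
States over the Cartan subalgebra inside all states.
\<close>

interpretation emb: word_rep psc "\<lambda>(i :: 'n::finite, k). pre (diag_unit i, k)" tstate "Poly_Mapping.single [] 1"
proof
  fix c d :: complex and x y :: "'n state" and l :: "'n \<times> nat" and a :: 'n and r :: nat
  show "psc (c + d) x = psc c x + psc d x" by (rule psc_left)
  show "psc c (x + y) = psc c x + psc c y" by (rule psc_right)
  show "psc c (psc d x) = psc (c * d) x" by (rule poly_mapping_eqI) (simp add: lookup_psc)
  show "psc 1 x = x" by (rule poly_mapping_eqI) (simp add: lookup_psc)
  obtain i k where l: "l = (i, k)" by (cases l)
  show "(case l of (i, k) \<Rightarrow> pre (diag_unit i, k)) (x + y) = (case l of (i, k) \<Rightarrow> pre (diag_unit i, k)) x + (case l of (i, k) \<Rightarrow> pre (diag_unit i, k)) y"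
    by (simp add: l pre_add)
  show "(case l of (i, k) \<Rightarrow> pre (diag_unit i, k)) (psc c x) = psc c ((case l of (i, k) \<Rightarrow> pre (diag_unit i, k)) x)"
    by (simp add: l pre_psc)
  show "tstate (x + y) = tstate x + tstate y" by (rule tstate_add)
  show "tstate (psc c x) = psc c (tstate x)"
  proof (induction x rule: pm_induct)
    case zero then show ?case by simp
  next
    case (single w d)
    have "psc c (psc d q) = psc (c * d) q" for q :: "'n state" by (rule poly_mapping_eqI) (simp add: lookup_psc)
    then show ?case by (simp add: psc_single tstate_single)
  qed (simp_all add: psc_right tstate_add)
  show "tstate (Poly_Mapping.single [] 1) = (0 :: 'n state)" by (simp add: tstate_single)
  show "tstate ((case (a, r) of (i, k) \<Rightarrow> pre (diag_unit i, k)) x)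
    = psc (of_nat (Suc r)) ((case (a, Suc r) of (i, k) \<Rightarrow> pre (diag_unit i, k)) x) + (case (a, r) of (i, k) \<Rightarrow> pre (diag_unit i, k)) (tstate x)"
    by (simp only: prod.case tstate_pre)
qed

definition word_elem :: "((complex^'n::finite^'n) \<times> nat) list \<Rightarrow> 'n ghat free_alg" where
  "word_elem w = prod_list (map (\<lambda>(x, r). gen (loop x (- int r - 1), 0)) w)"

lemma state_elem_lin: "state_elem = lin (\<lambda>c x. scal c * x) word_elem"
  by (rule ext) (simp add: state_elem_def lin_def word_elem_def)
lemma state_elem_add: "state_elem (p + q) = state_elem p + state_elem q"
  unfolding state_elem_lin by (rule lin_add) (simp add: scal_simps distrib_right)
lemma state_elem_single: "state_elem (Poly_Mapping.single w c) = scal c * word_elem w"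
  unfolding state_elem_lin by (rule lin_single) (simp add: scal_simps distrib_right)

lemma diag_unit_munit: "diag_unit i = munit i i" by (simp add: diag_unit_def munit_def)

lemma cartan_elem_emb: "cartan_elem s = state_elem (emb.ev s)"
proof -
  have w: "emb.wd w = Poly_Mapping.single (map (\<lambda>(i, k). (diag_unit i, k)) w) 1" for w :: "('a \<times> nat) list"
    by (induction w) (auto simp: pre_single)
  have c: "cartan_elem s = lin (\<lambda>c x. scal c * x) (\<lambda>w. word_elem (map (\<lambda>(i, k). (diag_unit i, k)) w)) s"
    by (simp add: cartan_elem_def lin_def word_elem_def comp_def split_def)
  show ?thesis unfolding c emb.ev_def
    by (rule lin_map[symmetric]) (simp_all add: psc_left scal_simps distrib_right state_elem_add w psc_single state_elem_single)
qed

section \<open>The kernel of the Harish-Chandra projection\<close>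

lemma U_minus_closed: "u \<in> U_minus \<Longrightarrow> v \<in> U_minus \<Longrightarrow> u * v \<in> U_minus" "u \<in> U_minus \<Longrightarrow> - u \<in> U_minus"
  "scal c \<in> U_minus" "X \<in> g_minus \<Longrightarrow> gen (X, 0) \<in> U_minus"
proof -
  assume "u \<in> U_minus" "v \<in> U_minus"
  then show "u * v \<in> U_minus" using keys_mult[of u v] by (force simp: U_minus_def plus_free_monoid_def)
next
  have "Poly_Mapping.keys (- u) = Poly_Mapping.keys u" by (auto simp: in_keys_iff)
  then show "u \<in> U_minus \<Longrightarrow> - u \<in> U_minus" by (simp add: U_minus_def)
qed (auto simp: U_minus_def scal_def gen_def zero_free_monoid_def)

lemma loop_g_minus: "loop x (- int r - 1) \<in> g_minus"
  by (auto simp: g_minus_def loop_lmon lmon_nth)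

lemma word_elem_U_minus: "word_elem w \<in> U_minus"
proof (induction w)
  case Nil
  have "1 \<in> (U_minus :: 'a ghat free_alg set)" using U_minus_closed(3)[of 1] by (simp add: scal_simps)
  then show ?case by (simp add: word_elem_def)
next
  case (Cons l w)
  then show ?case by (cases l) (auto simp: word_elem_def intro!: U_minus_closed loop_g_minus)
qed

text \<open>
Words in which some diagonal letters with index below \<open>c\<close> precede a letter below the diagonal in the column \<open>c\<close>. The strictly lower
triangular letter commutes with diagonal letters of other indices up to lower triangular ones, and can be moved to the front.
\<close>

inductive lower_word :: "'n::{finite,linorder} \<Rightarrow> ('n cmat \<times> nat) list \<Rightarrow> bool" for c where
  head: "c < a \<Longrightarrow> lower_word c ((munit a c, r) # w)"
| cons: "l < c \<Longrightarrow> lower_word c w \<Longrightarrow> lower_word c ((munit l l, s) # w)"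

lemma gen_0_U_ideal: "gen (0 :: 'n::finite ghat) \<in> U_ideal"
proof -
  have "ghat_scale 0 (0, 0) = (0 :: 'n ghat)" by (simp add: ghat_scale_def vec_eq_iff zero_prod_def)
  then have "gen (0 :: 'n ghat) \<in> U_rels" using U_rels.scale[of 0 "(0, 0) :: 'n ghat"] by (simp add: scal_def)
  then show "gen (0 :: 'n ghat) \<in> U_ideal" using U_ideal.rel[of _ 1 1] by fastforce
qed

text \<open>
A diagonal letter \<open>E\<^sub>l\<^sub>l\<close> with \<open>l < c < a\<close> commutes with \<open>E\<^sub>a\<^sub>c\<close>, so the lower triangular letter moves to the front unchanged.
\<close>

lemma lower_word_elem:
  "lower_word c w \<Longrightarrow> \<exists>a r u x. c < a \<and> word_elem w = gen (loop (munit a c) (- int r - 1), 0) * u + x \<and> u \<in> U_minus \<and> x \<in> U_ideal"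
proof (induction rule: lower_word.induct)
  case (head a r w)
  then show ?case
    by (intro exI[of _ a] exI[of _ r] exI[of _ "word_elem w"] exI[of _ 0])
      (auto simp: word_elem_def[of "_ # _"] U_ideal.zero word_elem_U_minus simp flip: word_elem_def)
next
  case (cons l w s)
  then obtain a r u x where IH: "c < a" "word_elem w = gen (loop (munit a c) (- int r - 1), 0) * u + x" "u \<in> U_minus" "x \<in> U_ideal" by blast
  let ?D = "gen (loop (munit l l) (- int s - 1), 0) :: 'a ghat free_alg" and ?Y = "gen (loop (munit a c) (- int r - 1), 0)"
  have "ghat_bracket (loop (munit l l) (- int s - 1), 0) (loop (munit a c) (- int r - 1), 0) = (0 :: 'a ghat)"
    using IH(1) cons(1) by (auto simp: ghat_bracket_def loop_mult munit_mult cocycle_loop zero_prod_def)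
  then have rel: "?D * ?Y - ?Y * ?D - gen 0 \<in> U_rels" using U_rels.bracket by metis
  have "?D * ?Y - ?Y * ?D = 1 * (?D * ?Y - ?Y * ?D - gen 0) * 1 + gen 0" by simp
  also have "\<dots> \<in> U_ideal" by (intro U_ideal.add U_ideal.rel rel gen_0_U_ideal)
  finally have com: "?D * ?Y - ?Y * ?D \<in> U_ideal" .
  have right: "y * z \<in> U_ideal" if "y \<in> U_ideal" for y z :: "'a ghat free_alg"
    using that
  proof (induction rule: U_ideal.induct)
    case (rel r a b)
    then show ?case using U_ideal.rel[of r a "b * z"] by (simp add: mult.assoc)
  qed (auto simp: distrib_right intro: U_ideal.intros)
  have "word_elem ((munit l l, s) # w) = ?D * (?Y * u + x)" using IH(2) by (simp add: word_elem_def)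
  also have "\<dots> = ?Y * (?D * u) + ((?D * ?Y - ?Y * ?D) * u + ?D * x)"
    by (simp add: distrib_left left_diff_distrib mult.assoc)
  finally have eq: "word_elem ((munit l l, s) # w) = ?Y * (?D * u) + ((?D * ?Y - ?Y * ?D) * u + ?D * x)" .
  have m1: "?D * u \<in> U_minus" using IH(3) by (intro U_minus_closed loop_g_minus)
  have m2: "(?D * ?Y - ?Y * ?D) * u + ?D * x \<in> U_ideal"
    by (rule U_ideal.add[OF right[OF com] U_ideal_left[OF IH(4)]])
  show ?case by (intro exI conjI) (rule IH(1), rule eq, rule m1, rule m2)
qed

lemma lower_word_hc: "lower_word c w \<Longrightarrow> scal d * word_elem w \<in> hc_kernel"
proof -
  assume "lower_word c w"
  then obtain a r u x where h: "c < a" "word_elem w = gen (loop (munit a c) (- int r - 1), 0) * u + x" "u \<in> U_minus" "x \<in> U_ideal"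
    using lower_word_elem by blast
  have Y: "loop (munit a c) (- int r - 1) \<in> n_minus_minus"
    using h(1) by (auto simp: n_minus_minus_def loop_g_minus loop_lmon munit_def)
  have c: "scal d * (gen (loop (munit a c) (- int r - 1), 0) * u) = gen (loop (munit a c) (- int r - 1), 0) * (scal d * u)"
    by (simp only: mult.assoc[symmetric] scal_commute[of d "gen (loop (munit a c) (- int r - 1), 0)"])
  show ?thesis
    unfolding h(2) distrib_left c
    by (rule hc_kernel.add[OF hc_kernel.left[OF Y U_minus_closed(1)[OF U_minus_closed(3) h(3)]] hc_kernel.base[OF U_ideal_left[OF h(4)]]])
qed

definition lower_states :: "'n::{finite,linorder} \<Rightarrow> 'n state set" where
  "lower_states c = {p. \<forall>w\<in>Poly_Mapping.keys p. lower_word c w}"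

lemma lower_add: "p \<in> lower_states c \<Longrightarrow> q \<in> lower_states c \<Longrightarrow> p + q \<in> lower_states c"
  using keys_add[of p q] by (auto simp: lower_states_def)
lemma lower_0 [simp]: "0 \<in> lower_states c" by (simp add: lower_states_def)
lemma lower_minus: "p \<in> lower_states c \<Longrightarrow> - p \<in> lower_states c"
proof -
  have "Poly_Mapping.keys (- p) = Poly_Mapping.keys p" by (auto simp: in_keys_iff)
  then show "p \<in> lower_states c \<Longrightarrow> - p \<in> lower_states c" by (simp add: lower_states_def)
qed
lemma lower_diff: "p \<in> lower_states c \<Longrightarrow> q \<in> lower_states c \<Longrightarrow> p - q \<in> lower_states c"
  using lower_add[of p c "- q"] lower_minus[of q c] by simp
lemma lower_sum: "(\<And>i. i \<in> A \<Longrightarrow> f i \<in> lower_states c) \<Longrightarrow> sum f A \<in> lower_states c"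
  by (induction A rule: infinite_finite_induct) (auto intro: lower_add)
lemma lower_single: "lower_word c w \<Longrightarrow> Poly_Mapping.single w d \<in> lower_states c" by (simp add: lower_states_def)

lemma pre_lin: "pre l p = (\<Sum>w\<in>Poly_Mapping.keys p. Poly_Mapping.single (l # w) (Poly_Mapping.lookup p w))"
  by (simp add: pre_def lin_def)

lemma lower_pre_head: "c < a \<Longrightarrow> pre (munit a c, r) p \<in> lower_states c"
  unfolding pre_lin by (intro lower_sum lower_single lower_word.head)
lemma lower_pre: "l < c \<Longrightarrow> p \<in> lower_states c \<Longrightarrow> pre (munit l l, r) p \<in> lower_states c"
  unfolding pre_lin by (intro lower_sum lower_single lower_word.cons) (auto simp: lower_states_def)

lemma lower_tstate: "p \<in> lower_states c \<Longrightarrow> tstate p \<in> lower_states c"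
proof -
  have t: "lower_word c w \<Longrightarrow> tword w \<in> lower_states c" for w
  proof (induction rule: lower_word.induct)
    case (head a r w)
    then show ?case by (auto intro!: lower_add lower_single lower_pre_head lower_word.head simp del: of_nat_Suc)
  next
    case (cons l w s)
    then show ?case by (auto intro!: lower_add lower_single lower_pre lower_word.cons simp del: of_nat_Suc)
  qed
  have pc: "psc d q \<in> lower_states c" if "q \<in> lower_states c" for d q
    using that by (auto simp: lower_states_def in_keys_iff lookup_psc)
  assume p: "p \<in> lower_states c"
  show "tstate p \<in> lower_states c"
    unfolding tstate_def lin_def
    by (rule lower_sum, rule pc, rule t) (use p in \<open>simp add: lower_states_def\<close>)
qed

lemma lower_hc: "p \<in> lower_states c \<Longrightarrow> state_elem p \<in> hc_kernel"
proof -
  have s: "sum f A \<in> hc_kernel" if "\<And>i. i \<in> A \<Longrightarrow> f i \<in> hc_kernel" for f and A :: "'b set"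
    using that by (induction A rule: infinite_finite_induct) (auto intro: hc_kernel.add hc_kernel.base U_ideal.zero)
  assume "p \<in> lower_states c"
  then show ?thesis unfolding state_elem_lin lin_def by (intro s) (auto simp: lower_states_def lower_word_hc)
qed

section \<open>The Harish-Chandra image\<close>

text \<open>
The diagonal part of one factor of the column determinant.
\<close>

definition gdiag :: "'n::{finite,linorder} \<Rightarrow> ('n, 'n state) grass \<Rightarrow> ('n, 'n state) grass" where
  "gdiag j g = gpsi j (gL est tstate j j g)"

lemma est_add: "est a b (p + q) = est a b p + est a b q" by (simp add: est_def pre_add)
lemma is_add_gdiag: "gdiag j (g + h) = gdiag j g + gdiag j h"
proof -
  have "gL est tstate j j (g + h) = gL est tstate j j g + gL est tstate j j h"
    by (auto simp: fun_eq_iff gL_def glift_def gshift_def est_add tstate_add algebra_simps)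
  then show ?thesis by (simp add: gdiag_def is_addD[OF is_add_g(1)])
qed
lemma is_add_gdiags: "foldr gdiag xs (g + h) = foldr gdiag xs g + foldr gdiag xs h"
  by (induction xs) (simp_all only: foldr.simps o_apply id_apply is_add_gdiag)
lemmas gdiags_lin = additive_diff_zero[of "foldr gdiag xs" for xs, OF is_add_gdiags] additive_sum[of "foldr gdiag xs" for xs, OF is_add_gdiags]

lemma gdiag_supp:
  assumes "\<And>S i. a \<notin> S \<Longrightarrow> h S i = 0"
  shows "(\<And>S i. a \<notin> S \<Longrightarrow> gdiag j h S i = 0)" "gdiag a h = 0"
proof -
  have z: "est a b 0 = 0" "tstate 0 = 0" for a b :: 'a by (simp_all add: est_def pre_def tstate_def)
  have L: "gL est tstate j j h S i = 0" if "a \<notin> S" for S i j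
    using assms[OF that] by (simp add: gL_def glift_def gshift_def z)
  show "gdiag j h S i = 0" if "a \<notin> S" for S i using that L by (simp add: gdiag_def gpsi_def)
  show "gdiag a h = 0" using L by (auto simp: fun_eq_iff gdiag_def gpsi_def)
qed

text \<open>
A repeated Grassmann variable kills the term. This excludes the letters above the diagonal: their row is already taken by a preceding diagonal factor.
\<close>

lemma gdiags_repeat:
  assumes "\<And>S i. a \<notin> S \<Longrightarrow> h S i = 0" "a \<in> set xs"
  shows "foldr gdiag xs h = 0"
  using assms(2)
proof (induction xs)
  case (Cons j xs)
  have z: "foldr gdiag ys 0 = 0" for ys by (rule gdiags_lin(1))
  have sup: "a \<notin> S \<Longrightarrow> foldr gdiag ys h S i = 0" for ys S i
  proof (induction ys arbitrary: S i)
    case Nil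
    then show ?case using assms(1) by simp
  next
    case (Cons b ys)
    have "gdiag b (foldr gdiag ys h) S i = 0" by (rule gdiag_supp(1)[OF _ Cons(2)]) (rule Cons(1))
    then show ?case by simp
  qed
  show ?case
  proof (cases "a \<in> set xs")
    case True
    then have "foldr gdiag xs h = 0" by (rule Cons(1))
    then show ?thesis using z[of "[j]"] by (simp only: foldr.simps o_apply id_apply)
  next
    case False
    with Cons have "j = a" by simp
    then show ?thesis using gdiag_supp(2)[of a "foldr gdiag xs h"] sup by simp
  qed
qed simp

lemma gdiags_lower:
  assumes "\<And>S i. h S i \<in> lower_states c" "\<And>j. j \<in> set xs \<Longrightarrow> j < c"
  shows "foldr gdiag xs h S i \<in> lower_states c"
  using assms(2)
proof (induction xs arbitrary: S i)
  case (Cons j xs)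
  define g where "g = foldr gdiag xs h"
  have g: "g S i \<in> lower_states c" for S i unfolding g_def using Cons by simp
  have "gdiag j g S i \<in> lower_states c"
    using Cons(2)[of j] by (auto simp: gdiag_def gpsi_def sgn_at_def gL_def glift_def gshift_def est_def
       intro!: lower_minus lower_diff lower_add lower_pre lower_tstate g)
  then show ?case by (simp add: g_def)
qed (simp add: assms)

text \<open>
Behind the diagonal factors of all columns before \<open>c\<close>, the entries of column \<open>c\<close> in the rows above the diagonal vanish by repetition of a Grassmann variable, and those
below the diagonal give lower words. Only the diagonal entry survives.
\<close>

lemma gxi_diag:
  assumes "\<And>j. j \<in> set xs \<longleftrightarrow> j < c"
  shows "(foldr gdiag xs (gxi est tstate c g) - foldr gdiag xs (gdiag c g)) S i \<in> lower_states c"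
proof -
  let ?t = "\<lambda>a. foldr gdiag xs (gpsi a (gL est tstate a c g))"
  have ap: "(\<Sum>a\<in>A. (f a :: ('a, 'a state) grass)) B i = (\<Sum>a\<in>A. f a B i)" for f and A :: "'a set" and B i
    by (induction A rule: infinite_finite_induct) auto
  have "gxi est tstate c g = gdiag c g + (\<Sum>a\<in>UNIV - {c}. gpsi a (gL est tstate a c g))"
    unfolding gxi_def gdiag_def by (subst sum.remove[of UNIV c]) auto
  then have "foldr gdiag xs (gxi est tstate c g) - foldr gdiag xs (gdiag c g) = (\<Sum>a\<in>UNIV - {c}. ?t a)"
    by (simp add: is_add_gdiags gdiags_lin)
  then have eq: "(foldr gdiag xs (gxi est tstate c g) - foldr gdiag xs (gdiag c g)) S i = (\<Sum>a\<in>UNIV - {c}. ?t a S i)"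
    by (simp add: ap)
  have mem: "?t a S i \<in> lower_states c" if "a \<in> UNIV - {c}" for a
  proof (cases "a < c")
    case True
    have "?t a = 0" by (rule gdiags_repeat[of a]) (use True assms in \<open>auto simp: gpsi_def\<close>)
    then show ?thesis by simp
  next
    case False
    with that have "c < a" by auto
    then show ?thesis
      by (intro gdiags_lower) (use assms in \<open>auto simp: gpsi_def sgn_at_def gL_def glift_def est_def intro!: lower_minus lower_pre_head\<close>)
  qed
  show ?thesis unfolding eq by (rule lower_sum) (rule mem)
qed

text \<open>
The columns are replaced by their diagonal parts from left to right.
\<close>

lemma gdet_triangular:
  assumes "sorted l" "distinct l" "set l = UNIV" "l = xs @ ys"
  shows "state_elem ((foldr gdiag xs (foldr (gxi est tstate) ys g) - foldr gdiag l g) S i) \<in> hc_kernel"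
  using assms(4)
proof (induction ys arbitrary: xs)
  case Nil
  then show ?case by (simp add: state_elem_def hc_kernel.base U_ideal.zero)
next
  case (Cons c ys)
  let ?h = "foldr (gxi est tstate) ys g"
  have iff: "j \<in> set xs \<longleftrightarrow> j < c" for j
  proof -
    have "j \<in> set xs \<union> {c} \<union> set ys" using assms(3) Cons(2) by auto
    moreover have "\<forall>x\<in>set xs. x \<le> c" "\<forall>y\<in>set ys. c \<le> y" "c \<notin> set xs" "set xs \<inter> set ys = {}"
      using assms(1,2) Cons(2) by (auto simp: sorted_append)
    ultimately show ?thesis by (cases "j = c") (auto simp: not_less order.order_iff_strict dest: leD)
  qed
  have 1: "state_elem ((foldr gdiag xs (gxi est tstate c ?h) - foldr gdiag xs (gdiag c ?h)) S i) \<in> hc_kernel"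
    by (rule lower_hc[OF gxi_diag]) (rule iff)
  have 2: "state_elem ((foldr gdiag xs (gdiag c ?h) - foldr gdiag l g) S i) \<in> hc_kernel"
    using Cons(1)[of "xs @ [c]"] Cons(2) by simp
  have e: "(foldr gdiag xs (foldr (gxi est tstate) (c # ys) g) - foldr gdiag l g) S i
    = (foldr gdiag xs (gxi est tstate c ?h) - foldr gdiag xs (gdiag c ?h)) S i + (foldr gdiag xs (gdiag c ?h) - foldr gdiag l g) S i"
    by simp
  show ?case unfolding e state_elem_add by (rule hc_kernel.add[OF 1 2])
qed

lemma gdiags_ddet:
  assumes "sorted l" "distinct l"
  shows "foldr gdiag l (gone (Poly_Mapping.single [] 1)) (set l) i = ddet (\<lambda>i. est i i) tstate (Poly_Mapping.single [] 1) l i"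
  using assms
proof (induction l arbitrary: i)
  case (Cons j l)
  define g where "g = foldr gdiag l (gone (Poly_Mapping.single [] 1))"
  have g: "g (set l) i = ddet (\<lambda>i. est i i) tstate (Poly_Mapping.single [] 1) l i" for i
    unfolding g_def using Cons by simp
  have c: "{k \<in> insert j (set l). k < j} = {}" using Cons(2) by auto
  have s: "sgn_at j (insert j (set l)) x = x" for x :: "'a state" unfolding sgn_at_def c by simp
  have "gdiag j g (set (j # l)) i = gL est tstate j j g (set l) i"
    using Cons(3) by (simp add: gdiag_def gpsi_def s)
  then show ?case by (simp add: g_def[symmetric] gL_def glift_def gshift_def g)
qed (simp add: gone_def)

text \<open>
Modulo the kernel of the projection the column determinant is the product of its diagonal entries.
\<close>

theorem sugawara_harish_chandra: "harish_chandra (sugawara_state j :: 'n::{finite,linorder} state) (miura_cartan j)"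
proof -
  let ?l = "sorted_list_of_set (UNIV :: 'n set)" and ?g = "gone (Poly_Mapping.single [] 1) :: ('n, 'n state) grass"
  have "emb.ev (miura_cartan j :: 'n cartan) = ddet (\<lambda>i. est i i) tstate (Poly_Mapping.single [] 1) ?l (CARD('n) - j)"
    unfolding miura_cartan_def
  proof (rule ddet_map)
    show "emb.ev (x + y) = emb.ev x + emb.ev y" for x y :: "'n cartan" by (rule emb.ev_add)
    show "emb.ev (pre (i, 0) x) = est i i (emb.ev x)" for i and x :: "'n cartan"
      unfolding emb.ev_pre prod.case by (simp add: est_def diag_unit_munit)
    show "emb.ev (tstate x) = tstate (emb.ev x)" for x :: "'n cartan" by (rule emb.ev_tstate)
    show "emb.ev (Poly_Mapping.single [] 1) = Poly_Mapping.single [] 1" by (rule emb.ev_one)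
  qed
  also have "\<dots> = foldr gdiag ?l ?g (set ?l) (CARD('n) - j)" by (rule gdiags_ddet[symmetric]) auto
  finally have "emb.ev (miura_cartan j :: 'n cartan) = foldr gdiag ?l ?g UNIV (CARD('n) - j)" by simp
  moreover have "sugawara_state j = foldr (gxi est tstate) ?l ?g UNIV (CARD('n) - j)"
    by (simp add: sugawara_state_def sugawara_def gdet_def)
  moreover have "state_elem ((foldr gdiag [] (foldr (gxi est tstate) ?l ?g) - foldr gdiag ?l ?g) UNIV (CARD('n) - j)) \<in> hc_kernel"
    by (rule gdet_triangular) auto
  moreover have "state_elem (p - q) = state_elem p - state_elem q" for p q :: "'n state"
    using additive_diff_zero(3)[of state_elem, OF state_elem_add] .
  ultimately show ?thesis by (simp add: harish_chandra_def cartan_elem_emb)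
qed

section \<open>The Feigin-Frenkel polynomial\<close>

text \<open>
A point \<open>E\<close> of \<open>h[[t]]\<close> makes power series a representation of Cartan words: the letter \<open>E\<^sub>i\<^sub>i t\<^bsup>-k-1\<^esup>\<close> is multiplication by \<open>\<partial>\<^sup>k E\<^sub>i / k!\<close>, whose
constant term is the coefficient of \<open>t\<^sup>k\<close> in \<open>E\<^sub>i\<close>.
\<close>

locale miura_fps = fixes E :: "'n::{finite,linorder} \<Rightarrow> complex fps"
begin

definition flt :: "'n \<times> nat \<Rightarrow> complex fps \<Rightarrow> complex fps" where
  "flt l x = fps_const (1 / fact (snd l)) * (fps_deriv ^^ snd l) (E (fst l)) * x"

lemma nth_deriv: "fps_nth ((fps_deriv ^^ k) f) 0 = fact k * fps_nth f k" for f :: "complex fps"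
proof -
  have "fps_nth ((fps_deriv ^^ k) f) m * fact m = fact (m + k) * fps_nth f (m + k)" for m
  proof (induction k arbitrary: m)
    case (Suc k)
    have "fps_nth ((fps_deriv ^^ Suc k) f) m * fact m = fps_nth ((fps_deriv ^^ k) f) (Suc m) * fact (Suc m)"
      by (simp add: algebra_simps)
    then show ?case using Suc[of "Suc m"] by (simp add: algebra_simps)
  qed simp
  from this[of 0] show ?thesis by simp
qed

sublocale F: word_rep "\<lambda>c x. fps_const c * x" flt fps_deriv 1
proof
  fix a r and x :: "complex fps"
  have "fps_const (of_nat (Suc r)) * fps_const (1 / fact (Suc r)) = (fps_const (1 / fact r) :: complex fps)"
    unfolding fact_Suc fps_const_mult by (rule arg_cong[where f = fps_const]) (simp add: divide_simps del: of_nat_Suc)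
  then have "fps_const (of_nat (Suc r)) * flt (a, Suc r) x = fps_const (1 / fact r) * (fps_deriv ^^ Suc r) (E a) * x"
    by (simp only: flt_def snd_conv fst_conv mult.assoc[symmetric])
  moreover have "fps_deriv (flt (a, r) x) = fps_const (1 / fact r) * (fps_deriv ^^ Suc r) (E a) * x + flt (a, r) (fps_deriv x)"
    by (simp add: flt_def algebra_simps)
  ultimately show "fps_deriv (flt (a, r) x) = fps_const (of_nat (Suc r)) * flt (a, Suc r) x + flt (a, r) (fps_deriv x)"
    by (simp only:)
qed (simp_all add: flt_def algebra_simps flip: fps_const_add fps_const_mult)

lemma flt_nth: "fps_nth (flt (i, k) x) 0 = fps_nth (E i) k * fps_nth x 0"
  by (simp add: flt_def nth_deriv)
lemma flt_0: "flt (i, 0) x = E i * x" by (simp add: flt_def)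

lemma cartan_fun_ev: "cartan_fun s E = fps_nth (F.ev s) 0"
proof -
  have w: "fps_nth (F.wd w) 0 = prod_list (map (\<lambda>(i, k). fps_nth (E i) k) w)" for w
    by (induction w) (auto simp: flt_nth)
  show ?thesis by (simp add: cartan_fun_def F.ev_def lin_def fps_sum_nth w)
qed

lemma miura_ev: "fps_nth (miura E j) 0 = cartan_fun (miura_cartan j) E"
proof -
  have "F.ev (miura_cartan j) = ddet (\<lambda>i x. E i * x) fps_deriv 1 (sorted_list_of_set UNIV) (CARD('n) - j)"
    unfolding miura_cartan_def by (rule ddet_map) (simp_all add: F.ev_add F.ev_pre F.ev_tstate F.ev_one flt_0)
  moreover have "poly.coeff (foldr (\<lambda>j. first_order_comp (E j)) l 1) i = ddet (\<lambda>i x. E i * x) fps_deriv 1 l i" for l i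
  proof (induction l arbitrary: i)
    case (Cons j l)
    then show ?case
      by (cases i) (simp_all add: first_order_comp_def coeff_map_poly)
  qed simp
  ultimately show ?thesis by (simp add: miura_def cartan_fun_ev)
qed

end

definition var_poly :: "'x \<Rightarrow> 'x mpolynomial" where
  "var_poly x = Poly_Mapping.single (Poly_Mapping.single x 1) 1"

lemma poly_eval_var: "em 1 = 1 \<Longrightarrow> poly_eval em \<phi> (var_poly x) = \<phi> x"
  by (simp add: poly_eval_def var_poly_def)

text \<open>
The Harish-Chandra image is the Miura product, whose \<open>j\<close>-th coefficient is by definition the pullback of \<open>a\<^sub>j\<close>.
\<close>

lemma sugawara_ff_polynomial:
  assumes "1 \<le> j" "j \<le> CARD('n)"
  shows "ff_polynomial (sugawara_state j :: 'n::{finite,linorder} state) (var_poly (j, 0))"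
  unfolding ff_polynomial_def
proof (intro conjI exI[of _ "miura_cartan j"] allI sugawara_harish_chandra)
  show "var_poly (j, 0) \<in> diff_polys CARD('n)" using assms by (simp add: diff_polys_def var_poly_def)
  fix E :: "'n \<Rightarrow> complex fps"
  show "poly_eval (\<lambda>c. c) (\<lambda>(i, r). fps_nth ((fps_deriv ^^ r) (miura E i)) 0) (var_poly (j, 0)) = cartan_fun (miura_cartan j) E"
    by (simp add: poly_eval_var miura_fps.miura_ev)
qed

text \<open>
The Feigin-Frenkel isomorphism sends the mode \<open>k\<close> of \<open>S\<^sub>j\<close> to the coefficient of \<open>t\<^bsup>-k-1\<^esup>\<close> in \<open>a\<^sub>j\<close>, and the centre acts through \<open>\<chi>\<close>.
\<close>

theorem mode_value:
  fixes \<rho> :: "'n::{finite,linorder} ghat \<Rightarrow> 'v::ab_group_add \<Rightarrow> 'v"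
  assumes "in_mod_chi a sc \<rho>" "1 \<le> j" "j \<le> CARD('n)"
  shows "md (smooth_rep.S \<rho> j) k v = sc (a j $$ (- k - 1)) v"
proof -
  interpret smooth_rep sc \<rho> using assms(1) by unfold_locales (simp_all add: in_mod_chi_def)
  obtain \<Phi> where \<Phi>: "feigin_frenkel \<Phi>" "\<And>z v. z \<in> (Uhat_centre :: 'n Uhat set) \<Longrightarrow> Uhat_act sc \<rho> z v = sc (\<Phi> z a) v"
    using assms(1) by (auto simp: in_mod_chi_def)
  have "\<Phi> (state_mode (sugawara_state j) k) = (\<lambda>a. poly_eval fls_const (\<lambda>(i, r). (fls_deriv ^^ r) (a i)) (var_poly (j, 0)) $$ (- k - 1))"
    using \<Phi>(1) sugawara_va_centre[of j] sugawara_ff_polynomial[OF assms(2,3)] unfolding feigin_frenkel_def by blast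
  then have "\<Phi> (state_mode (sugawara_state j) k) a = a j $$ (- k - 1)"
    by (simp add: poly_eval_var)
  then show ?thesis
    using \<Phi>(2)[OF sugawara_mode_central, of j k v] by (simp add: Uhat_act_sugawara)
qed

section \<open>Invariant vectors\<close>

context smooth_rep
begin

text \<open>
The matrix units \<open>E\<^sub>a\<^sub>b t\<^sup>r\<close> with \<open>r \<ge> 1\<close> that lie in \<open>k\<^sub>m\<close>.
\<close>

definition allowed :: "nat \<Rightarrow> 'n \<Rightarrow> int \<Rightarrow> bool" where
  "allowed m a r \<longleftrightarrow> 1 \<le> r \<and> (a = last_index \<longrightarrow> int m \<le> r)"

definition fixed_from :: "nat \<Rightarrow> int \<Rightarrow> 'v set" where
  "fixed_from m r = {w. \<forall>a b s. allowed m a s \<and> r \<le> s \<longrightarrow> xm (munit a b) s w = 0}"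

lemma xm_swap: "xm (munit a b) r (xm (munit c d) s w) = xm (munit c d) s (xm (munit a b) r w)
   + ((if b = c then xm (munit a d) (r + s) w else 0) - (if d = a then xm (munit c b) (r + s) w else 0)
   + (if r + s = 0 then zmul (s * kz a b c d) w else 0))"
  using xm_comm_unit[of a b r c d s w]
  by (simp only: unit_bracket_eq xm_diff if_distrib[of "\<lambda>x. xm x (r + s) w"] xm_0) (simp only: algebra_simps)

section \<open>Pole orders on invariant vectors\<close>

context
  fixes m :: nat
  assumes m: "1 \<le> m"
begin

abbreviation W :: "'v set" where "W \<equiv> fixed_from m 1"

lemma W_up: "w \<in> W \<Longrightarrow> c \<noteq> last_index \<Longrightarrow> 1 \<le> s \<Longrightarrow> xm (munit c d) s w = 0"
  by (simp add: fixed_from_def allowed_def)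
lemma W_last: "w \<in> W \<Longrightarrow> int m \<le> s \<Longrightarrow> xm (munit last_index d) s w = 0"
  using m by (simp add: fixed_from_def allowed_def)

text \<open>
The rows other than the last one at \<open>t\<^sup>0\<close> normalise the subalgebra of allowed units, so they preserve its invariants.
\<close>

lemma W_levi:
  assumes w: "w \<in> W" and c: "c \<noteq> last_index"
  shows "xm (munit c d) 0 w \<in> W"
  unfolding fixed_from_def
proof (intro CollectI allI impI)
  fix a b s assume a: "allowed m a s \<and> 1 \<le> s"
  have "xm (munit a b) s w = 0" "xm (munit a d) s w = 0" "xm (munit c b) s w = 0"
    using w a c by (auto simp: fixed_from_def allowed_def)
  then show "xm (munit a b) s (xm (munit c d) 0 w) = 0"
    using a by (simp add: xm_swap[of a b s c d 0] is_add_lin)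
qed

text \<open>
The stronger bound also controls the field on the images of invariant vectors under the last row, which are not invariant. It holds for fields
built from letters outside the last row, and it is what a single letter from the last row consumes.
\<close>

definition pole_up :: "int \<Rightarrow> 'v fld \<Rightarrow> bool" where
  "pole_up q F \<longleftrightarrow> (\<forall>w\<in>W. \<forall>k. q + int m - 1 \<le> k \<longrightarrow> md F k w = 0) \<and>
     (\<forall>w\<in>W. \<forall>k b i. 0 \<le> i \<and> q + int m - 1 \<le> k + i \<longrightarrow> md F k (xm (munit last_index b) i w) = 0)"

definition pole :: "int \<Rightarrow> 'v fld \<Rightarrow> bool" where
  "pole q F \<longleftrightarrow> (\<forall>w\<in>W. \<forall>k. q + int m - 1 \<le> k \<longrightarrow> md F k w = 0)"

text \<open>
The creation part of the current contributes the modes \<open>F\<^bsub>k+j\<^esub>\<close>, and the annihilation part the modes \<open>F\<^bsub>k-1-j\<^esub>\<close> after a nonnegative mode of the current.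
\<close>

lemma ec_zero:
  assumes "\<And>j. 0 \<le> j \<Longrightarrow> md F (k + j) v = 0" "\<And>j. 0 \<le> j \<Longrightarrow> md F (k - 1 - j) (xm (munit c d) j v) = 0"
  shows "md (ec c d F) k v = 0"
proof -
  have "\<forall>\<^sub>F N in sequentially. md (ec c d F) k v = 0"
    using NO_ev[of "lf (munit c d)" F k v]
    by eventually_elim (simp add: md_lf assms is_add_lin)
  then show ?thesis by simp
qed

lemma pole_up_fone: "pole_up 0 fone"
  using m W_last by (auto simp: pole_up_def md_fone)

lemma pole_up_ec:
  assumes F: "pole_up q F" and c: "c \<noteq> last_index"
  shows "pole_up (q + 1) (ec c d F)"
  unfolding pole_up_def
proof (intro conjI ballI allI impI)
  fix w k assume w: "w \<in> W" and k: "q + 1 + int m - 1 \<le> k"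
  show "md (ec c d F) k w = 0"
  proof (rule ec_zero)
    fix j :: int assume j: "0 \<le> j"
    show "md F (k + j) w = 0" using F w k j by (simp add: pole_up_def)
    show "md F (k - 1 - j) (xm (munit c d) j w) = 0"
    proof (cases "j = 0")
      case True
      then show ?thesis using F W_levi[OF w c] k by (simp add: pole_up_def)
    next
      case False
      then show ?thesis using W_up[OF w c] j by simp
    qed
  qed
next
  fix w k b i assume w: "w \<in> W" and k: "0 \<le> i \<and> q + 1 + int m - 1 \<le> k + i"
  show "md (ec c d F) k (xm (munit last_index b) i w) = 0"
  proof (rule ec_zero)
    fix j :: int assume j: "0 \<le> j"
    show "md F (k + j) (xm (munit last_index b) i w) = 0" using F w k j by (auto simp: pole_up_def)
    have t1: "md F (k - 1 - j) (xm (munit last_index b) i (xm (munit c d) j w)) = 0"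
    proof (cases "j = 0")
      case True
      then show ?thesis using F W_levi[OF w c] k by (simp add: pole_up_def)
    next
      case False
      then show ?thesis using W_up[OF w c] j by (simp add: is_add_lin)
    qed
    have t2: "md F (k - 1 - j) (xm (munit c b) (j + i) w) = 0"
    proof (cases "j + i = 0")
      case True
      then have "i = 0" "j = 0" using j k by auto
      then show ?thesis using F W_levi[OF w c] k by (simp add: pole_up_def)
    next
      case False
      then show ?thesis using W_up[OF w c] j k by simp
    qed
    have t3: "md F (k - 1 - j) (xm (munit last_index d) (j + i) w) = 0"
      using F w k j by (simp add: pole_up_def)
    have t4: "(if j + i = 0 then zmul (i * z) w else 0) = 0" for z using j k by (cases "i = 0") auto
    show "md F (k - 1 - j) (xm (munit c d) j (xm (munit last_index b) i w)) = 0"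
      unfolding xm_swap[of c d j last_index b i] t4 by (simp add: md_add md_diff t1 t2 t3 if_distrib[of "md F (k - 1 - j)"])
  qed
qed

lemma pole_up_fder: "pole_up q F \<Longrightarrow> pole_up (q + 1) (fder F)"
  unfolding pole_up_def md_fder by (auto simp: algebra_simps)

lemma pole_ec_last:
  assumes F: "pole_up q F"
  shows "pole (q + 1) (ec last_index d F)"
  unfolding pole_def
proof (intro ballI allI impI)
  fix w k assume w: "w \<in> W" and k: "q + 1 + int m - 1 \<le> k"
  show "md (ec last_index d F) k w = 0"
    by (rule ec_zero) (use F w k in \<open>auto simp: pole_up_def\<close>)
qed

lemma pole_ec:
  assumes F: "pole q F" and c: "c \<noteq> last_index"
  shows "pole (q + 1) (ec c d F)"
  unfolding pole_def
proof (intro ballI allI impI)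
  fix w k assume w: "w \<in> W" and k: "q + 1 + int m - 1 \<le> k"
  show "md (ec c d F) k w = 0"
  proof (rule ec_zero)
    fix j :: int assume j: "0 \<le> j"
    show "md F (k + j) w = 0" using F w k j by (simp add: pole_def)
    show "md F (k - 1 - j) (xm (munit c d) j w) = 0"
    proof (cases "j = 0")
      case True
      then show ?thesis using F W_levi[OF w c] k by (simp add: pole_def)
    next
      case False
      then show ?thesis using W_up[OF w c] j by simp
    qed
  qed
qed

lemma pole_fder: "pole q F \<Longrightarrow> pole (q + 1) (fder F)"
  unfolding pole_def md_fder by (auto simp: algebra_simps)

lemma pole_lin:
  "pole q 0" "pole q F \<Longrightarrow> pole q G \<Longrightarrow> pole q (F + G)" "pole q F \<Longrightarrow> pole q (- F)"
  "pole_up q 0" "pole_up q F \<Longrightarrow> pole_up q G \<Longrightarrow> pole_up q (F + G)" "pole_up q F \<Longrightarrow> pole_up q (- F)"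
  by (auto simp: pole_def pole_up_def)

text \<open>
In a Grassmann monomial \<open>\<psi>\<^sub>B\<close> the set \<open>B\<close> records the rows that have been used, so the stronger bound persists as long as the last row is not in \<open>B\<close>. Each of the
first-order factors raises the bound by one, and \<open>u\<close> raises it by zero.
\<close>

lemma pole_gdet:
  "(last_index \<notin> B \<longrightarrow> pole_up (int (length l) - int i) (gdet ec fder fone l B i)) \<and>
   pole (int (length l) - int i) (gdet ec fder fone l B i)"
proof (induction l arbitrary: B i)
  case Nil
  have "pole 0 fone" using pole_up_fone by (simp add: pole_def pole_up_def)
  then show ?case by (simp add: gdet_def gone_def pole_lin pole_up_fone)
next
  case (Cons j l)
  define g where "g = gdet ec fder fone l"
  let ?L = "int (length l)"
  have gu: "last_index \<notin> B \<Longrightarrow> pole_up (?L - int i) (g B i)" and g: "pole (?L - int i) (g B i)" for B i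
    unfolding g_def using Cons by blast+
  have ap: "(\<Sum>a\<in>A. (f a :: ('n, 'v fld) grass)) B i = (\<Sum>a\<in>A. f a B i)" for f and A :: "'n set" and B i
    by (induction A rule: infinite_finite_induct) auto
  have u: "gdet ec fder fone (j # l) = gxi ec fder j g" by (simp add: gdet_def g_def)
  have sumu: "(\<And>a. pole_up q (f a)) \<Longrightarrow> pole_up q (\<Sum>a\<in>A. f a)" for q f and A :: "'n set"
    by (induction A rule: infinite_finite_induct) (auto intro: pole_lin)
  have sum: "(\<And>a. pole q (f a)) \<Longrightarrow> pole q (\<Sum>a\<in>A. f a)" for q f and A :: "'n set"
    by (induction A rule: infinite_finite_induct) (auto intro: pole_lin)
  have e: "int (length (j # l)) - int i = ?L - int i + 1" by simp
  have sh: "i \<noteq> 0 \<Longrightarrow> ?L - int i + 1 = ?L - int (i - 1)" by simp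
  have Lu: "pole_up (?L - int i + 1) (gL ec fder a j g B i)" if "a \<noteq> last_index" "last_index \<notin> B" for a B
  proof -
    have "pole_up (?L - int i + 1) (if i = 0 then 0 else g B (i - 1))"
      using gu[OF that(2), of "i - 1"] by (cases "i = 0") (simp_all only: if_True if_False pole_lin sh simp_thms)
    then show ?thesis
      using pole_up_ec[OF gu[OF that(2), of i] that(1), of j] pole_up_fder[OF gu[OF that(2), of i]]
      by (auto simp: gL_def glift_def gshift_def intro!: pole_lin)
  qed
  have Lp: "pole (?L - int i + 1) (gL ec fder a j g B i)" if "a = last_index \<longrightarrow> last_index \<notin> B" for a B
  proof -
    have "pole (?L - int i + 1) (if i = 0 then 0 else g B (i - 1))"
      using g[of "i - 1" B] by (cases "i = 0") (simp_all only: if_True if_False pole_lin sh simp_thms)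
    moreover have "pole (?L - int i + 1) (ec a j (g B i))"
      using that gu pole_ec_last pole_ec[OF g] by (cases "a = last_index") auto
    ultimately show ?thesis
      using pole_fder[OF g[of i B]] by (auto simp: gL_def glift_def gshift_def intro!: pole_lin)
  qed
  show ?case unfolding e u gxi_def ap
  proof (intro conjI impI sumu sum)
    fix a
    assume B: "last_index \<notin> B"
    show "pole_up (?L - int i + 1) (gpsi a (gL ec fder a j g) B i)"
      using Lu[of a "B - {a}"] B by (cases "a = last_index") (auto simp: gpsi_def sgn_at_def intro!: pole_lin)
  next
    fix a
    show "pole (?L - int i + 1) (gpsi a (gL ec fder a j g) B i)"
      using Lp[of a "B - {a}"] by (auto simp: gpsi_def sgn_at_def intro!: pole_lin)
  qed
qed

text \<open>
The coefficient of \<open>u\<^bsup>n-j\<^esup>\<close> has \<open>j\<close> factors that raise the bound.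
\<close>

theorem S_pole:
  assumes "w \<in> W" "j \<le> CARD('n)" "int j + int m - 1 \<le> k"
  shows "md (S j) k w = 0"
proof -
  have "pole (int j) (S j)"
    using pole_gdet[of UNIV "sorted_list_of_set (UNIV :: 'n set)" "CARD('n) - j"] assms(2)
    by (simp add: S_def sugawara_def of_nat_diff)
  then show ?thesis using assms by (simp add: pole_def)
qed

end

section \<open>Existence of invariant vectors\<close>

text \<open>
Commuting locally nilpotent operators have a common null vector: the last nonzero power of one operator on a common null vector of the others.
\<close>

lemma common_kernel:
  assumes "finite A" "z \<in> Z" "z \<noteq> 0"
    and stable: "\<And>i z. i \<in> A \<Longrightarrow> z \<in> Z \<Longrightarrow> x i z \<in> Z"
    and comm: "\<And>i j z. i \<in> A \<Longrightarrow> j \<in> A \<Longrightarrow> z \<in> Z \<Longrightarrow> x i (x j z) = x j (x i z)"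
    and nilp: "\<And>i z. i \<in> A \<Longrightarrow> \<exists>p. (x i ^^ p) z = 0"
    and add: "\<And>i. i \<in> A \<Longrightarrow> x i 0 = (0 :: 'v)"
  shows "\<exists>z\<in>Z. z \<noteq> 0 \<and> (\<forall>i\<in>A. x i z = 0)"
  using assms(1) stable comm nilp add
proof (induction A rule: finite_induct)
  case empty
  show ?case using assms(2,3) by blast
next
  case (insert i A)
  have "\<exists>z\<in>Z. z \<noteq> 0 \<and> (\<forall>j\<in>A. x j z = 0)" by (rule insert.IH; (rule insert.prems; (assumption | erule insertI2)))
  then obtain y where y: "y \<in> Z" "y \<noteq> 0" "\<And>j. j \<in> A \<Longrightarrow> x j y = 0" by blast
  obtain p where p: "(x i ^^ p) y = 0" using insert.prems(3)[OF insertI1] by blast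
  define q where "q = (LEAST p. (x i ^^ p) y = 0)"
  have q: "(x i ^^ q) y = 0" unfolding q_def using p by (rule LeastI)
  then have "q \<noteq> 0" using y by (cases q) auto
  then obtain q' where q': "q = Suc q'" by (cases q) auto
  define u where "u = (x i ^^ q') y"
  have "u \<noteq> 0" using not_less_Least[of q' "\<lambda>p. (x i ^^ p) y = 0"] q' unfolding q_def u_def by simp
  moreover have "(x i ^^ k) y \<in> Z \<and> (\<forall>j\<in>A. x j ((x i ^^ k) y) = 0)" for k
  proof (induction k)
    case (Suc k)
    then show ?case
      using insert.prems(1)[of i] insert.prems(2)[of _ i "(x i ^^ k) y"] insert.prems(4)[of i] by simp
  qed (use y in auto)
  moreover have "x i u = 0" using q q' by (simp add: u_def)
  ultimately show ?case unfolding u_def by blast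
qed

text \<open>
On the vectors killed by all allowed units of order above \<open>r\<close>, the allowed units of order \<open>r\<close> commute, since their brackets have order \<open>2 r > r\<close>, and
they preserve this space.
\<close>

lemma descend:
  assumes m: "1 \<le> m" and r: "1 \<le> r" and w: "w \<in> fixed_from m (r + 1)" "w \<noteq> 0"
    and nilp: "\<And>a b v. allowed m a r \<Longrightarrow> \<exists>p. (xm (munit a b) r ^^ p) v = 0"
  shows "\<exists>w\<in>fixed_from m r. w \<noteq> 0"
proof -
  let ?A = "{(a, b :: 'n). allowed m a r}" and ?x = "\<lambda>(a, b). xm (munit a b) r"
  have kill: "xm (munit a b) s z = 0" if "z \<in> fixed_from m (r + 1)" "allowed m a s" "r + 1 \<le> s" for z a b s
    using that by (auto simp: fixed_from_def)
  have al: "allowed m a (r + s)" if "allowed m a r" "1 \<le> s" for a r s using that by (auto simp: allowed_def)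
  have "\<exists>z\<in>fixed_from m (r + 1). z \<noteq> 0 \<and> (\<forall>i\<in>?A. ?x i z = 0)"
  proof (rule common_kernel[OF _ w])
    show "finite ?A" by simp
    fix i z assume i: "i \<in> ?A" and z: "z \<in> fixed_from m (r + 1)"
    obtain c d where cd: "i = (c, d)" "allowed m c r" using i by auto
    have "xm (munit a b) s (xm (munit c d) r z) = 0" if "allowed m a s" "r + 1 \<le> s" for a b s
    proof -
      have "xm (munit a d) (s + r) z = 0" "xm (munit c b) (s + r) z = 0" "xm (munit a b) s z = 0"
        using kill[OF z] that cd al[of a s r] al[of c r s] r by (auto simp: add.commute)
      then show ?thesis using that r by (simp add: xm_swap[of a b s c d r] is_add_lin)
    qed
    then show "?x i z \<in> fixed_from m (r + 1)" by (auto simp: cd fixed_from_def)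
    fix j assume "j \<in> ?A"
    then obtain a b where ab: "j = (a, b)" "allowed m a r" by auto
    have "xm (munit c b) (r + r) z = 0" "xm (munit a d) (r + r) z = 0"
      using kill[OF z] cd ab al[of a r r] al[of c r r] r by auto
    then show "?x i (?x j z) = ?x j (?x i z)" using r by (simp add: cd ab xm_swap[of c d r a b r])
  qed (use nilp in \<open>auto simp: is_add_lin\<close>)
  then obtain z where z: "z \<in> fixed_from m (r + 1)" "z \<noteq> 0" "\<And>a b. allowed m a r \<Longrightarrow> xm (munit a b) r z = 0" by auto
  have "z \<in> fixed_from m r"
    unfolding fixed_from_def
  proof (intro CollectI allI impI)
    fix a b s assume s: "allowed m a s \<and> r \<le> s"
    show "xm (munit a b) s z = 0"
      using z(1,3) s by (cases "s = r") (auto simp: fixed_from_def)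
  qed
  with z show ?thesis by blast
qed

text \<open>
By smoothness any vector is killed by the units of high order; the order is then lowered step by step.
\<close>

theorem fixed_vector:
  assumes m: "1 \<le> m" and v: "v \<noteq> (0 :: 'v)"
    and nilp: "\<And>a b r v. allowed m a r \<Longrightarrow> \<exists>p. (xm (munit a b) r ^^ p) v = 0"
  shows "\<exists>w\<in>fixed_from m 1. w \<noteq> 0"
proof -
  obtain N where N: "\<forall>X\<in>arcs N. \<rho> (X, 0) v = 0" using smooth unfolding smooth_def by blast
  have "\<exists>w\<in>fixed_from m (int k + 1). w \<noteq> 0" if "k \<le> N" for k
    using that
  proof (induction "N - k" arbitrary: k)
    case 0
    then have "k = N" by simp
    have "\<rho> (loop (munit a b) s, 0) v = 0" if "int k + 1 \<le> s" for a b s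
      using N that \<open>k = N\<close> by (intro bspec[OF N] loop_in_arcs) simp
    then have "v \<in> fixed_from m (int k + 1)" by (simp add: fixed_from_def xm_def)
    then show ?case using v by blast
  next
    case (Suc d)
    then have "\<exists>w\<in>fixed_from m (int (Suc k) + 1). w \<noteq> 0" by (intro Suc(1)) auto
    then obtain w where "w \<in> fixed_from m ((int k + 1) + 1)" "w \<noteq> 0" by (auto simp: add.commute)
    then show ?case using descend[OF m, of "int k + 1"] nilp by auto
  qed
  from this[of 0] show ?thesis by simp
qed

end

section \<open>One-parameter subgroups of the congruence group\<close>

text \<open>
The perturbation of the identity at one matrix entry: \<open>exp (s t\<^sup>r) - 1\<close> on the diagonal and \<open>s t\<^sup>r\<close> off the diagonal, so that in both cases
\<open>s \<mapsto> exp (s E\<^sub>a\<^sub>b t\<^sup>r)\<close> is a one-parameter group. For \<open>r \<ge> 1\<close> each Taylor coefficient of \<open>exp (s t\<^sup>r)\<close> is a polynomial in \<open>s\<close>.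
\<close>

definition one_param_entry :: "bool \<Rightarrow> nat \<Rightarrow> complex \<Rightarrow> complex fps" where
  "one_param_entry d r s = (if d then fps_compose (fps_exp s) (fps_X ^ r) - 1 else fps_const s * fps_X ^ r)"

definition ematrix :: "'n \<Rightarrow> 'n \<Rightarrow> complex fps \<Rightarrow> complex fps^'n::finite^'n" where
  "ematrix a b h = (\<chi> i j. if i = a \<and> j = b then h else 0)"

definition one_param :: "'n \<Rightarrow> 'n \<Rightarrow> nat \<Rightarrow> complex \<Rightarrow> complex fps^'n::finite^'n" where
  "one_param a b r s = mat 1 + ematrix a b (one_param_entry (a = b) r s)"

lemma one_param_entry_nth:
  assumes "1 \<le> r"
  shows "fps_nth (one_param_entry d r s) k = (if d then (if 0 < k \<and> r dvd k then s ^ (k div r) / fact (k div r) else 0)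
     else (if k = r then s else 0))"
proof (cases d)
  case True
  have "fps_nth (fps_compose (fps_exp s) (fps_X ^ r)) k = (if r dvd k then s ^ (k div r) / fact (k div r) else 0)"
    using assms by (simp add: fps_nth_compose_X_power)
  with True show ?thesis by (auto simp: one_param_entry_def)
qed (simp add: one_param_entry_def)

lemma one_param_entry_add:
  assumes "1 \<le> r"
  shows "one_param_entry True r (s + t) = one_param_entry True r s + one_param_entry True r t + one_param_entry True r s * one_param_entry True r t"
    "one_param_entry False r (s + t) = one_param_entry False r s + one_param_entry False r t" "one_param_entry d r 0 = 0"
proof -
  have z: "fps_nth (fps_X ^ r :: complex fps) 0 = 0" using assms by simp
  have "fps_compose (fps_exp (s + t)) (fps_X ^ r) = fps_compose (fps_exp s) (fps_X ^ r) * fps_compose (fps_exp t) (fps_X ^ r)"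
    unfolding fps_exp_add_mult by (rule fps_compose_mult_distrib[OF z])
  then show "one_param_entry True r (s + t) = one_param_entry True r s + one_param_entry True r t + one_param_entry True r s * one_param_entry True r t"
    by (simp add: one_param_entry_def algebra_simps)
  show "one_param_entry False r (s + t) = one_param_entry False r s + one_param_entry False r t"
    by (simp add: one_param_entry_def distrib_right flip: fps_const_add)
  show "one_param_entry d r 0 = 0" by (rule fps_ext) (auto simp: one_param_entry_nth[OF assms] zero_power dvd_def)
qed

lemma ematrix_mult: "ematrix a b g ** ematrix a b h = (if a = b then ematrix a b (g * h) else 0)"
proof -
  have "(ematrix a b g ** ematrix a b h) $ i $ j = (if a = b then ematrix a b (g * h) else 0) $ i $ j" for i j
  proof -
    have "(ematrix a b g ** ematrix a b h) $ i $ j = (\<Sum>k\<in>UNIV. if k = b then (if i = a \<and> b = a \<and> j = b then g * h else 0) else 0)"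
      unfolding matrix_matrix_mult_def ematrix_def vec_lambda_beta by (intro sum.cong refl) auto
    then show ?thesis by (auto simp: ematrix_def)
  qed
  then show ?thesis by (simp add: vec_eq_iff)
qed

lemma matrix_add_rdistrib': "(A + B) ** C = A ** C + B ** (C :: 'a::semiring_1^'n::finite^'n)"
  by (simp add: matrix_matrix_mult_def vec_eq_iff distrib_right sum.distrib)

lemma ematrix_add: "ematrix a b (g + h) = ematrix a b g + ematrix a b h" "ematrix a b 0 = 0"
  by (auto simp: vec_eq_iff ematrix_def)

lemma one_param_mult:
  assumes "1 \<le> r"
  shows "one_param a b r (s + t) = one_param a b r s ** one_param a b r t" "one_param a b r 0 = mat 1"
proof -
  have "one_param a b r s ** one_param a b r t = mat 1 + ematrix a b (one_param_entry (a = b) r s) + ematrix a b (one_param_entry (a = b) r t)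
    + ematrix a b (one_param_entry (a = b) r s) ** ematrix a b (one_param_entry (a = b) r t)"
    by (simp add: one_param_def matrix_add_ldistrib matrix_add_rdistrib' add_ac)
  also have "\<dots> = one_param a b r (s + t)"
    by (cases "a = b") (simp_all add: ematrix_mult one_param_def one_param_entry_add(1,2)[OF assms] ematrix_add add_ac)
  finally show "one_param a b r (s + t) = one_param a b r s ** one_param a b r t" by simp
  show "one_param a b r 0 = mat 1" by (simp add: one_param_def one_param_entry_add(3)[OF assms] ematrix_add)
qed

lemma det_nth_0: "fps_nth (det (g :: complex fps^'n::finite^'n)) 0 = det (\<chi> i j. fps_nth (g $ i $ j) 0)"
proof -
  have p: "fps_nth (prod f A) 0 = (\<Prod>i\<in>A. fps_nth (f i) 0)" for f :: "'n \<Rightarrow> complex fps" and A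
    by (induction A rule: infinite_finite_induct) auto
  have o: "fps_nth (of_int z :: complex fps) 0 = of_int z" for z by (simp add: fps_of_int)
  show ?thesis by (simp add: det_def fps_sum_nth p o)
qed

lemma one_param_det:
  assumes "1 \<le> r" shows "fps_nth (det (one_param a b r s)) 0 = 1"
proof -
  have "(\<chi> i j. fps_nth (one_param a b r s $ i $ j) 0) = mat 1"
    using assms by (auto simp: vec_eq_iff one_param_def ematrix_def mat_def one_param_entry_nth[OF assms])
  then show ?thesis by (simp add: det_nth_0)
qed

lemma one_param_K_group:
  assumes "1 \<le> r" "a = last_index \<longrightarrow> m \<le> r"
  shows "one_param a b r s \<in> K_group m"
  using assms one_param_det[OF assms(1), of a b s]
  by (auto simp: K_group_def one_param_def ematrix_def one_param_entry_nth dest: dvd_imp_le)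

definition elementary_power :: "'n \<Rightarrow> 'n \<Rightarrow> nat \<Rightarrow> complex fps^'n::finite^'n" where
  "elementary_power a b r = ematrix a b (fps_X ^ r)"

lemma elementary_power_k_alg: "a = last_index \<longrightarrow> m \<le> r \<Longrightarrow> elementary_power a b r \<in> k_alg m"
  by (auto simp: k_alg_def elementary_power_def ematrix_def)

lemma elementary_power_loop: "matrix_to_K (elementary_power a b r) = loop (munit a b) (int r)"
proof -
  have "fps_to_fls (fps_X ^ r) $$ k = (if k = int r then 1 else (0 :: complex))" for k
    by (auto simp: fps_to_fls_nth)
  then show ?thesis
    by (auto simp: vec_eq_iff matrix_to_K_def elementary_power_def ematrix_def loop_lmon munit_def lmon_nth intro!: fls_eqI)
qed

section \<open>Regular functions along one-parameter subgroups\<close>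

text \<open>
Equality to first order at \<open>0\<close>.
\<close>

definition jet_eq :: "complex poly \<Rightarrow> complex poly \<Rightarrow> bool" where
  "jet_eq p q \<longleftrightarrow> poly.coeff p 0 = poly.coeff q 0 \<and> poly.coeff p 1 = poly.coeff q 1"

lemma coeff_mult_1: "poly.coeff (p * q) (Suc 0) = poly.coeff p 0 * poly.coeff q (Suc 0) + poly.coeff p (Suc 0) * poly.coeff q 0"
  by (simp add: coeff_mult)

lemma jet_eq_mult: "jet_eq p q \<Longrightarrow> jet_eq p' q' \<Longrightarrow> jet_eq (p * p') (q * q')"
  by (simp add: jet_eq_def coeff_mult_1 coeff_mult_0)
lemma jet_eq_add: "jet_eq p q \<Longrightarrow> jet_eq p' q' \<Longrightarrow> jet_eq (p + p') (q + q')"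
  by (simp add: jet_eq_def)
lemma jet_eq_refl: "jet_eq p p" by (simp add: jet_eq_def)
lemma jet_eq_power: "jet_eq p q \<Longrightarrow> jet_eq (p ^ n) (q ^ n)"
  by (induction n) (auto intro: jet_eq_mult jet_eq_refl)
lemma jet_eq_prod: "(\<And>i. i \<in> A \<Longrightarrow> jet_eq (f i) (g i)) \<Longrightarrow> jet_eq (prod f A) (prod g A)"
  by (induction A rule: infinite_finite_induct) (auto intro: jet_eq_mult jet_eq_refl)
lemma jet_eq_sum: "(\<And>i. i \<in> A \<Longrightarrow> jet_eq (f i) (g i)) \<Longrightarrow> jet_eq (sum f A) (sum g A)"
  by (induction A rule: infinite_finite_induct) (auto intro: jet_eq_add jet_eq_refl)

lemma poly_poly_eval: "poly (poly_eval (\<lambda>c. [:c:]) \<Phi> Q) s = poly_eval (\<lambda>c. c) (\<lambda>x. poly (\<Phi> x) s) Q"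
  by (simp add: poly_eval_def poly_sum poly_prod)

text \<open>
A regular function is polynomial along the one-parameter group, because its Taylor coefficients are polynomials in \<open>s\<close> and its determinant
is \<open>1\<close> at \<open>t = 0\<close>. To first order in \<open>s\<close> the group agrees with the line \<open>1 + s E\<^sub>a\<^sub>b t\<^sup>r\<close>, along which the derivative is taken.
\<close>

lemma regular_along:
  fixes f :: "complex fps^'n::finite^'n \<Rightarrow> complex"
  assumes f: "regular_fun f" and r: "1 \<le> r"
  shows "\<exists>p. (\<forall>s. f (one_param a b r s) = poly p s) \<and>
    ((\<lambda>s. f (\<chi> i j. mat 1 $ i $ j + fps_const s * elementary_power a b r $ i $ j)) has_field_derivative poly.coeff p 1) (at 0)"
proof -
  obtain Q :: "('n \<times> 'n \<times> nat) option mpolynomial" where Q: "\<And>g. f g = poly_eval (\<lambda>c. c)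
       (\<lambda>x. case x of None \<Rightarrow> inverse (fps_nth (det g) 0) | Some (i, j, r) \<Rightarrow> fps_nth (g $ i $ j) r) Q"
    using f unfolding regular_fun_def by blast
  define c :: "'n \<Rightarrow> 'n \<Rightarrow> nat \<Rightarrow> complex poly" where "c i j k = (if i = j \<and> k = 0 then 1 else 0)" for i j k
  define \<Phi> where "\<Phi> x = (case x of None \<Rightarrow> 1 | Some (i, j, k) \<Rightarrow> c i j k + (if i = a \<and> j = b then
      (if a = b then (if 0 < k \<and> r dvd k then Polynomial.monom (1 / fact (k div r)) (k div r) else 0) else (if k = r then [:0, 1:] else 0)) else 0))" for x
  define \<Psi> where "\<Psi> x = (case x of None \<Rightarrow> 1 | Some (i, j, k) \<Rightarrow> c i j k + (if i = a \<and> j = b \<and> k = r then [:0, 1:] else 0))" for x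
  define p p' where "p = poly_eval (\<lambda>c. [:c:]) \<Phi> Q" and "p' = poly_eval (\<lambda>c. [:c:]) \<Psi> Q"
  have m1: "fps_nth (mat 1 $ i $ j) k = poly (c i j k) s" for i j :: 'n and k s
    by (simp add: mat_def c_def)
  have "f (one_param a b r s) = poly p s" for s
  proof -
    have "(case x of None \<Rightarrow> inverse (fps_nth (det (one_param a b r s)) 0) | Some (i, j, k) \<Rightarrow> fps_nth (one_param a b r s $ i $ j) k) = poly (\<Phi> x) s" for x
    proof (cases x)
      case None then show ?thesis by (simp add: one_param_det[OF r] \<Phi>_def)
    next
      case (Some y)
      obtain i j k where y: "y = (i, j, k)" by (cases y)
      have "fps_nth (one_param a b r s $ i $ j) k = poly (c i j k) s + fps_nth (ematrix a b (one_param_entry (a = b) r s) $ i $ j) k"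
        by (simp add: one_param_def m1)
      then show ?thesis
        by (auto simp: Some y \<Phi>_def ematrix_def one_param_entry_nth[OF r] poly_monom)
    qed
    then show ?thesis unfolding Q p_def poly_poly_eval by (intro arg_cong[where f = "\<lambda>\<phi>. poly_eval (\<lambda>c. c) \<phi> Q"] ext)
  qed
  moreover have p': "f (\<chi> i j. mat 1 $ i $ j + fps_const s * elementary_power a b r $ i $ j) = poly p' s" for s
  proof -
    let ?g = "\<chi> i j. mat 1 $ i $ j + fps_const s * elementary_power a b r $ i $ j"
    have "(\<chi> i j. fps_nth (?g $ i $ j) 0) = mat 1"
      using r by (auto simp: vec_eq_iff mat_def elementary_power_def ematrix_def)
    then have d: "fps_nth (det ?g) 0 = 1" by (simp only: det_nth_0 det_I)
    have "(case x of None \<Rightarrow> inverse (fps_nth (det ?g) 0) | Some (i, j, k) \<Rightarrow> fps_nth (?g $ i $ j) k) = poly (\<Psi> x) s" for x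
    proof (cases x)
      case None then show ?thesis by (simp only: d option.case \<Psi>_def) simp
    next
      case (Some y)
      obtain i j k where y: "y = (i, j, k)" by (cases y)
      have "fps_nth (?g $ i $ j) k = poly (c i j k) s + fps_nth (fps_const s * elementary_power a b r $ i $ j) k"
        by (simp add: m1)
      then show ?thesis by (auto simp: Some y \<Psi>_def elementary_power_def ematrix_def)
    qed
    then show ?thesis unfolding Q p'_def poly_poly_eval by (intro arg_cong[where f = "\<lambda>\<phi>. poly_eval (\<lambda>c. c) \<phi> Q"] ext)
  qed
  moreover have "jet_eq p p'"
    unfolding p_def p'_def poly_eval_def
  proof (intro jet_eq_sum jet_eq_mult jet_eq_refl jet_eq_prod jet_eq_power)
    fix x
    have "jet_eq (if 0 < k \<and> r dvd k then Polynomial.monom (1 / fact (k div r)) (k div r) else 0) (if k = r then [:0, 1:] else 0)" for k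
    proof (cases "0 < k \<and> r dvd k")
      case True
      then obtain q where q: "k = r * q" by (auto simp: dvd_def)
      with True r have "k div r = q" "q \<noteq> 0" "k = r \<longleftrightarrow> q = 1" by auto
      with True show ?thesis by (auto simp: jet_eq_def)
    next
      case False
      then have "k \<noteq> r" using r by auto
      with False show ?thesis by (auto simp: jet_eq_def)
    qed
    then have h: "jet_eq (if a = b then (if 0 < k \<and> r dvd k then Polynomial.monom (1 / fact (k div r)) (k div r) else 0) else (if k = r then [:0, 1:] else 0)) (if k = r then [:0, 1:] else 0)" for k
      by (cases "a = b") (simp_all only: if_True if_False simp_thms jet_eq_refl)
    have ifj: "jet_eq (if Q then A else 0) (if Q then B else 0)" if "jet_eq A B" for Q A B
      using that by (simp add: jet_eq_refl)
    show "jet_eq (\<Phi> x) (\<Psi> x)"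
    proof (cases x)
      case (Some y)
      obtain i j k where y: "y = (i, j, k)" by (cases y)
      have "\<Psi> x = c i j k + (if i = a \<and> j = b then (if k = r then [:0, 1:] else 0) else 0)"
        by (simp add: \<Psi>_def Some y)
      then show ?thesis
        by (simp only: \<Phi>_def Some y option.case prod.case) (rule jet_eq_add[OF jet_eq_refl ifj[OF h]])
    qed (simp add: \<Phi>_def \<Psi>_def jet_eq_refl)
  qed
  moreover have "(poly p' has_field_derivative poly.coeff p' 1) (at 0)"
    using poly_DERIV[of p' 0] by (simp add: poly_0_coeff_0 coeff_pderiv)
  ultimately show ?thesis by (auto simp: jet_eq_def intro!: exI[of _ p])
qed

section \<open>Local nilpotency and the bound on the poles\<close>

context smooth_rep
begin

text \<open>
A vector-valued polynomial that vanishes identically has zero coefficients. Comparing the values at \<open>2 s\<close> and \<open>s\<close> removes the leading coefficient.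
\<close>

lemma vector_poly_zero:
  "(\<And>s. (\<Sum>k<K. sc (s ^ k) (w k)) = 0) \<Longrightarrow> k < K \<Longrightarrow> w k = 0"
proof (induction K arbitrary: w k)
  case (Suc K)
  have d: "(\<Sum>k<K. sc (s ^ k) (sc (2 ^ k - 2 ^ K) (w k))) = 0" for s
  proof -
    have "(\<Sum>k<Suc K. sc ((2 * s) ^ k) (w k)) - sc (2 ^ K) (\<Sum>k<Suc K. sc (s ^ k) (w k)) = 0"
      unfolding Suc.prems(1) by simp
    then have "(\<Sum>k<Suc K. sc ((2 * s) ^ k) (w k) - sc (2 ^ K) (sc (s ^ k) (w k))) = 0"
      by (simp only: V.scale_sum_right sum_subtractf)
    moreover have "sc ((2 * s) ^ k) (w k) - sc (2 ^ K) (sc (s ^ k) (w k)) = sc (s ^ k) (sc (2 ^ k - 2 ^ K) (w k))" for k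
      by (simp add: power_mult_distrib algebra_simps flip: V.scale_left_diff_distrib)
    ultimately show ?thesis by simp
  qed
  have z: "w k = 0" if "k < K" for k
  proof -
    have "sc (2 ^ k - 2 ^ K) (w k) = 0" by (rule Suc.IH[OF d that])
    moreover have "(2 ^ k :: complex) \<noteq> 2 ^ K"
    proof -
      have "(2 :: nat) ^ k \<noteq> 2 ^ K" using that by simp
      then have "of_nat (2 ^ k) \<noteq> (of_nat (2 ^ K) :: complex)" by (simp only: of_nat_eq_iff not_False_eq_True)
      then show ?thesis by simp
    qed
    ultimately show ?thesis by simp
  qed
  then have "w K = 0" using Suc.prems(1)[of 1] by simp
  with z Suc.prems(2) show ?case by (cases "k = K") auto
qed simp

lemma vpoly_expand:
  assumes "\<And>l. l < q \<Longrightarrow> degree (p l) < K"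
  shows "(\<Sum>l<q. sc (poly (p l) s) (e l)) = (\<Sum>k<K. sc (s ^ k) (\<Sum>l<q. sc (poly.coeff (p l) k) (e l)))"
proof -
  have "poly (p l) s = (\<Sum>k<K. poly.coeff (p l) k * s ^ k)" if "l < q" for l
    unfolding poly_altdef
    by (rule sum.mono_neutral_left) (use assms[OF that] in \<open>auto simp: coeff_eq_0\<close>)
  then have "(\<Sum>l<q. sc (poly (p l) s) (e l)) = (\<Sum>l<q. \<Sum>k<K. sc (s ^ k) (sc (poly.coeff (p l) k) (e l)))"
    by (simp add: V.scale_sum_left mult.commute)
  also have "\<dots> = (\<Sum>k<K. \<Sum>l<q. sc (s ^ k) (sc (poly.coeff (p l) k) (e l)))" by (rule sum.swap)
  finally show ?thesis by (simp add: V.scale_sum_right)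
qed

lemma vpoly_eq:
  fixes q q' :: nat
  assumes "\<And>s. (\<Sum>l<q. sc (poly (p l) s) (e l)) = (\<Sum>l<q'. sc (poly (p' l) s) (e' l))"
  shows "(\<Sum>l<q. sc (poly.coeff (p l) k) (e l)) = (\<Sum>l<q'. sc (poly.coeff (p' l) k) (e' l))"
proof -
  define K where "K = Suc (Max (insert k ((degree \<circ> p) ` {..<q} \<union> (degree \<circ> p') ` {..<q'})))"
  have K: "degree (p l) < K" if "l < q" for l unfolding K_def less_Suc_eq_le by (rule Max_ge) (use that in auto)
  have K': "degree (p' l) < K" if "l < q'" for l unfolding K_def less_Suc_eq_le by (rule Max_ge) (use that in auto)
  have k: "k < K" unfolding K_def less_Suc_eq_le by (rule Max_ge) auto
  have "(\<Sum>k<K. sc (s ^ k) ((\<Sum>l<q. sc (poly.coeff (p l) k) (e l)) - (\<Sum>l<q'. sc (poly.coeff (p' l) k) (e' l)))) = 0" for s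
    using assms[of s] by (simp add: V.scale_right_diff_distrib sum_subtractf flip: vpoly_expand[OF K] vpoly_expand[OF K'])
  from vector_poly_zero[OF this k] show ?thesis by simp
qed

text \<open>
If \<open>U(s) v = \<Sum>\<^sub>k s\<^sup>k u\<^sub>k\<close> is a polynomial and \<open>x\<close> is the generator of \<open>U\<close>, then the group law gives \<open>x u\<^sub>k = (k + 1) u\<^bsub>k+1\<^esub>\<close>, so
that \<open>x\<^sup>k v = k! u\<^sub>k\<close>, which is zero beyond the degree.
\<close>

lemma unipotent_nilpotent:
  fixes U :: "complex \<Rightarrow> 'v \<Rightarrow> 'v" and x :: "'v \<Rightarrow> 'v"
  assumes U0: "\<And>v. U 0 v = v" and Uadd: "\<And>s t v. U (s + t) v = U s (U t v)"
    and x_add: "\<And>u v. x (u + v) = x u + x v" and x_sc: "\<And>c v. x (sc c v) = sc c (x v)"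
    and U: "\<And>v. \<exists>(q::nat) p e. (\<forall>s. U s v = (\<Sum>l<q. sc (poly (p l) s) (e l))) \<and> x v = (\<Sum>l<q. sc (poly.coeff (p l) 1) (e l))"
  shows "\<exists>k. (x ^^ k) v = 0"
proof -
  obtain q p e where rep: "\<And>s. U s v = (\<Sum>l<(q::nat). sc (poly (p l) s) (e l))" using U[of v] by blast
  define u where "u k = (\<Sum>l<q. sc (poly.coeff (p l) k) (e l))" for k
  have xs: "x (\<Sum>l<q. sc (c l) (f l)) = (\<Sum>l<q. sc (c l) (x (f l)))" for c f
    by (simp add: additive_sum[of x, OF x_add] x_sc)
  have xU: "x (U t v) = (\<Sum>l<q. sc (poly (pderiv (p l)) t) (e l))" for t
  proof -
    obtain q1 p1 e1 where r1: "\<And>s. U s (U t v) = (\<Sum>l<(q1::nat). sc (poly (p1 l) s) (e1 l))"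
      and x1: "x (U t v) = (\<Sum>l<q1. sc (poly.coeff (p1 l) 1) (e1 l))" using U[of "U t v"] by blast
    have "(\<Sum>l<q1. sc (poly (p1 l) s) (e1 l)) = (\<Sum>l<q. sc (poly (pcompose (p l) [:t, 1:]) s) (e l))" for s
      using rep[of "s + t"] unfolding r1[symmetric] Uadd by (simp add: poly_pcompose add.commute)
    then have "x (U t v) = (\<Sum>l<q. sc (poly.coeff (pcompose (p l) [:t, 1:]) 1) (e l))"
      unfolding x1 by (rule vpoly_eq)
    moreover have "poly.coeff (pcompose r [:t, 1:]) 1 = poly (pderiv r) t" for r :: "complex poly"
    proof -
      have "poly.coeff (pcompose r [:t, 1:]) 1 = poly (pderiv (pcompose r [:t, 1:])) 0"
        by (simp add: poly_0_coeff_0 coeff_pderiv)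
      also have "\<dots> = poly (pderiv r) t" by (simp add: pderiv_pcompose poly_pcompose pderiv_pCons)
      finally show ?thesis .
    qed
    ultimately show ?thesis by simp
  qed
  have step: "x (u k) = sc (of_nat (Suc k)) (u (Suc k))" for k
  proof -
    have "(\<Sum>l<q. sc (poly (p l) t) (x (e l))) = (\<Sum>l<q. sc (poly (pderiv (p l)) t) (e l))" for t
      using xU[of t] by (simp add: rep xs)
    then have "(\<Sum>l<q. sc (poly.coeff (p l) k) (x (e l))) = (\<Sum>l<q. sc (poly.coeff (pderiv (p l)) k) (e l))"
      by (rule vpoly_eq)
    then show ?thesis by (simp add: u_def xs coeff_pderiv V.scale_sum_right del: of_nat_Suc)
  qed
  have u0: "u 0 = v" using rep[of 0] by (simp add: U0 u_def poly_0_coeff_0)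
  have pow: "(x ^^ k) v = sc (fact k) (u k)" for k
    by (induction k) (simp_all add: u0 x_sc step mult.commute)
  define K where "K = Suc (Max (insert 0 ((degree \<circ> p) ` {..<q})))"
  have "degree (p l) < K" if "l < q" for l unfolding K_def less_Suc_eq_le by (rule Max_ge) (use that in auto)
  then have "u K = 0" by (simp add: u_def coeff_eq_0 sum.neutral)
  then show ?thesis using pow[of K] by auto
qed

lemma integrable_nilpotent:
  assumes int: "integrable_k m sc \<rho>" and r: "allowed m a r"
  shows "\<exists>k. (xm (munit a b) r ^^ k) v = 0"
proof -
  obtain R where R: "\<forall>g\<in>K_group m. Vector_Spaces.linear sc sc (R g)" "\<forall>v. R (mat 1) v = v"
      "\<forall>g\<in>K_group m. \<forall>h\<in>K_group m. \<forall>v. R (g ** h) v = R g (R h v)"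
      "\<forall>v. \<exists>(q::nat) f e. (\<forall>l<q. regular_fun (f l)) \<and>
        (\<forall>g\<in>K_group m. R g v = (\<Sum>l<q. sc (f l g) (e l))) \<and>
        (\<forall>X\<in>k_alg m. \<exists>d. (\<forall>l<q. ((\<lambda>s. f l (\<chi> i j. mat 1 $ i $ j + fps_const s * X $ i $ j)) has_field_derivative d l) (at 0)) \<and>
           \<rho> (matrix_to_K X, 0) v = (\<Sum>l<q. sc (d l) (e l)))"
    using int unfolding integrable_k_def by (elim exE conjE) (rule that)
  define n where "n = nat r"
  have n: "1 \<le> n" "a = last_index \<longrightarrow> m \<le> n" "r = int n" using r by (auto simp: n_def allowed_def)
  have K: "one_param a b n s \<in> K_group m" for s by (rule one_param_K_group[OF n(1,2)])
  show ?thesis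
  proof (rule unipotent_nilpotent[where U = "\<lambda>s. R (one_param a b n s)"])
    show "R (one_param a b n 0) v = v" for v by (simp add: one_param_mult(2)[OF n(1)] R(2))
    show "R (one_param a b n (s + t)) v = R (one_param a b n s) (R (one_param a b n t) v)" for s t v
      unfolding one_param_mult(1)[OF n(1)] using R(3) K by blast
    fix v
    obtain q f e where reg: "\<And>l. l < (q::nat) \<Longrightarrow> regular_fun (f l)"
      and orb: "\<And>g. g \<in> K_group m \<Longrightarrow> R g v = (\<Sum>l<q. sc (f l g) (e l))"
      and der: "\<forall>X\<in>k_alg m. \<exists>d. (\<forall>l<q. ((\<lambda>s. f l (\<chi> i j. mat 1 $ i $ j + fps_const s * X $ i $ j)) has_field_derivative d l) (at 0)) \<and>
           \<rho> (matrix_to_K X, 0) v = (\<Sum>l<q. sc (d l) (e l))"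
      using spec[OF R(4), of v] by blast
    obtain d where d: "\<And>l. l < q \<Longrightarrow> ((\<lambda>s. f l (\<chi> i j. mat 1 $ i $ j + fps_const s * elementary_power a b n $ i $ j)) has_field_derivative d l) (at 0)"
      and x: "\<rho> (matrix_to_K (elementary_power a b n), 0) v = (\<Sum>l<q. sc (d l) (e l))"
      using der elementary_power_k_alg[OF n(2), of b] by blast
    define P where "P l p \<longleftrightarrow> (\<forall>s. f l (one_param a b n s) = poly p s) \<and>
      ((\<lambda>s. f l (\<chi> i j. mat 1 $ i $ j + fps_const s * elementary_power a b n $ i $ j)) has_field_derivative poly.coeff p 1) (at 0)" for l p
    have "\<forall>l. \<exists>p. l < q \<longrightarrow> P l p"
      unfolding P_def using regular_along[OF reg n(1)] by blast
    from choice[OF this] obtain p where P: "\<And>l. l < q \<Longrightarrow> P l (p l)" by blast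
    have p: "f l (one_param a b n s) = poly (p l) s" if "l < q" for l s
      using P[OF that] unfolding P_def by blast
    have "d l = poly.coeff (p l) 1" if "l < q" for l using DERIV_unique[OF d[OF that]] P[OF that] unfolding P_def by blast
    then have "xm (munit a b) r v = (\<Sum>l<q. sc (poly.coeff (p l) 1) (e l))"
      using x by (simp add: xm_def elementary_power_loop n(3))
    moreover have "R (one_param a b n s) v = (\<Sum>l<q. sc (poly (p l) s) (e l))" for s
      unfolding orb[OF K] using p by simp
    ultimately show "\<exists>(q::nat) p e. (\<forall>s. R (one_param a b n s) v = (\<Sum>l<q. sc (poly (p l) s) (e l))) \<and>
       xm (munit a b) r v = (\<Sum>l<q. sc (poly.coeff (p l) 1) (e l))" by blast
  qed (simp_all add: is_addD xm_sc)
qed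

end

lemma integrable_mono:
  assumes "integrable_k m sc \<rho>" "m \<le> m'"
  shows "integrable_k m' sc \<rho>"
proof -
  have "K_group m' \<subseteq> K_group m" "k_alg m' \<subseteq> k_alg m" using assms(2) by (auto simp: K_group_def k_alg_def)
  note sub = this
  show ?thesis
    using assms(1) unfolding integrable_k_def
    by (elim ex_forward conj_forward all_forward) (use sub in blast)+
qed

text \<open>
On the invariant vector the mode \<open>- i - 1\<close> of \<open>S\<^sub>j\<close> vanishes by the pole estimate, and equals the coefficient \<open>a\<^sub>j\<close> at \<open>t\<^sup>i\<close> by the central character.
\<close>

theorem pole_bound:
  fixes \<rho> :: "'n::{finite,linorder} ghat \<Rightarrow> 'v::ab_group_add \<Rightarrow> 'v"
  assumes chi: "in_mod_chi a sc \<rho>" and int: "integrable_k m sc \<rho>" and ne: "(UNIV :: 'v set) \<noteq> {0}"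
    and j: "1 \<le> j" "j \<le> CARD('n)" and i: "i < - int j - int m"
  shows "a j $$ i = 0"
proof -
  interpret smooth_rep sc \<rho> using chi by unfold_locales (simp_all add: in_mod_chi_def)
  \<comment> \<open>For \<open>m = 0\<close> the smaller algebra \<open>k\<^sub>1\<close> is used: the pole bound \<open>j + m - 1\<close> for \<open>m = 1\<close> is already \<open>j\<close>.\<close>
  define M where "M = max 1 m"
  have M: "1 \<le> M" "int M \<le> int m + 1" by (auto simp: M_def)
  have int': "integrable_k M sc \<rho>" by (rule integrable_mono[OF int]) (simp add: M_def)
  obtain v :: 'v where "v \<noteq> 0" using ne by auto
  then obtain w where w: "w \<in> fixed_from M 1" "w \<noteq> 0"
    using fixed_vector[OF M(1)] integrable_nilpotent[OF int'] by blast
  have "md (S j) (- i - 1) w = 0" by (rule S_pole[OF M(1) w(1) j(2)]) (use i M in auto)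
  then have "sc (a j $$ i) w = 0" using mode_value[OF chi j, of "- i - 1" w] by simp
  then show ?thesis using w(2) by simp
qed

section \<open>Lattices generated by a cyclic vector\<close>

lemma fls_X_times_deriv_nth: "(fls_X * fls_deriv f) $$ k = of_int k * f $$ k"
  by (simp add: fls_X_times_conv_shift(1))

lemma X_times_deriv_X_power: "fls_X * fls_deriv (fls_X ^ c) = (of_nat c * fls_X ^ c :: complex fls)"
  by (rule fls_eqI) (simp add: fls_X_times_deriv_nth fls_of_nat)

lemma ordge_X_power: "ordge (fls_X ^ s) (int s)"
  by (simp add: ordge_def)

lemma X_power_times_nth: "(fls_X ^ s * f) $$ k = (f :: complex fls) $$ (k - int s)"
  by (simp add: fls_X_power_times_conv_shift(1))

lemma ordge_X_power_times: "ordge (fls_X ^ s * f) (k + int s) \<longleftrightarrow> ordge f k"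
  unfolding ordge_def X_power_times_nth
  by (metis add.commute add_diff_cancel_left' diff_add_cancel diff_less_eq)

lemma ordge_mult_lowest:
  assumes "ordge f k" "ordge g l"
  shows "(f * g) $$ (k + l) = f $$ k * g $$ l"
proof (cases "f = 0 \<or> g = 0")
  case False
  have le: "k \<le> fls_subdegree f" "l \<le> fls_subdegree g"
    using assms False by (auto simp: ordge_def intro!: fls_subdegree_geI)
  have sub: "fls_subdegree (f * g) = fls_subdegree f + fls_subdegree g"
    using False by (intro fls_subdegree_mult) auto
  show ?thesis
  proof (cases "k = fls_subdegree f \<and> l = fls_subdegree g")
    case True
    then show ?thesis by simp
  next
    case F: False
    then have "(f * g) $$ (k + l) = 0" using le by (intro fls_eq0_below_subdegree) (auto simp: sub)
    moreover have "f $$ k = 0 \<or> g $$ l = 0" using F le by (auto intro!: fls_eq0_below_subdegree)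
    ultimately show ?thesis by auto
  qed
qed auto

definition fls_poly :: "nat \<Rightarrow> (nat \<Rightarrow> complex) \<Rightarrow> complex fls" where
  "fls_poly b g = (\<Sum>s<b. fls_const (g s) * fls_X ^ s)"

lemma fls_poly_nth: "fls_poly b g $$ k = (if 0 \<le> k \<and> k < int b then g (nat k) else 0)"
proof -
  have "fls_poly b g $$ k = (\<Sum>s<b. if s = nat k \<and> 0 \<le> k then g s else 0)"
    by (simp add: fls_poly_def fls_nth_sum) (intro sum.cong refl, auto)
  then show ?thesis by (cases "0 \<le> k") (simp_all add: zless_iff_Suc_zadd[symmetric] nat_less_iff)
qed

lemma ordge_poly: "ordge (fls_poly b g) 0"
  by (simp add: ordge_def fls_poly_nth)

lemma fls_poly_lincomb: "(\<Sum>a\<in>A. fls_const (x a) * fls_poly b (g a)) = fls_poly b (\<lambda>s. \<Sum>a\<in>A. x a * g a s)"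
  by (rule fls_eqI) (auto simp: fls_nth_sum fls_poly_nth)

lemma fls_poly_cong: "(\<And>s. s < b \<Longrightarrow> g s = h s) \<Longrightarrow> fls_poly b g = fls_poly b h"
  by (simp add: fls_poly_def)

lemma truncation:
  assumes "ordge f 0"
  shows "\<exists>g q. ordge q 0 \<and> f = fls_poly b g + fls_X ^ b * q"
proof (intro exI conjI)
  let ?h = "f - fls_poly b (\<lambda>s. f $$ int s)"
  have h: "ordge ?h (int b)" using assms by (auto simp: ordge_def fls_poly_nth)
  show "ordge (fls_shift (int b) ?h) 0" using h by (simp add: ordge_def)
  show "f = fls_poly b (\<lambda>s. f $$ int s) + fls_X ^ b * fls_shift (int b) ?h"
    by (simp add: fls_X_power_times_conv_shift(1))
qed

text \<open>
A homogeneous linear system with fewer equations than unknowns has a nonzero solution; Gaussian elimination of one equation at a time.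
\<close>

lemma homogeneous_system:
  fixes M :: "'a \<Rightarrow> 'b \<Rightarrow> complex"
  assumes "finite B" "finite A" "card B < card A"
  shows "\<exists>x. (\<exists>a\<in>A. x a \<noteq> 0) \<and> (\<forall>b\<in>B. (\<Sum>a\<in>A. x a * M a b) = 0)"
  using assms
proof (induction B arbitrary: A M rule: finite_induct)
  case empty
  then have "A \<noteq> {}" by auto
  then show ?case by (auto intro!: exI[of _ "\<lambda>_. 1"])
next
  case (insert b B)
  show ?case
  proof (cases "\<forall>a\<in>A. M a b = 0")
    case True
    have "card B < card A" using insert by simp
    then obtain x where "\<exists>a\<in>A. x a \<noteq> 0" "\<forall>b\<in>B. (\<Sum>a\<in>A. x a * M a b) = 0"
      using insert.IH[OF insert.prems(1), of M] by blast
    with True show ?thesis by (intro exI[of _ x]) auto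
  next
    case False
    then obtain a0 where a0: "a0 \<in> A" "M a0 b \<noteq> 0" by blast
    define M' where "M' a c = M a c - M a b / M a0 b * M a0 c" for a c
    have "card B < card (A - {a0})" using insert a0 by simp
    then obtain x where x: "\<exists>a\<in>A - {a0}. x a \<noteq> 0" "\<forall>c\<in>B. (\<Sum>a\<in>A - {a0}. x a * M' a c) = 0"
      using insert.IH[of "A - {a0}" M'] insert.prems by auto
    define z where "z = (\<Sum>a\<in>A - {a0}. x a * M a b) / M a0 b"
    define y where "y = x(a0 := - z)"
    have sum_y: "(\<Sum>a\<in>A. y a * M a c) = (\<Sum>a\<in>A - {a0}. x a * M a c) - z * M a0 c" for c
    proof -
      have "(\<Sum>a\<in>A. y a * M a c) = y a0 * M a0 c + (\<Sum>a\<in>A - {a0}. y a * M a c)"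
        by (rule sum.remove) (use insert.prems a0 in auto)
      also have "(\<Sum>a\<in>A - {a0}. y a * M a c) = (\<Sum>a\<in>A - {a0}. x a * M a c)"
        by (rule sum.cong) (auto simp: y_def)
      finally show ?thesis by (simp add: y_def)
    qed
    have "(\<Sum>a\<in>A - {a0}. x a * M' a c) = (\<Sum>a\<in>A. y a * M a c)" for c
      by (simp add: sum_y M'_def z_def right_diff_distrib sum_subtractf sum_distrib_right sum_divide_distrib mult.assoc)
    then have "(\<Sum>a\<in>A. y a * M a c) = 0" if "c \<in> B" for c using x(2) that by simp
    moreover have "(\<Sum>a\<in>A. y a * M a b) = 0" using a0 by (simp add: sum_y z_def)
    moreover have "\<exists>a\<in>A. y a \<noteq> 0" using x(1) by (auto simp: y_def)
    ultimately show ?thesis by (intro exI[of _ y]) auto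
  qed
qed

lemma sum_lessThan_add: "(\<Sum>i<n + m. f i) = (\<Sum>i<n. f i) + (\<Sum>i<(m::nat). f (n + i) :: 'a::comm_monoid_add)"
  by (induction m) (simp_all add: add.assoc)

text \<open>
A vector space over \<open>\<K>\<close> with an operator \<open>\<Theta>\<close> over the derivation \<open>t \<partial>\<^sub>t\<close>, which preserves \<open>\<O>\<close>.
\<close>

locale theta_module = vector_space sK
  for sK :: "complex fls \<Rightarrow> 'w::ab_group_add \<Rightarrow> 'w" +
  fixes \<Theta> :: "'w \<Rightarrow> 'w"
  assumes theta_add: "\<Theta> (x + y) = \<Theta> x + \<Theta> y"
    and theta_scale: "\<Theta> (sK a x) = sK (fls_X * fls_deriv a) x + sK a (\<Theta> x)"
begin

lemma theta_0: "\<Theta> 0 = 0" using theta_add[of 0 0] by simp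

lemma theta_sum: "\<Theta> (sum f A) = (\<Sum>a\<in>A. \<Theta> (f a))"
  by (induction A rule: infinite_finite_induct) (simp_all add: theta_0 theta_add)

lemma theta_X_power: "\<Theta> (sK (fls_X ^ c) x) = sK (of_nat c * fls_X ^ c) x + sK (fls_X ^ c) (\<Theta> x)"
  by (simp only: theta_scale X_times_deriv_X_power)

text \<open>
The \<open>\<O>\<close>-span of \<open>y\<^sub>0, \<dots>, y\<^bsub>N-1\<^esub>\<close>.
\<close>

definition lat :: "(nat \<Rightarrow> 'w) \<Rightarrow> nat \<Rightarrow> 'w set" where
  "lat y N = {\<Sum>i<N. sK (f i) (y i) | f. \<forall>i. ordge (f i) 0}"

lemma lat_I: "(\<And>i. i < N \<Longrightarrow> ordge (f i) 0) \<Longrightarrow> (\<Sum>i<N. sK (f i) (y i)) \<in> lat y N"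
  unfolding lat_def by (rule CollectI, rule exI[of _ "\<lambda>i. if i < N then f i else 0"]) auto

lemma lat_E:
  assumes "x \<in> lat y N"
  obtains f where "\<And>i. ordge (f i) 0" "x = (\<Sum>i<N. sK (f i) (y i))"
  using assms unfolding lat_def by auto

lemma lat_add: "x \<in> lat y N \<Longrightarrow> z \<in> lat y N \<Longrightarrow> x + z \<in> lat y N"
proof -
  assume "x \<in> lat y N" "z \<in> lat y N"
  then obtain f g where "\<And>i. ordge (f i) 0" "x = (\<Sum>i<N. sK (f i) (y i))"
    "\<And>i. ordge (g i) 0" "z = (\<Sum>i<N. sK (g i) (y i))" by (metis lat_E)
  then show ?thesis
    using lat_I[of N "\<lambda>i. f i + g i" y] by (simp add: scale_left_distrib sum.distrib ordge_add)
qed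

lemma lat_scale: "ordge a 0 \<Longrightarrow> x \<in> lat y N \<Longrightarrow> sK a x \<in> lat y N"
proof (erule lat_E)
  fix f assume "ordge a 0" "\<And>i. ordge (f i) 0" "x = (\<Sum>i<N. sK (f i) (y i))"
  then show ?thesis
    using lat_I[of N "\<lambda>i. a * f i" y] ordge_mult[of a 0 _ 0] by (simp add: scale_sum_right)
qed

lemma lat_0: "0 \<in> lat y N" using lat_I[of N "\<lambda>_. 0" y] by simp

lemma lat_sum: "(\<And>a. a \<in> A \<Longrightarrow> f a \<in> lat y N) \<Longrightarrow> sum f A \<in> lat y N"
  by (induction A rule: infinite_finite_induct) (auto intro: lat_0 lat_add)

lemma lat_gen: "i < N \<Longrightarrow> y i \<in> lat y N"
proof -
  assume i: "i < N"
  have "(\<Sum>j<N. sK (if j = i then 1 else 0) (y j)) = (\<Sum>j<N. if j = i then y j else 0)"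
    by (rule sum.cong) auto
  then show ?thesis using lat_I[of N "\<lambda>j. if j = i then 1 else 0" y] i by (auto simp: ordge_def)
qed

lemma lat_mono: "x \<in> lat y N \<Longrightarrow> N \<le> N' \<Longrightarrow> x \<in> lat y N'"
  by (erule lat_E) (auto intro!: lat_sum lat_scale lat_gen)

lemma lat_Suc_E:
  assumes "x \<in> lat y (Suc N)"
  obtains f x' where "ordge f 0" "x' \<in> lat y N" "x = sK f (y N) + x'"
proof -
  obtain f where "\<And>i. ordge (f i) 0" "x = (\<Sum>i<Suc N. sK (f i) (y i))" using assms unfolding lat_def by blast
  then show ?thesis by (intro that[of "f N" "\<Sum>i<N. sK (f i) (y i)"] lat_I) (simp_all add: add.commute)
qed

end

text \<open>
The sequence \<open>y\<^sub>i = t\<^sup>i D\<^sup>i v\<close> of a cyclic vector, with its relation \<open>P\<close> scaled to be integral and nonzero modulo \<open>t\<close>. The valuation \<open>r\<close> of the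
leading coefficient is then the irregularity.
\<close>

locale cyclic_lattice = theta_module sK \<Theta>
  for sK :: "complex fls \<Rightarrow> 'w::ab_group_add \<Rightarrow> 'w" and \<Theta> +
  fixes n :: nat and y :: "nat \<Rightarrow> 'w" and P :: "nat \<Rightarrow> complex fls" and r :: nat
  assumes rank_pos: "0 < n"
    and step: "\<Theta> (y i) = sK (of_nat i) (y i) + y (Suc i)"
    and relation: "(\<Sum>i<Suc n. sK (P i) (y i)) = 0"
    and P_integral: "ordge (P i) 0"
    and P_top: "P n = fls_X ^ r"
    and P_beyond: "n < i \<Longrightarrow> P i = 0"
    and P_primitive: "\<exists>i. P i $$ 0 \<noteq> 0"
    and independent: "(\<Sum>i<n. sK (f i) (y i)) = 0 \<Longrightarrow> i < n \<Longrightarrow> f i = 0"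
    and spanning: "\<exists>f. x = (\<Sum>i<n. sK (f i) (y i))"
begin

text \<open>
The action of \<open>\<Theta>\<close> on coefficient sequences. Modulo \<open>t\<close> it raises the degree by exactly one and keeps the leading coefficient.
\<close>

definition T :: "(nat \<Rightarrow> complex fls) \<Rightarrow> nat \<Rightarrow> complex fls" where
  "T f i = fls_X * fls_deriv (f i) + of_nat i * f i + (if i = 0 then 0 else f (i - 1))"

lemma theta_eval:
  assumes "f N = 0"
  shows "\<Theta> (\<Sum>i<N. sK (f i) (y i)) = (\<Sum>i<Suc N. sK (T f i) (y i))"
proof -
  have "\<Theta> (\<Sum>i<N. sK (f i) (y i)) = (\<Sum>i<N. sK (fls_X * fls_deriv (f i) + of_nat i * f i) (y i)) + (\<Sum>i<N. sK (f i) (y (Suc i)))"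
    by (simp add: theta_sum theta_scale step scale_right_distrib scale_left_distrib sum.distrib add.assoc mult.commute)
  also have "(\<Sum>i<N. sK (f i) (y (Suc i))) = (\<Sum>i<Suc N. sK (if i = 0 then 0 else f (i - 1)) (y i))"
    by (subst sum.lessThan_Suc_shift) simp
  also have "(\<Sum>i<N. sK (fls_X * fls_deriv (f i) + of_nat i * f i) (y i)) = (\<Sum>i<Suc N. sK (fls_X * fls_deriv (f i) + of_nat i * f i) (y i))"
    using assms by simp
  finally show ?thesis by (simp only: T_def scale_left_distrib sum.distrib)
qed

lemma T_nth: "T f i $$ k = of_int (k + int i) * f i $$ k + (if i = 0 then 0 else f (i - 1) $$ k)"
proof -
  have "(of_nat i * f i) $$ k = of_nat i * f i $$ k" for i by (simp add: fls_of_nat)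
  then show ?thesis by (simp add: T_def fls_X_times_deriv_nth distrib_right)
qed

definition PT :: "nat \<Rightarrow> nat \<Rightarrow> complex fls" where "PT i = (T ^^ i) P"

lemma PT_integral: "ordge (PT i j) 0"
proof (induction i arbitrary: j)
  case (Suc i)
  then show ?case by (auto simp: PT_def ordge_def T_nth)
qed (simp add: PT_def P_integral)

lemma PT_beyond: "n + i < j \<Longrightarrow> PT i j = 0"
proof (induction i arbitrary: j)
  case (Suc i)
  then show ?case by (simp add: PT_def T_def)
qed (simp add: PT_def P_beyond)

lemma PT_top: "PT i (n + i) = fls_X ^ r"
proof (induction i)
  case (Suc i)
  have "PT i (Suc (n + i)) = 0" by (rule PT_beyond) simp
  with Suc show ?case by (simp add: PT_def T_def)
qed (simp add: PT_def P_top)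

lemma PT_relation: "(\<Sum>j<Suc (n + i). sK (PT i j) (y j)) = 0"
proof (induction i)
  case (Suc i)
  have "\<Theta> (\<Sum>j<Suc (n + i). sK (PT i j) (y j)) = (\<Sum>j<Suc (Suc (n + i)). sK (T (PT i) j) (y j))"
    by (rule theta_eval) (simp add: PT_beyond)
  with Suc show ?case by (simp add: theta_0 PT_def)
qed (use relation in \<open>simp add: PT_def\<close>)

text \<open>
Modulo \<open>t\<close> the relations \<open>T\<^sup>i P\<close> have the distinct degrees \<open>e + i\<close> and the same leading coefficient.
\<close>

lemma PT_residue:
  "\<exists>e z. z \<noteq> 0 \<and> (\<forall>i. PT i (e + i) $$ 0 = z) \<and> (\<forall>i j. e + i < j \<longrightarrow> PT i j $$ 0 = 0)"
proof -
  have fin: "finite {i. P i $$ 0 \<noteq> 0}" by (rule finite_subset[of _ "{..n}"]) (auto simp: P_beyond not_less[symmetric])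
  define e where "e = Max {i. P i $$ 0 \<noteq> 0}"
  have e: "P e $$ 0 \<noteq> 0" unfolding e_def using Max_in[OF fin] P_primitive by auto
  have e': "P j $$ 0 = 0" if "e < j" for j using Max_ge[OF fin, of j] that unfolding e_def by force
  have b: "e + i < j \<Longrightarrow> PT i j $$ 0 = 0" for i j
  proof (induction i arbitrary: j)
    case (Suc i)
    then have "PT i j $$ 0 = 0" "PT i (j - 1) $$ 0 = 0" by auto
    then show ?case by (simp add: PT_def T_nth)
  qed (simp add: PT_def e')
  have "PT i (e + i) $$ 0 = P e $$ 0" for i
  proof (induction i)
    case (Suc i)
    have "PT i (Suc (e + i)) $$ 0 = 0" by (rule b) simp
    with Suc show ?case by (simp add: PT_def T_nth)
  qed (simp add: PT_def)
  with e b show ?thesis by blast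
qed

text \<open>
The relations \<open>T\<^sup>i P\<close> have the orders \<open>n + i\<close>, so division by them reduces any relation to one among the basis vectors.
\<close>

lemma relation_combination:
  assumes "\<And>i. n + k \<le> i \<Longrightarrow> f i = 0" "(\<Sum>i<n + k. sK (f i) (y i)) = 0"
  shows "\<exists>A. \<forall>j. f j = (\<Sum>i<k. A i * PT i j)"
  using assms
proof (induction k arbitrary: f)
  case 0
  then have "f j = 0" for j using independent[of f j] by (cases "j < n") auto
  then show ?case by simp
next
  case (Suc k)
  define c where "c = f (n + k) / fls_X ^ r"
  define g where "g j = f j - c * PT k j" for j
  have c: "c * fls_X ^ r = f (n + k)"
    using nonzero_eq_divide_eq[of "fls_X ^ r" c "f (n + k)"] by (simp add: c_def)
  have "g i = 0" if "n + k \<le> i" for i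
  proof (cases "i = n + k")
    case True
    then show ?thesis by (simp add: g_def PT_top c)
  next
    case False
    then show ?thesis using that Suc.prems(1)[of i] PT_beyond[of k i] by (simp add: g_def)
  qed
  note g0 = this
  have "(\<Sum>i<n + k. sK (g i) (y i)) = (\<Sum>i<Suc (n + k). sK (g i) (y i))" by (simp add: g0)
  also have "\<dots> = (\<Sum>i<Suc (n + k). sK (f i) (y i)) - sK c (\<Sum>i<Suc (n + k). sK (PT k i) (y i))"
    by (simp only: g_def scale_left_diff_distrib sum_subtractf scale_sum_right scale_scale)
  also have "\<dots> = 0" using Suc.prems(2) by (simp only: PT_relation scale_zero_right add_Suc_right diff_zero)
  finally obtain A where A: "\<forall>j. g j = (\<Sum>i<k. A i * PT i j)" using Suc.IH[of g, OF g0] by blast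
  have "f j = (\<Sum>i<Suc k. (A(k := c)) i * PT i j)" for j
  proof -
    have "(\<Sum>i<k. (A(k := c)) i * PT i j) = (\<Sum>i<k. A i * PT i j)" by (rule sum.cong) auto
    then show ?thesis using A[rule_format, of j] by (simp add: g_def algebra_simps)
  qed
  then show ?case by blast
qed

text \<open>
An analogue of the lemma of Gauss on contents: because the reductions of \<open>T\<^sup>i P\<close> modulo \<open>t\<close> are linearly independent, a combination of them is integral
only if its coefficients are.
\<close>

lemma gauss:
  assumes int: "\<And>j. ordge (\<Sum>i<k. A i * PT i j) 0" and l: "l < k"
  shows "ordge (A l) 0"
proof (rule ccontr)
  assume neg: "\<not> ordge (A l) 0"
  obtain e z where z: "z \<noteq> 0" and top: "\<And>i. PT i (e + i) $$ 0 = z" and beyond: "\<And>i j. e + i < j \<Longrightarrow> PT i j $$ 0 = 0"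
    using PT_residue by blast
  define S where "S = {i. i < k \<and> A i \<noteq> 0}"
  \<comment> \<open>The lowest exponent that occurs in the coefficients; it is negative if some coefficient is not integral.\<close>
  define \<kappa> where "\<kappa> = Min ((\<lambda>i. fls_subdegree (A i)) ` S)"
  have lS: "l \<in> S" using neg l by (auto simp: S_def)
  have fin: "finite S" by (simp add: S_def)
  have "fls_subdegree (A l) < 0" using neg fls_eq0_below_subdegree[of _ "A l"] unfolding ordge_def by force
  moreover have "\<kappa> \<le> fls_subdegree (A l)" unfolding \<kappa>_def using lS fin by (intro Min_le) auto
  ultimately have \<kappa>: "\<kappa> < 0" by simp
  have low: "ordge (A i) \<kappa>" if "i < k" for i
  proof (cases "A i = 0")
    case False
    then have "\<kappa> \<le> fls_subdegree (A i)" unfolding \<kappa>_def using that fin by (intro Min_le) (auto simp: S_def)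
    then show ?thesis by (auto simp: ordge_def intro: fls_eq0_below_subdegree)
  qed simp
  have "\<kappa> \<in> (\<lambda>i. fls_subdegree (A i)) ` S" unfolding \<kappa>_def by (rule Min_in) (use lS fin in auto)
  then have ne: "{i. i < k \<and> A i $$ \<kappa> \<noteq> 0} \<noteq> {}" by (auto simp: S_def)
  define m where "m = Max {i. i < k \<and> A i $$ \<kappa> \<noteq> 0}"
  \<comment> \<open>Among the coefficients of lowest exponent the last one determines the reduction in degree \<open>e + m\<close>.\<close>
  have m: "m < k" "A m $$ \<kappa> \<noteq> 0" using Max_in[OF _ ne] unfolding m_def by auto
  have mm: "A i $$ \<kappa> = 0" if "m < i" "i < k" for i
  proof (rule ccontr)
    assume "A i $$ \<kappa> \<noteq> 0"
    then have "i \<le> m" unfolding m_def using that by (intro Max_ge) auto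
    with that show False by simp
  qed
  have "(A i * PT i (e + m)) $$ \<kappa> = (if i = m then A m $$ \<kappa> * z else 0)" if "i < k" for i
  proof -
    have "(A i * PT i (e + m)) $$ \<kappa> = A i $$ \<kappa> * PT i (e + m) $$ 0"
      using ordge_mult_lowest[OF low[OF that] PT_integral] by simp
    then show ?thesis using mm[OF _ that] beyond[of i "e + m"] top[of m] by (cases i m rule: linorder_cases) auto
  qed
  then have "(\<Sum>i<k. A i * PT i (e + m)) $$ \<kappa> = A m $$ \<kappa> * z"
    using m(1) by (simp add: fls_nth_sum)
  moreover have "(\<Sum>i<k. A i * PT i (e + m)) $$ \<kappa> = 0" using int \<kappa> by (simp add: ordge_def)
  ultimately show False using m z by simp
qed

text \<open>
The coefficient in question is an integral multiple of the leading coefficient \<open>t\<^sup>r\<close> of \<open>T\<^sup>k P\<close>. Hence \<open>t\<^sup>s y\<^bsub>n+i\<^esub>\<close> with \<open>s < r\<close> are linearly independent over \<open>\<complex>\<close> modulo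
the span of \<open>y\<^sub>0, \<dots>, y\<^bsub>n-1\<^esub>\<close>.
\<close>

theorem integral_relation_top:
  assumes "\<And>i. ordge (f i) 0" "(\<Sum>i<Suc (n + k). sK (f i) (y i)) = 0"
  shows "ordge (f (n + k)) (int r)"
proof -
  define g where "g i = (if i < Suc (n + k) then f i else 0)" for i
  have "(\<Sum>i<n + Suc k. sK (g i) (y i)) = 0"
    unfolding add_Suc_right assms(2)[symmetric] by (rule sum.cong) (auto simp: g_def)
  moreover have "g i = 0" if "n + Suc k \<le> i" for i using that by (simp add: g_def)
  ultimately obtain A where A: "\<And>j. g j = (\<Sum>i<Suc k. A i * PT i j)"
    using relation_combination[of "Suc k" g] by blast
  have "ordge (\<Sum>i<Suc k. A i * PT i j) 0" for j
    unfolding A[symmetric] by (simp add: g_def assms(1))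
  then have "ordge (A k) 0" by (rule gauss) simp
  moreover have "f (n + k) = A k * fls_X ^ r"
  proof -
    have "(\<Sum>i<k. A i * PT i (n + k)) = 0" by (rule sum.neutral) (simp add: PT_beyond)
    then show ?thesis using A[of "n + k"] by (simp add: g_def PT_top)
  qed
  ultimately show ?thesis using ordge_mult[OF _ ordge_X_power] by fastforce
qed

lemma reduce: "sK (fls_X ^ r) (y (n + i)) \<in> lat y (n + i)"
proof -
  have "sK (fls_X ^ r) (y (n + i)) = (\<Sum>j<n + i. sK (- PT i j) (y j))"
    using PT_relation[of i] PT_top[of i] by (simp add: sum_negf eq_neg_iff_add_eq_0 add.commute)
  moreover have "(\<Sum>j<n + i. sK (- PT i j) (y j)) \<in> lat y (n + i)"
    using PT_integral by (intro lat_I) (simp add: ordge_def)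
  ultimately show ?thesis by (simp only:)
qed

text \<open>
The spanning counterpart: modulo \<open>t\<^sup>d\<close> times the first lattice, the span of the first \<open>n + k\<close> vectors has at most \<open>n d + k r\<close> dimensions over \<open>\<complex>\<close>.
\<close>

lemma decomposition:
  "x \<in> lat y (n + k) \<Longrightarrow> \<exists>g z. z \<in> lat y n \<and>
    x = (\<Sum>j<n + k. sK (fls_poly (if j < n then d else r) (g j)) (y j)) + sK (fls_X ^ d) z"
proof (induction k arbitrary: x)
  case 0
  then obtain f where f: "\<And>i. ordge (f i) 0" "x = (\<Sum>i<n. sK (f i) (y i))" by (auto elim: lat_E)
  have "\<forall>i. \<exists>g q. ordge q 0 \<and> f i = fls_poly d g + fls_X ^ d * q" using truncation[OF f(1)] by blast
  then obtain g q where gq: "\<And>i. ordge (q i) 0" "\<And>i. f i = fls_poly d (g i) + fls_X ^ d * q i" by metis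
  have "x = (\<Sum>j<n. sK (fls_poly d (g j)) (y j)) + sK (fls_X ^ d) (\<Sum>j<n. sK (q j) (y j))"
    by (simp add: f(2) gq(2) scale_left_distrib sum.distrib scale_sum_right)
  moreover have "(\<Sum>j<n. sK (fls_poly d (g j)) (y j)) = (\<Sum>j<n + 0. sK (fls_poly (if j < n then d else r) (g j)) (y j))"
    by simp
  ultimately show ?case using lat_I[of n q y] gq(1) by metis
next
  case (Suc k)
  then obtain f x' where f: "ordge f 0" "x' \<in> lat y (n + k)" "x = sK f (y (n + k)) + x'"
    by (auto elim: lat_Suc_E)
  obtain h q where hq: "ordge q 0" "f = fls_poly r h + fls_X ^ r * q" using truncation[OF f(1)] by blast
  have "sK q (sK (fls_X ^ r) (y (n + k))) + x' \<in> lat y (n + k)"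
    by (intro lat_add lat_scale hq reduce f)
  then obtain g z where g: "z \<in> lat y n" "sK q (sK (fls_X ^ r) (y (n + k))) + x' =
    (\<Sum>j<n + k. sK (fls_poly (if j < n then d else r) (g j)) (y j)) + sK (fls_X ^ d) z"
    using Suc.IH by blast
  have eq: "(\<Sum>j<n + k. sK (fls_poly (if j < n then d else r) ((g(n + k := h)) j)) (y j)) =
    (\<Sum>j<n + k. sK (fls_poly (if j < n then d else r) (g j)) (y j))" by (rule sum.cong) auto
  have x: "x = sK (fls_poly r h) (y (n + k)) +
      ((\<Sum>j<n + k. sK (fls_poly (if j < n then d else r) (g j)) (y j)) + sK (fls_X ^ d) z)"
    unfolding g(2)[symmetric] by (simp add: f(3) hq(2) scale_left_distrib mult.commute add.assoc)
  have "x = (\<Sum>j<n + Suc k. sK (fls_poly (if j < n then d else r) ((g(n + k := h)) j)) (y j)) + sK (fls_X ^ d) z"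
    by (simp only: x add_Suc_right sum.lessThan_Suc eq) (simp add: add_ac)
  with g(1) show ?case by blast
qed

lemma absorb: "\<exists>c. sK (fls_X ^ c) x \<in> lat y n"
proof -
  obtain f where f: "x = (\<Sum>i<n. sK (f i) (y i))" using spanning by blast
  have "\<exists>c. \<forall>i<n. ordge (f i) (- int c)"
  proof -
    have "\<forall>i. \<exists>c. ordge (f i) (- int c)" using ordge_ex by blast
    then obtain c where c: "\<And>i. ordge (f i) (- int (c i))" by metis
    have "c i \<le> Max (c ` {..<n})" if "i < n" for i using that by (intro Max_ge) auto
    then show ?thesis by (intro exI[of _ "Max (c ` {..<n})"]) (auto intro: ordge_mono[OF c])
  qed
  then obtain c where c: "\<And>i. i < n \<Longrightarrow> ordge (f i) (- int c)" by blast
  have "sK (fls_X ^ c) x = (\<Sum>i<n. sK (fls_X ^ c * f i) (y i))" by (simp add: f scale_sum_right)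
  also have "\<dots> \<in> lat y n" 
  proof (rule lat_I)
    fix i assume "i < n"
    then show "ordge (fls_X ^ c * f i) 0" using ordge_mult[OF ordge_X_power[of c] c[of i]] by simp
  qed
  finally show ?thesis by blast
qed

lemma absorb_all: "\<exists>c. \<forall>i<(N::nat). sK (fls_X ^ c) (u i) \<in> lat y n"
proof -
  have "\<forall>i. \<exists>c. sK (fls_X ^ c) (u i) \<in> lat y n" using absorb by blast
  then obtain c where c: "\<And>i. sK (fls_X ^ c i) (u i) \<in> lat y n" by metis
  show ?thesis
  proof (intro exI allI impI)
    fix i assume "i < N"
    then have le: "c i \<le> Max (c ` {..<N})" by (intro Max_ge) auto
    have "sK (fls_X ^ (Max (c ` {..<N}) - c i)) (sK (fls_X ^ c i) (u i)) \<in> lat y n"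
      by (intro lat_scale c) (use ordge_X_power in \<open>auto simp: ordge_def\<close>)
    then show "sK (fls_X ^ Max (c ` {..<N})) (u i) \<in> lat y n" using le by (simp flip: power_add)
  qed
qed

lemma theta_lat:
  assumes "x \<in> lat y N" shows "\<Theta> x \<in> lat y (Suc N)"
proof -
  obtain f where f: "\<And>i. ordge (f i) 0" "x = (\<Sum>i<N. sK (f i) (y i))" using assms by (auto elim: lat_E)
  define g where "g i = (if i < N then f i else 0)" for i
  have g: "ordge (g i) 0" for i using f(1) by (simp add: g_def)
  have gN: "g N = 0" by (simp add: g_def)
  have "x = (\<Sum>i<N. sK (g i) (y i))" unfolding f(2) by (rule sum.cong) (auto simp: g_def)
  then have "\<Theta> x = (\<Sum>i<Suc N. sK (T g i) (y i))" by (simp only: theta_eval[of g N, OF gN])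
  also have "\<dots> \<in> lat y (Suc N)" using g by (intro lat_I) (simp add: ordge_def T_nth)
  finally show ?thesis .
qed

text \<open>
The lattices of the other cyclic vector embed after multiplication with a fixed power \<open>t\<^sup>c\<close>, so their \<open>k r'\<close> independent vectors lie in a space of dimension \<open>k r + n d\<close>
modulo vectors that come from the first lattice of the other cyclic vector. For large \<open>k\<close> this gives \<open>r' \<le> r\<close>.
\<close>

theorem rank_bound:
  assumes other: "cyclic_lattice sK \<Theta> n y' P' r'"
  shows "r' \<le> r"
proof (rule ccontr)
  assume "\<not> r' \<le> r"
  then have r': "Suc r \<le> r'" by simp
  interpret O: cyclic_lattice sK \<Theta> n y' P' r' by (rule other)
  obtain c where c: "\<And>i. i < n \<Longrightarrow> sK (fls_X ^ c) (y' i) \<in> lat y n" using absorb_all by blast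
  obtain d0 where d0: "\<And>i. i < n \<Longrightarrow> sK (fls_X ^ d0) (y i) \<in> lat y' n" using O.absorb_all by blast
  have shift: "sK (fls_X ^ c) (y' (Suc i)) \<in> lat y (Suc N)" if "sK (fls_X ^ c) (y' i) \<in> lat y N" for i N
  proof -
    have "sK (fls_X ^ c) (y' (Suc i)) = \<Theta> (sK (fls_X ^ c) (y' i)) + sK (- of_nat (c + i)) (sK (fls_X ^ c) (y' i))"
      by (simp add: theta_X_power O.step scale_right_distrib scale_left_distrib scale_left_diff_distrib right_diff_distrib mult.commute add.commute)
    moreover have "ordge (- of_nat (c + i)) 0" by (simp add: ordge_def fls_of_nat del: of_nat_add)
    ultimately show ?thesis
      using theta_lat[OF that] lat_scale[OF _ lat_mono[OF that, of "Suc N"]] by (auto intro: lat_add)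
  qed
  have c': "sK (fls_X ^ c) (y' (n + i)) \<in> lat y (Suc (n + i))" for i
  proof (induction i)
    case 0
    show ?case using shift[OF c[of "n - 1"]] rank_pos by simp
  next
    case (Suc i)
    then show ?case using shift[OF Suc] by simp
  qed
  define d where "d = c + d0"
  \<comment> \<open>With this \<open>k\<close> the unknowns outnumber the equations as soon as \<open>r < r'\<close>.\<close>
  define k where "k = Suc (n * d)"
  define A where "A = {..<k} \<times> {..<r'}"
  \<comment> \<open>The equations are the coefficients of the decomposition: \<open>d\<close> for each of the \<open>n\<close> basis vectors and \<open>r\<close> for each later vector.\<close>
  define B where "B = (SIGMA j:{..<n + k}. {..<(if j < n then d else r)})"
  define u where "u a = sK (fls_X ^ snd a) (y' (n + fst a))" for a :: "nat \<times> nat"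
  have cu: "sK (fls_X ^ c) (u a) \<in> lat y (n + k)" if "a \<in> A" for a
  proof -
    have "sK (fls_X ^ snd a) (sK (fls_X ^ c) (y' (n + fst a))) \<in> lat y (n + k)"
      using that by (intro lat_scale lat_mono[OF c']) (auto simp: A_def ordge_def)
    then show ?thesis by (simp add: u_def mult.commute)
  qed
  have "\<forall>a\<in>A. \<exists>gz. snd gz \<in> lat y n \<and> sK (fls_X ^ c) (u a) =
      (\<Sum>j<n + k. sK (fls_poly (if j < n then d else r) (fst gz j)) (y j)) + sK (fls_X ^ d) (snd gz)"
    using decomposition[OF cu] by fastforce
  then obtain gz where "\<forall>a\<in>A. snd (gz a) \<in> lat y n \<and> sK (fls_X ^ c) (u a) =
      (\<Sum>j<n + k. sK (fls_poly (if j < n then d else r) (fst (gz a) j)) (y j)) + sK (fls_X ^ d) (snd (gz a))"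
    by (rule bchoice[THEN exE])
  note gz = conjunct1[OF bspec[OF this]] conjunct2[OF bspec[OF this]]
  have "card B = (\<Sum>j<n + k. if j < n then d else r)" unfolding B_def by (simp add: card_SigmaI)
  also have "\<dots> = n * d + k * r" by (simp add: sum_lessThan_add)
  also have "\<dots> < k * Suc r" by (simp add: k_def)
  also have "\<dots> \<le> k * r'" using r' by (rule mult_le_mono2)
  also have "\<dots> = card A" by (simp add: A_def)
  finally have card: "card B < card A" .
  have "finite B" "finite A" by (simp_all add: A_def B_def)
  then have "\<exists>x. (\<exists>a\<in>A. x a \<noteq> 0) \<and> (\<forall>b\<in>B. (\<Sum>a\<in>A. x a * fst (gz a) (fst b) (snd b)) = 0)"
    by (rule homogeneous_system[OF _ _ card])
  then obtain x where x: "\<exists>a\<in>A. x a \<noteq> 0"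
    and xB: "\<And>b. b \<in> B \<Longrightarrow> (\<Sum>a\<in>A. x a * fst (gz a) (fst b) (snd b)) = 0" by blast
  define Z where "Z = (\<Sum>a\<in>A. sK (fls_const (x a)) (snd (gz a)))"
  have Z: "Z \<in> lat y n" unfolding Z_def by (intro lat_sum lat_scale gz) (auto simp: ordge_def)
  have "sK (fls_X ^ c) (\<Sum>a\<in>A. sK (fls_const (x a)) (u a)) = (\<Sum>a\<in>A. sK (fls_const (x a)) (sK (fls_X ^ c) (u a)))"
    by (simp add: scale_sum_right mult.commute)
  also have "\<dots> = (\<Sum>a\<in>A. \<Sum>j<n + k. sK (fls_const (x a) * fls_poly (if j < n then d else r) (fst (gz a) j)) (y j)) + sK (fls_X ^ d) Z"
    by (simp add: gz(2) scale_right_distrib sum.distrib scale_sum_right Z_def mult.commute)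
  also have "(\<Sum>a\<in>A. \<Sum>j<n + k. sK (fls_const (x a) * fls_poly (if j < n then d else r) (fst (gz a) j)) (y j))
    = (\<Sum>j<n + k. sK (\<Sum>a\<in>A. fls_const (x a) * fls_poly (if j < n then d else r) (fst (gz a) j)) (y j))"
    by (subst sum.swap) (simp only: scale_sum_left)
  also have "\<dots> = 0"
  proof (rule sum.neutral, rule ballI)
    fix j assume j: "j \<in> {..<n + k}"
    have "fls_poly (if j < n then d else r) (\<lambda>s. \<Sum>a\<in>A. x a * fst (gz a) j s) = fls_poly (if j < n then d else r) (\<lambda>_. 0)"
      using xB[of "(j, _)"] j by (intro fls_poly_cong) (simp add: B_def)
    then show "sK (\<Sum>a\<in>A. fls_const (x a) * fls_poly (if j < n then d else r) (fst (gz a) j)) (y j) = 0"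
      unfolding fls_poly_lincomb by (simp only:) (simp add: fls_poly_def)
  qed
  finally have "sK (fls_X ^ c) (\<Sum>a\<in>A. sK (fls_const (x a)) (u a)) = sK (fls_X ^ c) (sK (fls_X ^ d0) Z)"
    by (simp add: d_def power_add)
  then have main: "(\<Sum>a\<in>A. sK (fls_const (x a)) (u a)) = sK (fls_X ^ d0) Z"
    by (simp only: scale_cancel_left) simp
  have "sK (fls_X ^ d0) Z \<in> lat y' n"
    using Z
  proof (rule lat_E)
    fix f assume f: "\<And>i. ordge (f i) 0" "Z = (\<Sum>i<n. sK (f i) (y i))"
    have "sK (fls_X ^ d0) Z = (\<Sum>i<n. sK (f i) (sK (fls_X ^ d0) (y i)))"
      by (simp add: f(2) scale_sum_right mult.commute)
    also have "\<dots> \<in> lat y' n" by (rule lat_sum) (rule lat_scale[OF f(1) d0], simp)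
    finally show ?thesis .
  qed
  then obtain w where w: "\<And>i. ordge (w i) 0" "sK (fls_X ^ d0) Z = (\<Sum>i<n. sK (w i) (y' i))"
    unfolding lat_def by blast
  define p where "p i = fls_poly r' (\<lambda>s. x (i, s))" for i
  have split: "(\<Sum>a\<in>A. sK (fls_const (x a)) (u a)) = (\<Sum>i<k. sK (p i) (y' (n + i)))"
    by (simp add: A_def u_def p_def fls_poly_def scale_sum_left sum.cartesian_product split_def)
  define S where "S = {i. i < k \<and> p i \<noteq> 0}"
  have pnth: "p i $$ int s = x (i, s)" if "s < r'" for i s using that by (simp add: p_def fls_poly_nth)
  have "S \<noteq> {}"
  proof -
    obtain i s where "i < k" "s < r'" "x (i, s) \<noteq> 0" using x by (auto simp: A_def)
    then have "p i $$ int s \<noteq> 0" by (simp add: pnth)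
    then have "p i \<noteq> 0" by auto
    with \<open>i < k\<close> show ?thesis by (auto simp: S_def)
  qed
  moreover have fS: "finite S" by (simp add: S_def)
  ultimately have "Max S \<in> S" by simp
  \<comment> \<open>The last index with a nonzero coefficient turns the combination into a relation with a leading term of valuation below \<open>r'\<close>.\<close>
  define m where "m = Max S"
  have m: "m < k" "p m \<noteq> 0" using \<open>Max S \<in> S\<close> by (auto simp: m_def S_def)
  have pm: "p i = 0" if "m < i" "i < k" for i
    using Max_ge[OF fS, of i] that by (auto simp: m_def S_def not_less[symmetric])
  define f where "f i = (if i < n then - w i else p (i - n))" for i
  have "(\<Sum>i<k. sK (p i) (y' (n + i))) = (\<Sum>i<Suc m. sK (p i) (y' (n + i)))"
    by (rule sum.mono_neutral_right) (use m pm in auto)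
  then have "(\<Sum>i<n. sK (w i) (y' i)) = (\<Sum>i<Suc m. sK (p i) (y' (n + i)))"
    using main split w(2) by simp
  moreover have "(\<Sum>i<Suc (n + m). sK (f i) (y' i)) =
      (\<Sum>i<n. sK (- w i) (y' i)) + (\<Sum>i<Suc m. sK (p i) (y' (n + i)))"
    unfolding add_Suc_right[symmetric] sum_lessThan_add
    by (intro arg_cong2[of _ _ _ _ "(+)"] sum.cong) (auto simp: f_def)
  ultimately have "(\<Sum>i<Suc (n + m). sK (f i) (y' i)) = 0" by (simp add: sum_negf del: sum.lessThan_Suc)
  moreover have "ordge (f i) 0" for i using w(1) ordge_poly by (auto simp: f_def p_def ordge_def)
  ultimately have "ordge (f (n + m)) (int r')" by (intro O.integral_relation_top)
  then have "ordge (p m) (int r')" by (simp add: f_def)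
  then have "p m = 0" by (intro fls_eqI) (auto simp: ordge_def p_def fls_poly_nth)
  with m show False by simp
qed

end

section \<open>Irregularity and conductor\<close>

lemma sum_flip: "(\<Sum>j = 1..n. g j (n - j)) = (\<Sum>i<(n::nat). g (n - i) i :: 'a::comm_monoid_add)"
  by (rule sum.reindex_bij_witness[of _ "\<lambda>i. n - i" "\<lambda>j. n - j"]) auto

locale oper_data =
  fixes n :: nat and sK :: "complex fls \<Rightarrow> 'w::ab_group_add \<Rightarrow> 'w" and D v
  assumes oper: "oper n sK D v"
begin

sublocale vector_space sK using oper by (simp add: oper_def connection_def)

lemma D_add: "D (x + y) = D x + D y" and D_scale: "D (sK a x) = sK (fls_deriv a) x + sK a (D x)"
  using oper by (simp_all add: oper_def connection_def)

lemma basis_spanning: "\<exists>f. x = (\<Sum>i<n. sK (f i) ((D ^^ i) v))"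
proof -
  have inj: "inj_on (\<lambda>i. (D ^^ i) v) {..<n}" and "x \<in> span ((\<lambda>i. (D ^^ i) v) ` {..<n})"
    using oper by (simp_all add: oper_def)
  then obtain u where "x = (\<Sum>w\<in>(\<lambda>i. (D ^^ i) v) ` {..<n}. sK (u w) w)"
    using span_finite[of "(\<lambda>i. (D ^^ i) v) ` {..<n}"] by auto
  then show ?thesis by (auto simp: sum.reindex[OF inj])
qed

lemma basis_independent:
  assumes "(\<Sum>i<n. sK (f i) ((D ^^ i) v)) = 0" "i < n" shows "f i = 0"
proof -
  let ?e = "\<lambda>i. (D ^^ i) v"
  have inj: "inj_on ?e {..<n}" and ind: "independent (?e ` {..<n})" using oper by (simp_all add: oper_def)
  define u where "u = (\<lambda>w. f (the_inv_into {..<n} ?e w))"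
  have u: "u (?e i) = f i" if "i < n" for i
    unfolding u_def using the_inv_into_f_f[OF inj, of i] that by simp
  have "(\<Sum>w\<in>?e ` {..<n}. sK (u w) w) = (\<Sum>i<n. sK (f i) (?e i))"
    unfolding sum.reindex[OF inj] by (rule sum.cong) (simp_all add: u)
  then have "u (?e i) = 0"
    using independentD[OF ind, of "?e ` {..<n}" u "?e i"] assms by simp
  with u assms(2) show ?thesis by simp
qed

abbreviation "a \<equiv> oper_coeffs n sK D v"

text \<open>
The definite description of the coefficients is well defined, because the iterates of the cyclic vector form a basis.
\<close>

lemma oper_relation: "(D ^^ n) v = (\<Sum>i<n. sK (a (n - i)) ((D ^^ i) v))"
proof -
  let ?R = "\<lambda>a. (\<forall>i. i \<notin> {1..n} \<longrightarrow> a i = 0) \<and> (D ^^ n) v = (\<Sum>i = 1..n. sK (a i) ((D ^^ (n - i)) v))"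
  obtain f where f: "(D ^^ n) v = (\<Sum>i<n. sK (f i) ((D ^^ i) v))" using basis_spanning by blast
  define b where "b j = (if j \<in> {1..n} then f (n - j) else 0)" for j
  have "(\<Sum>i<n. sK (f i) ((D ^^ i) v)) = (\<Sum>i<n. sK (b (n - i)) ((D ^^ i) v))"
    by (rule sum.cong) (auto simp: b_def)
  then have "(D ^^ n) v = (\<Sum>i = 1..n. sK (b i) ((D ^^ (n - i)) v))"
    by (simp only: f sum_flip[of "\<lambda>j i. sK (b j) ((D ^^ i) v)"])
  moreover have "\<forall>i. i \<notin> {1..n} \<longrightarrow> b i = 0" by (simp add: b_def)
  ultimately have b: "?R b" by blast
  have "c = b" if c: "?R c" for c
  proof
    fix j
    have "(\<Sum>i<n. sK (c (n - i)) ((D ^^ i) v)) = (\<Sum>i<n. sK (b (n - i)) ((D ^^ i) v))"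
      using b c by (simp only: sum_flip[of "\<lambda>j i. sK (b j) ((D ^^ i) v)"] sum_flip[of "\<lambda>j i. sK (c j) ((D ^^ i) v)"])
    then have "(\<Sum>i<n. sK (c (n - i) - b (n - i)) ((D ^^ i) v)) = 0"
      by (simp add: scale_left_diff_distrib sum_subtractf)
    from basis_independent[OF this, of "n - j"] show "c j = b j"
      using b c by (cases "j \<in> {1..n}") auto
  qed
  with b have "?R a" unfolding oper_coeffs_def by (rule theI[of ?R])
  then show ?thesis by (simp only: sum_flip[of "\<lambda>j i. sK (a j) ((D ^^ i) v)"])
qed

end

lemma irr_coeffs_nonneg: "0 \<le> irr_coeffs n a"
  and irr_coeffs_ordge: "1 \<le> j \<Longrightarrow> j \<le> n \<Longrightarrow> ordge (a j) (- int j - irr_coeffs n a)"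
  and irr_coeffs_attained: "irr_coeffs n a = 0 \<or> (\<exists>j. 1 \<le> j \<and> j \<le> n \<and> a j $$ (- int j - irr_coeffs n a) \<noteq> 0)"
proof -
  define b where "b = a(0 := 1)"
  define S where "S = {int i - fls_subdegree (b (n - i)) | i. i \<le> n \<and> b (n - i) \<noteq> 0}"
  have irr: "irr_coeffs n a = Max S - int n" by (simp add: irr_coeffs_def S_def b_def Let_def)
  have fin: "finite S" unfolding S_def by (rule finite_subset[of _ "(\<lambda>i. int i - fls_subdegree (b (n - i))) ` {..n}"]) auto
  have n: "int n \<in> S" unfolding S_def by (rule CollectI, rule exI[of _ n]) (simp add: b_def)
  show "0 \<le> irr_coeffs n a" using Max_ge[OF fin n] by (simp add: irr)
  show "ordge (a j) (- int j - irr_coeffs n a)" if j: "1 \<le> j" "j \<le> n"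
  proof (cases "a j = 0")
    case False
    then have "int (n - j) - fls_subdegree (a j) \<in> S"
      unfolding S_def by (intro CollectI exI[of _ "n - j"]) (use j in \<open>simp add: b_def\<close>)
    from Max_ge[OF fin this] have "- int j - irr_coeffs n a \<le> fls_subdegree (a j)"
      using j by (simp add: irr of_nat_diff)
    then show ?thesis by (auto simp: ordge_def intro: fls_eq0_below_subdegree)
  qed simp
  obtain i where i: "Max S = int i - fls_subdegree (b (n - i))" "i \<le> n" "b (n - i) \<noteq> 0"
    using Max_in[OF fin] n unfolding S_def by auto
  show "irr_coeffs n a = 0 \<or> (\<exists>j. 1 \<le> j \<and> j \<le> n \<and> a j $$ (- int j - irr_coeffs n a) \<noteq> 0)"
  proof (cases "i = n")
    case True
    then show ?thesis using i by (simp add: irr b_def)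
  next
    case False
    then have b: "b (n - i) = a (n - i)" using i by (simp add: b_def)
    have "- int (n - i) - irr_coeffs n a = fls_subdegree (a (n - i))"
      using i(1,2) by (simp add: irr b of_nat_diff)
    then show ?thesis using i False by (intro disjI2 exI[of _ "n - i"]) (simp add: b)
  qed
qed

lemma irr_coeffs_le:
  assumes "0 \<le> m" "\<And>j. 1 \<le> j \<Longrightarrow> j \<le> n \<Longrightarrow> ordge (a j) (- int j - m)"
  shows "irr_coeffs n a \<le> m"
proof (rule ccontr)
  assume "\<not> irr_coeffs n a \<le> m"
  with assms show False using irr_coeffs_attained[of n a] by (force simp: ordge_def)
qed

context oper_data
begin

definition "r = nat (irr_coeffs n a)"

definition "P i = (if i = n then fls_X ^ r else if i < n then - (fls_X ^ (r + (n - i)) * a (n - i)) else 0)"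

text \<open>
Multiplying \<open>D\<^sup>n v = \<Sum>\<^sub>j a\<^sub>j D\<^bsup>n-j\<^esup> v\<close> by \<open>t\<^bsup>r+n\<^esup>\<close> gives coefficients \<open>t\<^sup>r\<close> and \<open>- t\<^bsup>r+j\<^esup> a\<^sub>j\<close>. The irregularity is the least \<open>r \<ge> 0\<close>
for which all of them are integral, and then one of them is a unit.
\<close>

lemma cyclic_lattice:
  assumes n: "0 < n"
  shows "cyclic_lattice sK (\<lambda>x. sK fls_X (D x)) n (\<lambda>i. sK (fls_X ^ i) ((D ^^ i) v)) P r"
proof
  have irr: "irr_coeffs n a = int r" using irr_coeffs_nonneg[of n a] by (simp add: r_def)
  show "sK fls_X (D (x + y)) = sK fls_X (D x) + sK fls_X (D y)" for x y
    by (simp add: D_add scale_right_distrib)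
  show "sK fls_X (D (sK a x)) = sK (fls_X * fls_deriv a) x + sK a (sK fls_X (D x))" for a x
    by (simp add: D_scale scale_right_distrib mult.commute)
  show "sK fls_X (D (sK (fls_X ^ i) ((D ^^ i) v))) =
      sK (of_nat i) (sK (fls_X ^ i) ((D ^^ i) v)) + sK (fls_X ^ Suc i) ((D ^^ Suc i) v)" for i
  proof -
    have "sK fls_X (D (sK (fls_X ^ i) ((D ^^ i) v))) = sK (fls_X * fls_deriv (fls_X ^ i)) ((D ^^ i) v) + sK (fls_X * fls_X ^ i) (D ((D ^^ i) v))"
      by (simp only: D_scale scale_right_distrib scale_scale)
    then show ?thesis by (simp only: X_times_deriv_X_power scale_scale power_Suc funpow.simps o_apply)
  qed
  have "(\<Sum>i<n. sK (P i) (sK (fls_X ^ i) ((D ^^ i) v))) = (\<Sum>i<n. - sK (fls_X ^ (r + n)) (sK (a (n - i)) ((D ^^ i) v)))"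
  proof (rule sum.cong)
    fix i assume "i \<in> {..<n}"
    then have "P i * fls_X ^ i = - (fls_X ^ (r + n) * a (n - i))"
      by (auto simp: P_def mult.assoc mult.commute mult.left_commute simp flip: power_add)
    then show "sK (P i) (sK (fls_X ^ i) ((D ^^ i) v)) = - sK (fls_X ^ (r + n)) (sK (a (n - i)) ((D ^^ i) v))"
      by simp
  qed simp
  also have "\<dots> = - sK (fls_X ^ (r + n)) ((D ^^ n) v)"
    by (simp only: sum_negf scale_sum_right[symmetric] oper_relation[symmetric])
  finally show "(\<Sum>i<Suc n. sK (P i) (sK (fls_X ^ i) ((D ^^ i) v))) = 0"
    by (simp add: P_def power_add)
  show "ordge (P i) 0" for i
  proof (cases "i < n")
    case True
    have "ordge (a (n - i)) (- int (n - i) - irr_coeffs n a)"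
      by (rule irr_coeffs_ordge) (use True in auto)
    moreover have "- int (n - i) - irr_coeffs n a = - int (r + (n - i))" by (simp add: irr)
    ultimately have "ordge (a (n - i)) (- int (r + (n - i)))" by (simp only:)
    then have "ordge (fls_X ^ (r + (n - i)) * a (n - i)) 0"
      using ordge_X_power_times[of "r + (n - i)" "a (n - i)" "- int (r + (n - i))"] by simp
    then show ?thesis using True by (simp add: P_def ordge_def)
  qed (simp add: P_def ordge_def)
  show "P n = fls_X ^ r" by (simp add: P_def)
  show "n < i \<Longrightarrow> P i = 0" for i by (simp add: P_def)
  show "\<exists>i. P i $$ 0 \<noteq> 0"
  proof (cases "r = 0")
    case True
    then show ?thesis by (intro exI[of _ n]) (simp add: P_def)
  next
    case False
    then obtain j where j: "1 \<le> j" "j \<le> n" "a j $$ (- int j - int r) \<noteq> 0"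
      using irr_coeffs_attained[of n a] by (auto simp: irr)
    have "P (n - j) $$ 0 = - (a j $$ (0 - int (r + j)))"
      using j by (simp add: P_def X_power_times_nth)
    also have "\<dots> = - (a j $$ (- int j - int r))"
      by (rule arg_cong[where f = "\<lambda>k. - (a j $$ k)"]) simp
    finally have "P (n - j) $$ 0 = - (a j $$ (- int j - int r))" .
    with j show ?thesis by (intro exI[of _ "n - j"]) simp
  qed
  show "f i = 0" if "(\<Sum>i<n. sK (f i) (sK (fls_X ^ i) ((D ^^ i) v))) = 0" "i < n" for f i
    using basis_independent[of "\<lambda>i. f i * fls_X ^ i" i] that by simp
  show "\<exists>f. x = (\<Sum>i<n. sK (f i) (sK (fls_X ^ i) ((D ^^ i) v)))" for x
  proof -
    obtain f where f: "x = (\<Sum>i<n. sK (f i) ((D ^^ i) v))" using basis_spanning by blast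
    have c: "f i / fls_X ^ i * fls_X ^ i = f i" for i
      using nonzero_eq_divide_eq[of "fls_X ^ i" "f i / fls_X ^ i" "f i"] by simp
    show ?thesis by (intro exI[of _ "\<lambda>i. f i / fls_X ^ i"]) (simp only: f scale_scale c)
  qed
qed (rule n)

end

text \<open>
By symmetry the bound between the ranks of two cyclic vectors is an equality, so the definite description has a unique value.
\<close>

theorem irregularity_oper:
  assumes v: "oper n sK D v" and n: "0 < n"
  shows "irregularity n sK D = irr_coeffs n (oper_coeffs n sK D v)"
proof -
  have le: "irr_coeffs n (oper_coeffs n sK D u) \<le> irr_coeffs n (oper_coeffs n sK D w)"
    if "oper n sK D u" "oper n sK D w" for u w
  proof -
    interpret U: oper_data n sK D u by unfold_locales (rule that)
    interpret W: oper_data n sK D w by unfold_locales (rule that)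
    have "U.r \<le> W.r"
      by (rule cyclic_lattice.rank_bound[OF W.cyclic_lattice[OF n] U.cyclic_lattice[OF n]])
    then show ?thesis using irr_coeffs_nonneg[of n "oper_coeffs n sK D u"] irr_coeffs_nonneg[of n "oper_coeffs n sK D w"]
      by (simp add: U.r_def W.r_def)
  qed
  show ?thesis
    unfolding irregularity_def
  proof (rule the_equality)
    show "\<exists>u. oper n sK D u \<and> irr_coeffs n (oper_coeffs n sK D v) = irr_coeffs n (oper_coeffs n sK D u)"
      using v by blast
    fix s assume "\<exists>u. oper n sK D u \<and> s = irr_coeffs n (oper_coeffs n sK D u)"
    then obtain u where "oper n sK D u" "s = irr_coeffs n (oper_coeffs n sK D u)" by blast
    then show "s = irr_coeffs n (oper_coeffs n sK D v)" using le v by (intro antisym) simp_all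
  qed
qed

theorem theorem1:
  fixes sK :: "complex fls \<Rightarrow> 'w::ab_group_add \<Rightarrow> 'w"
    and D :: "'w \<Rightarrow> 'w" and v :: 'w
  assumes "oper CARD('n::{finite,linorder}) sK D v"
  shows "conductor TYPE('n) TYPE('v::ab_group_add) (oper_coeffs CARD('n) sK D v)
           \<ge> enat (nat (irregularity CARD('n) sK D))"
proof -
  let ?a = "oper_coeffs CARD('n) sK D v"
  have irr: "irregularity CARD('n) sK D = irr_coeffs CARD('n) ?a"
    by (rule irregularity_oper[OF assms]) simp
  have bound: "irr_coeffs CARD('n) ?a \<le> int m"
    if "(UNIV :: 'v set) \<noteq> {0}" "in_mod_chi ?a sc \<rho>" "integrable_k m sc \<rho>"
    for m and sc :: "complex \<Rightarrow> 'v \<Rightarrow> 'v" and \<rho> :: "'n ghat \<Rightarrow> 'v \<Rightarrow> 'v"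
    using pole_bound[OF that(2,3,1)] by (intro irr_coeffs_le) (auto simp: ordge_def)
  show ?thesis
    unfolding conductor_def irr
  proof (rule Inf_greatest)
    fix c
    assume "c \<in> {enat m | m. \<exists>(sc :: complex \<Rightarrow> 'v \<Rightarrow> 'v) (\<rho> :: 'n ghat \<Rightarrow> 'v \<Rightarrow> 'v).
       (UNIV :: 'v set) \<noteq> {0} \<and> in_mod_chi ?a sc \<rho> \<and> integrable_k m sc \<rho>}"
    then obtain m where "c = enat m" "irr_coeffs CARD('n) ?a \<le> int m" using bound by blast
    then show "enat (nat (irr_coeffs CARD('n) ?a)) \<le> c" by (simp add: nat_le_iff)
  qed
qed

end
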